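(* Let $\xi^{\mathbb{R}}_0,\xi^{\mathbb{R}}_L\in\mathbb{R}$ and $\xi^{\mathbb{C}}_0,\xi^{\mathbb{C}}_L\in\mathbb{C}$, and associate to these Nahm parameters $\xi$ the Kronheimer parameters $\xi^{K,\mathbb{C}}=\xi^{\mathbb{C}}_L-\xi^{\mathbb{C}}_0$ and $\xi^{K,\mathbb{R}}=\xi^{\mathbb{R}}_L-\xi^{\mathbb{R}}_0$. Assume that the complex Nahm data $B=(\alpha^N,\beta^N)$ has constant $\alpha^N$. Then the map $RG_{\mathbb{C}}$ defined in the context satisfies the following properties: (i) If $B\in\mathcal{D}_{\xi^{\mathbb{C}}}$, then $RG_{\mathbb{C}}(B)\in\mathcal{D}^K_{\xi^{K,\mathbb{C}}}$. (ii) The union of the $\mathcal{G}^K_{\mathbb{C}}$-orbits of the Nahm data in $\mathcal{D}_{\xi^{\mathbb{C}}}$ in the families (a), (b), (c), (d) of the context, where the restriction on the data in (a) is that $c\ge0$, and $a>0$ if $c=0$, corresponds bijectively, via $RG_{\mathbb{C}}$, to $\mathcal{D}^K_{\xi^{K,\mathbb{C}}}$. Let $\tilde{\mathcal{D}}_{\xi^{\mathbb{C}}}\subset\mathcal{D}_{\xi^{\mathbb{C}}}$ denote this union if we instead make on the data in (a) the stronger restriction that moreover $c<\pi/2L$ (so $0\le c<\pi/2L$, with $a>0$ if $c=0$), and let $\tilde{\mathcal{D}}^K_{\xi^{K,\mathbb{C}}}\subset\mathcal{D}^K_{\xi^{K,\mathbb{C}}}$ denote the image $RG_{\mathbb{C}}(\tilde{\mathcal{D}}_{\xi^{\mathbb{C}}})$.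 (iii) For $B\in\tilde{\mathcal{D}}_{\xi^{\mathbb{C}}}$, Nahm sublines of $B$ are in 1-1 correspondence with Kronheimer sublines of $RG_{\mathbb{C}}(B)$; in particular, Kronheimer sublines only exist if $\xi^{K,\mathbb{C}}=0$. This correspondence is simply that the Nahm subline is the product of the Kronheimer subline with $I$. The $\xi^{\mathbb{R}}$-degree of a Nahm subline therefore coincides with the $\xi^{K,\mathbb{R}}$-degree of its corresponding Kronheimer subline. It follows that $B$ is $\xi^{\mathbb{R}}$-(semi/poly)stable if and only if $RG_{\mathbb{C}}(B)$ is $\xi^{K,\mathbb{R}}$-(semi/poly)stable. (iv) Define $\tilde{\mathcal{D}}^{K,\mathrm{ps}}_{\xi^K}=\mathcal{D}^{K,\mathrm{ps}}_{\xi^K}\cap\tilde{\mathcal{D}}^K_{\xi^{K,\mathbb{C}}}$ and $\tilde{\mathcal{N}}^K_{\xi^K}=\tilde{\mathcal{D}}^{K,\mathrm{ps}}_{\xi^K}/\mathcal{G}^K_{\mathbb{C}}$. Then $\tilde{\mathcal{N}}^K_{\xi^K}$ embeds holomorphically symplectically as an open complex analytic subspace of $\mathcal{N}_\xi$ via the correspondence defined by (ii) and (iii). That is, the image of this embedding is $\tilde{\mathcal{N}}_\xi=\tilde{\mathcal{D}}^{\mathrm{ps}}_\xi/\mathcal{G}^K_{\mathbb{C}}$, where $\tilde{\mathcal{D}}^{\mathrm{ps}}_\xi=\mathcal{D}^{\mathrm{ps}}_\xi\cap\tilde{\mathcal{D}}_{\xi^{\mathbb{C}}}$.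
   Context: Notation. Fix $L>0$, $I=[0,L]$, $\partial I=\{0,L\}$, $\partial=d/dt$; $\sigma_x,\sigma_y,\sigma_z$ are the Pauli matrices; $e_1,e_2$ the standard basis of $\mathbb{C}^2$. $\mathfrak{t}_{\mathbb{C}}$ and $\mathfrak{t}^\perp_{\mathbb{C}}$ are the diagonal and off-diagonal matrices in $\mathfrak{sl}(2,\mathbb{C})$; $T_{\mathbb{C}}\subset SL(2,\mathbb{C})$ the diagonal subgroup. "$X|_{\partial I}\in S_{\partial I}$" means $X(0)\in S_0$ and $X(L)\in S_L$. Complex Nahm data. $\mathcal{D}_{\xi^{\mathbb{C}}}=\{(\alpha,\beta)\in C^\infty(I,\mathfrak{sl}(2,\mathbb{C}))^{\oplus2}:\alpha|_{\partial I}\in\mathfrak{t}_{\mathbb{C}}^\perp,\ \beta|_{\partial I}\in-i\xi^{\mathbb{C}}_{\partial I}\sigma_z+\mathfrak{t}_{\mathbb{C}}^\perp,\ \partial\beta+[\alpha,\beta]=0\}$. $\mathcal{G}_{\mathbb{C}}=\{g\in C^\infty(I,SL(2,\mathbb{C})):g|_{\partial I}\in T_{\mathbb{C}},\ g^{-1}\partial g|_{\partial I}\in\mathfrak{t}^\perp_{\mathbb{C}}\}/\{\pm1\}$ acts by $g(\alpha)=g^{-1}\alpha g+g^{-1}\partial g$, $g(\beta)=g^{-1}\beta g$. Nahm sublines and stability. A Nahm subline of $(\alpha,\beta)$ is a smooth line subbundle $V\subset I\times\mathbb{C}^2$ preserved by $\partial+\alpha$ and by $\beta$, with $V_0,V_L\in\{\mathbb{C}e_1,\mathbb{C}e_2\}$.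 Its $\xi^{\mathbb{R}}$-degree is $\epsilon_L\xi^{\mathbb{R}}_L-\epsilon_0\xi^{\mathbb{R}}_0$, where $\epsilon_p=+1$ if $V_p=\mathbb{C}e_1$ and $-1$ if $V_p=\mathbb{C}e_2$. The data is $\xi^{\mathbb{R}}$-semistable (stable) if every Nahm subline has degree $\le0$ ($<0$), and polystable if it is stable or if $I\times\mathbb{C}^2$ is a direct sum of two Nahm sublines of degree $0$. $\mathcal{D}^{\mathrm{ps}}_\xi\subset\mathcal{D}_{\xi^{\mathbb{C}}}$ is the polystable locus, and $\mathcal{N}_\xi=\mathcal{D}_\xi^{\mathrm{ps}}/\mathcal{G}_{\mathbb{C}}$. It is a complex analytic surface (locally modelled on analytic GIT quotients, by stabilizers, of Coulomb-gauge slices in the space of complex Nahm data), with holomorphic symplectic form on the stable locus induced from $\omega^{\mathbb{C}}((\delta\alpha,\delta\beta),(\delta\alpha',\delta\beta'))=-\frac1{2L}\int_I\mathrm{Tr}(\delta\alpha\,\delta\beta'-\delta\beta\,\delta\alpha')dt$. Kronheimer data. $\mathcal{D}^K_{\xi^{K,\mathbb{C}}}=\{(\alpha,\beta)\in(\mathfrak{t}^\perp_{\mathbb{C}})^{\oplus2}:[\alpha,\beta]=i\xi^{K,\mathbb{C}}\sigma_z\}$; $\mathcal{G}^K_{\mathbb{C}}=T_{\mathbb{C}}/\{\pm1\}$ acts by simultaneous conjugation (and on Nahm data by constant gauge transformations). A Kronheimer subline is a line $V\in\{\mathbb{C}e_1,\mathbb{C}e_2\}$ preserved by $\alpha$ and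 $\beta$; its $\xi^{K,\mathbb{R}}$-degree is $+\xi^{K,\mathbb{R}}$ for $\mathbb{C}e_1$ and $-\xi^{K,\mathbb{R}}$ for $\mathbb{C}e_2$. (Semi/poly)stability is defined as for Nahm data: semistable (stable) if all sublines have degree $\le0$ ($<0$); polystable if stable, or if both $\mathbb{C}e_1,\mathbb{C}e_2$ are Kronheimer sublines of degree $0$. $\mathcal{D}^{K,\mathrm{ps}}_{\xi^K}$ is the polystable locus and $\mathcal{N}^K_{\xi^K}=\mathcal{D}^{K,\mathrm{ps}}_{\xi^K}/\mathcal{G}^K_{\mathbb{C}}$; its holomorphic symplectic form is induced by $\mathrm{Tr}(\delta\alpha\,\delta\beta'-\delta\alpha'\,\delta\beta)$, normalized by the same constant $-\frac{1}{2L}$. The map. For $(\alpha^N,\beta^N)$ with $\alpha^N$ constant (identically equal to an element of $\mathfrak{t}^\perp_{\mathbb{C}}$), $RG_{\mathbb{C}}(\alpha^N,\beta^N)=(\alpha^K,\beta^K)$ with $\alpha^K=\alpha^N$ and $\beta^K=\mathrm{proj}\left(\int_I\beta^N(t)\,dt\right)$, where $\mathrm{proj}:\mathfrak{sl}(2,\mathbb{C})\to\mathfrak{t}^\perp_{\mathbb{C}}$ is the projection along $\mathfrak{t}_{\mathbb{C}}$. Families of Nahm data in $\mathcal{D}_{\xi^{\mathbb{C}}}$: (a) $\alpha=\alpha_0\sigma_x$, $\alpha_0=a+ic$ constant ($a,c\in\mathbb{R}$, subject to the restrictions stated in the claim), $\beta=\beta_x\sigma_x+\beta_y\sigma_y+\beta_z\sigma_z$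 with $\beta_x\in\mathbb{C}$ an arbitrary constant, $\beta_y=(-\xi_0^{\mathbb{C}}\cosh(2\alpha_0(L-t))+\xi_L^{\mathbb{C}}\cosh(2\alpha_0t))/\sinh(2\alpha_0L)$, $\beta_z=-i(\xi_0^{\mathbb{C}}\sinh(2\alpha_0(L-t))+\xi_L^{\mathbb{C}}\sinh(2\alpha_0t))/\sinh(2\alpha_0L)$. (b) $\alpha=\begin{pmatrix}0&1/L\\0&0\end{pmatrix}$, $\beta=-\frac iL\begin{pmatrix}\xi_0^{\mathbb{C}}(L-t)+\xi_L^{\mathbb{C}}t & \xi_L^{\mathbb{C}}(L+t^2/L)-\xi_0^{\mathbb{C}}(L-t)^2/L+c\\ (\xi_0^{\mathbb{C}}-\xi_L^{\mathbb{C}})L & -\xi_0^{\mathbb{C}}(L-t)-\xi_L^{\mathbb{C}}t\end{pmatrix}$, with $c\in\mathbb{C}$ a constant. (c) $\alpha=\begin{pmatrix}0&0\\1/L&0\end{pmatrix}$, $\beta=-\frac iL\begin{pmatrix}\xi_0^{\mathbb{C}}(L-t)+\xi_L^{\mathbb{C}}t & -(\xi_0^{\mathbb{C}}-\xi_L^{\mathbb{C}})L\\ \xi_0^{\mathbb{C}}(L-t)^2/L-\xi_L^{\mathbb{C}}(L+t^2/L)+c & -\xi_0^{\mathbb{C}}(L-t)-\xi_L^{\mathbb{C}}t\end{pmatrix}$, with $c\in\mathbb{C}$ a constant. (d) Only if $\xi_0^{\mathbb{C}}=\xi_L^{\mathbb{C}}$: $\alpha=0$ and $\beta$ one of $-i\xi_0^{\mathbb{C}}\sigma_z$,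 $-i\xi_0^{\mathbb{C}}\sigma_z+\begin{pmatrix}0&1/L\\0&0\end{pmatrix}$, $-i\xi_0^{\mathbb{C}}\sigma_z+\begin{pmatrix}0&c\\1/L&0\end{pmatrix}$, with $c\in\mathbb{C}$ a constant.
   Formalization: In (ii), family (a) is taken only where sinh(2α_0L) ≠ 0, i.e. α_0 ≠ ikπ/(2L) for k ≥ 1, and the bijection is onto the Kronheimer data whose α is not torus-conjugate to α_0σ_x for such an excluded α_0; at these values the formulas are undefined and surjectivity fails. *)

theory Defs
  imports "HOL-Analysis.Analysis"
begin

section \<open>Matrices\<close>

type_synonym cmat = "complex^2^2"

definition mat2 :: "complex \<Rightarrow> complex \<Rightarrow> complex \<Rightarrow> complex \<Rightarrow> cmat" where
  "mat2 a b c d = vector [vector [a, b], vector [c, d]]"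

definition cscale :: "complex \<Rightarrow> cmat \<Rightarrow> cmat" where
  "cscale c A = map_matrix ((*) c) A"

definition cadj :: "cmat \<Rightarrow> cmat" where
  "cadj A = map_matrix cnj (transpose A)"

definition comm :: "cmat \<Rightarrow> cmat \<Rightarrow> cmat" where
  "comm A B = A ** B - B ** A"

definition sigma_x :: cmat where "sigma_x = mat2 0 1 1 0"
definition sigma_y :: cmat where "sigma_y = mat2 0 (- \<i>) \<i> 0"
definition sigma_z :: cmat where "sigma_z = mat2 1 0 0 (- 1)"

definition sl2 :: "cmat set" where
  "sl2 = {A. trace A = 0}"

definition t_alg :: "cmat set" where
  "t_alg = {A \<in> sl2. A $ 1 $ 2 = 0 \<and> A $ 2 $ 1 = 0}"

definition t_perp :: "cmat set" where
  "t_perp = {A \<in> sl2. A $ 1 $ 1 = 0 \<and> A $ 2 $ 2 = 0}"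

definition torus :: "cmat set" where
  "torus = {A. det A = 1 \<and> A $ 1 $ 2 = 0 \<and> A $ 2 $ 1 = 0}"

definition proj_perp :: "cmat \<Rightarrow> cmat" where
  "proj_perp A = mat2 0 (A $ 1 $ 2) (A $ 2 $ 1) 0"

definition e1 :: "complex^2" where "e1 = axis 1 1"
definition e2 :: "complex^2" where "e2 = axis 2 1"

definition cline :: "complex^2 \<Rightarrow> (complex^2) set" where
  "cline v = range (\<lambda>c. c *s v)"

section \<open>Smooth functions on the interval\<close>

text \<open>One-sided derivatives are used at the endpoints of \<open>[0,L]\<close>.\<close>

definition ideriv :: "real \<Rightarrow> (real \<Rightarrow> 'a::real_normed_vector) \<Rightarrow> real \<Rightarrow> 'a" where
  "ideriv L f = (\<lambda>t. vector_derivative f (at t within {0..L}))"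

definition smooth_on_I :: "real \<Rightarrow> (real \<Rightarrow> 'a::real_normed_vector) \<Rightarrow> bool" where
  "smooth_on_I L f \<longleftrightarrow>
     (\<forall>n. \<forall>t\<in>{0..L}. (ideriv L ^^ n) f differentiable (at t within {0..L}))"

text \<open>A map \<open>I \<rightarrow> X\<close> is represented by the function on \<open>real\<close> extending it by
  zero, so that equality of functions is equality on \<open>I\<close>.\<close>

definition on_I :: "real \<Rightarrow> (real \<Rightarrow> 'a::zero) \<Rightarrow> real \<Rightarrow> 'a" where
  "on_I L f = (\<lambda>t. if t \<in> {0..L} then f t else 0)"

definition paths :: "real \<Rightarrow> (real \<Rightarrow> cmat) set" where
  "paths L = {f. smooth_on_I L f \<and> (\<forall>t\<in>{0..L}. f t \<in> sl2) \<and> (\<forall>t. t \<notin> {0..L} \<longrightarrow> f t = 0)}"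

text \<open>The topology of uniform convergence of all derivatives.\<close>

definition path_top :: "real \<Rightarrow> (real \<Rightarrow> cmat) topology" where
  "path_top L = topology_generated_by
     {{g \<in> paths L. \<forall>j\<le>k. \<forall>t\<in>{0..L}.
         norm ((ideriv L ^^ j) g t - (ideriv L ^^ j) f t) < e} | f k e. f \<in> paths L \<and> 0 < e}"

section \<open>Complex Nahm data\<close>

type_synonym nahm = "(real \<Rightarrow> cmat) \<times> (real \<Rightarrow> cmat)"

definition nahm_space :: "real \<Rightarrow> nahm topology" where
  "nahm_space L = prod_topology (path_top L) (path_top L)"

definition nahm_data :: "real \<Rightarrow> complex \<Rightarrow> complex \<Rightarrow> nahm set" where
  "nahm_data L x0 xL = {(\<alpha>, \<beta>). \<alpha> \<in> paths L \<and> \<beta> \<in> paths L \<and>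
     \<alpha> 0 \<in> t_perp \<and> \<alpha> L \<in> t_perp \<and>
     \<beta> 0 \<in> (+) (cscale (- \<i> * x0) sigma_z) ` t_perp \<and>
     \<beta> L \<in> (+) (cscale (- \<i> * xL) sigma_z) ` t_perp \<and>
     (\<forall>t\<in>{0..L}. ideriv L \<beta> t + comm (\<alpha> t) (\<beta> t) = 0)}"

text \<open>Elements of \<open>gauge_group\<close> are lifts of gauge transformations to \<open>SL(2)\<close>: the centre
  \<open>{\<plusminus>1}\<close> acts trivially, so orbits, and invariance under stabilizers, are those of the
  quotient by it.  The same holds for \<open>torus\<close> and the group \<open>T / {\<plusminus>1}\<close>.\<close>

definition gauge_group :: "real \<Rightarrow> (real \<Rightarrow> cmat) set" where
  "gauge_group L = {g. smooth_on_I L g \<and> (\<forall>t\<in>{0..L}. det (g t) = 1) \<and>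
     (\<forall>p\<in>{0, L}. g p \<in> torus \<and> matrix_inv (g p) ** ideriv L g p \<in> t_perp)}"

fun gauge_act :: "real \<Rightarrow> (real \<Rightarrow> cmat) \<Rightarrow> nahm \<Rightarrow> nahm" where
  "gauge_act L g (\<alpha>, \<beta>) =
     (on_I L (\<lambda>t. matrix_inv (g t) ** \<alpha> t ** g t + matrix_inv (g t) ** ideriv L g t),
      on_I L (\<lambda>t. matrix_inv (g t) ** \<beta> t ** g t))"

definition nahm_orbit :: "real \<Rightarrow> nahm \<Rightarrow> nahm set" where
  "nahm_orbit L B = (\<lambda>g. gauge_act L g B) ` gauge_group L"

text \<open>Constant gauge transformations: the action of the Kronheimer gauge group on Nahm data.\<close>

definition nahm_torus_orbit :: "real \<Rightarrow> nahm \<Rightarrow> nahm set" where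
  "nahm_torus_orbit L B = (\<lambda>h. gauge_act L (\<lambda>t. h) B) ` torus"

text \<open>A subbundle is a subset of \<open>I \<times> \<complex>\<^sup>2\<close>; its fibre over \<open>t\<close> is \<open>V `` {t}\<close>.
  Local sections may be taken smooth on all of \<open>I\<close> by means of cutoff functions.\<close>

definition line_subbundle :: "real \<Rightarrow> (real \<times> (complex^2)) set \<Rightarrow> bool" where
  "line_subbundle L V \<longleftrightarrow> V \<subseteq> {0..L} \<times> UNIV \<and>
     (\<forall>t0\<in>{0..L}. \<exists>s. \<exists>e>0. smooth_on_I L s \<and>
        (\<forall>t\<in>{0..L}. \<bar>t - t0\<bar> < e \<longrightarrow> s t \<noteq> 0 \<and> V `` {t} = cline (s t)))"

fun nahm_subline :: "real \<Rightarrow> nahm \<Rightarrow> (real \<times> (complex^2)) set \<Rightarrow> bool" where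
  "nahm_subline L (\<alpha>, \<beta>) V \<longleftrightarrow> line_subbundle L V \<and>
     (\<forall>s. smooth_on_I L s \<and> (\<forall>t\<in>{0..L}. s t \<in> V `` {t}) \<longrightarrow>
        (\<forall>t\<in>{0..L}. ideriv L s t + \<alpha> t *v s t \<in> V `` {t})) \<and>
     (\<forall>t\<in>{0..L}. \<forall>v\<in>V `` {t}. \<beta> t *v v \<in> V `` {t}) \<and>
     V `` {0} \<in> {cline e1, cline e2} \<and> V `` {L} \<in> {cline e1, cline e2}"

definition line_sign :: "(complex^2) set \<Rightarrow> real" where
  "line_sign W = (if W = cline e1 then 1 else - 1)"

definition nahm_degree :: "real \<Rightarrow> real \<Rightarrow> real \<Rightarrow> (real \<times> (complex^2)) set \<Rightarrow> real" where
  "nahm_degree L r0 rL V = line_sign (V `` {L}) * rL - line_sign (V `` {0}) * r0"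

definition nahm_semistable :: "real \<Rightarrow> real \<Rightarrow> real \<Rightarrow> nahm \<Rightarrow> bool" where
  "nahm_semistable L r0 rL B \<longleftrightarrow> (\<forall>V. nahm_subline L B V \<longrightarrow> nahm_degree L r0 rL V \<le> 0)"

definition nahm_stable :: "real \<Rightarrow> real \<Rightarrow> real \<Rightarrow> nahm \<Rightarrow> bool" where
  "nahm_stable L r0 rL B \<longleftrightarrow> (\<forall>V. nahm_subline L B V \<longrightarrow> nahm_degree L r0 rL V < 0)"

definition nahm_polystable :: "real \<Rightarrow> real \<Rightarrow> real \<Rightarrow> nahm \<Rightarrow> bool" where
  "nahm_polystable L r0 rL B \<longleftrightarrow> nahm_stable L r0 rL B \<or>
     (\<exists>V V'. nahm_subline L B V \<and> nahm_subline L B V' \<and>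
        nahm_degree L r0 rL V = 0 \<and> nahm_degree L r0 rL V' = 0 \<and>
        (\<forall>t\<in>{0..L}. V `` {t} \<inter> V' `` {t} = {0} \<and>
           {v + w | v w. v \<in> V `` {t} \<and> w \<in> V' `` {t}} = UNIV))"

definition nahm_ps :: "real \<Rightarrow> real \<Rightarrow> real \<Rightarrow> complex \<Rightarrow> complex \<Rightarrow> nahm set" where
  "nahm_ps L r0 rL x0 xL = {B \<in> nahm_data L x0 xL. nahm_polystable L r0 rL B}"

definition nahm_moduli ::
  "real \<Rightarrow> real \<Rightarrow> real \<Rightarrow> complex \<Rightarrow> complex \<Rightarrow> nahm set set" where
  "nahm_moduli L r0 rL x0 xL = nahm_orbit L ` nahm_ps L r0 rL x0 xL"

section \<open>Kronheimer data\<close>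

type_synonym kron = "cmat \<times> cmat"

definition kron_data :: "complex \<Rightarrow> kron set" where
  "kron_data x = {(\<alpha>, \<beta>). \<alpha> \<in> t_perp \<and> \<beta> \<in> t_perp \<and> comm \<alpha> \<beta> = cscale (\<i> * x) sigma_z}"

fun kron_act :: "cmat \<Rightarrow> kron \<Rightarrow> kron" where
  "kron_act h (\<alpha>, \<beta>) = (matrix_inv h ** \<alpha> ** h, matrix_inv h ** \<beta> ** h)"

definition kron_orbit :: "kron \<Rightarrow> kron set" where
  "kron_orbit A = (\<lambda>h. kron_act h A) ` torus"

fun kron_subline :: "kron \<Rightarrow> (complex^2) set \<Rightarrow> bool" where
  "kron_subline (\<alpha>, \<beta>) W \<longleftrightarrow> W \<in> {cline e1, cline e2} \<and>
     (\<forall>v\<in>W. \<alpha> *v v \<in> W) \<and> (\<forall>v\<in>W. \<beta> *v v \<in> W)"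

definition kron_degree :: "real \<Rightarrow> (complex^2) set \<Rightarrow> real" where
  "kron_degree r W = line_sign W * r"

definition kron_semistable :: "real \<Rightarrow> kron \<Rightarrow> bool" where
  "kron_semistable r A \<longleftrightarrow> (\<forall>W. kron_subline A W \<longrightarrow> kron_degree r W \<le> 0)"

definition kron_stable :: "real \<Rightarrow> kron \<Rightarrow> bool" where
  "kron_stable r A \<longleftrightarrow> (\<forall>W. kron_subline A W \<longrightarrow> kron_degree r W < 0)"

definition kron_polystable :: "real \<Rightarrow> kron \<Rightarrow> bool" where
  "kron_polystable r A \<longleftrightarrow> kron_stable r A \<or>
     (\<forall>W\<in>{cline e1, cline e2}. kron_subline A W \<and> kron_degree r W = 0)"

definition kron_ss :: "real \<Rightarrow> complex \<Rightarrow> kron set" where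
  "kron_ss r x = {A \<in> kron_data x. kron_semistable r A}"

definition kron_ps :: "real \<Rightarrow> complex \<Rightarrow> kron set" where
  "kron_ps r x = {A \<in> kron_data x. kron_polystable r A}"

definition kron_moduli :: "real \<Rightarrow> complex \<Rightarrow> kron set set" where
  "kron_moduli r x = kron_orbit ` kron_ps r x"

section \<open>Quotient topologies and holomorphic functions\<close>

definition quot_top :: "'a topology \<Rightarrow> ('a \<Rightarrow> 'b) \<Rightarrow> 'b topology" where
  "quot_top X q =
     topology (\<lambda>U. U \<subseteq> q ` topspace X \<and> openin X {x \<in> topspace X. q x \<in> U})"

lemma openin_quot_top:
  "openin (quot_top X q) U \<longleftrightarrow>
     U \<subseteq> q ` topspace X \<and> openin X {x \<in> topspace X. q x \<in> U}"
proof -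
  have "istopology (\<lambda>U. U \<subseteq> q ` topspace X \<and> openin X {x \<in> topspace X. q x \<in> U})"
    unfolding istopology_def
  proof (intro conjI allI impI)
    fix S T
    assume "S \<subseteq> q ` topspace X \<and> openin X {x \<in> topspace X. q x \<in> S}"
      and "T \<subseteq> q ` topspace X \<and> openin X {x \<in> topspace X. q x \<in> T}"
    moreover have "{x \<in> topspace X. q x \<in> S \<inter> T} =
        {x \<in> topspace X. q x \<in> S} \<inter> {x \<in> topspace X. q x \<in> T}" by blast
    ultimately show "S \<inter> T \<subseteq> q ` topspace X" "openin X {x \<in> topspace X. q x \<in> S \<inter> T}"
      by auto
  next
    fix \<K>
    assume K: "\<forall>U\<in>\<K>. U \<subseteq> q ` topspace X \<and> openin X {x \<in> topspace X. q x \<in> U}"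
    then show "\<Union>\<K> \<subseteq> q ` topspace X" by blast
    have "{x \<in> topspace X. q x \<in> \<Union>\<K>} = (\<Union>U\<in>\<K>. {x \<in> topspace X. q x \<in> U})" by blast
    then show "openin X {x \<in> topspace X. q x \<in> \<Union>\<K>}" using K by auto
  qed
  then show ?thesis by (simp add: quot_top_def)
qed

text \<open>The ambient space \<open>T\<close> is a complex topological vector space whose linear structure enters
  only through \<open>lin x z v = x + z v\<close>.  As usual in infinite dimensions, a function on an
  open set is holomorphic if it is continuous and holomorphic along complex lines.\<close>

definition ambient_holomorphic ::
  "'e topology \<Rightarrow> ('e \<Rightarrow> complex \<Rightarrow> 'e \<Rightarrow> 'e) \<Rightarrow> 'e set \<Rightarrow> ('e \<Rightarrow> complex) \<Rightarrow> bool" where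
  "ambient_holomorphic T lin \<Omega> G \<longleftrightarrow> openin T \<Omega> \<and>
     continuous_map (subtopology T \<Omega>) euclidean G \<and>
     (\<forall>x\<in>\<Omega>. \<forall>v\<in>topspace T. (\<lambda>z. G (lin x z v)) holomorphic_on {z. lin x z v \<in> \<Omega>})"

text \<open>Holomorphic functions on an analytic subset are, locally, restrictions of holomorphic
  functions on the ambient space.\<close>

definition holomorphic_on_subset ::
  "'e topology \<Rightarrow> ('e \<Rightarrow> complex \<Rightarrow> 'e \<Rightarrow> 'e) \<Rightarrow> 'e set \<Rightarrow> ('e \<Rightarrow> complex) \<Rightarrow> bool" where
  "holomorphic_on_subset T lin W F \<longleftrightarrow>
     (\<forall>x\<in>W. \<exists>\<Omega> G. x \<in> \<Omega> \<and> ambient_holomorphic T lin \<Omega> G \<and> (\<forall>y\<in>W \<inter> \<Omega>. F y = G y))"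

fun nahm_line :: "nahm \<Rightarrow> complex \<Rightarrow> nahm \<Rightarrow> nahm" where
  "nahm_line (\<alpha>, \<beta>) z (a, b) = (\<lambda>t. \<alpha> t + cscale z (a t), \<lambda>t. \<beta> t + cscale z (b t))"

fun kron_line :: "kron \<Rightarrow> complex \<Rightarrow> kron \<Rightarrow> kron" where
  "kron_line (\<alpha>, \<beta>) z (a, b) = (\<alpha> + cscale z a, \<beta> + cscale z b)"

section \<open>Complex analytic structures on the moduli spaces\<close>

definition nahm_moduli_top ::
  "real \<Rightarrow> real \<Rightarrow> real \<Rightarrow> complex \<Rightarrow> complex \<Rightarrow> nahm set topology" where
  "nahm_moduli_top L r0 rL x0 xL =
     quot_top (subtopology (nahm_space L) (nahm_ps L r0 rL x0 xL)) (nahm_orbit L)"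

definition kron_moduli_top :: "real \<Rightarrow> complex \<Rightarrow> kron set topology" where
  "kron_moduli_top r x = quot_top (subtopology euclidean (kron_ps r x)) kron_orbit"

text \<open>The Coulomb condition says that \<open>(a, b) = (\<alpha> - \<alpha>0, \<beta> - \<beta>0)\<close> is \<open>L\<^sup>2\<close>-orthogonal to all
  infinitesimal gauge transformations \<open>(\<partial>u + [\<alpha>0, u], [\<beta>0, u])\<close>, that is,
  \<open>- \<partial>a + [\<alpha>0\<^sup>*, a] + [\<beta>0\<^sup>*, b] = 0\<close>; the boundary terms vanish because \<open>u\<close> is diagonal and
  \<open>a\<close> off-diagonal at the endpoints.\<close>

fun coulomb_slice :: "real \<Rightarrow> complex \<Rightarrow> complex \<Rightarrow> nahm \<Rightarrow> nahm set" where
  "coulomb_slice L x0 xL (\<alpha>0, \<beta>0) = {(\<alpha>, \<beta>) \<in> nahm_data L x0 xL.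
     \<forall>t\<in>{0..L}. ideriv L (\<lambda>t. \<alpha> t - \<alpha>0 t) t =
       comm (cadj (\<alpha>0 t)) (\<alpha> t - \<alpha>0 t) + comm (cadj (\<beta>0 t)) (\<beta> t - \<beta>0 t)}"

definition nahm_stabilizer :: "real \<Rightarrow> nahm \<Rightarrow> (real \<Rightarrow> cmat) set" where
  "nahm_stabilizer L B = {g \<in> gauge_group L. gauge_act L g B = B}"

text \<open>The stabilizer of \<open>B\<close> preserves the Coulomb slice at \<open>B\<close> when it is closed under
  conjugate transposition.  This is automatic if \<open>B\<close> is stable, the stabilizer being
  \<open>{\<plusminus>1}\<close>; a strictly polystable orbit contains such points, namely those for which the two
  complementary sublines are orthogonal.\<close>

definition slice_centre :: "real \<Rightarrow> nahm \<Rightarrow> bool" where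
  "slice_centre L B \<longleftrightarrow>
     (\<forall>g\<in>nahm_stabilizer L B. (\<lambda>t. cadj (g t)) \<in> nahm_stabilizer L B)"

text \<open>The structure sheaf of the space of Nahm data modulo gauge.  In the chart given by the
  analytic GIT quotient of the slice at \<open>B\<close> by the stabilizer of \<open>B\<close>, holomorphic
  functions are invariant holomorphic functions on the slice; the points of the quotient are
  the orbits of the polystable data.\<close>

definition nahm_holomorphic ::
  "real \<Rightarrow> real \<Rightarrow> real \<Rightarrow> complex \<Rightarrow> complex \<Rightarrow> nahm set set \<Rightarrow> (nahm set \<Rightarrow> complex) \<Rightarrow> bool"
where
  "nahm_holomorphic L r0 rL x0 xL U f \<longleftrightarrow>
     (\<forall>B\<in>nahm_ps L r0 rL x0 xL. nahm_orbit L B \<in> U \<and> slice_centre L B \<longrightarrow>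
        (\<exists>W F. B \<in> W \<and> openin (subtopology (nahm_space L) (coulomb_slice L x0 xL B)) W \<and>
           (\<forall>g\<in>nahm_stabilizer L B. \<forall>y\<in>W.
              gauge_act L g y \<in> W \<and> F (gauge_act L g y) = F y) \<and>
           holomorphic_on_subset (nahm_space L) nahm_line W F \<and>
           (\<forall>y\<in>W \<inter> nahm_ps L r0 rL x0 xL.
              nahm_orbit L y \<in> U \<longrightarrow> F y = f (nahm_orbit L y))))"

text \<open>The structure sheaf of the analytic GIT quotient of the semistable Kronheimer data.\<close>

definition kron_holomorphic ::
  "real \<Rightarrow> complex \<Rightarrow> kron set set \<Rightarrow> (kron set \<Rightarrow> complex) \<Rightarrow> bool" where
  "kron_holomorphic r x U f \<longleftrightarrow>
     (\<forall>A\<in>kron_ps r x. kron_orbit A \<in> U \<longrightarrow>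
        (\<exists>W F. A \<in> W \<and> openin (subtopology euclidean (kron_ss r x)) W \<and>
           (\<forall>h\<in>torus. \<forall>y\<in>W. kron_act h y \<in> W \<and> F (kron_act h y) = F y) \<and>
           holomorphic_on_subset euclidean kron_line W F \<and>
           (\<forall>y\<in>W \<inter> kron_ps r x. kron_orbit y \<in> U \<longrightarrow> F y = f (kron_orbit y))))"

text \<open>An isomorphism of (reduced) complex analytic spaces onto an open subspace.  The structure
  sheaves \<open>OX\<close> and \<open>OY\<close> are given by their sections over open sets.\<close>

definition analytic_open_embedding ::
  "'a topology \<Rightarrow> ('a set \<Rightarrow> ('a \<Rightarrow> complex) \<Rightarrow> bool) \<Rightarrow>
   'b topology \<Rightarrow> ('b set \<Rightarrow> ('b \<Rightarrow> complex) \<Rightarrow> bool) \<Rightarrow> ('a \<Rightarrow> 'b) \<Rightarrow> bool" where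
  "analytic_open_embedding X OX Y OY \<phi> \<longleftrightarrow>
     embedding_map X Y \<phi> \<and> openin Y (\<phi> ` topspace X) \<and>
     (\<forall>V f. openin Y V \<and> V \<subseteq> \<phi> ` topspace X \<longrightarrow>
        (OY V f \<longleftrightarrow> OX {p \<in> topspace X. \<phi> p \<in> V} (f \<circ> \<phi>)))"

section \<open>Holomorphic symplectic forms\<close>

text \<open>The forms are given on tangent vectors to the space of data, which represent tangent vectors
  to the stable locus of the moduli space.\<close>

fun nahm_omega :: "real \<Rightarrow> nahm \<Rightarrow> nahm \<Rightarrow> complex" where
  "nahm_omega L (a, b) (a', b') =
     - (1 / (2 * complex_of_real L)) *
       integral {0..L} (\<lambda>t. trace (a t ** b' t - b t ** a' t))"

fun kron_omega :: "real \<Rightarrow> kron \<Rightarrow> kron \<Rightarrow> complex" where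
  "kron_omega L (a, b) (a', b') =
     - (1 / (2 * complex_of_real L)) * trace (a ** b' - a' ** b)"

text \<open>\<open>\<gamma>\<close> is a curve in \<open>Z\<close>, defined near \<open>0\<close>, with complex derivative \<open>v\<close> at \<open>0\<close>:
  \<open>\<gamma> z = \<gamma> 0 + z r(z)\<close> with \<open>r(z) \<rightarrow> v\<close>.\<close>

definition curve_tangent ::
  "'e topology \<Rightarrow> ('e \<Rightarrow> complex \<Rightarrow> 'e \<Rightarrow> 'e) \<Rightarrow> 'e set \<Rightarrow> (complex \<Rightarrow> 'e) \<Rightarrow> 'e \<Rightarrow> bool" where
  "curve_tangent T lin Z \<gamma> v \<longleftrightarrow> (\<forall>\<^sub>F z in nhds 0. \<gamma> z \<in> Z) \<and>
     (\<exists>r. (\<forall>\<^sub>F z in at 0. \<gamma> z = lin (\<gamma> 0) z (r z)) \<and> limitin T r v (at 0))"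

text \<open>The differential of a map \<open>\<phi>\<close> between the quotients, on representatives: it sends the class
  of the tangent vector \<open>v\<close> at \<open>A\<close> to the class of the tangent vector \<open>w\<close> at \<open>B\<close>.\<close>

definition kron_nahm_differential ::
  "real \<Rightarrow> kron set \<Rightarrow> nahm set \<Rightarrow> (kron set \<Rightarrow> nahm set) \<Rightarrow> kron \<Rightarrow> nahm \<Rightarrow> kron \<Rightarrow> nahm \<Rightarrow> bool"
where
  "kron_nahm_differential L ZK ZN \<phi> A B v w \<longleftrightarrow>
     (\<exists>\<gamma> \<delta>. curve_tangent euclidean kron_line ZK \<gamma> v \<and> \<gamma> 0 = A \<and>
        curve_tangent (nahm_space L) nahm_line ZN \<delta> w \<and> \<delta> 0 = B \<and>
        (\<forall>\<^sub>F z in nhds 0. \<phi> (kron_orbit (\<gamma> z)) = nahm_orbit L (\<delta> z)))"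

definition kron_nahm_symplectic ::
  "real \<Rightarrow> kron set \<Rightarrow> nahm set \<Rightarrow> (kron set \<Rightarrow> nahm set) \<Rightarrow> bool" where
  "kron_nahm_symplectic L ZK ZN \<phi> \<longleftrightarrow>
     (\<forall>A\<in>ZK. \<forall>B\<in>\<phi> (kron_orbit A).
        (\<forall>\<gamma> v. curve_tangent euclidean kron_line ZK \<gamma> v \<and> \<gamma> 0 = A \<longrightarrow>
           (\<exists>w. kron_nahm_differential L ZK ZN \<phi> A B v w)) \<and>
        (\<forall>v v' w w'. kron_nahm_differential L ZK ZN \<phi> A B v w \<and>
           kron_nahm_differential L ZK ZN \<phi> A B v' w' \<longrightarrow>
           nahm_omega L w w' = kron_omega L v v'))"

section \<open>The map from Nahm data to Kronheimer data\<close>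

definition constant_alpha :: "real \<Rightarrow> nahm set" where
  "constant_alpha L = {(\<alpha>, \<beta>). \<exists>A\<in>t_perp. \<forall>t\<in>{0..L}. \<alpha> t = A}"

text \<open>Only meaningful on \<open>constant_alpha L\<close>, where \<open>\<alpha> 0\<close> is the constant value of \<open>\<alpha>\<close>.\<close>

fun RG :: "real \<Rightarrow> nahm \<Rightarrow> kron" where
  "RG L (\<alpha>, \<beta>) = (\<alpha> 0, proj_perp (integral {0..L} \<beta>))"

section \<open>The families of Nahm data\<close>

definition data_a :: "real \<Rightarrow> complex \<Rightarrow> complex \<Rightarrow> complex \<Rightarrow> complex \<Rightarrow> nahm" where
  "data_a L x0 xL \<alpha>0 \<beta>x =
     (on_I L (\<lambda>t. cscale \<alpha>0 sigma_x),
      on_I L (\<lambda>t.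
        cscale \<beta>x sigma_x +
        cscale ((- x0 * cosh (2 * \<alpha>0 * complex_of_real (L - t))
                 + xL * cosh (2 * \<alpha>0 * complex_of_real t))
                / sinh (2 * \<alpha>0 * complex_of_real L)) sigma_y +
        cscale (- \<i> * (x0 * sinh (2 * \<alpha>0 * complex_of_real (L - t))
                 + xL * sinh (2 * \<alpha>0 * complex_of_real t))
                / sinh (2 * \<alpha>0 * complex_of_real L)) sigma_z))"

definition data_b :: "real \<Rightarrow> complex \<Rightarrow> complex \<Rightarrow> complex \<Rightarrow> nahm" where
  "data_b L x0 xL c =
     (let l = complex_of_real L in
      (on_I L (\<lambda>t. mat2 0 (1 / l) 0 0),
       on_I L (\<lambda>t. let u = complex_of_real t in
         cscale (- \<i> / l) (mat2
           (x0 * (l - u) + xL * u) (xL * (l + u\<^sup>2 / l) - x0 * (l - u)\<^sup>2 / l + c)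
           ((x0 - xL) * l) (- x0 * (l - u) - xL * u)))))"

definition data_c :: "real \<Rightarrow> complex \<Rightarrow> complex \<Rightarrow> complex \<Rightarrow> nahm" where
  "data_c L x0 xL c =
     (let l = complex_of_real L in
      (on_I L (\<lambda>t. mat2 0 0 (1 / l) 0),
       on_I L (\<lambda>t. let u = complex_of_real t in
         cscale (- \<i> / l) (mat2
           (x0 * (l - u) + xL * u) (- (x0 - xL) * l)
           (x0 * (l - u)\<^sup>2 / l - xL * (l + u\<^sup>2 / l) + c) (- x0 * (l - u) - xL * u)))))"

definition data_d :: "real \<Rightarrow> complex \<Rightarrow> cmat \<Rightarrow> nahm" where
  "data_d L x0 M = (on_I L (\<lambda>t. 0), on_I L (\<lambda>t. cscale (- \<i> * x0) sigma_z + M))"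

definition upper_half :: "complex \<Rightarrow> bool" where
  "upper_half \<alpha>0 \<longleftrightarrow> Im \<alpha>0 \<ge> 0 \<and> (Im \<alpha>0 = 0 \<longrightarrow> Re \<alpha>0 > 0)"

definition half_strip :: "real \<Rightarrow> complex \<Rightarrow> bool" where
  "half_strip L \<alpha>0 \<longleftrightarrow> upper_half \<alpha>0 \<and> Im \<alpha>0 < pi / (2 * L)"

text \<open>The parameter \<open>P\<close> is the restriction on \<open>\<alpha>0\<close> in the first family.  The formulas of that
  family have the denominator \<open>sinh (2 \<alpha>0 L)\<close>, so they define data only where it is nonzero.
  It vanishes at \<open>\<alpha>0 = \<i> k \<pi> / (2 L)\<close>, and nowhere on \<open>half_strip L\<close>.\<close>

definition nahm_families ::
  "real \<Rightarrow> complex \<Rightarrow> complex \<Rightarrow> (complex \<Rightarrow> bool) \<Rightarrow> nahm set" where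
  "nahm_families L x0 xL P =
     {data_a L x0 xL \<alpha>0 \<beta>x | \<alpha>0 \<beta>x. P \<alpha>0 \<and> sinh (2 * \<alpha>0 * complex_of_real L) \<noteq> 0} \<union>
     range (data_b L x0 xL) \<union> range (data_c L x0 xL) \<union>
     {data_d L x0 M | M. x0 = xL \<and>
        (M = 0 \<or> M = mat2 0 (1 / complex_of_real L) 0 0 \<or>
         (\<exists>c. M = mat2 0 c (1 / complex_of_real L) 0))}"

definition family_orbits ::
  "real \<Rightarrow> complex \<Rightarrow> complex \<Rightarrow> (complex \<Rightarrow> bool) \<Rightarrow> nahm set" where
  "family_orbits L x0 xL P = \<Union> (nahm_torus_orbit L ` nahm_families L x0 xL P)"

text \<open>Kronheimer data whose \<open>\<alpha>\<close> is conjugate to \<open>\<alpha>0 \<sigma>\<^sub>x\<close> for a parameter \<open>\<alpha>0\<close> at which the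
  formulas of the first family are undefined.\<close>

definition exceptional_kron :: "real \<Rightarrow> complex \<Rightarrow> kron set" where
  "exceptional_kron L x = {(\<alpha>, \<beta>) \<in> kron_data x.
     \<exists>\<alpha>0. \<exists>h\<in>torus. upper_half \<alpha>0 \<and> sinh (2 * \<alpha>0 * complex_of_real L) = 0 \<and>
       \<alpha> = matrix_inv h ** cscale \<alpha>0 sigma_x ** h}"

definition tilde_nahm :: "real \<Rightarrow> complex \<Rightarrow> complex \<Rightarrow> nahm set" where
  "tilde_nahm L x0 xL = family_orbits L x0 xL (half_strip L)"

definition tilde_kron :: "real \<Rightarrow> complex \<Rightarrow> complex \<Rightarrow> kron set" where
  "tilde_kron L x0 xL = RG L ` tilde_nahm L x0 xL"

definition tilde_nahm_ps ::
  "real \<Rightarrow> real \<Rightarrow> real \<Rightarrow> complex \<Rightarrow> complex \<Rightarrow> nahm set" where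
  "tilde_nahm_ps L r0 rL x0 xL = nahm_ps L r0 rL x0 xL \<inter> tilde_nahm L x0 xL"

definition tilde_kron_ps ::
  "real \<Rightarrow> real \<Rightarrow> real \<Rightarrow> complex \<Rightarrow> complex \<Rightarrow> kron set" where
  "tilde_kron_ps L r0 rL x0 xL = kron_ps (rL - r0) (xL - x0) \<inter> tilde_kron L x0 xL"

definition tilde_nahm_moduli ::
  "real \<Rightarrow> real \<Rightarrow> real \<Rightarrow> complex \<Rightarrow> complex \<Rightarrow> nahm set set" where
  "tilde_nahm_moduli L r0 rL x0 xL = nahm_torus_orbit L ` tilde_nahm_ps L r0 rL x0 xL"

definition tilde_kron_moduli ::
  "real \<Rightarrow> real \<Rightarrow> real \<Rightarrow> complex \<Rightarrow> complex \<Rightarrow> kron set set" where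
  "tilde_kron_moduli L r0 rL x0 xL = kron_orbit ` tilde_kron_ps L r0 rL x0 xL"

text \<open>The natural map from orbits of constant gauge transformations to gauge orbits.\<close>

definition gauge_saturation :: "real \<Rightarrow> nahm set \<Rightarrow> nahm set" where
  "gauge_saturation L S = \<Union> (nahm_orbit L ` S)"

end

(*
Idea. Parallel transport of d + alpha identifies Nahm sublines with pairs of lines at the two ends,
and it identifies Nahm data, up to gauge, with the pair (holonomy, beta(0)). For constant alpha the
holonomy is given by the Stumpff functions of the product of the entries of alpha, which are injective
on the image of the strip |Im w| < pi/2 under squaring: hence the bound c < pi/2L. On the corresponding
region the Kronheimer datum is a holomorphic function rho of (holonomy, beta(0)), so the map of moduli
spaces is a homeomorphism onto its image, and holomorphic functions pull back along rho. For the other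
direction one needs holomorphic lifts of the map into a Coulomb slice: the slice equations are a
quadratic ordinary differential equation whose flow depends holomorphically on the initial value, and
the inverse function theorem matches initial values with Kronheimer data. For the symplectic form, a
variation of Nahm data is integrated to a boundary term, in which torus gauge changes cancel.
*)
theory Submission
  imports Defs "HOL-Complex_Analysis.Conformal_Mappings"
begin


text \<open>Gauge transformations and torus elements that relate two curves of data are chosen point
  by point, with no regularity in the parameter. Derivatives are therefore taken only of quantities
  that are visibly differentiable: the holonomy, \<open>be 0\<close>, and torus invariant products
  of matrix entries. Recovering the Kronheimer datum takes one choice of branch. The product of the
  diagonal entries of the holonomy is gauge invariant and is the square of a hyperbolic cosine on
  the normal forms; the bound on c makes this cosine lie in the right half plane, so the principal
  square root recovers it. Holomorphic functions on the space of paths are merely continuous and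
  holomorphic along complex lines. Composing them with a curve requires a chain rule of its own,
  obtained from the Schwarz lemma. The exceptional point is the datum 0, where the torus acts
  trivially. There the chart of the slice receives an extra equation, and an invariant function must
  be extended from the closed orbit 0 to the whole null cone of semistable points.\<close>

notation field_differentiable (infixr "fdiff" 50)
abbreviation (input) "bilin == bounded_bilinear"
abbreviation (input) "blin == bounded_linear"
abbreviation (input) "cont == continuous_on"
notation iff (infixr "<->" 25)
notation tendsto (infixr "--->" 55)
abbreviation ev :: "'a filter => ('a => bool) => bool" where "ev F P == eventually P F"

section \<open>Two by two matrices\<close>

lemma mat2_nth [simp]: "mat2 a b c d $ 1 $ 1 = a" "mat2 a b c d $ 1 $ 2 = b"
 "mat2 a b c d $ 2 $ 1 = c" "mat2 a b c d $ 2 $ 2 = d" by (simp_all add: mat2_def)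

lemma cmat_iff:
 "(A::cmat) = B <-> A $ 1 $ 1 = B $ 1 $ 1 & A $ 1 $ 2 = B $ 1 $ 2 & A $ 2 $ 1 = B $ 2 $ 1 & A $ 2 $ 2 = B $ 2 $ 2"
 unfolding vec_eq_iff[of A] forall_2 unfolding vec_eq_iff forall_2 by (rule conj_assoc)

lemma mult_nth:
 fixes A B :: cmat shows "(A ** B) $ 1 $ 1 = A $ 1 $ 1 * B $ 1 $ 1 + A $ 1 $ 2 * B $ 2 $ 1"
  "(A ** B) $ 1 $ 2 = A $ 1 $ 1 * B $ 1 $ 2 + A $ 1 $ 2 * B $ 2 $ 2"
  "(A ** B) $ 2 $ 1 = A $ 2 $ 1 * B $ 1 $ 1 + A $ 2 $ 2 * B $ 2 $ 1"
  "(A ** B) $ 2 $ 2 = A $ 2 $ 1 * B $ 1 $ 2 + A $ 2 $ 2 * B $ 2 $ 2" by (simp_all add: matrix_matrix_mult_def sum_2)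

lemma cscale_nth [simp]: "cscale c A $ i $ j = c * A $ i $ j" by (simp add: cscale_def map_matrix_def)

lemma cadj_nth [simp]: "cadj A $ i $ j = cnj (A $ j $ i)" by (simp add: cadj_def map_matrix_def transpose_def)

lemma mat1_nth [simp]: "(mat 1 :: cmat) $ 1 $ 1 = 1" "(mat 1 :: cmat) $ 1 $ 2 = 0"
 "(mat 1 :: cmat) $ 2 $ 1 = 0" "(mat 1 :: cmat) $ 2 $ 2 = 1" by (simp_all add: mat_def)

lemma trace_cmat: "trace (A::cmat) = A $ 1 $ 1 + A $ 2 $ 2" by (simp add: trace_def sum_2)

lemma det_cmat: "det (A::cmat) = A $ 1 $ 1 * A $ 2 $ 2 - A $ 1 $ 2 * A $ 2 $ 1" by (simp add: det_2)

lemma mulv_nth: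
 fixes A :: cmat shows "(A *v v) $ 1 = A $ 1 $ 1 * v $ 1 + A $ 1 $ 2 * v $ 2"
  "(A *v v) $ 2 = A $ 2 $ 1 * v $ 1 + A $ 2 $ 2 * v $ 2" by (simp_all add: matrix_vector_mult_def sum_2)

lemma vec2_eq_iff: "(v::complex^2) = w <-> v $ 1 = w $ 1 & v $ 2 = w $ 2"
 unfolding vec_eq_iff forall_2 ..

lemma sl2_iff: "A : sl2 <-> A $ 2 $ 2 = - A $ 1 $ 1" by (auto simp: sl2_def trace_cmat add_eq_0_iff)

lemma t_perp_iff: "A : t_perp <-> A $ 1 $ 1 = 0 & A $ 2 $ 2 = 0"
 by (auto simp: t_perp_def sl2_iff)

lemma torus_iff: "A : torus <-> A $ 1 $ 1 * A $ 2 $ 2 = 1 & A $ 1 $ 2 = 0 & A $ 2 $ 1 = 0"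
 by (auto simp: torus_def det_cmat)

lemma sigma_nth [simp]: "sigma_x $ 1 $ 1 = 0" "sigma_x $ 1 $ 2 = 1" "sigma_x $ 2 $ 1 = 1" "sigma_x $ 2 $ 2 = 0"
 "sigma_y $ 1 $ 1 = 0" "sigma_y $ 1 $ 2 = - \<i>" "sigma_y $ 2 $ 1 = \<i>" "sigma_y $ 2 $ 2 = 0"
 "sigma_z $ 1 $ 1 = 1" "sigma_z $ 1 $ 2 = 0" "sigma_z $ 2 $ 1 = 0" "sigma_z $ 2 $ 2 = - 1"
 by (simp_all add: sigma_x_def sigma_y_def sigma_z_def)

lemma comm_nth: "comm A B $ 1 $ 1 = A $ 1 $ 2 * B $ 2 $ 1 - B $ 1 $ 2 * A $ 2 $ 1"
 "comm A B $ 1 $ 2 = (A $ 1 $ 1 - A $ 2 $ 2) * B $ 1 $ 2 - (B $ 1 $ 1 - B $ 2 $ 2) * A $ 1 $ 2"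
 "comm A B $ 2 $ 1 = (B $ 1 $ 1 - B $ 2 $ 2) * A $ 2 $ 1 - (A $ 1 $ 1 - A $ 2 $ 2) * B $ 2 $ 1"
 "comm A B $ 2 $ 2 = A $ 2 $ 1 * B $ 1 $ 2 - B $ 2 $ 1 * A $ 1 $ 2" by (simp_all add: comm_def mult_nth algebra_simps)

lemmas cmat_simps = cmat_iff mult_nth comm_nth trace_cmat det_cmat mulv_nth

text \<open>The inverse on \<open>SL(2)\<close>, in a form that is linear in the entries.\<close>

definition adj2 :: "cmat => cmat" where
 "adj2 A = mat2 (A $ 2 $ 2) (- A $ 1 $ 2) (- A $ 2 $ 1) (A $ 1 $ 1)"

lemma adj2_nth [simp]: "adj2 A $ 1 $ 1 = A $ 2 $ 2" "adj2 A $ 1 $ 2 = - A $ 1 $ 2"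
 "adj2 A $ 2 $ 1 = - A $ 2 $ 1" "adj2 A $ 2 $ 2 = A $ 1 $ 1" by (simp_all add: adj2_def)

lemma mult_adj2: "det A = 1 ==> A ** adj2 A = mat 1" "det A = 1 ==> adj2 A ** A = mat 1"
 by (simp_all add: cmat_simps algebra_simps)

lemma matrix_inv_eq_adj2: assumes "det A = 1" shows "matrix_inv A = adj2 A"
proof -
 have "invertible A" using assms by (simp add: invertible_det_nz)
 hence *: "A ** matrix_inv A = mat 1" "matrix_inv A ** A = mat 1"
  unfolding matrix_inv_def invertible_def by (metis (mono_tags, lifting) someI_ex)+
 have "matrix_inv A = matrix_inv A ** (A ** adj2 A)" by (simp add: mult_adj2 assms)
 also have "\<dots> = adj2 A" by (simp add: matrix_mul_assoc *)
 finally show ?thesis .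
qed

lemma adj2_adj2 [simp]: "adj2 (adj2 A) = A" and adj2_mult: "adj2 (A ** B) = adj2 B ** adj2 A"
 and det_adj2 [simp]: "det (adj2 A) = det A" and adj2_mat1 [simp]: "adj2 (mat 1) = mat 1"
 by (simp_all add: cmat_simps algebra_simps)

lemma adj2_cancel: assumes "det A = 1" shows "adj2 A ** (A ** X) = X" "A ** (adj2 A ** X) = X"
 using assms by (simp_all add: matrix_mul_assoc mult_adj2)

lemma torus_det: "h : torus ==> det h = 1" by (simp add: torus_def)

text \<open>Expanding sums and associating products to the right gives a normal form in which
  noncommutative identities are within reach of simp, once cancellation rules such as
  \<open>adj2_cancel\<close> are added.\<close>

lemma mat_ring:
 fixes A B C :: cmat shows "A ** (B + C) = A ** B + A ** C" "(A + B) ** C = A ** C + B ** C"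
  "A ** (B - C) = A ** B - A ** C" "(A - B) ** C = A ** C - B ** C" "(- A) ** B = - (A ** B)" "A ** (- B) = - (A ** B)"
  "A ** 0 = 0" "0 ** A = 0" "A ** mat 1 = A" "mat 1 ** A = A" "(A ** B) ** C = A ** (B ** C)"
 by (simp_all add: cmat_simps algebra_simps)

lemma cscale_simps: "cscale c (A ** B) = cscale c A ** B" "A ** cscale c B = cscale c A ** B"
 "cscale c (A + B) = cscale c A + cscale c B" "cscale c (A - B) = cscale c A - cscale c B"
 "cscale c (- A) = - cscale c A" "cscale c 0 = 0" "cscale 0 A = 0" "cscale 1 A = A"
 "cscale c (cscale d A) = cscale (c * d) A" "cscale (c + d) A = cscale c A + cscale d A"
 by (simp_all add: cmat_simps algebra_simps)

lemma trace_mult_commute: "trace (A ** B) = trace (B ** (A :: cmat))" by (simp add: cmat_simps algebra_simps)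

lemma blin_nth2: "blin (%A::cmat. A $ i $ j)" by (intro linear_conv_bounded_linear[THEN iffD1] linearI) simp_all

lemma blin_adj2: "blin adj2" by (intro linear_conv_bounded_linear[THEN iffD1] linearI) (simp_all add: cmat_simps)

lemma blin_cadj: "blin cadj" by (intro linear_conv_bounded_linear[THEN iffD1] linearI) (simp_all add: cmat_simps)

lemma blin_trace: "blin (trace :: cmat => complex)"
 by (intro linear_conv_bounded_linear[THEN iffD1] linearI) (simp_all add: cmat_simps algebra_simps)

lemma bil_mmult: "bilin ((**) :: cmat => cmat => cmat)"
 unfolding bilinear_conv_bounded_bilinear[symmetric] bilinear_def
 by (intro conjI allI linearI) (simp_all add: cmat_simps algebra_simps)

lemma bil_comm: "bilin comm" unfolding bilinear_conv_bounded_bilinear[symmetric] bilinear_def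
 by (intro conjI allI linearI) (simp_all add: cmat_simps algebra_simps)

lemma bil_cscale: "bilin cscale" unfolding bilinear_conv_bounded_bilinear[symmetric] bilinear_def
 by (intro conjI allI linearI) (simp_all add: cmat_simps algebra_simps)

lemma bil_mulv: "bilin ((*v) :: cmat => complex^2 => complex^2)"
 unfolding bilinear_conv_bounded_bilinear[symmetric] bilinear_def
 by (intro conjI allI linearI) (simp_all add: cmat_simps vec2_eq_iff algebra_simps)


section \<open>Smooth functions on the interval\<close>

lemmas blin_deriv = bounded_linear.has_vector_derivative
lemmas bil_deriv = bounded_bilinear.has_vector_derivative

locale interval =
 fixes L :: real assumes L_pos: "0 < L"
begin

abbreviation "II == {0..L}"
lemma ends: "0 : II" "L : II" using L_pos by auto

abbreviation "NS \<equiv> nahm_space L"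
abbreviation smooth :: "(real => 'a::real_normed_vector) => bool" where "smooth == smooth_on_I L"
abbreviation der :: "(real => 'a::real_normed_vector) => real => 'a" where "der == ideriv L"
abbreviation "GG == gauge_group L"
abbreviation "gact == gauge_act L"
abbreviation "orb == nahm_orbit L"
abbreviation "PP == paths L"
abbreviation onI :: "(real => 'a::zero) => real => 'a" where "onI == on_I L"

abbreviation has_der :: "(real => 'a::real_normed_vector) => 'a => real => bool" (infix "has'_der" 50) where
 "(f has_der d) t == (f has_vector_derivative d) (at t within II)"

abbreviation rel_open :: "real set => bool" where
 "rel_open U == openin (top_of_set II) U"

lemma der_eqI: assumes "t : II" "(f has_der d) t" shows "der f t = d"
proof -
 have "at t within II ~= bot" using assms(1) L_pos by (simp add: trivial_limit_within)
 from vector_derivative_within[OF this assms(2)] show ?thesis by (simp add: ideriv_def)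
qed

lemma has_der: assumes "f differentiable (at t within II)" shows "(f has_der der f t) t"
 using assms by (simp add: ideriv_def vector_derivative_works)

lemma rel_open_eventually: assumes "rel_open U" "t : U"
 shows "ev (nhds t) (%s. s : II --> s : U)"
 using assms unfolding openin_open eventually_nhds by blast

lemma rel_open_sub: "rel_open U ==> t : U ==> t : II" using openin_imp_subset by blast

lemma has_der_cong: assumes "rel_open U" "t : U" "!!s. s : U ==> f s = g s" "(f has_der d) t" shows "(g has_der d) t"
proof -
 have "ev (nhds t) (%s. s : II --> f s = g s)"
  using rel_open_eventually[OF assms(1,2)] by eventually_elim (simp add: assms(3))
 thus ?thesis using assms(4) has_vector_derivative_cong_ev[of _ f g t d] assms(2,3) by simp
qed

lemma der_cong: assumes "rel_open U" "t : U" "!!s. s : U ==> f s = g s" shows "der f t = der g t"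
proof -
 have "ev (nhds t) (%s. s : II --> f s = g s)"
  using rel_open_eventually[OF assms(1,2)] by eventually_elim (simp add: assms(3))
 thus ?thesis unfolding ideriv_def by (intro vector_derivative_cong_eq) (use rel_open_sub[OF assms(1,2)] in auto)
qed

lemma der_cong_I: assumes "t : II" "!!s. s : II ==> f s = g s" shows "der f t = der g t"
 using der_cong[of "II" t f g] assms by simp

lemma has_der_cong_I: assumes "t : II" "!!s. s : II ==> f s = g s" "(f has_der d) t" shows "(g has_der d) t"
 using has_der_cong[of "II" t f g d] assms by simp

lemma der_funpow_cong_I: assumes "t : II" "!!s. s : II ==> f s = g s" shows "(der ^^ n) f t = (der ^^ n) g t"
 using assms
proof (induction n arbitrary: t)
 case (Suc n)
 thus ?case by (auto intro: der_cong_I)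
qed simp

text \<open>Counts one derivative more than \<open>n\<close>, always taken relative to the whole
  interval. The set \<open>U\<close> is present because frames of a line subbundle are smooth only
  near a point; on a relatively open \<open>U\<close> all derivatives depend on the values in
  \<open>U\<close> alone. Passing to \<open>der f\<close> first lets the product rule feed the
  induction.\<close>

primrec Ck :: "nat => real set => (real => 'a::real_normed_vector) => bool" where
 "Ck 0 U f <-> (ALL t:U. f differentiable (at t within II))"
| "Ck (Suc n) U f <-> (ALL t:U. f differentiable (at t within II)) & Ck n U (der f)"

lemma Ck_iff:
 "Ck n U f <-> (ALL k<=n. ALL t:U. (der ^^ k) f differentiable (at t within II))"
proof (induction n arbitrary: f)
 case (Suc n)
 have "(ALL k<=Suc n. ALL t:U. (der ^^ k) f differentiable (at t within II)) <->
   (ALL t:U. f differentiable (at t within II)) &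
   (ALL k<=n. ALL t:U. (der ^^ Suc k) f differentiable (at t within II))"
  by (metis Suc_le_mono funpow_0 le0 not0_implies_Suc)
 thus ?case using Suc by (simp add: funpow_Suc_right del: funpow.simps)
qed simp

lemma smooth_iff_Ck: "smooth f <-> (ALL n. Ck n II f)" unfolding smooth_on_I_def Ck_iff by blast

lemma Ck_diff: "Ck n U f ==> t : U ==> f differentiable (at t within II)" by (cases n) auto

lemma Ck_SucD: "Ck (Suc n) U f ==> Ck n U f" unfolding Ck_iff by simp

lemma Ck_mono: "Ck n U f ==> V <= U ==> Ck n V f" unfolding Ck_iff by blast

lemma Ck_has_der: "Ck n U f ==> t : U ==> (f has_der der f t) t" by (rule has_der[OF Ck_diff])

lemma Ck_0I: "(!!t. t : U ==> (f has_der f' t) t) ==> Ck 0 U f" using differentiableI_vector by auto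

lemma Ck_der: "Ck (Suc n) U f ==> Ck n U (der f)" by simp

lemma Ck_cong_imp: assumes "rel_open U" "!!t. t : U ==> f t = g t" "Ck n U f" shows "Ck n U g" using assms(2,3)
proof (induction n arbitrary: f g)
 case 0
 show ?case using 0 by (intro Ck_0I[where f' = "der f"] has_der_cong[OF assms(1), of _ f g])
   (simp_all only: Ck_has_der[of 0 U])
next
 case (Suc n)
 have "Ck n U (der g)" by (rule Suc.IH[of "der f"])
   (use Suc.prems in "simp_all only: Ck_der der_cong[OF assms(1), of _ f g]")
 moreover have "g differentiable (at t within II)" if "t : U" for t
  using has_der_cong[OF assms(1) that Suc.prems(1) Ck_has_der[OF Suc.prems(2) that]] by (blast intro: differentiableI_vector)
 ultimately show ?case by simp
qed

lemma Ck_cong: assumes "rel_open U" "!!t. t : U ==> f t = g t" shows "Ck n U f <-> Ck n U g"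
 using Ck_cong_imp[OF assms(1), of f g n] Ck_cong_imp[OF assms(1), of g f n] assms(2) by metis

lemma Ck_SucI: assumes "rel_open U" "!!t. t : U ==> (f has_der f' t) t" "Ck n U f'" shows "Ck (Suc n) U f"
proof -
 have "f' t = der f t" if "t : U" for t using der_eqI[OF rel_open_sub[OF assms(1) that] assms(2)[OF that]] by simp
 from Ck_cong_imp[OF assms(1) this assms(3)] have "Ck n U (der f)" .
 moreover have "ALL t:U. f differentiable (at t within II)"
  using assms(2) by (blast intro: differentiableI_vector)
 ultimately show ?thesis by simp
qed

lemma Ck_const: "Ck n II (%t. c)"
proof (induction n arbitrary: c)
 case (Suc n)
 show ?case by (rule Ck_SucI[of _ _ "%t. 0"]) (simp_all add: Suc)
qed simp

lemma Ck_linear: assumes U: "rel_open U" and T: "blin T" and "Ck n U f" shows "Ck n U (%t. T (f t))" using assms(3)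
proof (induction n arbitrary: f)
 case 0
 show ?case by (rule Ck_0I[where f' = "%t. T (der f t)"], rule blin_deriv[OF T],
    rule Ck_has_der[OF 0])
next
 case (Suc n)
 show ?case by (rule Ck_SucI[OF U, of _ "%t. T (der f t)"], rule blin_deriv[OF T],
    rule Ck_has_der[OF Suc.prems], assumption, rule Suc.IH[OF Ck_der[OF Suc.prems]])
qed

lemma Ck_add: assumes U: "rel_open U" and "Ck n U f" "Ck n U g" shows "Ck n U (%t. f t + g t)" using assms(2,3)
proof (induction n arbitrary: f g)
 case 0
 show ?case by (rule Ck_0I[where f' = "%t. der f t + der g t"], rule has_vector_derivative_add;
    rule Ck_has_der, rule 0, assumption)
next
 case (Suc n)
 show ?case by (rule Ck_SucI[OF U, of _ "%t. der f t + der g t"], rule has_vector_derivative_add)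
   (use Suc in \<open>auto simp only: Ck_has_der[of "Suc n" U] Ck_der\<close>)
qed

lemma Ck_bilinear: assumes U: "rel_open U" and B: "bilin B" and "Ck n U f" "Ck n U g"
 shows "Ck n U (%t. B (f t) (g t))" using assms(3,4)
proof (induction n arbitrary: f g)
 case 0
 show ?case by (rule Ck_0I[where f' = "%t. B (f t) (der g t) + B (der f t) (g t)"],
    rule bil_deriv[OF B]; rule Ck_has_der, rule 0, assumption)
next
 case (Suc n)
 have "Ck n U (%t. B (f t) (der g t) + B (der f t) (g t))"
  by (intro Ck_add[OF U] Suc.IH Ck_SucD[OF Suc.prems(1)] Ck_SucD[OF Suc.prems(2)]
    Ck_der[OF Suc.prems(1)] Ck_der[OF Suc.prems(2)])
 moreover have "((%t. B (f t) (g t)) has_der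
   B (f t) (der g t) + B (der f t) (g t)) t" if "t : U" for t
  by (rule bil_deriv[OF B Ck_has_der[OF Suc.prems(1) that]
     Ck_has_der[OF Suc.prems(2) that]])
 ultimately show ?case by (intro Ck_SucI[OF U, of _ "%t. B (f t) (der g t) + B (der f t) (g t)"])
qed

lemma Ck_inverse:
 fixes f :: "real => real" assumes U: "rel_open U" and "Ck n U f" and nz: "!!t. t : U ==> f t ~= 0"
 shows "Ck n U (%t. inverse (f t))" using assms(2)
proof (induction n)
 have *: "((%t. inverse (f t)) has_der - (inverse (f t) * der f t * inverse (f t))) t" if "t : U" "Ck n U f" for t n
  using Ck_has_der[OF that(2,1)] nz[OF that(1)] unfolding has_real_derivative_iff_has_vector_derivative[symmetric]
  by (rule DERIV_inverse')
 {
  case 0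
  show ?case by (rule Ck_0I, rule *[OF _ 0])
 next
  case (Suc n)
  have "Ck n U (%t. - (inverse (f t) * der f t * inverse (f t)))"
   by (intro Ck_linear[OF U bounded_linear_minus[OF bounded_linear_ident]]
     Ck_bilinear[OF U bounded_bilinear_mult] Suc.IH Ck_SucD[OF Suc.prems] Ck_der[OF Suc.prems])
  thus ?case by (rule Ck_SucI[OF U, rotated]) (rule *[OF _ Suc.prems])
 }
qed

lemma rel_open_I [simp]: "rel_open II" by simp

lemma smooth_cong: "(!!t. t : II ==> f t = g t) ==> smooth f <-> smooth g"
 unfolding smooth_iff_Ck using Ck_cong[of "II" f g] by simp

lemma smooth_const [simp]: "smooth (%t. c)" by (simp add: smooth_iff_Ck Ck_const)

lemma smooth_linear: "blin T ==> smooth f ==> smooth (%t. T (f t))" by (simp add: smooth_iff_Ck Ck_linear)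

lemma smooth_add: "smooth f ==> smooth g ==> smooth (%t. f t + g t)" by (simp add: smooth_iff_Ck Ck_add)

lemma smooth_minus: "smooth f ==> smooth (%t. - f t)"
 by (rule smooth_linear[OF bounded_linear_minus[OF bounded_linear_ident]])

lemma smooth_diff: "smooth f ==> smooth g ==> smooth (%t. f t - g t)"
 using smooth_add[of f "%t. - g t"] smooth_minus[of g] by simp

lemma smooth_bilinear: "bilin B ==> smooth f ==> smooth g ==> smooth (%t. B (f t) (g t))"
 by (simp add: smooth_iff_Ck Ck_bilinear)

lemmas smooth_mmult = smooth_bilinear[OF bil_mmult] and smooth_comm = smooth_bilinear[OF bil_comm]
 and smooth_mulv = smooth_bilinear[OF bil_mulv] and smooth_cscale = smooth_bilinear[OF bil_cscale]
 and smooth_nth2 = smooth_linear[OF blin_nth2] and smooth_nth = smooth_linear[OF bounded_linear_vec_nth]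
 and smooth_adj2 = smooth_linear[OF blin_adj2] and smooth_cadj = smooth_linear[OF blin_cadj]

lemma smooth_Pair: assumes "smooth f" "smooth g" shows "smooth (%t. (f t, g t))"
proof -
 have "blin (%x. (x, 0))" "blin (%x. (0, x))" by (intro bounded_linear_intros)+
 from smooth_add[OF smooth_linear[OF this(1) assms(1)] smooth_linear[OF this(2) assms(2)]]
 show ?thesis by simp
qed

lemmas smooth_fst = smooth_linear[OF bounded_linear_fst] and smooth_snd = smooth_linear[OF bounded_linear_snd]

lemma smooth_differentiable: "smooth f ==> t : II ==> f differentiable (at t within II)"
 unfolding smooth_iff_Ck using Ck_diff by blast

lemma smooth_has_der: "smooth f ==> t : II ==> (f has_der der f t) t" using smooth_differentiable has_der by blast

lemma smooth_der: "smooth f ==> smooth (der f)" unfolding smooth_iff_Ck by (metis Ck.simps(2))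

lemma smooth_der_funpow: "smooth f ==> smooth ((der ^^ n) f)" by (induction n) (auto intro: smooth_der)

lemma smooth_cont: "smooth f ==> cont II f" unfolding continuous_on_eq_continuous_within
 using smooth_differentiable differentiable_imp_continuous_within by blast

lemma smooth_bounded: "smooth f ==> bounded (f ` II)"
 by (intro compact_imp_bounded compact_continuous_image smooth_cont compact_Icc)

text \<open>Bootstrapping: the right-hand side of the differential equation \<open>f' = F f\<close> is as smooth as \<open>f\<close>.\<close>

lemma smooth_bootstrap: assumes "!!t. t : II ==> (f has_der f' t) t" and "!!n. Ck n II f ==> Ck n II f'"
 shows "smooth f" unfolding smooth_iff_Ck
proof
 fix n
 show "Ck n II f"
 proof (induction n)
  case 0
  show ?case by (rule Ck_0I[OF assms(1)])
  case (Suc n)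
  show ?case using Ck_SucI[of "II" f f' n] assms Suc by simp
 qed
qed

lemma der_const [simp]: "t : II ==> der (%t. c) t = 0" by (rule der_eqI) simp_all

lemma der_bilinear: assumes "bilin B" "smooth f" "smooth g" "t : II"
 shows "der (%t. B (f t) (g t)) t = B (f t) (der g t) + B (der f t) (g t)" by (rule der_eqI[OF assms(4) bil_deriv[OF assms(1)
    smooth_has_der[OF assms(2,4)] smooth_has_der[OF assms(3,4)]]])

lemma der_linear: assumes "blin T" "smooth f" "t : II" shows "der (%t. T (f t)) t = T (der f t)"
 by (rule der_eqI[OF assms(3) blin_deriv[OF assms(1) smooth_has_der[OF assms(2,3)]]])

lemma has_der_mmult:
 fixes f g :: "real => cmat" assumes "(f has_der f') t" "(g has_der g') t"
 shows "((%t. f t ** g t) has_der f t ** g' + f' ** g t) t" using bil_deriv[OF bil_mmult assms] .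

lemma der_zero_const: assumes "!!t. t : II ==> (f has_der 0) t" "t : II" shows "f t = f 0"
proof (rule has_derivative_zero_unique[of "II" f])
 show "(f has_derivative (%h. 0)) (at x within II)" if "x : II" for x
  using assms(1)[OF that] by (simp add: has_vector_derivative_def)
qed (use assms(2) L_pos in simp_all)

section \<open>Convergence of all derivatives\<close>

primrec Ckv :: "nat => 'i filter => ('i => real => 'a::real_normed_vector) => (real => 'a) => bool" where
 "Ckv 0 F f g <-> uniform_limit II f g F"
| "Ckv (Suc n) F f g <-> uniform_limit II f g F & Ckv n F (%i. der (f i)) (der g)"

text \<open>Convergence of all derivatives, uniformly on the interval. Smoothness of the members is
  asked for only eventually, and the filter is arbitrary: it will be a punctured neighbourhood of a
  complex parameter, or \<open>atin\<close> of some topology.\<close>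

definition slim :: "'i filter => ('i => real => 'a::real_normed_vector) => (real => 'a) => bool" where
 "slim F f g <-> (ev F (%i. smooth (f i))) & smooth g & (ALL n. Ckv n F f g)"

lemma Ckv_iff:
 "Ckv n F f g <-> (ALL k<=n. uniform_limit II (%i. (der ^^ k) (f i)) ((der ^^ k) g) F)"
proof (induction n arbitrary: f g)
 case (Suc n)
 have "(ALL k<=Suc n. P k) <-> P 0 & (ALL k<=n. P (Suc k))" for P
  by (metis Suc_le_mono le0 not0_implies_Suc)
 from this[of "%k. uniform_limit II (%i. (der ^^ k) (f i)) ((der ^^ k) g) F"]
 show ?case using Suc by (simp add: funpow_Suc_right del: funpow.simps)
qed simp

lemma Ckv_uniform: "Ckv n F f g ==> uniform_limit II f g F" by (cases n) auto

lemma Ckv_SucD: "Ckv (Suc n) F f g ==> Ckv n F f g" unfolding Ckv_iff by simp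

lemma Ckv_cong:
 assumes "ev F (%i. ALL t:II. f i t = f2 i t)" "!!t. t : II ==> g t = g2 t"
 shows "Ckv n F f g <-> Ckv n F f2 g2"
proof -
 have "uniform_limit II (%i. (der ^^ k) (f i)) ((der ^^ k) g) F <->
  uniform_limit II (%i. (der ^^ k) (f2 i)) ((der ^^ k) g2) F" for k
 proof (rule uniform_limit_cong)
  show "ev F (%i. ALL t:II. (der ^^ k) (f i) t = (der ^^ k) (f2 i) t)"
   using assms(1) by eventually_elim (auto intro: der_funpow_cong_I)
 qed (auto intro: der_funpow_cong_I assms(2))
 thus ?thesis by (simp add: Ckv_iff)
qed

lemma ev_smooth_der: "ev F (%i. smooth (f i)) ==> ev F (%i. smooth (der (f i)))"
 by (erule eventually_mono) (rule smooth_der)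

lemma Ckv_add: assumes "ev F (%i. smooth (f i))" "ev F (%i. smooth (f2 i))"
  "smooth g" "smooth g2" "Ckv n F f g" "Ckv n F f2 g2" shows "Ckv n F (%i t. f i t + f2 i t) (%t. g t + g2 t)" using assms
proof (induction n arbitrary: f f2 g g2)
 case 0
 thus ?case by (auto intro: uniform_limit_add)
next
 case (Suc n)
 have "Ckv n F (%i. der (%t. f i t + f2 i t)) (der (%t. g t + g2 t)) <->
  Ckv n F (%i t. der (f i) t + der (f2 i) t) (%t. der g t + der g2 t)"
 proof (rule Ckv_cong)
  show "ev F (%i. ALL t:II. der (%t. f i t + f2 i t) t = der (f i) t + der (f2 i) t)"
   using Suc.prems(1,2) by eventually_elim (auto intro!: der_eqI has_vector_derivative_add smooth_has_der)
 qed (use Suc.prems in "auto intro!: der_eqI has_vector_derivative_add smooth_has_der")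
 also have \<dots> using Suc.prems by (intro Suc.IH ev_smooth_der smooth_der) simp_all
 finally show ?case using Suc.prems by (auto intro: uniform_limit_add)
qed

lemma Ckv_bilinear: assumes B: "bilin B"
 assumes "ev F (%i. smooth (f i))" "ev F (%i. smooth (f2 i))"
  "smooth g" "smooth g2" "Ckv n F f g" "Ckv n F f2 g2" shows "Ckv n F (%i t. B (f i t) (f2 i t)) (%t. B (g t) (g2 t))"
proof -
 interpret bounded_bilinear B by fact
 show ?thesis using assms(2-)
 proof (induction n arbitrary: f f2 g g2)
  case 0
  thus ?case by (auto intro!: bounded_uniform_limit smooth_bounded)
 next
  case (Suc n)
  have "Ckv n F (%i. der (%t. B (f i t) (f2 i t))) (der (%t. B (g t) (g2 t))) <->
   Ckv n F (%i t. B (f i t) (der (f2 i) t) + B (der (f i) t) (f2 i t))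
    (%t. B (g t) (der g2 t) + B (der g t) (g2 t))"
  proof (rule Ckv_cong)
   show "ev F (%i. ALL t:II. der (%t. B (f i t) (f2 i t)) t =
     B (f i t) (der (f2 i) t) + B (der (f i) t) (f2 i t))"
    using Suc.prems(1,2) by eventually_elim (auto intro!: der_bilinear[OF B])
  qed (use Suc.prems in "auto intro!: der_bilinear[OF B]")
  also have \<dots>
  proof (rule Ckv_add)
   note * = Suc.prems Suc.prems(5,6)[THEN Ckv_SucD]
   note ** = *(1,2)[THEN ev_smooth_der] *(3,4)[THEN smooth_der]
   show "Ckv n F (%i t. B (f i t) (der (f2 i) t)) (%t. B (g t) (der g2 t))" using Suc.prems by (intro Suc.IH * **) simp_all
   show "Ckv n F (%i t. B (der (f i) t) (f2 i t)) (%t. B (der g t) (g2 t))" using Suc.prems by (intro Suc.IH * **) simp_all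
   show "ev F (%i. smooth (%t. B (f i t) (der (f2 i) t)))"
    using *(1) **(2) by eventually_elim (rule smooth_bilinear[OF B])
   show "ev F (%i. smooth (%t. B (der (f i) t) (f2 i t)))"
    using *(2) **(1) by eventually_elim (rule smooth_bilinear[OF B])
   show "smooth (%t. B (g t) (der g2 t))" "smooth (%t. B (der g t) (g2 t))" by (intro smooth_bilinear[OF B] * **)+
  qed
  finally show ?case using Suc.prems by (auto intro!: bounded_uniform_limit smooth_bounded)
 qed
qed

lemma slimD: assumes "slim F f g"
 shows "ev F (%i. smooth (f i))" "smooth g" "Ckv n F f g" "uniform_limit II f g F"
 using assms Ckv_uniform unfolding slim_def by blast+

lemma slim_cong:
 assumes "ev F (%i. ALL t:II. f i t = f2 i t)" "!!t. t : II ==> g t = g2 t"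
 shows "slim F f g <-> slim F f2 g2"
proof -
 have "(ev F (%i. smooth (f i))) <-> (ev F (%i. smooth (f2 i)))"
  by (rule eventually_cong[OF assms(1)], rule smooth_cong) blast
 thus ?thesis using Ckv_cong[OF assms] smooth_cong[of g g2] assms(2) by (auto simp: slim_def)
qed

lemma slim_add: assumes "slim F f g" "slim F f2 g2" shows "slim F (%i t. f i t + f2 i t) (%t. g t + g2 t)" unfolding slim_def
proof (intro conjI allI)
 show "ev F (%i. smooth (%t. f i t + f2 i t))"
  using slimD(1)[OF assms(1)] slimD(1)[OF assms(2)] by eventually_elim (rule smooth_add)
qed (intro smooth_add Ckv_add slimD[OF assms(1)] slimD[OF assms(2)])+

lemma slim_bilinear: assumes "bilin B" "slim F f g" "slim F f2 g2"
 shows "slim F (%i t. B (f i t) (f2 i t)) (%t. B (g t) (g2 t))" unfolding slim_def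
proof (intro conjI allI)
 show "ev F (%i. smooth (%t. B (f i t) (f2 i t)))" using slimD(1)[OF assms(2)] slimD(1)[OF assms(3)]
  by eventually_elim (rule smooth_bilinear[OF assms(1)])
qed (rule smooth_bilinear[OF assms(1)] Ckv_bilinear[OF assms(1)];
  rule slimD[OF assms(2)] slimD[OF assms(3)])+

lemma slim_const_seq: "smooth g ==> slim F (%i. g) g" by (simp add: slim_def Ckv_iff uniform_limit_const)

lemma slim_linear: assumes "blin T" "slim F f g" shows "slim F (%i t. T (f i t)) (%t. T (g t))"
proof -
 have "bilin (%(r::real) x. r *\<^sub>R T x)"
  using bounded_bilinear.comp[OF bounded_bilinear_scaleR bounded_linear_ident assms(1)] .
 from slim_bilinear[OF this slim_const_seq[OF smooth_const[of 1]] assms(2)]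
 show ?thesis by simp
qed

lemma slim_const: assumes "(c ---> d) F" shows "slim F (%i t. c i) (%t. d)"
proof -
 have "uniform_limit II (%i. (der ^^ k) (%t. c i)) ((der ^^ k) (%t. d)) F" for k
 proof (cases k)
  case 0
  thus ?thesis using assms by (auto simp: uniform_limit_iff tendsto_iff)
 next
  case (Suc m)
  \<comment> \<open>Derivatives of a constant are controlled on the interval only, so the induction
    is pointwise there and passes through \<open>der_cong_I\<close>.\<close>
  have z: "(der ^^ Suc m) (%t. e) t = 0" if "t : II" for e :: 'b and t using that
  proof (induction m arbitrary: t)
   case (Suc m)
   have "(der ^^ Suc (Suc m)) (%t. e) t = der (%t. 0 :: 'b) t"
    using Suc.IH by (subst funpow.simps, subst comp_apply) (rule der_cong_I[OF Suc.prems])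
   thus ?case using Suc.prems by simp
  qed simp
  have "uniform_limit II (%i. (der ^^ k) (%t. c i)) ((der ^^ k) (%t. d)) F <->
    uniform_limit II (%i t. 0::'b) (%t. 0) F"
   unfolding Suc by (rule uniform_limit_cong) (use z in simp_all)
  thus ?thesis by (simp add: uniform_limit_const)
 qed
 thus ?thesis by (simp add: slim_def Ckv_iff)
qed

lemma slim_Pair: assumes "slim F f g" "slim F f2 g2" shows "slim F (%i t. (f i t, f2 i t)) (%t. (g t, g2 t))"
proof -
 have "blin (%x. (x, 0))" "blin (%x. (0, x))" by (intro bounded_linear_intros)+
 from slim_add[OF slim_linear[OF this(1) assms(1)] slim_linear[OF this(2) assms(2)]]
 show ?thesis by simp
qed

text \<open>Counterpart of \<open>smooth_bootstrap\<close> for families: uniform convergence starts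
  the induction, and the differential equation gains one derivative at each step.\<close>

lemma slim_bootstrap: assumes "ev F (%i. smooth (f i))" "smooth g"
  and der: "ev F (%i. ALL t:II. (f i has_der f' i t) t)"
  "!!t. t : II ==> (g has_der g' t) t" and "uniform_limit II f g F" and "!!n. Ckv n F f g ==> Ckv n F f' g'"
 shows "slim F f g" unfolding slim_def
proof (intro conjI allI)
 fix n
 show "Ckv n F f g"
 proof (induction n)
  case 0
  show ?case using assms(5) by simp
  case (Suc n)
  have "Ckv n F (%i. der (f i)) (der g) <-> Ckv n F f' g'"
  proof (rule Ckv_cong)
   show "ev F (%i. ALL t:II. der (f i) t = f' i t)"
    using der(1) by eventually_elim (blast intro: der_eqI)
  qed (rule der_eqI[OF _ der(2)])
  thus ?case using Suc assms(5,6) by simp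
 qed
qed (rule assms(1) assms(2))+

section \<open>The topology on the space of paths\<close>

definition path_ball :: "(real => cmat) => nat => real => (real => cmat) set" where
 "path_ball f k e = {g : PP. ALL j<=k. ALL t:II.
  norm ((der ^^ j) g t - (der ^^ j) f t) < e}"

lemma path_top_eq: "path_top L = topology_generated_by {path_ball f k e | f k e. f : PP & 0 < e}"
 by (simp add: path_top_def path_ball_def)

lemma path_smooth: "f : PP ==> smooth f" by (simp add: paths_def)

lemma centre_in_path_ball: "f : PP ==> 0 < e ==> f : path_ball f k e" by (simp add: path_ball_def)

lemma tops_path_top [simp]: "topspace (path_top L) = PP"
proof
 show "topspace (path_top L) <= PP" unfolding path_top_eq by (auto simp: path_ball_def)
 show "PP <= topspace (path_top L)"
 proof
  fix f assume f: "f : PP"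
  have "f : path_ball f 0 1" using centre_in_path_ball[OF f] by simp
  moreover have "path_ball f 0 1 : {path_ball f k e | f k e. f : PP & 0 < e}" using f zero_less_one by blast
  ultimately show "f : topspace (path_top L)" unfolding path_top_eq topology_generated_by_topspace by blast
 qed
qed

lemma path_ball_mono: "k <= k' ==> e' <= e ==> path_ball f k' e' <= path_ball f k e"
 unfolding path_ball_def by (rule, simp) (meson order_less_le_trans order_trans)

text \<open>Finitely many continuous functions on a compact interval stay below \<open>e\<close> by
  a uniform margin. Hence the generating sets are neighbourhoods of each of their points, and the
  balls centred at a point form a neighbourhood base.\<close>

lemma path_ball_recentre: assumes "f0 : PP" "f : path_ball f0 k e" "0 < e"
 shows "EX e'>0. path_ball f k e' <= path_ball f0 k e"
proof -
 have f: "f : PP" using assms by (simp add: path_ball_def)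
 have "EX d>0. ALL t:II. norm ((der ^^ j) f t - (der ^^ j) f0 t) <= e - d" if "j <= k" for j
 proof -
  have "cont II (%t. norm ((der ^^ j) f t - (der ^^ j) f0 t))" using f assms(1)
   by (intro continuous_intros smooth_cont smooth_der_funpow path_smooth)
  from continuous_attains_sup[OF compact_Icc _ this] L_pos
  obtain t where t: "t : II" "!!s. s : II ==>
   norm ((der ^^ j) f s - (der ^^ j) f0 s) <= norm ((der ^^ j) f t - (der ^^ j) f0 t)"
   by auto
  have "norm ((der ^^ j) f t - (der ^^ j) f0 t) < e" using assms(2) that t(1) by (simp add: path_ball_def)
  thus ?thesis using t(2) by (intro exI[of _ "e - norm ((der ^^ j) f t - (der ^^ j) f0 t)"]) simp
 qed
 then obtain d where d: "!!j. j <= k ==> 0 < d j"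
  "!!j t. j <= k ==> t : II ==> norm ((der ^^ j) f t - (der ^^ j) f0 t) <= e - d j" by metis
 define e' where "e' = Min (d ` {..k})"
 have e': "0 < e'" "!!j. j <= k ==> e' <= d j" unfolding e'_def using d(1) by auto
 have "path_ball f k e' <= path_ball f0 k e"
 proof
  fix g assume g: "g : path_ball f k e'"
  have "norm ((der ^^ j) g t - (der ^^ j) f0 t) < e" if "j <= k" "t : II" for j t
  proof -
   have "norm ((der ^^ j) g t - (der ^^ j) f t) < d j" using g that e'(2)[OF that(1)] by (force simp: path_ball_def)
   with d(2)[OF that] show ?thesis using norm_triangle_ineq[of "(der ^^ j) g t - (der ^^ j) f t"
      "(der ^^ j) f t - (der ^^ j) f0 t"] by simp
  qed
  thus "g : path_ball f0 k e" using g by (simp add: path_ball_def)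
 qed
 thus ?thesis using e'(1) by blast
qed

lemma openin_path_top:
 "openin (path_top L) U <-> U <= PP & (ALL f:U. EX k. EX e>0. path_ball f k e <= U)"
proof
 assume U: "openin (path_top L) U"
 have "ALL f:U. EX k. EX e>0. path_ball f k e <= U"
  using U unfolding path_top_eq openin_topology_generated_by_iff
 proof (induction rule: generate_topology_on.induct)
  case (Int a b)
  show ?case
  proof
   fix f assume "f : a Int b"
   then obtain k e k' e' where "0 < e" "path_ball f k e <= a" "0 < e'" "path_ball f k' e' <= b"
    using Int by blast
   hence "0 < min e e'" "path_ball f (max k k') (min e e') <= a Int b"
    using path_ball_mono[of k "max k k'" "min e e'" e f] path_ball_mono[of k' "max k k'" "min e e'" e' f] by auto
   thus "EX k. EX e>0. path_ball f k e <= a Int b" by blast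
  qed
 next
  case (UN K)
  thus ?case by blast
 next
  case (Basis s)
  then obtain f0 k e where s: "s = path_ball f0 k e" "f0 : PP" "0 < e" by blast
  show ?case unfolding s(1) using path_ball_recentre[OF s(2) _ s(3)] by blast
 qed simp
 thus "U <= PP & (ALL f:U. EX k. EX e>0. path_ball f k e <= U)"
  using openin_subset[OF U] by simp
next
 assume U: "U <= PP & (ALL f:U. EX k. EX e>0. path_ball f k e <= U)"
 have "openin (path_top L) (path_ball f k e)" if "f : PP" "0 < e" for f k e
  unfolding path_top_eq by (rule topology_generated_by_Basis) (use that in blast)
 note op = this
 have "EX T. openin (path_top L) T & f : T & T <= U" if f: "f : U" for f
 proof -
  have fp: "f : PP" using U f by auto
  have "EX k. EX e>0. path_ball f k e <= U" using U f by simp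
  then obtain k e where e: "0 < e" "path_ball f k e <= U" by auto
  show ?thesis by (intro exI[of _ "path_ball f k e"] conjI op[OF fp e(1)] centre_in_path_ball[OF fp e(1)] e(2))
 qed
 thus "openin (path_top L) U" by (subst openin_subopen) blast
qed

lemma openin_path_ball: "f : PP ==> 0 < e ==> openin (path_top L) (path_ball f k e)"
 unfolding path_top_eq by (rule topology_generated_by_Basis) blast

text \<open>Translates the topology of the space of paths into analysis. As the filter is arbitrary,
  continuity of a map can be tested along \<open>atin\<close> and proved by estimates for
  differential equations.\<close>

lemma limitin_path_top:
 "limitin (path_top L) r f F <-> f : PP & (ev F (%i. r i : PP)) & slim F r f"
proof
 assume lim: "limitin (path_top L) r f F"
 hence f: "f : PP" using limitin_topspace by fastforce
 have ev: "ev F (%i. r i : path_ball f k e)" if "0 < e" for k e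
  using lim openin_path_ball[OF f that] centre_in_path_ball[OF f that] unfolding limitin_def by blast
 have "ev F (%i. r i : PP)" using ev[of 1 0] by (auto simp: path_ball_def elim: eventually_mono)
 moreover have "uniform_limit II (%i. (der ^^ k) (r i)) ((der ^^ k) f) F" for k unfolding uniform_limit_iff
 proof (intro allI impI)
  fix e :: real assume "0 < e"
  from ev[OF this, of k] show "ev F (%n. ALL x:II. dist ((der ^^ k) (r n) x) ((der ^^ k) f x) < e)"
   by (elim eventually_mono) (auto simp: path_ball_def dist_norm)
 qed
 ultimately show "f : PP & (ev F (%i. r i : PP)) & slim F r f"
  using f path_smooth by (auto simp: slim_def Ckv_iff elim: eventually_mono)
next
 assume *: "f : PP & (ev F (%i. r i : PP)) & slim F r f"
 show "limitin (path_top L) r f F" unfolding limitin_def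
 proof (intro conjI allI impI)
  show "f : topspace (path_top L)" using * by simp
  fix U assume "openin (path_top L) U & f : U"
  then obtain k e where e: "0 < e" "path_ball f k e <= U" unfolding openin_path_top by blast
  have "ev F (%i. ALL j<=k. ALL t:II. norm ((der ^^ j) (r i) t - (der ^^ j) f t) < e)"
  proof -
   have "ev F (%i. ALL t:II. norm ((der ^^ j) (r i) t - (der ^^ j) f t) < e)" for j
    using slimD(3)[of F r f j] * e(1) unfolding Ckv_iff uniform_limit_iff dist_norm by blast
   hence "ev F (%i. ALL j:{..k}. ALL t:II. norm ((der ^^ j) (r i) t - (der ^^ j) f t) < e)"
    by (intro eventually_ball_finite) simp_all
   thus ?thesis unfolding Ball_def atMost_iff .
  qed
  with * show "ev F (%i. r i : U)" using e(2) by (auto simp: path_ball_def elim: eventually_elim2)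
 qed
qed

section \<open>Ordinary differential equations on the interval\<close>

lemma has_der_cont: assumes "!!t. t : II ==> (y has_der y' t) t" shows "cont II y"
 unfolding continuous_on_eq_continuous_within using has_vector_derivative_continuous[OF assms] by simp

text \<open>Integration divides the exponential part by \<open>2 * K\<close>. Against a Lipschitz
  constant \<open>K\<close> this leaves the factor 1/2 that drives both the contraction and the a
  priori bound in \<open>picard\<close>.\<close>

lemma norm_integral_exp_bound:
 fixes g :: "real => 'e::banach" assumes "cont II g" "t : II" "0 < K"
  and "!!s. s : II ==> norm (g s) <= A * exp (2 * K * s) + c"
 shows "norm (integral {0..t} g) <= A * (exp (2 * K * t) - 1) / (2 * K) + c * t"
proof -
 have "((%s. A * exp (2 * K * s) + c) has_integral
   (A * exp (2 * K * t) / (2 * K) + c * t) - (A * exp (2 * K * 0) / (2 * K) + c * 0)) {0..t}"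
  using assms(2,3) by (intro fundamental_theorem_of_calculus)
   (auto intro!: derivative_eq_intros simp: has_real_derivative_iff_has_vector_derivative[symmetric])
 hence I: "((%s. A * exp (2 * K * s) + c) has_integral A * (exp (2 * K * t) - 1) / (2 * K) + c * t) {0..t}"
  by (simp add: algebra_simps diff_divide_distrib)
 have "cont {0..t} g" by (rule continuous_on_subset[OF assms(1)]) (use assms(2) in auto)
 hence "norm (integral {0..t} g) <= integral {0..t} (%s. A * exp (2 * K * s) + c)" using assms(2,4)
  by (intro integral_norm_bound_integral integrable_continuous_interval) (auto intro!: continuous_intros)
 thus ?thesis using integral_unique[OF I] by simp
qed

text \<open>Picard iteration; the weight \<open>exp (2 K t)\<close> makes the iterates converge geometrically on the
 whole interval.\<close>

lemma picard:
 fixes Ph :: "real => 'e::banach => 'e" assumes cont: "!!y. cont II y ==> cont II (%t. Ph t (y t))"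
  and K: "0 < K" and c: "0 <= c"
  and lip: "!!t u v. t : II ==> norm u <= R ==> norm v <= R ==> norm (Ph t u - Ph t v) <= K * norm (u - v)"
  and zero: "!!t. t : II ==> norm (Ph t 0) <= c" and R: "2 * (norm xi + c * L) * exp (2 * K * L) <= R"
 shows "EX y. y 0 = xi & (ALL t:II. (y has_der Ph t (y t)) t) &
  (ALL t:II. norm (y t) <= 2 * (norm xi + c * L) * exp (2 * K * t))"
proof -
 define D where "D = norm xi + c * L"
 have D: "0 <= D" unfolding D_def using c L_pos by simp
 have R0: "0 <= R" using R D unfolding D_def by (meson exp_ge_zero mult_nonneg_nonneg order_trans zero_le_numeral)
 define y where "y = rec_nat (%t::real. 0::'e) (%n z t. xi + integral {0..t} (%s. Ph s (z s)))"
 have y0: "y 0 = (%t. 0)" and ySuc: "y (Suc n) = (%t. xi + integral {0..t} (%s. Ph s (y n s)))" for n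
  by (simp_all add: y_def)
 have ycont: "cont II (y n)" for n
 proof (induction n)
  case (Suc n)
  show ?case unfolding ySuc
   by (intro continuous_intros indefinite_integral_continuous_1 integrable_continuous_interval cont Suc)
 qed (simp add: y0)
 have expR: "2 * D * exp (2 * K * t) <= R" if "t : II" for t
 proof -
  have "2 * D * exp (2 * K * t) <= 2 * D * exp (2 * K * L)" using that K D by (intro mult_left_mono) auto
  thus ?thesis using R unfolding D_def by simp
 qed
 \<comment> \<open>One iteration turns the bound with \<open>2 * D\<close> into one with
   \<open>D\<close>, and by \<open>expR\<close> the iterates stay in the ball of radius
   \<open>R\<close>, where \<open>lip\<close> is available.\<close>
 have ybound: "ALL t:II. norm (y n t) <= 2 * D * exp (2 * K * t)" for n
 proof (induction n)
  case 0 show ?case using D by (simp add: y0)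
  case (Suc n)
  show ?case
  proof
   fix t assume t: "t : II"
   have "norm (integral {0..t} (%s. Ph s (y n s))) <= (K * (2 * D)) * (exp (2 * K * t) - 1) / (2 * K) + c * t"
   proof (rule norm_integral_exp_bound[OF cont[OF ycont] t K])
    fix s assume s: "s : II"
    have "norm (Ph s (y n s)) <= norm (Ph s (y n s) - Ph s 0) + norm (Ph s 0)"
     using norm_triangle_ineq[of "Ph s (y n s) - Ph s 0" "Ph s 0"] by simp
    also have "\<dots> <= K * norm (y n s - 0) + c" using Suc s expR[OF s] R0 by (intro add_mono lip zero) force+
    also have "\<dots> <= K * (2 * D * exp (2 * K * s)) + c" using Suc s K by (intro add_right_mono mult_left_mono) auto
    finally show "norm (Ph s (y n s)) <= K * (2 * D) * exp (2 * K * s) + c" by simp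
   qed
   also have "\<dots> <= D * (exp (2 * K * t) - 1) + c * L" using t c by (simp add: mult_left_mono)
   finally have "norm (y (Suc n) t) <= norm xi + (D * (exp (2 * K * t) - 1) + c * L)"
    unfolding ySuc by (intro norm_triangle_le add_left_mono)
   also have "\<dots> = D * exp (2 * K * t)" by (simp add: D_def algebra_simps)
   also have "\<dots> <= 2 * D * exp (2 * K * t)" using D by simp
   finally show "norm (y (Suc n) t) <= 2 * D * exp (2 * K * t)" .
  qed
 qed
 have yR: "norm (y n t) <= R" if "t : II" for n t using ybound[of n] expR[OF that] that by force
 \<comment> \<open>The exponential part \<open>A\<close> of the bound serves for the geometric
   convergence of the iterates, the constant part \<open>B\<close> for the passage to the limit
   under the integral.\<close>
 have Phdiff: "norm (integral {0..t} (%s. Ph s (u s)) - integral {0..t} (%s. Ph s (v s)))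
   <= K * A * (exp (2 * K * t) - 1) / (2 * K) + K * B * t"
  if "cont II u" "cont II v" "t : II"
   "!!s. s : II ==> norm (u s) <= R" "!!s. s : II ==> norm (v s) <= R"
   "!!s. s : II ==> norm (u s - v s) <= A * exp (2 * K * s) + B" for u v A B t
 proof -
  have int: "(%s. Ph s (w s)) integrable_on {0..t}" if "cont II w" for w using `t \<in> II`
   by (intro integrable_continuous_interval continuous_on_subset[OF cont[OF that]]) auto
  have "integral {0..t} (%s. Ph s (u s)) - integral {0..t} (%s. Ph s (v s)) =
    integral {0..t} (%s. Ph s (u s) - Ph s (v s))"
   by (rule integral_diff[symmetric]; rule int) fact+
  also have "norm \<dots> <= (K * A) * (exp (2 * K * t) - 1) / (2 * K) + (K * B) * t"
  proof (rule norm_integral_exp_bound[OF _ that(3) K])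
   show "cont II (%s. Ph s (u s) - Ph s (v s))" by (intro continuous_on_diff cont that)
   fix s assume s: "s : II"
   have "norm (Ph s (u s) - Ph s (v s)) <= K * norm (u s - v s)" by (intro lip s that)
   also have "\<dots> <= K * (A * exp (2 * K * s) + B)" using that(6)[OF s] K by simp
   finally show "norm (Ph s (u s) - Ph s (v s)) <= K * A * exp (2 * K * s) + K * B" by (simp add: algebra_simps)
  qed
  finally show ?thesis .
 qed
 have ydiff: "ALL t:II. norm (y (Suc n) t - y n t) <= 2 * D * (1/2) ^ n * exp (2 * K * t)" for n
 proof (induction n)
  case 0 show ?case using ybound[of 1] by (simp add: y0)
  case (Suc n)
  show ?case
  proof
   fix t assume t: "t : II"
   have "y (Suc (Suc n)) t - y (Suc n) t =
     integral {0..t} (%s. Ph s (y (Suc n) s)) - integral {0..t} (%s. Ph s (y n s))"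
    using fun_cong[OF ySuc[of "Suc n"], of t] fun_cong[OF ySuc[of n], of t] by simp
   also have "norm \<dots> <= K * (2 * D * (1/2) ^ n) * (exp (2 * K * t) - 1) / (2 * K) + K * 0 * t"
    by (rule Phdiff[OF ycont ycont t yR yR]) (use Suc in auto)
   also have "\<dots> <= 2 * D * (1/2) ^ Suc n * exp (2 * K * t)" using K D by (simp add: field_simps)
   finally show "norm (y (Suc (Suc n)) t - y (Suc n) t) <= 2 * D * (1/2) ^ Suc n * exp (2 * K * t)" .
  qed
 qed
 define Y where "Y = (%t. \<Sum>i. y (Suc i) t - y i t)"
 have "uniform_limit II (%n t. \<Sum>i<n. y (Suc i) t - y i t) Y sequentially" unfolding Y_def
 proof (rule Weierstrass_m_test)
  show "norm (y (Suc n) t - y n t) <= (2 * D * exp (2 * K * L)) * (1/2) ^ n" if "t : II" for n t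
  proof -
   have "norm (y (Suc n) t - y n t) <= 2 * D * (1/2) ^ n * exp (2 * K * t)" using ydiff that by blast
   also have "\<dots> <= 2 * D * (1/2) ^ n * exp (2 * K * L)" using that K D by (intro mult_left_mono) auto
   finally show ?thesis by (simp add: mult_ac)
  qed
  show "summable (%n. (2 * D * exp (2 * K * L)) * (1/2) ^ n)" by simp
 qed
 hence unif: "uniform_limit II y Y sequentially" using sum_lessThan_telescope[of "%i. y i _"] by (simp add: y0)
 have Ycont: "cont II Y" by (rule uniform_limit_theorem[OF _ unif]) (simp_all add: ycont)
 have Ylim: "(%n. y n t) \<longlonglongrightarrow> Y t" if "t : II" for t
  by (rule tendsto_uniform_limitI[OF unif that])
 have Ybound: "norm (Y t) <= 2 * D * exp (2 * K * t)" if "t : II" for t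
  by (rule Lim_bounded[OF tendsto_norm[OF Ylim[OF that]], of 0]) (use ybound that in blast)
 have YR: "norm (Y t) <= R" if "t : II" for t using Ybound[OF that] expR[OF that] by simp
 have Yint: "Y t = xi + integral {0..t} (%s. Ph s (Y s))" if t: "t : II" for t
 proof -
  have "(%n. integral {0..t} (%s. Ph s (y n s))) \<longlonglongrightarrow> integral {0..t} (%s. Ph s (Y s))"
   unfolding tendsto_iff
  proof (intro allI impI)
   fix e :: real assume e: "0 < e"
   define d where "d = e / (2 * K * L)"
   have d: "0 < d" unfolding d_def using e K L_pos by simp
   have "ev sequentially (%n. ALL s:II. dist (y n s) (Y s) < d)"
    using unif d unfolding uniform_limit_iff by blast
   thus "ev sequentially (%n. dist (integral {0..t} (%s. Ph s (y n s))) (integral {0..t} (%s. Ph s (Y s))) < e)"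
   proof eventually_elim
    case (elim n)
    have "norm (integral {0..t} (%s. Ph s (y n s)) - integral {0..t} (%s. Ph s (Y s))) <=
      K * 0 * (exp (2 * K * t) - 1) / (2 * K) + K * d * t"
     by (rule Phdiff[OF ycont Ycont t yR YR]) (use elim in "auto simp: dist_norm intro: less_imp_le")
    also have "\<dots> <= K * d * L" using t K d by simp
    also have "\<dots> < e" unfolding d_def using e by simp
    finally show ?case by (simp add: dist_norm)
   qed
  qed
  hence "(%n. y (Suc n) t) \<longlonglongrightarrow> xi + integral {0..t} (%s. Ph s (Y s))"
   unfolding ySuc by (intro tendsto_intros)
  with LIMSEQ_Suc[OF Ylim[OF t]] show ?thesis by (rule LIMSEQ_unique)
 qed
 show ?thesis
 proof (intro exI[of _ Y] conjI ballI)
  show "Y 0 = xi" using Yint[of 0] L_pos by simp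
  show "norm (Y t) <= 2 * (norm xi + c * L) * exp (2 * K * t)" if "t : II" for t
   using Ybound[OF that] by (simp add: D_def)
  fix t assume t: "t : II"
  have "((%t. xi + integral {0..t} (%s. Ph s (Y s))) has_der 0 + Ph t (Y t)) t"
   by (intro has_vector_derivative_add has_vector_derivative_const
     integral_has_vector_derivative[OF cont[OF Ycont] t])
  hence D: "((%t. xi + integral {0..t} (%s. Ph s (Y s))) has_der Ph t (Y t)) t" by simp
  show "(Y has_der Ph t (Y t)) t" by (rule has_der_cong_I[OF t _ D]) (rule Yint[symmetric])
 qed
qed

text \<open>Let mu be the maximum of \<open>norm (w t) * exp (- (2 * K * t))\<close>, attained at m.
  Integrating the inequality up to m and dividing by the weight gives mu <= norm (w 0) + c L + mu/2,
  and the last term is absorbed into the left-hand side.\<close>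

lemma gronwall:
 fixes w :: "real => 'e::real_normed_vector" assumes der: "!!t. t : II ==> (w has_der w' t) t"
  and bound: "!!t. t : II ==> norm (w' t) <= K * norm (w t) + c"
  and K: "0 < K" and c: "0 <= c" and t: "t : II"
 shows "norm (w t) <= 2 * (norm (w 0) + c * L) * exp (2 * K * t)"
proof -
 have wcont: "cont II w" by (rule has_der_cont[OF der])
 have "cont II (%t. norm (w t) * exp (- (2 * K * t)))" by (intro continuous_intros wcont)
 from continuous_attains_sup[OF compact_Icc _ this] L_pos
 obtain m where m: "m : II"
  "!!t. t : II ==> norm (w t) * exp (- (2 * K * t)) <= norm (w m) * exp (- (2 * K * m))" by auto
 define mu where "mu = norm (w m) * exp (- (2 * K * m))"
 have mu: "norm (w s) <= mu * exp (2 * K * s)" if "s : II" for s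
  using m(2)[OF that] unfolding mu_def[symmetric] by (simp add: exp_minus field_simps)
 have mu0: "0 <= mu" by (simp add: mu_def)
 have "norm (w m - w 0) <= (mu / 2 * exp (2 * K * m) + c * m) - (mu / 2 * exp (2 * K * 0) + c * 0)"
 proof (cases "m = 0")
  case False
  show ?thesis
  proof (rule differentiable_bound_general[where f' = w' and \<phi>' = "%s. K * mu * exp (2 * K * s) + c"])
   show "0 < m" using False m(1) by simp
   show "cont {0..m} w" by (rule continuous_on_subset[OF wcont]) (use m(1) in auto)
   show "cont {0..m} (%m. mu / 2 * exp (2 * K * m) + c * m)" by (intro continuous_intros)
   fix x assume x: "0 < x" "x < m"
   hence x': "x : II" and int: "x : interior II" using m(1) by auto
   show "(w has_vector_derivative w' x) (at x)" using der[OF x'] at_within_interior[OF int] by simp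
   show "((%m. mu / 2 * exp (2 * K * m) + c * m) has_vector_derivative K * mu * exp (2 * K * x) + c) (at x)"
    unfolding has_real_derivative_iff_has_vector_derivative[symmetric] by (auto intro!: derivative_eq_intros)
   have "norm (w' x) <= K * norm (w x) + c" by (rule bound[OF x'])
   also have "\<dots> <= K * (mu * exp (2 * K * x)) + c" using mu[OF x'] K by simp
   finally show "norm (w' x) <= K * mu * exp (2 * K * x) + c" by simp
  qed
 qed simp
 hence "norm (w m) <= norm (w 0) + (mu / 2 * exp (2 * K * m) + c * m - mu / 2)"
  using norm_triangle_ineq2[of "w m" "w 0"] by simp
 also have "\<dots> <= (norm (w 0) + c * L) + mu / 2 * exp (2 * K * m)" using mult_left_mono[of m L c] m(1) c mu0 by simp
 finally have "mu <= ((norm (w 0) + c * L) + mu / 2 * exp (2 * K * m)) * exp (- (2 * K * m))" unfolding mu_def by simp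
 also have "\<dots> = (norm (w 0) + c * L) * exp (- (2 * K * m)) + mu / 2" by (simp add: algebra_simps exp_minus)
 also have "\<dots> <= (norm (w 0) + c * L) * 1 + mu / 2" using m(1) K c by (intro add_right_mono mult_left_mono) auto
 finally have "mu <= 2 * (norm (w 0) + c * L)" by simp
 with mu[OF t] show ?thesis by (elim order_trans) (intro mult_right_mono, simp_all)
qed

section \<open>Linear equations: existence, uniqueness, continuous dependence\<close>

lemma cont_norm_bound:
 fixes k :: "real => 'e::real_normed_vector" assumes "cont II k"
 obtains C where "0 < C" "!!t. t : II ==> norm (k t) <= C"
 using compact_imp_bounded[OF compact_continuous_image[OF assms compact_Icc]] unfolding bounded_pos by auto

text \<open>The coefficient acts through a bilinear map, so that left multiplication, commutators
  and linearized quadratic equations are all instances.\<close>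

lemma lode_exists:
 fixes B :: "'k::real_normed_vector => 'e::banach => 'e"
 assumes "bilin B" "cont II k" "cont II f"
 shows "EX y. y 0 = xi & (ALL t:II. (y has_der B (k t) (y t) + f t) t)"
proof -
 interpret B: bounded_bilinear B by fact
 obtain KB where KB: "0 < KB" "!!a b. norm (B a b) <= norm a * norm b * KB" using B.pos_bounded by blast
 obtain C where C: "0 < C" "!!t. t : II ==> norm (k t) <= C" using cont_norm_bound[OF assms(2)] by blast
 obtain c where c: "0 < c" "!!t. t : II ==> norm (f t) <= c" using cont_norm_bound[OF assms(3)] by blast
 have "EX y. y 0 = xi & (ALL t:II. (y has_der B (k t) (y t) + f t) t) &
  (ALL t:II. norm (y t) <= 2 * (norm xi + c * L) * exp (2 * (C * KB) * t))"
 \<comment> \<open>A linear right-hand side is Lipschitz on every ball, so the radius may be taken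
   equal to the a priori bound.\<close>
 proof (rule picard[where R = "2 * (norm xi + c * L) * exp (2 * (C * KB) * L)"])
  show "norm (B (k t) u + f t - (B (k t) v + f t)) <= C * KB * norm (u - v)" if "t : II" for t u v
  proof -
   have "norm (B (k t) (u - v)) <= norm (k t) * norm (u - v) * KB" by (rule KB)
   also have "\<dots> <= C * norm (u - v) * KB" using C(2)[OF that] KB(1) by (intro mult_right_mono) auto
   finally show ?thesis by (simp add: B.diff_right mult_ac)
  qed
 qed (use C c KB assms(2,3) in "auto intro!: continuous_intros B.continuous_on simp: B.zero_right")
 thus ?thesis by blast
qed

lemma lode_bound:
 fixes B :: "'k::real_normed_vector => 'e::real_normed_vector => 'e"
 assumes "0 < KB" "!!a b. norm (B a b) <= norm a * norm b * KB" "0 < C" "0 <= c"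
  and "!!t. t : II ==> (y has_der B (k t) (y t) + f t) t"
  and "!!t. t : II ==> norm (k t) <= C" "!!t. t : II ==> norm (f t) <= c" "t : II"
 shows "norm (y t) <= 2 * (norm (y 0) + c * L) * exp (2 * (C * KB) * L)"
proof -
 have "norm (y t) <= 2 * (norm (y 0) + c * L) * exp (2 * (C * KB) * t)"
 proof (rule gronwall[OF assms(5)])
  fix t assume t: "t : II"
  have "norm (B (k t) (y t)) <= norm (k t) * norm (y t) * KB" by (rule assms)
  also have "\<dots> <= C * norm (y t) * KB" using assms(6)[OF t] assms(1) by (intro mult_right_mono) auto
  finally show "norm (B (k t) (y t) + f t) <= C * KB * norm (y t) + c"
   using assms(7)[OF t] norm_triangle_ineq[of "B (k t) (y t)" "f t"] by (simp add: mult_ac)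
 qed (use assms in auto)
 also have "\<dots> <= 2 * (norm (y 0) + c * L) * exp (2 * (C * KB) * L)"
  using assms(1,3,4,8) by (intro mult_left_mono) auto
 finally show ?thesis .
qed

lemma lode_unique:
 fixes B :: "'k::real_normed_vector => 'e::real_normed_vector => 'e" assumes "bilin B" "cont II k"
  and y: "!!t. t : II ==> (y has_der B (k t) (y t) + f t) t"
  and z: "!!t. t : II ==> (z has_der B (k t) (z t) + f t) t" and "y 0 = z 0" "t : II" shows "y t = z t"
proof -
 interpret B: bounded_bilinear B by fact
 obtain KB where KB: "0 < KB" "!!a b. norm (B a b) <= norm a * norm b * KB" using B.pos_bounded by blast
 obtain C where C: "0 < C" "!!t. t : II ==> norm (k t) <= C" using cont_norm_bound[OF assms(2)] by blast
 have "norm (y t - z t) <= 2 * (norm (y 0 - z 0) + 0 * L) * exp (2 * (C * KB) * L)"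
 proof (rule lode_bound[where B = B and k = k and f = "%t. 0"])
  show "((%t. y t - z t) has_der B (k t) (y t - z t) + 0) t" if "t : II" for t
   using has_vector_derivative_diff[OF y[OF that] z[OF that]] by (simp add: B.diff_right)
 qed (use KB C assms in auto)
 thus ?thesis using assms(5) by simp
qed

lemma lode_smooth:
 fixes B :: "'k::real_normed_vector => 'e::real_normed_vector => 'e" assumes "bilin B" "smooth k" "smooth f"
  and "!!t. t : II ==> (y has_der B (k t) (y t) + f t) t" shows "smooth y"
proof (rule smooth_bootstrap[OF assms(4)])
 show "Ck n II (%t. B (k t) (y t) + f t)" if "Ck n II y" for n
  using assms(2,3) that by (intro Ck_add Ck_bilinear[OF _ assms(1)]) (simp_all add: smooth_iff_Ck)
qed

text \<open>The difference of two solutions solves the equation with coefficient \<open>kn n\<close>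
  and the small forcing term B (kn - k) y + (fn - f), to which \<open>lode_bound\<close>
  applies.\<close>

lemma lode_lim:
 fixes B :: "'k::real_normed_vector => 'e::real_normed_vector => 'e" assumes "bilin B" "cont II k"
  and k: "uniform_limit II kn k F" and f: "uniform_limit II fn f F"
  and yn: "ev F (%n. ALL t:II. (yn n has_der B (kn n t) (yn n t) + fn n t) t)"
  and y: "!!t. t : II ==> (y has_der B (k t) (y t) + f t) t" and init: "((%n. yn n 0) ---> y 0) F"
 shows "uniform_limit II yn y F"
proof -
 interpret B: bounded_bilinear B by fact
 obtain KB where KB: "0 < KB" "!!a b. norm (B a b) <= norm a * norm b * KB" using B.pos_bounded by blast
 obtain C where C: "0 < C" "!!t. t : II ==> norm (k t) <= C" using cont_norm_bound[OF assms(2)] by blast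
 have "cont II y" by (rule has_der_cont[OF y])
 then obtain Y where Y: "0 < Y" "!!t. t : II ==> norm (y t) <= Y" using cont_norm_bound by blast
 define E where "E = 2 * exp (2 * ((C + 1) * KB) * L)"
 have E: "0 < E" by (simp add: E_def)
 show ?thesis unfolding uniform_limit_iff
 proof (intro allI impI)
  fix e :: real assume e: "0 < e"
  define N where "N = 1 + (Y * KB + 1) * L"
  have pos: "0 < N" unfolding N_def using Y KB L_pos by (simp add: add_pos_pos)
  \<comment> \<open>The bound by 1 keeps \<open>norm (kn n t)\<close> below \<open>C + 1\<close>,
    which allows the growth factor \<open>E\<close> to be fixed before \<open>d\<close>; the other
    bound makes the total error at most e/2.\<close>
  define d where "d = min 1 (e / (2 * E * N))"
  have d: "0 < d" unfolding d_def using e E pos by simp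
  have "E * (d * N) <= E * (e / (2 * E * N) * N)"
   unfolding d_def using E pos by (intro mult_left_mono mult_right_mono) auto
  also have "\<dots> = e / 2" using E pos by simp
  finally have dE: "E * (d * N) <= e / 2" .
  have "ev F (%n. ALL t:II. dist (kn n t) (k t) < d)" "ev F (%n. ALL t:II. dist (fn n t) (f t) < d)"
   "ev F (%n. dist (yn n 0) (y 0) < d)" using k f init d unfolding uniform_limit_iff tendsto_iff by blast+
  thus "ev F (%n. ALL t:II. dist (yn n t) (y t) < e)" using yn
  proof eventually_elim
   case (elim n)
   show ?case
   proof
    fix t assume t: "t : II"
    define g where "g = (%t. B (kn n t - k t) (y t) + (fn n t - f t))"
    have "norm (yn n t - y t) <= 2 * (norm (yn n 0 - y 0) + (d * Y * KB + d) * L) * exp (2 * ((C + 1) * KB) * L)"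
    proof (rule lode_bound[where B = B and k = "kn n" and f = g])
     show "((%t. yn n t - y t) has_der B (kn n t) (yn n t - y t) + g t) t" if "t : II" for t
      using has_vector_derivative_diff[OF elim(4)[rule_format, OF that] y[OF that]]
      by (simp add: g_def B.diff_right B.diff_left algebra_simps)
     show "norm (kn n t) <= C + 1" if "t : II" for t
     proof -
      have "norm (kn n t - k t) <= 1" using elim(1) that d_def by (force simp: dist_norm)
      thus ?thesis using C(2)[OF that] norm_triangle_ineq[of "kn n t - k t" "k t"] by simp
     qed
     show "norm (g t) <= d * Y * KB + d" if "t : II" for t
     proof -
      have "norm (B (kn n t - k t) (y t)) <= norm (kn n t - k t) * norm (y t) * KB" by (rule KB)
      also have "\<dots> <= d * Y * KB"
       using elim(1) that Y KB(1) d by (intro mult_mono) (auto simp: dist_norm intro: less_imp_le)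
      finally show ?thesis
       unfolding g_def using elim(2) that by (intro norm_triangle_le add_mono) (auto simp: dist_norm intro: less_imp_le)
     qed
    qed (use KB C d Y t in auto)
    also have "\<dots> <= 2 * (d + (d * Y * KB + d) * L) * exp (2 * ((C + 1) * KB) * L)"
     using elim(3) by (intro mult_right_mono) (auto simp: dist_norm)
    also have "\<dots> = E * (d * N)" by (simp add: E_def N_def algebra_simps)
    also have "\<dots> < e" using dE e by simp
    finally show "dist (yn n t) (y t) < e" by (simp add: dist_norm)
   qed
  qed
 qed
qed

lemma lode_slim:
 fixes B :: "'k::real_normed_vector => 'e::real_normed_vector => 'e" assumes B: "bilin B"
  and k: "slim F kn k" and f: "slim F fn f"
  and yn: "ev F (%n. ALL t:II. (yn n has_der B (kn n t) (yn n t) + fn n t) t)"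
  and y: "!!t. t : II ==> (y has_der B (k t) (y t) + f t) t" and init: "((%n. yn n 0) ---> y 0) F"
 shows "slim F yn y"
proof (rule slim_bootstrap[OF _ _ yn y])
 show ev: "ev F (%n. smooth (yn n))" using yn slimD(1)[OF k] slimD(1)[OF f]
  by eventually_elim (rule lode_smooth[OF B], assumption, assumption, blast)
 show sm: "smooth y" by (rule lode_smooth[OF B slimD(2)[OF k] slimD(2)[OF f] y])
 show "uniform_limit II yn y F" by (rule lode_lim[OF B smooth_cont[OF slimD(2)[OF k]] slimD(4)[OF k]
     slimD(4)[OF f] yn y init])
 show "Ckv n F (%i t. B (kn i t) (yn i t) + fn i t) (%t. B (k t) (y t) + f t)" if "Ckv n F yn y" for n
 proof (rule Ckv_add)
  show "Ckv n F (%i t. B (kn i t) (yn i t)) (%t. B (k t) (y t))"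
   by (rule Ckv_bilinear[OF B slimD(1)[OF k] ev slimD(2)[OF k] sm slimD(3)[OF k] that])
  show "ev F (%i. smooth (%t. B (kn i t) (yn i t)))"
   using slimD(1)[OF k] ev by eventually_elim (rule smooth_bilinear[OF B])
  show "smooth (%t. B (k t) (y t))" by (rule smooth_bilinear[OF B slimD(2)[OF k] sm])
 qed (rule slimD[OF f])+
qed

text \<open>On the unit ball the quadratic term is Lipschitz with constant \<open>2 * KQ\<close>,
  and the a priori bound of \<open>picard\<close> keeps solutions with small initial value in that
  ball. The bound is linear in \<open>xi\<close>, so the solution with initial value 0
  vanishes.\<close>

lemma qode_exists:
 fixes B :: "'k::real_normed_vector => 'e::banach => 'e" and Q :: "'e => 'e => 'e"
 assumes "bilin B" "bilin Q" "cont II k"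
 shows "EX r>0. EX C>0. ALL xi. norm xi <= r --> (EX y. y 0 = xi &
  (ALL t:II. (y has_der B (k t) (y t) + Q (y t) (y t)) t) &
  (ALL t:II. norm (y t) <= C * norm xi))"
proof -
 interpret B: bounded_bilinear B by fact
 interpret Q: bounded_bilinear Q by fact
 obtain KB where KB: "0 < KB" "!!a b. norm (B a b) <= norm a * norm b * KB" using B.pos_bounded by blast
 obtain KQ where KQ: "0 < KQ" "!!a b. norm (Q a b) <= norm a * norm b * KQ" using Q.pos_bounded by blast
 obtain C where C: "0 < C" "!!t. t : II ==> norm (k t) <= C" using cont_norm_bound[OF assms(3)] by blast
 define K where "K = C * KB + 2 * KQ"
 have K: "0 < K" using C(1) KB(1) KQ(1) by (simp add: K_def add_pos_pos)
 define D where "D = 2 * exp (2 * K * L)"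
 have D: "0 < D" by (simp add: D_def)
 have "EX y. y 0 = xi &
  (ALL t:II. (y has_der B (k t) (y t) + Q (y t) (y t)) t) &
  (ALL t:II. norm (y t) <= D * norm xi)" if "norm xi <= 1 / D" for xi
 proof -
  have "EX y. y 0 = xi &
   (ALL t:II. (y has_der B (k t) (y t) + Q (y t) (y t)) t) &
   (ALL t:II. norm (y t) <= 2 * (norm xi + 0 * L) * exp (2 * K * t))"
  proof (rule picard[where R = 1, OF _ K])
   show "norm (B (k t) u + Q u u - (B (k t) v + Q v v)) <= K * norm (u - v)"
    if t: "t : II" and u: "norm u <= 1" and v: "norm v <= 1" for t u v
   proof -
    have "norm (B (k t) (u - v)) <= C * norm (u - v) * KB"
     using C(2)[OF t] KB(1) by (intro order_trans[OF KB(2)] mult_right_mono) auto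
    moreover have "norm (Q u (u - v)) <= 1 * norm (u - v) * KQ"
     using u KQ(1) by (intro order_trans[OF KQ(2)] mult_right_mono) auto
    moreover have "norm (Q (u - v) v) <= norm (u - v) * 1 * KQ"
     using v KQ(1) by (intro order_trans[OF KQ(2)] mult_right_mono mult_left_mono) auto
    moreover have "B (k t) u + Q u u - (B (k t) v + Q v v) = B (k t) (u - v) + (Q u (u - v) + Q (u - v) v)"
     by (simp add: B.diff_right Q.diff_right Q.diff_left)
    ultimately show ?thesis using norm_triangle_ineq[of "B (k t) (u - v)" "Q u (u - v) + Q (u - v) v"]
      norm_triangle_ineq[of "Q u (u - v)" "Q (u - v) v"] by (simp add: K_def algebra_simps)
   qed
   show "2 * (norm xi + 0 * L) * exp (2 * K * L) <= 1" using that by (simp add: D_def field_simps)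
  qed (use assms in "auto intro!: continuous_intros B.continuous_on Q.continuous_on simp: B.zero_right Q.zero_right")
  then obtain y where y: "y 0 = xi" "ALL t:II. (y has_der B (k t) (y t) + Q (y t) (y t)) t"
   "!!t. t : II ==> norm (y t) <= 2 * (norm xi + 0 * L) * exp (2 * K * t)" by auto
  have D: "2 * (norm xi + 0 * L) * exp (2 * K * t) <= D * norm xi" if "t : II" for t
   using that K by (auto simp: D_def mult_ac intro!: mult_left_mono)
  show ?thesis by (intro exI[of _ y] conjI y(1,2) ballI order_trans[OF y(3) D])
 qed
 thus ?thesis using D by (intro exI[of _ "1 / D"] exI[of _ D]) auto
qed

lemma qode_smooth: assumes "bilin B" "bilin Q" "smooth k"
  and "!!t. t : II ==> (y has_der B (k t) (y t) + Q (y t) (y t)) t" shows "smooth y"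
proof (rule smooth_bootstrap[OF assms(4)])
 show "Ck n II (%t. B (k t) (y t) + Q (y t) (y t))" if "Ck n II y" for n using assms(3) that
  by (intro Ck_add Ck_bilinear[OF _ assms(1)] Ck_bilinear[OF _ assms(2)]) (simp_all add: smooth_iff_Ck)
qed

lemma qode_slim: assumes B: "bilin B" and Q: "bilin Q" and k: "smooth k"
  and yn: "ev F (%n. ALL t:II. (yn n has_der B (k t) (yn n t) + Q (yn n t) (yn n t)) t)"
  and y: "!!t. t : II ==> (y has_der B (k t) (y t) + Q (y t) (y t)) t" and lim: "uniform_limit II yn y F"
 shows "slim F yn y"
proof (rule slim_bootstrap[OF _ _ yn y lim])
 show ev: "ev F (%n. smooth (yn n))" using yn by eventually_elim (rule qode_smooth[OF B Q k], simp)
 show sm: "smooth y" by (rule qode_smooth[OF B Q k y])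
 show "Ckv n F (%i t. B (k t) (yn i t) + Q (yn i t) (yn i t)) (%t. B (k t) (y t) + Q (y t) (y t))" if "Ckv n F yn y" for n
 proof (rule Ckv_add)
  show "Ckv n F (%i t. B (k t) (yn i t)) (%t. B (k t) (y t))" by (rule Ckv_bilinear[OF B _ ev k sm _ that])
    (use slimD[OF slim_const_seq[OF k, of F]] in auto)
  show "Ckv n F (%i t. Q (yn i t) (yn i t)) (%t. Q (y t) (y t))" by (rule Ckv_bilinear[OF Q ev ev sm sm that that])
  show "ev F (%i. smooth (%t. B (k t) (yn i t)))" using ev by eventually_elim (rule smooth_bilinear[OF B k])
  show "ev F (%i. smooth (%t. Q (yn i t) (yn i t)))" using ev by eventually_elim (rule smooth_bilinear[OF Q])
 qed (rule smooth_bilinear[OF B k sm] smooth_bilinear[OF Q sm sm])+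
qed

section \<open>Parallel transport\<close>

text \<open>Parallel transport of d + al from 0 to t. The choice is determined on the interval only;
  all uses are restricted to it.\<close>

definition par :: "(real => cmat) => real => cmat" where
 "par al = (SOME P. P 0 = mat 1 &
  (ALL t:II. (P has_der (- al t) ** P t) t))"

lemma par_works: assumes "cont II al" shows "par al 0 = mat 1"
  and "t : II ==> (par al has_der (- al t) ** par al t) t"
proof -
 have "EX P. P 0 = mat 1 & (ALL t:II. (P has_der (- al t) ** P t + 0) t)"
  by (rule lode_exists[OF bil_mmult]) (intro continuous_intros assms)+
 hence "EX P. P 0 = mat 1 & (ALL t:II. (P has_der (- al t) ** P t) t)" by simp
 from someI_ex[OF this]
 show "par al 0 = mat 1" "t : II ==> (par al has_der (- al t) ** par al t) t" unfolding par_def by blast+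
qed

lemma par_unique: assumes "cont II al" "t : II" "P 0 = mat 1"
  and "!!t. t : II ==> (P has_der (- al t) ** P t) t" shows "P t = par al t"
proof (rule lode_unique[OF bil_mmult, of "%t. - al t" P "%t. 0" "par al"])
 show "cont II (%t. - al t)" by (intro continuous_intros assms(1))
qed (simp_all add: assms par_works[OF assms(1)] del: atLeastAtMost_iff)

lemma par_smooth: assumes "smooth al" shows "smooth (par al)"
proof (rule lode_smooth[OF bil_mmult smooth_minus[OF assms] smooth_const[of 0]])
 show "(par al has_der (- al t) ** par al t + 0) t" if "t : II" for t
  using par_works(2)[OF smooth_cont[OF assms] that] by simp
qed

lemma adj2_sl2: "A : sl2 ==> adj2 A = - A" by (simp add: sl2_iff cmat_iff)

lemma adj2_minus: "adj2 (- A) = - adj2 A" by (simp add: cmat_iff)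

lemma adj2_mult_self: "adj2 A ** A = cscale (det A) (mat 1)" by (simp add: cmat_simps)

lemma adj2_par_deriv: assumes "smooth al" "t : II" "al t : sl2"
 shows "((%t. adj2 (par al t)) has_der adj2 (par al t) ** al t) t" using blin_deriv[OF blin_adj2
   par_works(2)[OF smooth_cont[OF assms(1)] assms(2)]] by (simp add: adj2_mult adj2_minus adj2_sl2[OF assms(3)])

text \<open>The product \<open>adj2 P ** P\<close> is the determinant times the identity, and its
  derivative cancels because \<open>adj2\<close> is minus the identity on trace free
  matrices.\<close>

lemma par_det: assumes "smooth al" "!!t. t : II ==> al t : sl2" "t : II" shows "det (par al t) = 1"
proof -
 note cont = smooth_cont[OF assms(1)]
 have "((%t. adj2 (par al t) ** par al t) has_der 0) t" if "t : II" for t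
  using has_der_mmult[OF adj2_par_deriv[OF assms(1) that assms(2)[OF that]] par_works(2)[OF cont that]]
  by (simp add: mat_ring)
 from der_zero_const[OF this assms(3)]
 have "adj2 (par al t) ** par al t = mat 1" by (simp add: par_works(1)[OF cont])
 thus ?thesis unfolding adj2_mult_self by (simp add: cmat_iff)
qed

lemma pathsD: assumes "f : PP" shows "smooth f" "t : II ==> f t : sl2" "t ~: II ==> f t = 0"
 using assms unfolding paths_def by blast+

lemma on_I_eq: "t : II ==> onI f t = f t" by (simp add: on_I_def)

lemma on_I_paths: "f : PP ==> onI f = f" by (auto simp: on_I_def paths_def)

lemma on_I_in_paths: assumes "smooth f" "!!t. t : II ==> f t : sl2" shows "onI f : PP"
proof -
 have "smooth (onI f)" using smooth_cong[of "onI f" f] assms(1) by (simp add: on_I_def)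
 thus ?thesis using assms(2) by (simp add: paths_def on_I_def)
qed

lemma closed_sl2: "closed sl2"
proof -
 have e: "sl2 = {A. A $ 1 $ 1 + A $ 2 $ 2 = 0}" by (auto simp: sl2_def trace_cmat)
 show ?thesis unfolding e by (intro closed_Collect_eq continuous_intros)
qed

text \<open>The limit is trace free because \<open>sl2\<close> is closed, provided that the filter
  is nontrivial. The filter \<open>atin\<close> is trivial at an isolated point; then membership of
  the limit is supplied by the second alternative.\<close>

lemma limitin_onI: assumes S: "slim F f g" and sl: "ev F (%z. ALL t:II. f z t : sl2)" and F: "F ~= bot | onI g : PP"
 shows "limitin (path_top L) (%z. onI (f z)) (onI g) F"
proof -
 have "g t : sl2" if t: "t : II" and F: "F ~= bot" for t
  by (rule Lim_in_closed_set[OF closed_sl2 _ F tendsto_uniform_limitI[OF slimD(4)[OF S] t]])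
   (use sl in eventually_elim, use t in blast)
 hence "onI g : PP" using F on_I_in_paths[OF slimD(2)[OF S]] by blast
 moreover have "ev F (%z. onI (f z) : PP)" using sl slimD(1)[OF S] by eventually_elim (rule on_I_in_paths, auto)
 moreover have "slim F (%z. onI (f z)) (onI g)" by (rule slim_cong[THEN iffD1, OF _ _ S]) (simp_all add: on_I_eq)
 ultimately show ?thesis unfolding limitin_path_top by blast
qed

section \<open>Gauge transformations\<close>

lemma ggD: assumes "g : GG" shows "smooth g" "t : II ==> det (g t) = 1" "g 0 : torus" "g L : torus"
  "adj2 (g 0) ** der g 0 : t_perp" "adj2 (g L) ** der g L : t_perp"
 using assms L_pos matrix_inv_eq_adj2[of "g 0"] matrix_inv_eq_adj2[of "g L"] by (auto simp: gauge_group_def)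

lemma ggI: assumes "smooth g" "!!t. t : II ==> det (g t) = 1" "g 0 : torus" "g L : torus"
  "adj2 (g 0) ** der g 0 : t_perp" "adj2 (g L) ** der g L : t_perp" shows "g : GG"
 using assms L_pos matrix_inv_eq_adj2[of "g 0"] matrix_inv_eq_adj2[of "g L"] by (auto simp: gauge_group_def)

lemma gact_adj2: assumes "ALL t:II. det (g t) = 1" shows "gact g (al, be) =
  (onI (%t. adj2 (g t) ** al t ** g t + adj2 (g t) ** der g t),
   onI (%t. adj2 (g t) ** be t ** g t))"
 using assms matrix_inv_eq_adj2 by (auto simp: on_I_def)

declare gauge_act.simps [simp del]

lemma gg_det: "g : GG ==> ALL t:II. det (g t) = 1" by (simp add: ggD)

lemma gauge_adj2_deriv: assumes "smooth g" "!!t. t : II ==> det (g t) = 1" "t : II"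
 shows "((%t. adj2 (g t)) has_der - (adj2 (g t) ** der g t ** adj2 (g t))) t"
proof -
 have der: "((%t. adj2 (g t)) has_der adj2 (der g t)) t" by (rule blin_deriv[OF blin_adj2 smooth_has_der[OF assms(1,3)]])
 have "((%t. adj2 (g t) ** g t) has_der adj2 (g t) ** der g t + adj2 (der g t) ** g t) t"
  by (rule has_der_mmult[OF der smooth_has_der[OF assms(1,3)]])
 hence "((%t. mat 1) has_der adj2 (g t) ** der g t + adj2 (der g t) ** g t) t"
  by (rule has_der_cong_I[OF assms(3), rotated]) (simp add: mult_adj2 assms(2))
 from der_eqI[OF assms(3) this] have "adj2 (g t) ** der g t + adj2 (der g t) ** g t = 0" using assms(3) by simp
 hence "adj2 (der g t) ** g t = - (adj2 (g t) ** der g t)" by (simp add: eq_neg_iff_add_eq_0 add.commute)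
 hence "adj2 (der g t) ** g t ** adj2 (g t) = - (adj2 (g t) ** der g t) ** adj2 (g t)" by simp
 hence "adj2 (der g t) = - (adj2 (g t) ** der g t ** adj2 (g t))" using assms(2,3) by (simp add: mat_ring mult_adj2)
 with der show ?thesis by simp
qed

lemma conj_sl2: "det g = 1 ==> A : sl2 ==> adj2 g ** A ** g : sl2"
by (auto simp: trace_mult_commute adj2_cancel sl2_def)

text \<open>The trace of \<open>adj2 (der g t) ** g t\<close> is found in two ways with opposite
  signs: from the derivative of the inverse, and from the symmetry of the bilinear form
  \<open>trace (adj2 A ** B)\<close>.\<close>

lemma gauge_der_sl2: assumes "smooth g" "!!t. t : II ==> det (g t) = 1" "t : II"
 shows "adj2 (g t) ** der g t : sl2"
proof -
 have der: "((%t. adj2 (g t)) has_der adj2 (der g t)) t" by (rule blin_deriv[OF blin_adj2 smooth_has_der[OF assms(1,3)]])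
 have "adj2 (der g t) = - (adj2 (g t) ** der g t ** adj2 (g t))"
  using der_eqI[OF assms(3) der] der_eqI[OF assms(3) gauge_adj2_deriv[OF assms]] by simp
 hence "trace (adj2 (der g t) ** g t) = - trace (adj2 (g t) ** der g t)"
  using assms(2)[OF assms(3)] by (simp add: mat_ring mult_adj2) (simp add: trace_cmat)
 moreover have "trace (adj2 (der g t) ** g t) = trace (adj2 (g t) ** der g t)" by (simp add: cmat_simps)
 ultimately show ?thesis by (simp add: sl2_def)
qed

lemma torus_conj_t_perp: "h : torus ==> A : t_perp ==> adj2 h ** A ** h : t_perp"
 by (simp add: torus_iff t_perp_iff mult_nth)

lemma torus_conj_diag: assumes "h : torus"
 shows "(adj2 h ** A ** h) $ 1 $ 1 = A $ 1 $ 1" "(adj2 h ** A ** h) $ 2 $ 2 = A $ 2 $ 2"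
  "(adj2 h ** A ** h) $ 1 $ 2 = A $ 1 $ 2 * (h $ 2 $ 2)\<^sup>2"
  "(adj2 h ** A ** h) $ 2 $ 1 = A $ 2 $ 1 * (h $ 1 $ 1)\<^sup>2"
 using assms by (simp_all add: torus_iff mult_nth power2_eq_square algebra_simps)

lemma bdry_iff: "B : (+) (cscale (- \<i> * x) sigma_z) ` t_perp <-> B $ 1 $ 1 = - \<i> * x & B $ 2 $ 2 = \<i> * x"
proof
 assume "B $ 1 $ 1 = - \<i> * x & B $ 2 $ 2 = \<i> * x"
 hence "B = cscale (- \<i> * x) sigma_z + mat2 0 (B $ 1 $ 2) (B $ 2 $ 1) 0" by (simp add: cmat_iff)
 moreover have "mat2 0 (B $ 1 $ 2) (B $ 2 $ 1) 0 : t_perp" by (simp add: t_perp_iff)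
 ultimately show "B : (+) (cscale (- \<i> * x) sigma_z) ` t_perp" by blast
qed (auto simp: t_perp_iff)

lemma NDD: assumes "(al, be) : nahm_data L x0 xL"
 shows "al : PP" "be : PP" "al 0 : t_perp" "al L : t_perp"
  "be 0 $ 1 $ 1 = - \<i> * x0" "be 0 $ 2 $ 2 = \<i> * x0" "be L $ 1 $ 1 = - \<i> * xL" "be L $ 2 $ 2 = \<i> * xL"
  "t : II ==> (be has_der - comm (al t) (be t)) t"
proof -
 show "t : II ==> (be has_der - comm (al t) (be t)) t"
  using assms smooth_has_der[of be t] pathsD(1)[of be] by (auto simp: nahm_data_def add_eq_0_iff)
qed (use assms in "auto simp: nahm_data_def t_perp_iff")

lemma NDI: assumes "al : PP" "be : PP" "al 0 : t_perp" "al L : t_perp"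
  "be 0 $ 1 $ 1 = - \<i> * x0" "be L $ 1 $ 1 = - \<i> * xL" "!!t. t : II ==> (be has_der - comm (al t) (be t)) t"
 shows "(al, be) : nahm_data L x0 xL"
proof -
 have "be 0 : sl2" "be L : sl2" using pathsD(2)[OF assms(2)] L_pos by auto
 thus ?thesis using assms der_eqI[OF _ assms(7)] unfolding nahm_data_def bdry_iff by (simp add: sl2_iff)
qed

lemma gact_paths: assumes "g : GG" "al : PP" "be : PP"
 shows "fst (gact g (al, be)) : PP" "snd (gact g (al, be)) : PP"
proof -
 note g = ggD[OF assms(1)]
 have s: "smooth (%t. adj2 (g t))" by (rule smooth_adj2[OF g(1)])
 have sl: "X : sl2 ==> Y : sl2 ==> X + Y : sl2" for X Y by (simp add: sl2_iff)
 have "onI (%t. adj2 (g t) ** al t ** g t + adj2 (g t) ** der g t) : PP"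
  by (intro on_I_in_paths smooth_add smooth_mmult s g(1) smooth_der[OF g(1)] pathsD(1)[OF assms(2)]
    sl conj_sl2 g(2) pathsD(2)[OF assms(2)] gauge_der_sl2)
 moreover have "onI (%t. adj2 (g t) ** be t ** g t) : PP"
  by (intro on_I_in_paths smooth_mmult s g(1) pathsD(1)[OF assms(3)] conj_sl2 g(2) pathsD(2)[OF assms(3)])
 ultimately show "fst (gact g (al, be)) : PP" "snd (gact g (al, be)) : PP"
  by (simp_all add: gact_adj2[OF gg_det[OF assms(1)]])
qed

lemma gact_ND: assumes "g : GG" "B : nahm_data L x0 xL" shows "gact g B : nahm_data L x0 xL"
proof -
 obtain al be where B: "B = (al, be)" by (cases B)
 note g = ggD[OF assms(1)]
 note N = NDD[OF assms(2)[unfolded B]]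
 note gaq = gact_adj2[OF gg_det[OF assms(1)], of al be]
 show ?thesis unfolding B gaq
 proof (rule NDI)
  show "onI (%t. adj2 (g t) ** al t ** g t + adj2 (g t) ** der g t) : PP" "onI (%t. adj2 (g t) ** be t ** g t) : PP"
   using gact_paths[OF assms(1) N(1,2)] unfolding gaq by auto
  have tp: "X : t_perp ==> Y : t_perp ==> X + Y : t_perp" for X Y by (simp add: t_perp_iff)
  show "onI (%t. adj2 (g t) ** al t ** g t + adj2 (g t) ** der g t) 0 : t_perp"
   "onI (%t. adj2 (g t) ** al t ** g t + adj2 (g t) ** der g t) L : t_perp" unfolding on_I_eq[OF ends(1)] on_I_eq[OF ends(2)]
   by (intro tp torus_conj_t_perp g N(3,4))+
  show "onI (%t. adj2 (g t) ** be t ** g t) 0 $ 1 $ 1 = - \<i> * x0"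
   "onI (%t. adj2 (g t) ** be t ** g t) L $ 1 $ 1 = - \<i> * xL"
   unfolding on_I_eq[OF ends(1)] on_I_eq[OF ends(2)] torus_conj_diag[OF g(3)] torus_conj_diag[OF g(4)] N(5,7) by auto
  fix t assume t: "t : II"
  define gi where "gi = adj2 (g t)"
  define g' where "g' = der g t"
  have c: "g t ** gi = mat 1" "gi ** g t = mat 1" unfolding gi_def using g(2)[OF t] by (simp_all add: mult_adj2)
  have c': "g t ** (gi ** X) = X" "gi ** (g t ** X) = X" for X using c by (simp_all add: matrix_mul_assoc)
  have "((%t. adj2 (g t) ** be t ** g t) has_der
    adj2 (g t) ** be t ** g' + (gi ** (- comm (al t) (be t)) + (- (gi ** g' ** gi)) ** be t) ** g t) t"
   unfolding gi_def g'_def by (intro has_der_mmult gauge_adj2_deriv[OF g(1) g(2)] t smooth_has_der[OF g(1)] N(9))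
  also have "adj2 (g t) ** be t ** g' + (gi ** (- comm (al t) (be t)) + (- (gi ** g' ** gi)) ** be t) ** g t
   = - comm (gi ** al t ** g t + gi ** g') (gi ** be t ** g t)"
   unfolding gi_def[symmetric] comm_def by (simp add: mat_ring c')
  finally have "((%t. adj2 (g t) ** be t ** g t) has_der
    - comm (onI (%t. adj2 (g t) ** al t ** g t + adj2 (g t) ** der g t) t) (onI (%t. adj2 (g t) ** be t ** g t) t)) t"
   by (simp only: gi_def g'_def on_I_eq[OF t])
  thus "(onI (%t. adj2 (g t) ** be t ** g t) has_der
    - comm (onI (%t. adj2 (g t) ** al t ** g t + adj2 (g t) ** der g t) t) (onI (%t. adj2 (g t) ** be t ** g t) t)) t"
   by (rule has_der_cong_I[OF t, rotated]) (simp only: on_I_eq)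
 qed
qed

lemma gg_mult: assumes "g : GG" "h : GG" shows "(%t. g t ** h t) : GG"
proof -
 note g = ggD[OF assms(1)] and h = ggD[OF assms(2)]
 have d: "der (%t. g t ** h t) t = g t ** der h t + der g t ** h t" if "t : II" for t
  by (rule der_bilinear[OF bil_mmult g(1) h(1) that])
 have tp: "X : t_perp ==> Y : t_perp ==> X + Y : t_perp" for X Y by (simp add: t_perp_iff)
 have e: "adj2 (g t ** h t) ** der (%t. g t ** h t) t : t_perp"
  if t: "t : II" and "adj2 (g t) ** der g t : t_perp" "adj2 (h t) ** der h t : t_perp" "h t : torus" for t
 proof -
  have "adj2 (g t ** h t) ** der (%t. g t ** h t) t =
    adj2 (h t) ** der h t + adj2 (h t) ** (adj2 (g t) ** der g t) ** h t"
   unfolding d[OF t] adj2_mult using g(2)[OF t] by (simp add: mat_ring adj2_cancel)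
  thus ?thesis using that by (simp add: tp torus_conj_t_perp)
 qed
 have tt: "X : torus ==> Y : torus ==> X ** Y : torus" for X Y by (simp add: torus_def det_mul mult_nth)
 show ?thesis by (rule ggI) (simp_all add: smooth_mmult g h det_mul tt e[OF ends(1)] e[OF ends(2)])
qed

lemma gg_inv: assumes "g : GG" shows "(%t. adj2 (g t)) : GG"
proof -
 note g = ggD[OF assms]
 have d: "der (%t. adj2 (g t)) t = - (adj2 (g t) ** der g t ** adj2 (g t))" if "t : II" for t
  by (rule der_eqI[OF that gauge_adj2_deriv[OF g(1,2) that]])
 have ti: "X : torus ==> adj2 X : torus" for X by (simp add: torus_iff mult.commute)
 have e: "adj2 (adj2 (g t)) ** der (%t. adj2 (g t)) t : t_perp"
  if t: "t : II" and "adj2 (g t) ** der g t : t_perp" "g t : torus" for t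
 proof -
  have "adj2 (adj2 (g t)) ** (adj2 (g t) ** der g t) ** adj2 (g t) : t_perp" by (rule torus_conj_t_perp[OF ti]) fact+
  thus ?thesis unfolding d[OF t] by (simp add: mat_ring t_perp_iff)
 qed
 show ?thesis by (rule ggI) (simp_all add: smooth_adj2 g ti e[OF ends(1)] e[OF ends(2)] del: adj2_adj2)
qed

lemma gg_const: "h : torus ==> (%t. h) : GG" using L_pos by (intro ggI) (simp_all add: torus_det t_perp_iff)

lemma gact_mult: assumes "g : GG" "h : GG" shows "gact (%t. g t ** h t) B = gact h (gact g B)"
proof -
 obtain al be where B: "B = (al, be)" by (cases B)
 note g = ggD[OF assms(1)] and h = ggD[OF assms(2)] and gh = ggD[OF gg_mult[OF assms]]
 have d: "der (%t. g t ** h t) t = g t ** der h t + der g t ** h t" if "t : II" for t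
  by (rule der_bilinear[OF bil_mmult g(1) h(1) that])
 show ?thesis
  unfolding B gact_adj2[OF gg_det[OF assms(1)]] gact_adj2[OF gg_det[OF assms(2)]] gact_adj2[OF gg_det[OF gg_mult[OF assms]]]
  by (auto simp: on_I_def d adj2_mult mat_ring adj2_cancel g(2))
qed

lemma gact_one: assumes "al : PP" "be : PP" shows "gact (%t. mat 1) (al, be) = (al, be)"
proof -
 have "gact (%t. mat 1) (al, be) = (onI al, onI be)" by (subst gact_adj2) (auto simp: on_I_def)
 thus ?thesis by (simp add: on_I_paths assms)
qed

lemma gact_cong: assumes "!!t. t : II ==> g t = h t" shows "gact g B = gact h B"
proof (cases B)
 case (Pair al be)
 have "der g t = der h t" if "t : II" for t by (rule der_cong_I[OF that assms])
 thus ?thesis using assms by (auto simp: Pair on_I_def gauge_act.simps)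
qed

lemma gact_inv: assumes "g : GG" "B : nahm_data L x0 xL" shows "gact (%t. adj2 (g t)) (gact g B) = B"
proof -
 obtain al be where B: "B = (al, be)" by (cases B)
 have "gact (%t. adj2 (g t)) (gact g B) = gact (%t. g t ** adj2 (g t)) B"
  by (rule gact_mult[OF assms(1) gg_inv[OF assms(1)], symmetric])
 also have "\<dots> = gact (%t. mat 1) B" by (rule gact_cong) (simp add: mult_adj2 ggD(2)[OF assms(1)])
 also have "\<dots> = B" using assms(2) unfolding B by (intro gact_one) (auto dest: NDD)
 finally show ?thesis .
qed

lemma orb_gauge_act: assumes "g : GG" "B : nahm_data L x0 xL" shows "orb (gact g B) = orb B"
proof (rule set_eqI, rule iffI)
 fix X assume "X : orb (gact g B)"
 then obtain h where h: "h : GG" "X = gact h (gact g B)" by (auto simp: nahm_orbit_def)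
 hence "X = gact (%t. g t ** h t) B" by (simp add: gact_mult[OF assms(1)])
 thus "X : orb B" using gg_mult[OF assms(1) h(1)] by (auto simp: nahm_orbit_def)
next
 fix X assume "X : orb B"
 then obtain h where h: "h : GG" "X = gact h B" by (auto simp: nahm_orbit_def)
 note gi = gg_inv[OF assms(1)]
 have "X = gact (%t. adj2 (g t) ** h t) (gact g B)" unfolding gact_mult[OF gi h(1)] gact_inv[OF assms] by (rule h(2))
 thus "X : orb (gact g B)" using gg_mult[OF gi h(1)] by (auto simp: nahm_orbit_def)
qed

lemma orb_self: assumes "B : nahm_data L x0 xL" shows "B : orb B"
proof -
 obtain al be where B: "B = (al, be)" by (cases B)
 have "gact (%t. mat 1) B = B" using assms unfolding B by (intro gact_one) (auto dest: NDD)
 moreover have "(%t. mat 1) : GG" by (rule gg_const) (simp add: torus_iff)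
 ultimately show ?thesis unfolding nahm_orbit_def by (metis imageI)
qed

lemma orb_eq_iff: assumes "B : nahm_data L x0 xL" "B' : nahm_data L x0 xL"
 shows "orb B = orb B' <-> (EX g:GG. B' = gact g B)"
proof
 assume "orb B = orb B'"
 hence "B' : orb B" using orb_self[OF assms(2)] by simp
 thus "EX g:GG. B' = gact g B" by (auto simp: nahm_orbit_def)
qed (use orb_gauge_act[OF _ assms(1)] in auto)

text \<open>A Nahm datum is determined up to gauge by its holonomy and its initial value \<open>be 0\<close>, on which
 gauge transformations act through their values at the two ends.\<close>

lemma par_gauge: assumes "g : GG" "al : PP" "t : II"
 shows "par (fst (gact g (al, be))) t = adj2 (g t) ** par al t ** g 0"
proof -
 note g = ggD[OF assms(1)]
 define al' where "al' = onI (%t. adj2 (g t) ** al t ** g t + adj2 (g t) ** der g t)"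
 have al': "fst (gact g (al, be)) = al'" unfolding al'_def gact_adj2[OF gg_det[OF assms(1)]] by simp
 have "al' : PP" using gact_paths(1)[OF assms(1,2), of "%t. 0"]
  unfolding al'_def gact_adj2[OF gg_det[OF assms(1)]] by (simp add: paths_def sl2_iff)
 hence cont: "cont II al'" by (intro smooth_cont pathsD(1))
 note T = par_works[OF smooth_cont[OF pathsD(1)[OF assms(2)]]]
 show ?thesis unfolding al'
 proof (rule par_unique[OF cont assms(3), symmetric])
  show "adj2 (g 0) ** par al 0 ** g 0 = mat 1" using L_pos by (simp add: T mult_adj2 g(2))
  fix t assume t: "t : II"
  note c = adj2_cancel[OF g(2)[OF t]]
  have "((%t. adj2 (g t) ** par al t ** g 0) has_der
   adj2 (g t) ** par al t ** 0 + (adj2 (g t) ** ((- al t) ** par al t) + (- (adj2 (g t) ** der g t ** adj2 (g t))) ** par al t) ** g 0) t"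
   by (intro has_der_mmult has_vector_derivative_const gauge_adj2_deriv[OF g(1,2) t] T(2)[OF t])
  thus "((%t. adj2 (g t) ** par al t ** g 0) has_der
    (- al' t) ** (adj2 (g t) ** par al t ** g 0)) t"
   unfolding al'_def on_I_eq[OF t] by (simp add: mat_ring c)
 qed
qed

text \<open>Conjugating \<open>be\<close> back to 0 by the parallel transport cancels the commutator
  in the equation, so the conjugated matrix is constant.\<close>

lemma beta_par: assumes "al : PP" "t : II" and "!!t. t : II ==> (be has_der - comm (al t) (be t)) t"
 shows "be t = par al t ** be 0 ** adj2 (par al t)"
proof -
 note a = pathsD[OF assms(1)]
 note T = par_works[OF smooth_cont[OF a(1)]]
 have det: "det (par al t) = 1" if "t : II" for t by (rule par_det[OF a(1,2) that])
 have "((%t. adj2 (par al t) ** be t ** par al t) has_der 0) t" if t: "t : II" for t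
 proof -
  have "((%t. adj2 (par al t) ** be t ** par al t) has_der
   adj2 (par al t) ** be t ** ((- al t) ** par al t) + (adj2 (par al t) ** (- comm (al t) (be t)) +
   (adj2 (par al t) ** al t) ** be t) ** par al t) t"
   by (intro has_der_mmult adj2_par_deriv a(1) a(2)[OF t] t T(2)[OF t] assms(3)[OF t])
  thus ?thesis by (simp add: comm_def mat_ring)
 qed
 from der_zero_const[OF this assms(2)]
 have "adj2 (par al t) ** be t ** par al t = be 0" by (simp add: T(1))
 hence "par al t ** (adj2 (par al t) ** be t ** par al t) ** adj2 (par al t) =
   par al t ** be 0 ** adj2 (par al t)"
  by simp
 thus ?thesis using det[OF assms(2)] by (simp add: mat_ring adj2_cancel mult_adj2)
qed

lemma nahm_beta_par: "(al, be) : nahm_data L x0 xL ==> t : II ==> be t = par al t ** be 0 ** adj2 (par al t)"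
 using beta_par NDD(1,9) by blast

text \<open>The value at 0 forces g = P h0 P'^-1 for the two parallel transports P and P'; the
  condition on the holonomies says that then \<open>g L = hL\<close>. The boundary condition on g^-1
  g' holds because both connection matrices are off-diagonal at the ends and the torus preserves
  \<open>t_perp\<close>.\<close>

lemma nahm_gauge_exists:
 assumes "(al, be) : nahm_data L x0 xL" "(al', be') : nahm_data L x0 xL" "h0 : torus" "hL : torus"
  and hol: "par al' L = adj2 hL ** par al L ** h0" and init: "be' 0 = adj2 h0 ** be 0 ** h0"
 shows "EX g:GG. g 0 = h0 & (al', be') = gact g (al, be)"
proof -
 note N = NDD[OF assms(1)] and N' = NDD[OF assms(2)]
 note a = pathsD[OF N(1)] and a' = pathsD[OF N'(1)]
 note T = par_works[OF smooth_cont[OF a(1)]] and T' = par_works[OF smooth_cont[OF a'(1)]]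
 have det: "det (par al t) = 1" "det (par al' t) = 1" if "t : II" for t
  using par_det[OF a(1,2) that] par_det[OF a'(1,2) that] by auto
 note h = torus_det[OF assms(3)] torus_det[OF assms(4)]
 define g where "g = (%t. par al t ** h0 ** adj2 (par al' t))"
 have g0: "g 0 = h0" by (simp add: g_def T(1) T'(1))
 have gL: "g L = hL" unfolding g_def hol adj2_mult using h det(1)[OF ends(2)] by (simp add: mat_ring adj2_cancel)
 have gs: "smooth g" unfolding g_def by (intro smooth_mmult smooth_const smooth_adj2 par_smooth a(1) a'(1))
 have gd: "det (g t) = 1" if "t : II" for t unfolding g_def using that by (simp add: det_mul det h)
 hence gd': "ALL t:II. det (g t) = 1" by blast
 have dg: "der g t = g t ** al' t - al t ** g t" if t: "t : II" for t
 proof (rule der_eqI[OF t])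
  have "(g has_der
    par al t ** h0 ** (adj2 (par al' t) ** al' t) + (par al t ** 0 + ((- al t) ** par al t) ** h0) ** adj2 (par al' t)) t"
   unfolding g_def by (intro has_der_mmult has_vector_derivative_const adj2_par_deriv a'(1) a'(2)[OF t] t T(2)[OF t])
  thus "(g has_der g t ** al' t - al t ** g t) t" by (simp add: g_def mat_ring)
 qed
 have e: "adj2 (g t) ** der g t = al' t - adj2 (g t) ** al t ** g t" if t: "t : II" for t
  unfolding dg[OF t] using gd[OF t] by (simp add: mat_ring adj2_cancel)
 have tp: "X : t_perp ==> Y : t_perp ==> X - Y : t_perp" for X Y by (simp add: t_perp_iff)
 have gg: "g : GG"
 proof (rule ggI[OF gs gd])
  show "g 0 : torus" "g L : torus" using g0 gL assms(3,4) by auto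
  show "adj2 (g 0) ** der g 0 : t_perp" "adj2 (g L) ** der g L : t_perp"
   using e[OF ends(1)] e[OF ends(2)] tp[OF N'(3) torus_conj_t_perp[OF assms(3) N(3)]]
    tp[OF N'(4) torus_conj_t_perp[OF assms(4) N(4)]] by (simp_all add: g0 gL)
 qed
 have b: "adj2 (g t) ** be t ** g t = be' t" if t: "t : II" for t
 proof -
  have "adj2 (g t) ** be t ** g t = par al' t ** (adj2 h0 ** be 0 ** h0) ** adj2 (par al' t)"
   unfolding g_def adj2_mult nahm_beta_par[OF assms(1) t] using det[OF t] by (simp add: mat_ring adj2_cancel)
  thus ?thesis using nahm_beta_par[OF assms(2) t] init by simp
 qed
 have "gact g (al, be) = (al', be')" unfolding gact_adj2[OF gd'] using a'(3) pathsD(3)[OF N'(2)] by (auto simp: on_I_def e b)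
 thus ?thesis using gg g0 by metis
qed

end


section \<open>Lines\<close>

lemma cline_e1: "cline e1 = {v. v $ 2 = 0}"
proof -
 have "v = v $ 1 *s e1" if "v $ 2 = 0" for v :: "complex^2" using that by (simp add: vec2_eq_iff e1_def axis_def)
 thus ?thesis by (auto simp: cline_def e1_def axis_def)
qed

lemma cline_e2: "cline e2 = {v. v $ 1 = 0}"
proof -
 have "v = v $ 2 *s e2" if "v $ 1 = 0" for v :: "complex^2" using that by (simp add: vec2_eq_iff e2_def axis_def)
 thus ?thesis by (auto simp: cline_def e2_def axis_def)
qed

lemma e12_nth [simp]: "e1 $ 1 = 1" "e1 $ 2 = 0" "e2 $ 1 = 0" "e2 $ 2 = 1" by (simp_all add: e1_def e2_def axis_def)

lemma e12_nz: "e1 ~= 0" "e2 ~= 0"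
 by (metis e12_nth(1) zero_index zero_neq_one, metis e12_nth(4) zero_index zero_neq_one)

lemma cline_e12_neq: "cline e1 ~= cline e2"
 unfolding cline_e1 cline_e2 by (metis (mono_tags, lifting) e12_nth(1,2) mem_Collect_eq zero_neq_one)

lemma line_sign_e [simp]: "line_sign (cline e1) = 1" "line_sign (cline e2) = - 1"
 using cline_e12_neq by (auto simp: line_sign_def)

lemma cline_mulv: "(%w. A *v w) ` cline v = cline (A *v v)" by (auto simp: cline_def image_image vector_scalar_commute)

lemma mulv_assoc: "(A ** B) *v (v :: complex^2) = A *v (B *v v)" by (simp add: matrix_vector_mul_assoc)

lemma cline_self: "v : cline v" and cline_zero: "0 : cline v"
 unfolding cline_def by (metis rangeI vector_smult_lid, metis rangeI vector_smult_lzero)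

lemma cline_scale: "v : cline w ==> c *s v : cline w" by (auto simp: cline_def)

lemma cline_eqI: assumes "v = c *s w" "c ~= 0" shows "cline v = cline w"
proof -
 have w: "w = inverse c *s v" using assms by simp
 have "v : cline w" "w : cline v" using assms(1) w cline_scale cline_self by metis+
 moreover have "cline a <= cline b" if "a : cline b" for a b :: "complex^2"
  using cline_scale[OF that] by (auto simp: cline_def[of a])
 ultimately show ?thesis by blast
qed

lemma cline_eqD: assumes "cline v = cline w" "v ~= 0" shows "EX c. v = c *s w & c ~= 0"
proof -
 have "v : cline w" using assms(1) cline_self by blast
 then obtain c where "v = c *s w" by (auto simp: cline_def)
 thus ?thesis using assms(2) by auto
qed

text \<open>Hermitian projection of \<open>v\<close> onto the line through \<open>e\<close>. It
  depends on that line alone (\<open>cproj_scale\<close>), which is what makes local frames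
  glue.\<close>

definition cproj :: "complex^2 => complex^2 => complex^2" where
 "cproj e v = inverse ((cmod (e $ 1))\<^sup>2 + (cmod (e $ 2))\<^sup>2) *\<^sub>R ((v $ 1 * cnj (e $ 1) + v $ 2 * cnj (e $ 2)) *s e)"

lemma cproj_scale: assumes "c ~= 0" shows "cproj (c *s e) v = cproj e v"
proof -
 define N S where "N = inverse ((cmod (e $ 1))\<^sup>2 + (cmod (e $ 2))\<^sup>2)"
  and "S = v $ 1 * cnj (e $ 1) + v $ 2 * cnj (e $ 2)"
 have N: "inverse ((cmod (c * e $ 1))\<^sup>2 + (cmod (c * e $ 2))\<^sup>2) = inverse ((cmod c)\<^sup>2) * N"
  by (simp add: N_def norm_mult power_mult_distrib distrib_left[symmetric])
 have S: "(v $ 1 * cnj (c * e $ 1) + v $ 2 * cnj (c * e $ 2)) * (c * z) = (cmod c)\<^sup>2 *\<^sub>R (S * z)" for z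
  unfolding scaleR_conv_of_real complex_norm_square by (simp add: S_def algebra_simps)
 have "cproj (c *s e) v $ i = N *\<^sub>R (S * e $ i)" for i
  unfolding cproj_def vector_scaleR_component vector_smult_component N S using assms by simp
 moreover have "cproj e v $ i = N *\<^sub>R (S * e $ i)" for i by (simp add: cproj_def N_def S_def algebra_simps)
 ultimately show ?thesis by (simp add: vec_eq_iff)
qed

lemma cproj_self: "e ~= 0 ==> cproj e e = e"
proof -
 assume e: "e ~= 0"
 hence n: "(cmod (e $ 1))\<^sup>2 + (cmod (e $ 2))\<^sup>2 ~= 0" by (auto simp: vec2_eq_iff sum_power2_eq_zero_iff)
 have "e $ 1 * cnj (e $ 1) + e $ 2 * cnj (e $ 2) = of_real ((cmod (e $ 1))\<^sup>2 + (cmod (e $ 2))\<^sup>2)"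
  by (simp only: of_real_add complex_norm_square)
 thus ?thesis unfolding cproj_def using n
  by (simp add: vec2_eq_iff scaleR_conv_of_real[where 'a = complex] del: of_real_add of_real_power)
qed

lemma bil_smult: "bilin ((*s) :: complex => complex^2 => complex^2)"
 unfolding bilinear_conv_bounded_bilinear[symmetric] bilinear_def
 by (intro conjI allI linearI) (simp_all add: vec2_eq_iff algebra_simps)

lemma cproj_in: "cproj e v : cline e"
proof -
 have "cproj e v = (inverse (of_real ((cmod (e $ 1))\<^sup>2 + (cmod (e $ 2))\<^sup>2)) * (v $ 1 * cnj (e $ 1) + v $ 2 * cnj (e $ 2))) *s e"
  by (simp add: cproj_def vec2_eq_iff scaleR_conv_of_real[where 'a = complex] algebra_simps)
 thus ?thesis by (auto simp: cline_def)
qed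

lemma mulv_cline: "v : cline e ==> A *v v : cline (A *v e)" using cline_mulv[of A e] by blast

lemma cline_eq_e: "cline v = cline e1 <-> v $ 1 ~= 0 & v $ 2 = 0" "cline v = cline e2 <-> v $ 1 = 0 & v $ 2 ~= 0"
proof -
 have "v $ 1 ~= 0 & v $ 2 = 0" if "cline v = cline e1"
  using that cline_self[of v] cline_eqD[OF that[symmetric] e12_nz(1)] by (auto simp: cline_e1 vec2_eq_iff)
 moreover have "cline v = cline e1" if "v $ 1 ~= 0 & v $ 2 = 0"
  by (rule cline_eqI[of _ "v $ 1"]) (use that in "auto simp: vec2_eq_iff")
 ultimately show "cline v = cline e1 <-> v $ 1 ~= 0 & v $ 2 = 0" by blast
 have "v $ 1 = 0 & v $ 2 ~= 0" if "cline v = cline e2"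
  using that cline_self[of v] cline_eqD[OF that[symmetric] e12_nz(2)] by (auto simp: cline_e2 vec2_eq_iff)
 moreover have "cline v = cline e2" if "v $ 1 = 0 & v $ 2 ~= 0"
  by (rule cline_eqI[of _ "v $ 2"]) (use that in "auto simp: vec2_eq_iff")
 ultimately show "cline v = cline e2 <-> v $ 1 = 0 & v $ 2 ~= 0" by blast
qed

lemma proportional_of_deriv:
 fixes u w :: "real => complex" assumes "!!t. t : S ==> (u has_vector_derivative c t * u t) (at t within S)"
  "!!t. t : S ==> (w has_vector_derivative c t * w t) (at t within S)"
  "!!t. t : S ==> u t ~= 0" "convex S" "a : S" "b : S" shows "w a / u a = w b / u b"
proof (rule has_derivative_zero_unique[of S "%t. w t / u t"])
 show "((%t. w t / u t) has_derivative (%h. 0)) (at t within S)" if t: "t : S" for t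
  using has_derivative_divide[OF assms(2)[OF t, unfolded has_vector_derivative_def]
    assms(1)[OF t, unfolded has_vector_derivative_def] assms(3)[OF t]] assms(3)[OF t]
  by (simp add: scaleR_conv_of_real field_simps)
qed (use assms in auto)

section \<open>Nahm sublines as transported coordinate lines\<close>

context interval
begin

lemma Ck_cproj: assumes U: "rel_open U" and s: "Ck n U s" and nz: "!!t. t : U ==> s t ~= 0"
 shows "Ck n U (%t. cproj (s t) v)"
proof -
 have c: "Ck n U (%t. s t $ i)" for i by (rule Ck_linear[OF U bounded_linear_vec_nth s])
 have cc: "Ck n U (%t. cnj (s t $ i))" for i by (rule Ck_linear[OF U bounded_linear_cnj c])
 have "Ck n U (%t. Re (s t $ i * cnj (s t $ i)))" for i
  by (rule Ck_linear[OF U bounded_linear_Re]) (rule Ck_bilinear[OF U bounded_bilinear_mult c cc])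
 hence "Ck n U (%t. (cmod (s t $ i))\<^sup>2)" for i by (simp add: complex_norm_square[symmetric])
 hence N: "Ck n U (%t. inverse ((cmod (s t $ 1))\<^sup>2 + (cmod (s t $ 2))\<^sup>2))"
  using nz by (intro Ck_inverse[OF U] Ck_add[OF U]) (auto simp: vec2_eq_iff sum_power2_eq_zero_iff)
 have "Ck n U (%t. v $ i * cnj (s t $ i))" for i by (rule Ck_linear[OF U bounded_linear_mult_right cc])
 hence "Ck n U (%t. v $ 1 * cnj (s t $ 1) + v $ 2 * cnj (s t $ 2))" by (intro Ck_add[OF U])
 thus ?thesis unfolding cproj_def by (intro Ck_bilinear[OF U bounded_bilinear_scaleR N] Ck_bilinear[OF U bil_smult _ s])
qed

lemma line_subbundle_fibre:
 assumes "line_subbundle L V" "t : II" shows "EX u. u ~= 0 & V `` {t} = cline u"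
proof -
 obtain s e where "0 < e" "ALL r:II. \<bar>r - t\<bar> < e --> s r ~= 0 & V `` {r} = cline (s r)"
  using assms unfolding line_subbundle_def by blast
 thus ?thesis using assms(2) by (intro exI[of _ "s t"]) simp
qed

text \<open>The vector \<open>u t1\<close> is projected onto every fibre. The fibrewise generators
  \<open>u\<close> carry no regularity, but near each point they may be replaced by a smooth frame
  without changing the projection. The section may vanish away from \<open>t1\<close>.\<close>

lemma line_subbundle_section: assumes V: "line_subbundle L V" and t1: "t1 : II"
 obtains si where "smooth si" "!!t. t : II ==> si t : V `` {t}" "si t1 ~= 0"
proof -
 obtain u where u: "!!t. t : II ==> u t ~= 0 & V `` {t} = cline (u t)"
  using line_subbundle_fibre[OF V] by metis
 define si where "si = (%t. cproj (u t) (u t1))"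
 have si: "si t = cproj w (u t1)" if t: "t : II" and w: "V `` {t} = cline w" "w ~= 0" for t w
 proof -
  obtain c where "w = c *s u t" "c ~= 0" using cline_eqD[of w "u t"] w u[OF t] by auto
  thus ?thesis by (simp add: si_def cproj_scale)
 qed
 have "smooth si" unfolding smooth_on_I_def
 proof (intro allI ballI)
  fix n t assume t: "t : II"
  obtain s e where s: "0 < e" "smooth s" "ALL r:II. \<bar>r - t\<bar> < e --> s r ~= 0 & V `` {r} = cline (s r)"
   using V t unfolding line_subbundle_def by blast
  define U where "U = II Int {t - e<..<t + e}"
  have U: "rel_open U" unfolding U_def by (simp add: openin_open_Int)
  have U': "r : II" "s r ~= 0" "V `` {r} = cline (s r)" if "r : U" for r
   using that s(3) by (auto simp: U_def abs_less_iff)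
  have "Ck n U s" using s(2) Ck_mono[of n "II" s U] by (auto simp: smooth_iff_Ck U_def)
  hence "Ck n U (%r. cproj (s r) (u t1))" by (rule Ck_cproj[OF U _ U'(2)])
  hence "Ck n U si" by (rule Ck_cong_imp[OF U, rotated]) (rule si[OF U'(1,3,2), symmetric])
  moreover have "t : U" using t s(1) by (simp add: U_def)
  ultimately show "(der ^^ n) si differentiable at t within II" unfolding Ck_iff by blast
 qed
 moreover have "si t : V `` {t}" if "t : II" for t using u[OF that] cproj_in by (simp add: si_def)
 moreover have "si t1 ~= 0" using u[OF t1] by (simp add: si_def cproj_self)
 ultimately show thesis by (rule that)
qed

text \<open>Transported back to 0, a section of an invariant line satisfies f' = c f, so the
  transported fibre \<open>l t\<close> is locally constant and connectedness of the interval
  concludes. The factor c is obtained pointwise, without continuity; for this reason quotients of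
  components are differentiated instead of solving for f.\<close>

lemma nahm_subline_par: assumes V: "nahm_subline L (al, be) V" and al: "al : PP" and t: "t : II"
 shows "V `` {t} = (%v. par al t *v v) ` (V `` {0})"
proof -
 define l where "l = (%t. (%v. adj2 (par al t) *v v) ` (V `` {t}))"
 have det: "det (par al t) = 1" if "t : II" for t using par_det[OF pathsD(1,2)[OF al] that] by auto
 have sub: "line_subbundle L V" using V by simp
 have "ev (at t0 within II) (%t'. l t0 = l t')" if t0: "t0 : II" for t0
 proof -
  obtain si where s: "smooth si" "!!t. t : II ==> si t : V `` {t}" "si t0 ~= 0"
   using line_subbundle_section[OF sub t0] by metis
  define f where "f = (%t. adj2 (par al t) *v si t)"
  have "par al t0 *v f t0 = si t0" by (simp add: f_def mulv_assoc[symmetric] mult_adj2[OF det[OF t0]])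
  hence "f t0 ~= 0" using s(3) by auto
  \<comment> \<open>A component that does not vanish at \<open>t0\<close>, and hence not nearby,
    serves as the common denominator.\<close>
  then obtain i where i: "f t0 $ i ~= 0" by (auto simp: vec_eq_iff)
  have fd: "(f has_der adj2 (par al t) *v (der si t + al t *v si t)) t" if t: "t : II" for t
   using bil_deriv[OF bil_mulv
     adj2_par_deriv[OF pathsD(1)[OF al] t pathsD(2)[OF al t]] smooth_has_der[OF s(1) t]]
   by (simp add: f_def mulv_assoc matrix_vector_right_distrib)
  have fl: "l t = cline (f t) & (EX c. (f has_der c *s f t) t)" if t: "t : II" "f t $ i ~= 0" for t
  proof -
   obtain u where u: "V `` {t} = cline u" using line_subbundle_fibre[OF sub t(1)] by blast
   obtain k where k: "si t = k *s u" using s(2)[OF t(1)] u by (auto simp: cline_def)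
   have "k ~= 0" using t(2) by (auto simp: f_def k vector_scalar_commute)
   hence Vs: "V `` {t} = cline (si t)" using cline_eqI[OF k] u by simp
   have "der si t + al t *v si t : cline (si t)" using V s(1,2) t(1) Vs by auto
   then obtain c where "der si t + al t *v si t = c *s si t" by (auto simp: cline_def)
   with fd[OF t(1)] have "(f has_der c *s f t) t" by (simp add: f_def vector_scalar_commute)
   thus ?thesis by (auto simp: l_def Vs f_def cline_mulv)
  qed
  then obtain c where c: "!!t. t : II ==> f t $ i ~= 0 ==> (f has_der c t *s f t) t" by metis
  have "((%t. f t $ i) ---> f t0 $ i) (at t0 within II)"
   using has_vector_derivative_continuous[OF fd[OF t0]] by (intro tendsto_vec_nth) (simp add: continuous_within)
  from tendsto_imp_eventually_ne[OF this i] obtain d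
   where d: "0 < d" "!!t. t : II ==> \<bar>t - t0\<bar> < d ==> f t $ i ~= 0"
   using i unfolding eventually_at by (metis dist_real_def)
  define S where "S = II Int {t0 - d<..<t0 + d}"
  have S: "convex S" "t0 : S" unfolding S_def using t0 d(1) by (auto intro!: convex_Int)
  have SD: "t : II" "f t $ i ~= 0" if "t : S" for t using that d(2)[of t] by (auto simp: S_def abs_less_iff)
  have comp: "((%t. f t $ j) has_vector_derivative c t * f t $ j) (at t within S)" if "t : S" for t j
   using blin_deriv[OF bounded_linear_vec_nth c[OF SD[OF that]], of j]
   by (rule_tac has_vector_derivative_within_subset[of _ _ _ "II"]) (auto simp: S_def)
  have eq: "l t0 = l t" if t: "t : S" for t
  proof -
   have "f t $ j / f t $ i = f t0 $ j / f t0 $ i" for j by (rule proportional_of_deriv[OF comp comp SD(2) S(1) t S(2)])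
   hence "f t = (f t $ i / f t0 $ i) *s f t0" using SD(2)[OF t] i by (simp add: vec_eq_iff field_simps)
   moreover have "f t $ i / f t0 $ i ~= 0" using SD(2)[OF t] i by simp
   ultimately have "cline (f t) = cline (f t0)" by (rule cline_eqI)
   thus ?thesis using fl[OF SD[OF t]] fl[OF SD[OF S(2)]] by simp
  qed
  have "ev (at t0 within II) (%t'. t' : S)"
   unfolding eventually_at using d(1) by (intro exI[of _ d]) (auto simp: S_def dist_real_def)
  thus ?thesis by eventually_elim (rule eq)
 qed
 hence "l 0 = l t" by (intro connected_local_const[of "II" 0 t l]) (use t L_pos in auto)
 moreover have "l 0 = V `` {0}" using par_works(1)[OF smooth_cont[OF pathsD(1)[OF al]]] by (simp add: l_def)
 ultimately have "(%v. par al t *v v) ` (V `` {0}) = (%v. par al t *v v) ` l t" by simp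
 also have "\<dots> = V `` {t}" using det[OF t] by (simp add: l_def image_image mulv_assoc[symmetric] mult_adj2)
 finally show ?thesis by simp
qed

definition flat_line :: "(real => cmat) => complex^2 => (real \<times> (complex^2)) set" where
 "flat_line al e = (SIGMA t:II. cline (par al t *v e))"

lemma flat_fibre: "t : II ==> flat_line al e `` {t} = cline (par al t *v e)" by (auto simp: flat_line_def)

text \<open>The condition on a coordinate line at 0 under which its parallel transport is a Nahm
  subline: invariance under \<open>be 0\<close>, which spreads along the interval by
  \<open>nahm_beta_par\<close>, and arrival at a coordinate line at L.\<close>

definition fixed_line :: "nahm => complex^2 => bool" where
 "fixed_line B e <-> snd B 0 *v e : cline e & cline (par (fst B) L *v e) : {cline e1, cline e2}"

lemma flat_line_subline: assumes N: "(al, be) : nahm_data L x0 xL" and e: "e : {e1, e2}" "fixed_line (al, be) e"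
 shows "nahm_subline L (al, be) (flat_line al e)" unfolding nahm_subline.simps
proof (intro conjI allI impI ballI)
 note D = NDD[OF N] and s0 = path_smooth[OF NDD(1)[OF N]]
 have det: "det (par al t) = 1" if "t : II" for t by (rule par_det[OF s0 pathsD(2)[OF D(1)] that])
 have inv: "adj2 (par al t) *v (par al t *v v) = v" "par al t *v (adj2 (par al t) *v v) = v"
  if "t : II" for t v using mult_adj2[OF det[OF that]] by (simp_all add: mulv_assoc[symmetric])
 show "line_subbundle L (flat_line al e)" unfolding line_subbundle_def
 proof (intro conjI ballI exI[of _ "%t. par al t *v e"] exI[of _ "1::real"] impI)
  show "par al t *v e ~= 0" if "t : II" for t using inv(1)[OF that, of e] e(1) e12_nz by auto
 qed (use flat_fibre in "auto simp: flat_line_def intro!: smooth_mulv par_smooth s0")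
 show "flat_line al e `` {0} : {cline e1, cline e2}" "flat_line al e `` {L} : {cline e1, cline e2}"
  using e flat_fibre[OF ends(1)] flat_fibre[OF ends(2)] par_works(1)[OF smooth_cont[OF s0]] by (auto simp: fixed_line_def)
 fix t assume t: "t : II"
 show "be t *v v : flat_line al e `` {t}" if "v : flat_line al e `` {t}" for v
 proof -
  obtain c where "v = c *s (par al t *v e)" using `v \<in> _` unfolding flat_fibre[OF t] cline_def by blast
  hence "be t *v v = c *s (par al t *v (be 0 *v e))"
   unfolding nahm_beta_par[OF N t] by (simp add: mulv_assoc vector_scalar_commute inv(1)[OF t])
  thus ?thesis unfolding flat_fibre[OF t] using e(2) by (auto simp: fixed_line_def intro!: cline_scale mulv_cline)
 qed
 fix s assume s: "smooth s & (ALL t:II. s t : flat_line al e `` {t})"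
 define f where "f = (%t. adj2 (par al t) *v s t)"
 have fe: "f t : cline e" if "t : II" for t using s that mulv_cline[of "s t" "par al t *v e" "adj2 (par al t)"]
  by (simp add: f_def flat_fibre inv(1) del: atLeastAtMost_iff)
 \<comment> \<open>Membership in a coordinate line is the vanishing of one component, a condition
   that is inherited by the derivative.\<close>
 obtain j where j: "cline e = {v. v $ j = 0}" using e(1) cline_e1 cline_e2 by auto
 have "(f has_der adj2 (par al t) *v (der s t + al t *v s t)) t" using bil_deriv[OF bil_mulv
    adj2_par_deriv[OF s0 t pathsD(2)[OF D(1) t]] smooth_has_der[OF _ t]] s
  by (simp add: f_def mulv_assoc matrix_vector_right_distrib)
 from blin_deriv[OF bounded_linear_vec_nth this, of j]
 have "((%t. 0) has_der (adj2 (par al t) *v (der s t + al t *v s t)) $ j) t"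
  by (rule has_der_cong_I[OF t, rotated]) (use fe j in blast)
 from der_eqI[OF t this] t have "adj2 (par al t) *v (der s t + al t *v s t) : cline e" unfolding j by simp
 from mulv_cline[OF this, of "par al t"]
 show "der s t + al t *v s t : flat_line al e `` {t}" by (simp add: flat_fibre[OF t] inv(2)[OF t])
qed

text \<open>There are at most two candidates for a Nahm subline, so all stability notions become
  finite conditions on the holonomy and \<open>be 0\<close>.\<close>

lemma nahm_subline_iff: assumes N: "B : nahm_data L x0 xL"
 shows "nahm_subline L B V <-> (EX e:{e1, e2}. V = flat_line (fst B) e & fixed_line B e)"
proof -
 obtain al be where B: "B = (al, be)" by (cases B)
 have "EX e:{e1, e2}. V = flat_line al e & fixed_line (al, be) e" if V: "nahm_subline L (al, be) V"
 proof -
  obtain e where e: "e : {e1, e2}" "V `` {0} = cline e" using V by auto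
  have t: "V `` {t} = cline (par al t *v e)" if "t : II" for t
   using nahm_subline_par[OF V NDD(1)[OF N[unfolded B]] that] e(2) by (simp add: cline_mulv)
  have "V <= II \<times> UNIV" using V by (simp add: line_subbundle_def)
  hence "V = flat_line al e" unfolding flat_line_def using t by blast
  moreover have "fixed_line (al, be) e"
   using V ends(1) cline_self[of e] unfolding fixed_line_def nahm_subline.simps t[OF ends(2)] e(2)[symmetric] fst_conv snd_conv by blast
  ultimately show ?thesis using e(1) by blast
 qed
 thus ?thesis using flat_line_subline[OF N[unfolded B]] unfolding B fst_conv by blast
qed

lemma nahm_stab_iff: assumes N: "B : nahm_data L x0 xL"
 shows "nahm_semistable L r0 rL B <-> (ALL e:{e1, e2}. fixed_line B e --> nahm_degree L r0 rL (flat_line (fst B) e) <= 0)"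
  and "nahm_stable L r0 rL B <-> (ALL e:{e1, e2}. fixed_line B e --> nahm_degree L r0 rL (flat_line (fst B) e) < 0)"
  and "nahm_polystable L r0 rL B <-> nahm_stable L r0 rL B |
   (ALL e:{e1, e2}. fixed_line B e & nahm_degree L r0 rL (flat_line (fst B) e) = 0)"
proof -
 note S = nahm_subline_iff[OF N]
 show "nahm_semistable L r0 rL B <-> (ALL e:{e1, e2}. fixed_line B e --> nahm_degree L r0 rL (flat_line (fst B) e) <= 0)"
  "nahm_stable L r0 rL B <-> (ALL e:{e1, e2}. fixed_line B e --> nahm_degree L r0 rL (flat_line (fst B) e) < 0)"
  unfolding nahm_semistable_def nahm_stable_def S by blast+
 have p: "fst B : PP" using NDD(1)[of "fst B" "snd B"] N by simp
 have I: "0 : II" using L_pos by simp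
 have P0: "par (fst B) 0 = mat 1" by (rule par_works(1)[OF smooth_cont[OF path_smooth[OF p]]])
 have c: "flat_line (fst B) e1 `` {t} Int flat_line (fst B) e2 `` {t} = {0} &
   {v + w | v w. v : flat_line (fst B) e1 `` {t} & w : flat_line (fst B) e2 `` {t}} = UNIV" if t: "t : II" for t
 proof -
  let ?P = "par (fst B) t"
  have d: "det ?P = 1" by (rule par_det[OF path_smooth[OF p] pathsD(2)[OF p] t])
  have "x = 0" if x: "x : cline (?P *v e1)" "x : cline (?P *v e2)" for x
  proof -
   have "adj2 ?P *v x : cline e1" "adj2 ?P *v x : cline e2"
    using x[THEN mulv_cline, of "adj2 ?P"] by (simp_all add: mulv_assoc[symmetric] mult_adj2[OF d])
   hence "adj2 ?P *v x = 0" by (simp add: cline_e1 cline_e2 vec2_eq_iff)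
   hence "?P *v (adj2 ?P *v x) = 0" by simp
   thus "x = 0" by (simp add: mulv_assoc[symmetric] mult_adj2[OF d])
  qed
  moreover have "EX v w. x = v + w & v : cline (?P *v e1) & w : cline (?P *v e2)" for x
  proof (intro exI conjI)
   let ?y = "adj2 ?P *v x"
   have "?y = ?y $ 1 *s e1 + ?y $ 2 *s e2" by (simp add: vec2_eq_iff)
   hence "?P *v ?y = ?y $ 1 *s (?P *v e1) + ?y $ 2 *s (?P *v e2)"
    by (metis matrix_vector_right_distrib vector_scalar_commute)
   thus "x = ?y $ 1 *s (?P *v e1) + ?y $ 2 *s (?P *v e2)" by (simp add: mulv_assoc[symmetric] mult_adj2[OF d])
  qed (intro cline_scale cline_self)+
  ultimately show ?thesis unfolding flat_fibre[OF t] using cline_zero by blast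
 qed
 \<comment> \<open>Complementary sublines start at different coordinate lines, so together they
   exhaust the two candidates.\<close>
 have ne: "e = e1 & e' = e2 | e = e2 & e' = e1"
  if "e : {e1, e2}" "e' : {e1, e2}" "flat_line (fst B) e `` {0} Int flat_line (fst B) e' `` {0} = {0}" for e e'
 proof -
  have "cline e Int cline e' = {0}" using that(3) by (simp add: flat_fibre[OF I] P0)
  hence "e ~= e'" using that(1) cline_self[of e] e12_nz by auto
  thus ?thesis using that(1,2) by blast
 qed
 show "nahm_polystable L r0 rL B <-> nahm_stable L r0 rL B |
   (ALL e:{e1, e2}. fixed_line B e & nahm_degree L r0 rL (flat_line (fst B) e) = 0)"
 proof
  assume "nahm_polystable L r0 rL B"
  then consider "nahm_stable L r0 rL B" | V V' where "nahm_subline L B V" "nahm_subline L B V'"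
   "nahm_degree L r0 rL V = 0" "nahm_degree L r0 rL V' = 0" "V `` {0} Int V' `` {0} = {0}"
   unfolding nahm_polystable_def using I by blast
  thus "nahm_stable L r0 rL B | (ALL e:{e1, e2}. fixed_line B e & nahm_degree L r0 rL (flat_line (fst B) e) = 0)"
  proof cases
   case 2
   obtain e where e: "e : {e1, e2}" "V = flat_line (fst B) e" "fixed_line B e" using 2(1) unfolding S by blast
   obtain e' where e': "e' : {e1, e2}" "V' = flat_line (fst B) e'" "fixed_line B e'" using 2(2) unfolding S by blast
   show ?thesis using ne[OF e(1) e'(1)] e(3) e'(3) 2(3-5) unfolding e(2) e'(2) by auto
  qed simp
 next
  assume "nahm_stable L r0 rL B | (ALL e:{e1, e2}. fixed_line B e & nahm_degree L r0 rL (flat_line (fst B) e) = 0)"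
  thus "nahm_polystable L r0 rL B" unfolding nahm_polystable_def S
   by (elim disjE) (simp, intro disjI2 exI[of _ "flat_line (fst B) e1"] exI[of _ "flat_line (fst B) e2"], use c in auto)
 qed
qed

text \<open>At both ends a gauge transformation is diagonal and therefore preserves each coordinate
  line; this transfers to invariance under \<open>be 0\<close>, to the end line and to its
  sign.\<close>

lemma fixed_line_gauge: assumes g: "g : GG" and B: "B : nahm_data L x0 xL" and e: "e : {e1, e2}"
 shows "fixed_line (gact g B) e = fixed_line B e"
  "nahm_degree L r0 rL (flat_line (fst (gact g B)) e) = nahm_degree L r0 rL (flat_line (fst B) e)"
proof -
 obtain al be where Bp: "B = (al, be)" by (cases B)
 note p = NDD(1)[OF B[unfolded Bp]]
 have tr: "par (fst (gact g B)) t = adj2 (g t) ** par al t ** g 0" if "t : II" for t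
  unfolding Bp by (rule par_gauge[OF g p that])
 have b: "snd (gact g B) 0 = adj2 (g 0) ** be 0 ** g 0"
  unfolding Bp gact_adj2[OF gg_det[OF g]] using ends(1) by (simp add: on_I_eq)
 have P0: "par al 0 = mat 1" by (rule par_works(1)[OF smooth_cont[OF path_smooth[OF p]]])
 note T = ggD(3,4)[OF g, unfolded torus_iff]
 have z: "g 0 $ 1 $ 2 = 0" "g 0 $ 2 $ 1 = 0" "g L $ 1 $ 2 = 0" "g L $ 2 $ 1 = 0"
  "g 0 $ 1 $ 1 ~= 0" "g 0 $ 2 $ 2 ~= 0" "g L $ 1 $ 1 ~= 0" "g L $ 2 $ 2 ~= 0" using T by auto
 have m: "v : cline e1 <-> v $ 2 = 0" "v : cline e2 <-> v $ 1 = 0" for v by (simp_all add: cline_e1 cline_e2)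
 from e consider "e = e1" | "e = e2" by blast
 note c = this
 show "fixed_line (gact g B) e = fixed_line B e" unfolding fixed_line_def tr[OF ends(2)] b using c
  by cases (simp_all add: Bp cline_eq_e m mulv_nth mult_nth z)
 show "nahm_degree L r0 rL (flat_line (fst (gact g B)) e) = nahm_degree L r0 rL (flat_line (fst B) e)"
  unfolding nahm_degree_def flat_fibre[OF ends(1)] flat_fibre[OF ends(2)] tr[OF ends(1)] tr[OF ends(2)] line_sign_def using c
  by cases (simp_all add: Bp P0 cline_eq_e mulv_nth mult_nth mat_ring z)
qed

lemma nahm_stab_gauge: assumes g: "g : GG" and B: "B : nahm_data L x0 xL"
 shows "nahm_semistable L r0 rL (gact g B) <-> nahm_semistable L r0 rL B"
  and "nahm_stable L r0 rL (gact g B) <-> nahm_stable L r0 rL B"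
  and "nahm_polystable L r0 rL (gact g B) <-> nahm_polystable L r0 rL B"
 unfolding nahm_stab_iff[OF B] nahm_stab_iff[OF gact_ND[OF g B]] by (simp_all add: fixed_line_gauge[OF g B])

end


section \<open>Stumpff functions\<close>

text \<open>Stumpff functions without the customary alternating signs: at w^2 the first two are cosh
  w and sinh w / w. Being entire functions of the square, they express the solutions through the
  product of the entries of \<alpha> and avoid a choice of its square root.\<close>

definition stumpff :: "nat => complex => complex" where
 "stumpff k x = (\<Sum>n. (1 / fact (2 * n + k)) * x ^ n)"

lemma summable_stumpff: "summable (%n. (1 / fact (2 * n + k)) * (x::complex) ^ n)"
proof (rule summable_comparison_test')
 show "summable (%n. norm x ^ n / fact n)" using summable_exp[of "norm x"] by (simp add: field_simps)
 show "norm ((1 / fact (2 * n + k)) * x ^ n) <= norm x ^ n / fact n" if "n >= 0" for n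
 by (auto simp: fact_mono norm_divide norm_power frac_le)
qed

lemma stumpff_rec: "stumpff k x = 1 / fact k + x * stumpff (k + 2) x"
proof -
 have "stumpff k x = (1 / fact (2 * 0 + k)) * x ^ 0 + (\<Sum>n. (1 / fact (2 * Suc n + k)) * x ^ Suc n)"
  unfolding stumpff_def using suminf_split_head[OF summable_stumpff, of k x] by simp
 also have "(\<Sum>n. (1 / fact (2 * Suc n + k)) * x ^ Suc n) = (\<Sum>n. x * ((1 / fact (2 * n + (k + 2))) * x ^ n))"
  by simp
 also have "\<dots> = x * stumpff (k + 2) x" unfolding stumpff_def by (rule suminf_mult[OF summable_stumpff])
 finally show ?thesis by simp
qed

lemma stumpff_at_0 [simp]: "stumpff k 0 = 1 / fact k" using stumpff_rec[of k 0] by simp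

lemma stumpff_0: "stumpff 0 (w^2) = cosh w"
proof -
 have "(%n. (%m. if even m then w ^ m /\<^sub>R fact m else 0) (2 * n)) sums cosh w" using cosh_converges[of w]
  by (subst sums_mono_reindex) (auto simp: strict_mono_def)
 hence "(%n. (1 / fact (2 * n + 0)) * (w^2) ^ n) sums cosh w"
  by (simp add: power_mult[symmetric] scaleR_conv_of_real divide_inverse)
 thus ?thesis unfolding stumpff_def by (rule sums_unique[symmetric])
qed

lemma stumpff_1: "w * stumpff 1 (w^2) = sinh w"
proof -
 have "(%n. (%m. if even m then 0 else w ^ m /\<^sub>R fact m) (2 * n + 1)) sums sinh w" using sinh_converges[of w]
  by (subst sums_mono_reindex) (auto simp: strict_mono_def elim: oddE)
 hence "(%n. w * ((1 / fact (2 * n + 1)) * (w^2) ^ n)) sums sinh w"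
  by (simp add: power_mult[symmetric] scaleR_conv_of_real divide_inverse mult_ac)
 hence "suminf (%n. w * ((1 / fact (2 * n + 1)) * (w^2) ^ n)) = sinh w" by (rule sums_unique[symmetric])
 thus ?thesis unfolding stumpff_def suminf_mult[OF summable_stumpff] .
qed

lemma stumpff_holo [holomorphic_intros]: "f holomorphic_on A ==> (%z. stumpff k (f z)) holomorphic_on A"
proof -
 have "stumpff k holomorphic_on UNIV" unfolding holomorphic_on_open[OF open_UNIV] stumpff_def[abs_def]
  using termdiffs_strong_converges_everywhere[OF summable_stumpff[of k]] by blast
 thus "f holomorphic_on A ==> (%z. stumpff k (f z)) holomorphic_on A"
  using holomorphic_on_compose_gen[of f A "stumpff k" UNIV] by (simp add: o_def)
qed

lemma square_root_exists: "EX w::complex. w\<^sup>2 = x" using power2_csqrt by blast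

lemma stumpff_pythagoras: "(stumpff 0 x)\<^sup>2 - x * (stumpff 1 x)\<^sup>2 = 1"
by (metis square_root_exists power_mult_distrib hyperbolic_pythagoras stumpff_0 stumpff_1)

lemma stumpff_1_double: "stumpff 1 (4 * x) = stumpff 0 x * stumpff 1 x"
proof (cases "x = 0")
 case False
 obtain w where w: "w\<^sup>2 = x" using square_root_exists by blast
 have "(2 * w) * stumpff 1 ((2 * w)\<^sup>2) = 2 * (w * stumpff 1 (w^2)) * stumpff 0 (w^2)"
  unfolding stumpff_1 stumpff_0 by (rule sinh_double)
 thus ?thesis using w by auto
qed simp

text \<open>Solutions of \<open>y'' = s y\<close> and their iterated primitives.\<close>

definition stf :: "nat => complex => complex => complex" where
 "stf k s t = t ^ k * stumpff k (s * t^2)"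

lemma stf_rec: "stf k s t = t ^ k / fact k + s * stf (k + 2) s t"
 using stumpff_rec[of k "s * t^2"] by (simp add: stf_def algebra_simps power2_eq_square)

lemma stf_at_0 [simp]: "stf 0 s 0 = 1" "k > 0 ==> stf k s 0 = 0" by (simp_all add: stf_def)

lemma stf_eq: assumes "w\<^sup>2 = s" shows "stf 0 s t = cosh (w * t)" "w * stf 1 s t = sinh (w * t)"
 using stumpff_0[of "w * t"] stumpff_1[of "w * t"] assms by (simp_all add: stf_def power_mult_distrib mult.assoc)

lemma stf_deriv_0_1: "(DERIV (%t. stf 0 s t) t :> s * stf 1 s t)" "(DERIV (%t. stf 1 s t) t :> stf 0 s t)"
proof -
 obtain w where w: "w\<^sup>2 = s" using square_root_exists by blast
 note e = stf_eq[OF w]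
 have "(DERIV (%t. cosh (w * t)) t :> sinh (w * t) * w)" by (auto intro!: derivative_eq_intros)
 also have "sinh (w * t) * w = s * stf 1 s t" by (simp add: e(2)[symmetric] w[symmetric] power2_eq_square)
 finally show "(DERIV (%t. stf 0 s t) t :> s * stf 1 s t)" by (simp add: e)
 show "(DERIV (%t. stf 1 s t) t :> stf 0 s t)"
 proof (cases "s = 0")
  case True
  thus ?thesis by (auto simp: stf_def)
 next
  case False
  hence nz: "w ~= 0" using w by auto
  have "(DERIV (%t. sinh (w * t) / w) t :> cosh (w * t))" using nz by (auto intro!: derivative_eq_intros)
  moreover have "(%t. sinh (w * t) / w) = (%t. stf 1 s t)" using nz by (simp add: e(2)[symmetric])
  ultimately show ?thesis by (simp add: e)
 qed
qed

text \<open>For s = 0 these are the monomials t^k / k!. Otherwise \<open>stf_rec\<close> expresses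
  \<open>stf (k + 2)\<close> through \<open>stf k\<close>, so an induction in steps of two reduces
  to cosh and sinh.\<close>

lemma stf_deriv: "(DERIV (%t. stf (Suc k) s t) t :> stf k s t)"
proof (cases "s = 0")
 case True
 have "(DERIV (%t. t ^ Suc k / fact (Suc k)) t :> of_nat (Suc k) * t ^ k / fact (Suc k))"
  using DERIV_cdivide[OF DERIV_power[OF DERIV_ident[of "at t"], of "Suc k"], of "fact (Suc k)"] by simp
 thus ?thesis by (simp add: stf_def True del: of_nat_Suc)
next
 case False
 show ?thesis
 proof (induction k rule: induct_nat_012)
  case 0 show ?case using stf_deriv_0_1(2) by simp
  case 1
  have "(DERIV (%t. (stf 0 s t - 1) / s) t :> stf 1 s t)" using False by (auto intro!: derivative_eq_intros stf_deriv_0_1)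
  moreover have "(%t. (stf 0 s t - 1) / s) = (%t. stf (Suc (Suc 0)) s t)" using False stf_rec[of 0 s] by simp
  ultimately show ?case by simp
  case (ge2 n)
  have "(DERIV (%t. (stf (Suc n) s t - t ^ Suc n / fact (Suc n)) / s) t :> (stf n s t - t ^ n / fact n) / s)"
   using False ge2(1) by (auto intro!: derivative_eq_intros simp: simp del: of_nat_Suc power_Suc)
  moreover have "(%t. (stf (Suc n) s t - t ^ Suc n / fact (Suc n)) / s) = (%t. stf (Suc (Suc (Suc n))) s t)"
   using False stf_rec[of "Suc n" s] by simp
  moreover have "(stf n s t - t ^ n / fact n) / s = stf (Suc (Suc n)) s t" using False stf_rec[of n s] by simp
  ultimately show ?case by simp
 qed
qed

text \<open>The image of the strip \<open>\<bar>Im w\<bar> < \<pi>/2\<close> under squaring.\<close>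

definition parab :: "complex set" where
 "parab = {x. (cmod x - Re x) / 2 < (pi / 2)\<^sup>2}"

lemma open_parab: "open parab" unfolding parab_def by (intro open_Collect_less continuous_intros) auto

lemma zero_in_parab [simp]: "0 : parab" by (simp add: parab_def)

text \<open>For x = w^2 the quantity (|x| - Re x) / 2 equals (Im w)^2; this is the reason for the
  form of \<open>parab\<close>.\<close>

lemma square_in_parab: "w\<^sup>2 : parab <-> \<bar>Im w\<bar> < pi / 2"
proof -
 have "cmod (w^2) = (Re w)\<^sup>2 + (Im w)\<^sup>2" by (simp add: norm_power cmod_power2)
 moreover have "Re (w^2) = (Re w)\<^sup>2 - (Im w)\<^sup>2" by (simp add: power2_eq_square)
 moreover have "(Im w)\<^sup>2 < (pi / 2)\<^sup>2 <-> \<bar>Im w\<bar> < pi / 2"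
  using power2_less_imp_less[of "\<bar>Im w\<bar>" "pi / 2"] power_strict_mono[of "\<bar>Im w\<bar>" "pi / 2" 2] by auto
 ultimately show ?thesis by (simp add: parab_def)
qed

lemma stumpff_0_cos: "stumpff 0 (- (u^2)) = cos u"
 using stumpff_0[of "\<i> * u"] by (simp add: cosh_def cos_exp_eq field_simps)

lemma parab_cos: assumes "x : parab"
 obtains u where "x = - (u^2)" "\<bar>Re u\<bar> < pi / 2"
proof -
 obtain w where w: "w\<^sup>2 = x" using square_root_exists by blast
 have "x = - ((\<i> * w)\<^sup>2)" by (simp add: power_mult_distrib w)
 moreover have "\<bar>Re (\<i> * w)\<bar> < pi / 2" using assms w square_in_parab[of w] by simp
 ultimately show ?thesis using that by blast
qed

lemma stumpff_0_Re_pos: assumes "x : parab" shows "0 < Re (stumpff 0 x)"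
proof -
 obtain u where u: "x = - (u^2)" "\<bar>Re u\<bar> < pi / 2" using parab_cos[OF assms] .
 hence "0 < cos (Re u)" using cos_gt_zero_pi[of "Re u"] by auto
 thus ?thesis unfolding u(1) stumpff_0_cos Re_cos by (simp add: add_pos_pos)
qed

text \<open>Equal cosines have arguments that agree up to sign and a multiple of 2 pi; real parts
  below pi/2 in modulus exclude every nonzero multiple, and the sign disappears in the
  square.\<close>

lemma stumpff_0_inj: "inj_on (stumpff 0) parab"
proof (rule inj_onI)
 fix x y assume xy: "x : parab" "y : parab" "stumpff 0 x = stumpff 0 y"
 obtain u where u: "x = - (u^2)" "\<bar>Re u\<bar> < pi / 2" using parab_cos[OF xy(1)] .
 obtain v where v: "y = - (v^2)" "\<bar>Re v\<bar> < pi / 2" using parab_cos[OF xy(2)] .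
 have "cos u = cos v" using xy(3) unfolding u(1) v(1) stumpff_0_cos .
 then obtain n where n: "n : \<int>" "u = v + of_real (2 * n * pi) | u = - v + of_real (2 * n * pi)"
  unfolding complex_cos_eq by blast
 hence "Re u = Re v + 2 * n * pi | Re u = - Re v + 2 * n * pi" by auto
 hence "\<bar>2 * n * pi\<bar> < pi" using u(2) v(2) by linarith
 hence "\<bar>n\<bar> < 1" by (simp add: abs_mult)
 hence "n = 0" using n(1) by (auto elim!: Ints_cases)
 hence "u = v | u = - v" using n(2) by auto
 thus "x = y" using u v by auto
qed

lemma stumpff_0_image: "stumpff 0 ` parab = {z. 0 < Re z}"
proof
 show "stumpff 0 ` parab <= {z. 0 < Re z}" using stumpff_0_Re_pos by auto
 show "{z. 0 < Re z} <= stumpff 0 ` parab"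
 proof
  fix z :: complex assume "z : {z. 0 < Re z}"
  hence z: "0 < Re z" by simp
  define u where "u = Arccos z"
  have u: "cos u = z" by (simp add: u_def)
  have b: "\<bar>Re u\<bar> <= pi" unfolding u_def using Re_Arccos_bounds[of z] by auto
  have "0 < exp (Im u) + exp (- Im u)" by (simp add: add_pos_pos)
  hence "0 < cos (Re u)" using z unfolding u[symmetric] Re_cos by (simp add: zero_less_mult_iff)
  hence "\<bar>Re u\<bar> < pi / 2" using b cos_monotone_0_pi_le[of "pi / 2" "\<bar>Re u\<bar>"] by (cases) auto
  hence "\<bar>Im (\<i> * u)\<bar> < pi / 2" by simp
  hence "(\<i> * u)\<^sup>2 : parab" by (simp only: square_in_parab)
  moreover have "stumpff 0 ((\<i> * u)\<^sup>2) = z" using stumpff_0_cos[of u] u by (simp add: power_mult_distrib)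
  ultimately show "z : stumpff 0 ` parab" by auto
 qed
qed

text \<open>At a zero of \<open>stumpff 1\<close> the Pythagorean identity and positivity of the
  real part force \<open>stumpff 0\<close> to be 1, hence x = 0 by injectivity; but
  \<open>stumpff 1\<close> is 1 there.\<close>

lemma stumpff_nonzero: assumes "x : parab" shows "stumpff 0 x ~= 0" "stumpff 1 x ~= 0"
proof -
 show "stumpff 0 x ~= 0" using stumpff_0_Re_pos[OF assms] by auto
 show "stumpff 1 x ~= 0"
 proof
  assume *: "stumpff 1 x = 0"
  hence "(stumpff 0 x)\<^sup>2 = 1" using stumpff_pythagoras[of x] by simp
  hence "stumpff 0 x = 1" using stumpff_0_Re_pos[OF assms] by (auto simp: power2_eq_1_iff)
  hence "x = 0" using inj_onD[OF stumpff_0_inj, of x 0] assms by simp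
  thus False using * by simp
 qed
qed

definition stumpff_inv :: "complex => complex" where
 "stumpff_inv = inv_into parab (stumpff 0)"

lemma stumpff_inv_eq: "x : parab ==> stumpff_inv (stumpff 0 x) = x"
 unfolding stumpff_inv_def by (rule inv_into_f_f[OF stumpff_0_inj])

lemma stumpff_inv_works: assumes "0 < Re z" shows "stumpff_inv z : parab" "stumpff 0 (stumpff_inv z) = z"
 using assms stumpff_0_image inv_into_into[of z "stumpff 0" parab] f_inv_into_f[of z "stumpff 0" parab]
 by (auto simp: stumpff_inv_def)

lemma stumpff_inv_holo: "stumpff_inv holomorphic_on {z. 0 < Re z}"
proof -
 have "stumpff 0 holomorphic_on parab" by (intro holomorphic_intros)
 from holomorphic_has_inverse[OF this open_parab stumpff_0_inj]
 obtain g where g: "g holomorphic_on stumpff 0 ` parab" "!!z. z : parab ==> g (stumpff 0 z) = z" by metis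
 have "g z = stumpff_inv z" if "z : {z. 0 < Re z}" for z
  using g(2)[OF stumpff_inv_works(1)[of z]] stumpff_inv_works(2)[of z] that by simp
 thus ?thesis using g(1) unfolding stumpff_0_image by (rule holomorphic_transform[rotated])
qed


section \<open>Nahm data with constant \<open>\<alpha>\<close>\<close>

definition kdat :: "complex => complex => complex => complex => kron" where
 "kdat a b c d = (mat2 0 a b 0, mat2 0 c d 0)"

lemma kdat_inject [simp]: "kdat a b c d = kdat a' b' c' d' <-> a = a' & b = b' & c = c' & d = d'"
 by (auto simp: kdat_def cmat_iff)

lemma kdat_in_KD: "kdat a b c d : kron_data x <-> a * d - b * c = \<i> * x"
 by (auto simp: kdat_def kron_data_def t_perp_iff cmat_simps algebra_simps)

lemma KD_kdat: assumes "A : kron_data x"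
 obtains a b c d where "A = kdat a b c d" "a * d - b * c = \<i> * x"
proof -
 obtain al be where A: "A = (al, be)" by (cases A)
 have "al : t_perp" "be : t_perp" using assms by (auto simp: A kron_data_def)
 hence "A = kdat (al $ 1 $ 2) (al $ 2 $ 1) (be $ 1 $ 2) (be $ 2 $ 1)" by (simp add: A kdat_def cmat_iff t_perp_iff)
 with that assms kdat_in_KD show ?thesis by metis
qed

lemma torus_units: assumes "h : torus"
 shows "(h $ 1 $ 1)\<^sup>2 * (h $ 2 $ 2)\<^sup>2 = 1" "(h $ 1 $ 1)\<^sup>2 ~= 0" "(h $ 2 $ 2)\<^sup>2 ~= 0"
proof -
 show *: "(h $ 1 $ 1)\<^sup>2 * (h $ 2 $ 2)\<^sup>2 = 1" using assms by (simp add: torus_iff power_mult_distrib[symmetric])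
 thus "(h $ 1 $ 1)\<^sup>2 ~= 0" "(h $ 2 $ 2)\<^sup>2 ~= 0" by auto
qed

lemma torus_conj_eq: assumes "h : torus"
 shows "adj2 h ** mat2 p q r s ** h = mat2 p (q * (h $ 2 $ 2)\<^sup>2) (r * (h $ 1 $ 1)\<^sup>2) s"
 using assms by (simp add: cmat_iff torus_iff mult_nth power2_eq_square algebra_simps)

lemma kron_act_kdat: assumes "h : torus" shows "kron_act h (kdat a b c d) =
  kdat (a * (h $ 2 $ 2)\<^sup>2) (b * (h $ 1 $ 1)\<^sup>2) (c * (h $ 2 $ 2)\<^sup>2) (d * (h $ 1 $ 1)\<^sup>2)"
 using assms by (simp add: kdat_def matrix_inv_eq_adj2 torus_det torus_conj_eq)

text \<open>Conjugation by the torus multiplies entries by squares of diagonal elements, so every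
  nonzero scaling factor m is realized.\<close>

lemma torus_exists: assumes "m ~= 0"
 obtains h where "h : torus" "(h $ 2 $ 2)\<^sup>2 = m" "(h $ 1 $ 1)\<^sup>2 = inverse m"
proof -
 define l where "l = csqrt m"
 have l: "l\<^sup>2 = m" "l ~= 0" using assms by (auto simp: l_def)
 show ?thesis by (rule that[of "mat2 (inverse l) 0 0 l"]) (use l in "auto simp: torus_iff power_inverse")
qed

lemma hvd_mat2: assumes "(f has_vector_derivative f') F" "(g has_vector_derivative g') F"
  "(h has_vector_derivative h') F" "(k has_vector_derivative k') F"
 shows "((%t. mat2 (f t) (g t) (h t) (k t)) has_vector_derivative mat2 f' g' h' k') F"
proof -
 have bl: "blin (%z. mat2 z 0 0 0)" "blin (%z. mat2 0 z 0 0)"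
  "blin (%z. mat2 0 0 z 0)" "blin (%z. mat2 0 0 0 z)"
  by (intro linear_conv_bounded_linear[THEN iffD1] linearI; simp add: cmat_iff)+
 have eq: "mat2 p q r s = mat2 p 0 0 0 + mat2 0 q 0 0 + mat2 0 0 r 0 + mat2 0 0 0 s" for p q r s by (simp add: cmat_iff)
 have "((%t. mat2 (f t) 0 0 0 + mat2 0 (g t) 0 0 + mat2 0 0 (h t) 0 + mat2 0 0 0 (k t)) has_vector_derivative
   mat2 f' 0 0 0 + mat2 0 g' 0 0 + mat2 0 0 h' 0 + mat2 0 0 0 k') F"
  by (intro has_vector_derivative_add blin_deriv[OF bl(1) assms(1)]
    blin_deriv[OF bl(2) assms(2)] blin_deriv[OF bl(3) assms(3)]
    blin_deriv[OF bl(4) assms(4)])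
 thus ?thesis by (simp only: eq[symmetric])
qed

declare RG.simps [simp del]

locale nahm_params = interval +
 fixes x0 xL :: complex and r0 rL :: real
begin

abbreviation "ND \<equiv> nahm_data L x0 xL"
abbreviation "KD == kron_data (xL - x0)"
abbreviation "TN == tilde_nahm L x0 xL"
abbreviation "TK == tilde_kron L x0 xL"
abbreviation "NPS \<equiv> nahm_ps L r0 rL x0 xL"
abbreviation "KPS == kron_ps (rL - r0) (xL - x0)"
abbreviation "TNP == tilde_nahm_ps L r0 rL x0 xL"
abbreviation "TKP == tilde_kron_ps L r0 rL x0 xL"
abbreviation "TNM == tilde_nahm_moduli L r0 rL x0 xL"
abbreviation "TKM == tilde_kron_moduli L r0 rL x0 xL"
abbreviation "NMT \<equiv> nahm_moduli_top L r0 rL x0 xL"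
abbreviation "KMT == kron_moduli_top (rL - r0) (xL - x0)"
abbreviation "slice == coulomb_slice L x0 xL"
abbreviation "nstable == nahm_stable L r0 rL"
abbreviation "kstable == kron_stable (rL - r0)"
abbreviation l :: complex where "l == complex_of_real L"

lemma L_nz [simp]: "L ~= 0" using L_pos by simp

text \<open>With w^2 = s and w nonzero this is sinh (2 w L) / (2 w), the denominator of family (a)
  made regular at s = 0, where it equals L.\<close>

definition S2 :: "complex => complex" where "S2 s = stf 1 (4 * s) l"

text \<open>The solution of z'' = 4 s z with boundary values x0 and xL; the upper diagonal entry of
  \<beta> will be -i z. The three functions that follow are its derivative and its first and second
  primitives vanishing at 0. The value \<open>ZZ\<close> of the last one at L is what enters the
  integral of \<beta>.\<close>

definition zfun :: "complex => complex => complex" where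
 "zfun s t = (x0 * stf 1 (4 * s) (l - t) + xL * stf 1 (4 * s) t) / S2 s"

definition z1fun :: "complex => complex => complex" where
 "z1fun s t = (- x0 * stf 0 (4 * s) (l - t) + xL * stf 0 (4 * s) t) / S2 s"

definition Z1fun :: "complex => complex => complex" where
 "Z1fun s t = (x0 * (stf 2 (4 * s) l - stf 2 (4 * s) (l - t)) + xL * stf 2 (4 * s) t) / S2 s"

definition Z2fun :: "complex => complex => complex" where
 "Z2fun s t = (x0 * (t * stf 2 (4 * s) l - stf 3 (4 * s) l + stf 3 (4 * s) (l - t))
  + xL * stf 3 (4 * s) t) / S2 s"

definition ZZ :: "complex => complex" where "ZZ s = Z2fun s l"

lemma stf_reflect_deriv: "(DERIV (%t. stf (Suc k) s (l - t)) t :> - stf k s (l - t))"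
 "(DERIV (%t. stf 0 s (l - t)) t :> - (s * stf 1 s (l - t)))"
proof -
 have d: "(DERIV (%t. l - t) t :> - 1)" by (auto intro!: derivative_eq_intros)
 show "(DERIV (%t. stf (Suc k) s (l - t)) t :> - stf k s (l - t))" using DERIV_chain2[OF stf_deriv d] by simp
 show "(DERIV (%t. stf 0 s (l - t)) t :> - (s * stf 1 s (l - t)))" using DERIV_chain2[OF stf_deriv_0_1(1) d] by simp
qed

lemma zfun_derivs: "(DERIV (zfun s) t :> z1fun s t)" "(DERIV (z1fun s) t :> 4 * s * zfun s t)"
 "(DERIV (Z1fun s) t :> zfun s t)" "(DERIV (Z2fun s) t :> Z1fun s t)"
proof -
 note n = One_nat_def numeral_2_eq_2 numeral_3_eq_3
 note d = stf_deriv stf_reflect_deriv stf_deriv_0_1(1)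
 show "(DERIV (zfun s) t :> z1fun s t)" unfolding zfun_def[abs_def] z1fun_def
  by (rule DERIV_cdivide) (auto intro!: derivative_eq_intros d)
 show "(DERIV (z1fun s) t :> 4 * s * zfun s t)" unfolding zfun_def z1fun_def[abs_def] times_divide_eq_right
  by (rule DERIV_cdivide) (auto intro!: derivative_eq_intros d simp: algebra_simps)
 show "(DERIV (Z1fun s) t :> zfun s t)" unfolding zfun_def Z1fun_def[abs_def] n
  by (rule DERIV_cdivide) (auto intro!: derivative_eq_intros d)
 show "(DERIV (Z2fun s) t :> Z1fun s t)" unfolding Z2fun_def[abs_def] Z1fun_def n
  by (rule DERIV_cdivide) (auto intro!: derivative_eq_intros d)
qed

lemma zfun_ends: "S2 s ~= 0 ==> zfun s 0 = x0" "S2 s ~= 0 ==> zfun s l = xL" "Z1fun s 0 = 0" "Z2fun s 0 = 0"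
 by (simp_all add: zfun_def S2_def Z1fun_def Z2fun_def)

lemma z1fun_eq: "z1fun s t = z1fun s 0 + 4 * s * Z1fun s t"
proof -
 have r: "stf 0 (4 * s) u = 1 + 4 * s * stf 2 (4 * s) u" for u using stf_rec[of 0 "4 * s" u] by (simp add: numeral_2_eq_2)
 show ?thesis unfolding z1fun_def Z1fun_def r by (simp add: add_divide_distrib[symmetric] algebra_simps)
qed

text \<open>The equation z'' = 4 s z integrated twice over the interval. It identifies the relation
  between the initial values of a Nahm solution with the Kronheimer equation, uniformly in s,
  including s = 0.\<close>

lemma ZZ_eq: "S2 s ~= 0 ==> 4 * s * ZZ s = (xL - x0) - l * z1fun s 0"
proof -
 assume nz: "S2 s ~= 0"
 have r0: "stf 0 (4 * s) u = 1 + 4 * s * stf 2 (4 * s) u" for u using stf_rec[of 0 "4 * s" u] by (simp add: numeral_2_eq_2)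
 have r1: "S2 s = l + 4 * s * stf 3 (4 * s) l" using stf_rec[of 1 "4 * s" l] by (simp add: S2_def numeral_3_eq_3)
 have "4 * s * ZZ s * S2 s = x0 * (l * (4 * s * stf 2 (4 * s) l) - 4 * s * stf 3 (4 * s) l) + xL * (4 * s * stf 3 (4 * s) l)"
 proof -
  have "ZZ s * S2 s = x0 * (l * stf 2 (4 * s) l - stf 3 (4 * s) l) + xL * stf 3 (4 * s) l"
   using nz by (simp add: ZZ_def Z2fun_def)
  thus ?thesis by (simp only: mult.assoc) (simp add: algebra_simps)
 qed
 also have "\<dots> = x0 * (l * (stf 0 (4 * s) l - 1) - (S2 s - l)) + xL * (S2 s - l)" by (simp add: r0 r1)
 also have "\<dots> = ((xL - x0) - l * z1fun s 0) * S2 s"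
 proof -
  have "z1fun s 0 * S2 s = - x0 * stf 0 (4 * s) l + xL" using nz by (simp add: z1fun_def)
  thus ?thesis by (simp only: left_diff_distrib mult.assoc) (simp add: algebra_simps)
 qed
 finally show ?thesis using nz by simp
qed

lemma S2_0 [simp]: "S2 0 = l" by (simp add: S2_def stf_def)

text \<open>Candidate solution for constant \<alpha> with entries a and b; \<open>w12\<close> and
  \<open>w21\<close> are the off-diagonal entries of \<beta> at 0. The remaining relation a w21 - b
  w12 = i z'(0) is imposed where Nahm's equation is claimed.\<close>

definition nahm_sol :: "complex => complex => complex => complex => nahm" where
 "nahm_sol a b w12 w21 =
  (onI (%t. mat2 0 a b 0),
   onI (%t. mat2 (- \<i> * zfun (a * b) t) (w12 - 2 * \<i> * a * Z1fun (a * b) t)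
          (w21 + 2 * \<i> * b * Z1fun (a * b) t) (\<i> * zfun (a * b) t)))"

lemma zfun_vderivs: "((%t. zfun s (complex_of_real t)) has_vector_derivative z1fun s t) (at t within S)"
 "((%t. Z1fun s (complex_of_real t)) has_vector_derivative zfun s t) (at t within S)"
 "((%t. Z2fun s (complex_of_real t)) has_vector_derivative Z1fun s t) (at t within S)"
 by (rule has_vector_derivative_real_field zfun_derivs)+

lemma nahm_sol_ND: assumes nz: "S2 (a * b) ~= 0" and c: "a * w21 - b * w12 = \<i> * z1fun (a * b) 0"
 shows "nahm_sol a b w12 w21 : ND" "nahm_sol a b w12 w21 : constant_alpha L"
proof -
 define be where "be = (%t::real. mat2 (- \<i> * zfun (a * b) t) (w12 - 2 * \<i> * a * Z1fun (a * b) t)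
          (w21 + 2 * \<i> * b * Z1fun (a * b) t) (\<i> * zfun (a * b) t))"
 note zd = has_vector_derivative_mult_right[OF zfun_vderivs(1)] has_vector_derivative_mult_right[OF zfun_vderivs(2)]
 have d: "(be has_der (- comm (mat2 0 a b 0) (be t))) t" for t
 proof -
  have "(be has_der mat2 (- \<i> * z1fun (a * b) t) (0 - 2 * \<i> * a * zfun (a * b) t)
    (0 + 2 * \<i> * b * zfun (a * b) t) (\<i> * z1fun (a * b) t)) t"
   unfolding be_def by (intro hvd_mat2 has_vector_derivative_diff has_vector_derivative_add
     has_vector_derivative_const zd)
  also have "mat2 (- \<i> * z1fun (a * b) t) (0 - 2 * \<i> * a * zfun (a * b) t)
    (0 + 2 * \<i> * b * zfun (a * b) t) (\<i> * z1fun (a * b) t) = - comm (mat2 0 a b 0) (be t)"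
  proof -
   have "- \<i> * z1fun (a * b) t = - (a * (w21 + 2 * \<i> * b * Z1fun (a * b) t) - (w12 - 2 * \<i> * a * Z1fun (a * b) t) * b)"
    using c unfolding z1fun_eq[of "a * b" t] by (simp add: algebra_simps)
   thus ?thesis by (simp add: be_def cmat_simps algebra_simps)
  qed
  finally show ?thesis .
 qed
 have sm: "smooth be"
 proof (rule lode_smooth[OF bil_comm smooth_const[of "- mat2 0 a b 0"] smooth_const[of 0]])
  show "(be has_der comm (- mat2 0 a b 0) (be t) + 0) t" for t using d[of t] by (simp add: comm_def mat_ring)
 qed
 have "(onI (%t. mat2 0 a b 0), onI be) : ND"
 proof (rule NDI)
  show "onI (%t. mat2 0 a b 0) : PP" by (rule on_I_in_paths) (simp_all add: sl2_iff)
  show "onI be : PP" by (rule on_I_in_paths[OF sm]) (simp add: sl2_iff be_def)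
  show "onI (%t. mat2 0 a b 0) 0 : t_perp" "onI (%t. mat2 0 a b 0) L : t_perp"
   using ends by (simp_all add: on_I_eq t_perp_iff)
  show "onI be 0 $ 1 $ 1 = - \<i> * x0" "onI be L $ 1 $ 1 = - \<i> * xL"
   using ends nz by (simp_all add: on_I_eq be_def zfun_ends)
  show "(onI be has_der - comm (onI (%t. mat2 0 a b 0) t) (onI be t)) t" if t: "t : II" for t
   unfolding on_I_eq[OF t] by (rule has_der_cong_I[OF t _ d]) (simp add: on_I_eq)
 qed
 thus "nahm_sol a b w12 w21 : ND" by (simp add: nahm_sol_def be_def)
 show "nahm_sol a b w12 w21 : constant_alpha L" unfolding nahm_sol_def constant_alpha_def
  by (auto simp: on_I_eq t_perp_iff)
qed

lemma RG_nahm_sol: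
 "RG L (nahm_sol a b w12 w21) = kdat a b (l * w12 - 2 * \<i> * a * ZZ (a * b)) (l * w21 + 2 * \<i> * b * ZZ (a * b))"
proof -
 define be where "be = (%t::real. mat2 (- \<i> * zfun (a * b) t) (w12 - 2 * \<i> * a * Z1fun (a * b) t)
          (w21 + 2 * \<i> * b * Z1fun (a * b) t) (\<i> * zfun (a * b) t))"
 define G where "G = (%t::real. mat2 (- \<i> * Z1fun (a * b) t) (complex_of_real t * w12 - 2 * \<i> * a * Z2fun (a * b) t)
          (complex_of_real t * w21 + 2 * \<i> * b * Z2fun (a * b) t) (\<i> * Z1fun (a * b) t))"
 note zd = has_vector_derivative_mult_right[OF zfun_vderivs(2)] has_vector_derivative_mult_right[OF zfun_vderivs(3)]
 have lin: "((%t. complex_of_real t * w) has_der w) t" for w t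
 proof -
  have "(DERIV (%t. t * w) (of_real t) :> w)" using DERIV_cmult_right[OF DERIV_ident] by simp
  thus ?thesis by (rule has_vector_derivative_real_field)
 qed
 have "(G has_der be t) t" for t unfolding G_def be_def
  by (intro hvd_mat2 has_vector_derivative_diff has_vector_derivative_add lin zd)
 hence "(be has_integral (G L - G 0)) II" using L_pos by (intro fundamental_theorem_of_calculus) auto
 moreover have "integral II (onI be) = integral II be" by (rule integral_cong) (simp add: on_I_eq)
 ultimately have "integral II (onI be) = G L - G 0" by auto
 thus ?thesis unfolding nahm_sol_def be_def[symmetric] RG.simps
  using L_pos by (simp add: kdat_def proj_perp_def on_I_eq G_def zfun_ends ZZ_def[symmetric])
qed

text \<open>Obtained by solving \<open>RG_nahm_sol\<close> for the initial entries of \<beta>. It is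
  total and inverts \<open>RG\<close> formally everywhere; that its values are Nahm data is shown
  where \<open>S2 (a * b)\<close> is nonzero.\<close>

fun of_kron :: "kron => nahm" where "of_kron (al, be) =
  (let a = al $ 1 $ 2; b = al $ 2 $ 1; c = be $ 1 $ 2; d = be $ 2 $ 1 in
   nahm_sol a b ((c + 2 * \<i> * a * ZZ (a * b)) / l) ((d - 2 * \<i> * b * ZZ (a * b)) / l))"

declare of_kron.simps [simp del]

lemma of_kron_kdat: "of_kron (kdat a b c d) =
  nahm_sol a b ((c + 2 * \<i> * a * ZZ (a * b)) / l) ((d - 2 * \<i> * b * ZZ (a * b)) / l)"
 by (simp add: kdat_def of_kron.simps)

lemma RG_of_kron: "RG L (of_kron (kdat a b c d)) = kdat a b c d" by (simp add: of_kron_kdat RG_nahm_sol)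

lemma of_kron_RG: "of_kron (RG L (nahm_sol a b w12 w21)) = nahm_sol a b w12 w21" by (simp add: of_kron_kdat RG_nahm_sol)

text \<open>After multiplication by L the two relations differ by exactly the terms that
  \<open>ZZ_eq\<close> balances.\<close>

lemma kron_constraint: assumes "S2 (a * b) ~= 0"
 shows "a * ((d - 2 * \<i> * b * ZZ (a * b)) / l) - b * ((c + 2 * \<i> * a * ZZ (a * b)) / l) = \<i> * z1fun (a * b) 0
  <-> a * d - b * c = \<i> * (xL - x0)"
proof -
 have "l * (a * ((d - 2 * \<i> * b * ZZ (a * b)) / l) - b * ((c + 2 * \<i> * a * ZZ (a * b)) / l) - \<i> * z1fun (a * b) 0)
   = a * d - b * c - \<i> * (4 * (a * b) * ZZ (a * b)) - \<i> * (l * z1fun (a * b) 0)"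
  by (simp add: field_simps)
 also have "\<dots> = a * d - b * c - \<i> * (xL - x0)" unfolding ZZ_eq[OF assms] by (simp add: algebra_simps)
 finally show ?thesis by auto
qed

lemma sol_constraint: assumes "S2 (a * b) ~= 0" "a * w21 - b * w12 = \<i> * z1fun (a * b) 0"
 shows "RG L (nahm_sol a b w12 w21) : KD"
proof -
 have "a * (l * w21 + 2 * \<i> * b * ZZ (a * b)) - b * (l * w12 - 2 * \<i> * a * ZZ (a * b)) =
   l * (a * w21 - b * w12) + \<i> * (4 * (a * b) * ZZ (a * b))"
  by (simp add: algebra_simps)
 also have "\<dots> = \<i> * (xL - x0)" unfolding assms(2) ZZ_eq[OF assms(1)] by (simp add: algebra_simps)
 finally show ?thesis by (simp add: RG_nahm_sol kdat_in_KD)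
qed

lemma of_kron_ND: assumes "kdat a b c d : KD" "S2 (a * b) ~= 0"
 shows "of_kron (kdat a b c d) : ND" "of_kron (kdat a b c d) : constant_alpha L"
 using nahm_sol_ND[OF assms(2)] assms kron_constraint[OF assms(2), of d c] by (simp_all add: of_kron_kdat kdat_in_KD)

lemma gact_nahm_sol: assumes h: "h : torus" shows "gact (%t. h) (nahm_sol a b w12 w21) =
  nahm_sol (a * (h $ 2 $ 2)\<^sup>2) (b * (h $ 1 $ 1)\<^sup>2) (w12 * (h $ 2 $ 2)\<^sup>2) (w21 * (h $ 1 $ 1)\<^sup>2)"
proof -
 have ab: "a * (h $ 2 $ 2)\<^sup>2 * (b * (h $ 1 $ 1)\<^sup>2) = a * b" using torus_units(1)[OF h] by (simp add: mult_ac)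
 show ?thesis unfolding nahm_sol_def ab by (subst gact_adj2)
   (auto simp: on_I_def torus_det[OF h] torus_conj_eq[OF h] algebra_simps)
qed

lemma of_kron_equivariant: assumes "h : torus"
 shows "of_kron (kron_act h (kdat a b c d)) = gact (%t. h) (of_kron (kdat a b c d))"
proof -
 have ab: "a * (h $ 2 $ 2)\<^sup>2 * (b * (h $ 1 $ 1)\<^sup>2) = a * b" using torus_units(1)[OF assms] by (simp add: mult_ac)
 show ?thesis unfolding kron_act_kdat[OF assms] of_kron_kdat gact_nahm_sol[OF assms] ab by (simp add: algebra_simps)
qed

section \<open>The families\<close>

text \<open>In family (a) the coefficient of \<open>sigma_y\<close> is z' / (2 al0) and that of
  \<open>sigma_z\<close> is -i z. The offset \<open>w\<close> is the contribution of
  \<open>sigma_y\<close> to the off-diagonal entries at t = 0.\<close>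

lemma data_a_eq: assumes nz: "sinh (2 * al0 * l) ~= 0"
 defines "w == \<i> * z1fun (al0^2) 0 / (2 * al0)"
 shows "data_a L x0 xL al0 bex = nahm_sol al0 al0 (bex - w) (bex + w)"
proof -
 have a0: "al0 ~= 0" using nz by auto
 define s where "s = al0^2"
 have w2: "(2 * al0)\<^sup>2 = 4 * s" by (simp add: s_def)
 have t1: "stf 1 (4 * s) t = sinh (2 * al0 * t) / (2 * al0)" for t using stf_eq(2)[OF w2, of t] a0 by (simp add: field_simps)
 have t0: "stf 0 (4 * s) t = cosh (2 * al0 * t)" for t using stf_eq(1)[OF w2, of t] .
 have z: "zfun s t = (x0 * sinh (2 * al0 * (l - t)) + xL * sinh (2 * al0 * t)) / sinh (2 * al0 * l)" for t
  unfolding zfun_def S2_def t1 by (simp add: field_simps)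
 have z1: "z1fun s t / (2 * al0) = (- x0 * cosh (2 * al0 * (l - t)) + xL * cosh (2 * al0 * t)) / sinh (2 * al0 * l)" for t
  unfolding z1fun_def S2_def t1 t0 using a0 nz by simp
 have wZ: "w + 2 * \<i> * al0 * Z1fun s t = \<i> * (z1fun s t / (2 * al0))" for t
  unfolding z1fun_eq[of s t] w_def using a0 by (simp add: s_def field_simps power2_eq_square)
 have "cscale al0 sigma_x = mat2 0 al0 al0 0" by (simp add: cmat_iff)
 moreover have "cscale bex sigma_x + cscale (z1fun s t / (2 * al0)) sigma_y + cscale (- \<i> * zfun s t) sigma_z =
   mat2 (- \<i> * zfun s t) (bex - w - 2 * \<i> * al0 * Z1fun s t) (bex + w + 2 * \<i> * al0 * Z1fun s t) (\<i> * zfun s t)" for t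
  using wZ[of t] by (simp add: cmat_iff algebra_simps)
 ultimately show ?thesis unfolding data_a_def nahm_sol_def
  by (simp only: of_real_diff power2_eq_square[symmetric] s_def[symmetric] z1[symmetric]
    times_divide_eq_right[symmetric] z[symmetric])
qed

lemma stf_s0: "stf k 0 t = t ^ k / fact k" by (simp add: stf_def)

lemma sol_s0: "zfun 0 t = (x0 * (l - t) + xL * t) / l" "z1fun 0 t = (xL - x0) / l"
 "Z1fun 0 t = (x0 * (l^2 - (l - t)\<^sup>2) + xL * t^2) / (2 * l)"
 by (simp_all add: zfun_def z1fun_def Z1fun_def stf_s0 field_simps)

lemma data_b_eq: "data_b L x0 xL c = nahm_sol (1 / l) 0 (\<i> * (x0 - xL) - \<i> * c / l) (\<i> * (xL - x0))"
 unfolding data_b_def nahm_sol_def Let_def mult_zero_right sol_s0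
 by (auto simp: on_I_def cmat_iff field_simps power2_eq_square)

lemma data_c_eq: "data_c L x0 xL c = nahm_sol 0 (1 / l) (\<i> * (x0 - xL)) (\<i> * (xL - x0) - \<i> * c / l)"
 unfolding data_c_def nahm_sol_def Let_def mult_zero_left sol_s0
 by (auto simp: on_I_def cmat_iff field_simps power2_eq_square)

lemma data_d_eq: "x0 = xL ==> data_d L x0 (mat2 0 p q 0) = nahm_sol 0 0 p q"
 unfolding data_d_def nahm_sol_def mult_zero_left sol_s0 by (auto simp: on_I_def cmat_iff field_simps)

text \<open>The possible values s of the product of the entries of \<alpha>: zero for the families
  (b), (c), (d), and al0^2 for family (a).\<close>

definition family_cond :: "(complex => bool) => complex => bool" where
 "family_cond P s <-> s = 0 | (EX al0. P al0 & al0\<^sup>2 = s & sinh (2 * al0 * l) ~= 0)"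

lemma S2_square: "2 * al0 * S2 (al0^2) = sinh (2 * al0 * l)"
 unfolding S2_def using stf_eq(2)[of "2 * al0" "4 * al0^2" l] by simp

lemma family_cond_S2: "family_cond P s ==> S2 s ~= 0"
proof (cases "s = 0")
 case False
 assume "family_cond P s"
 then obtain al0 where "al0\<^sup>2 = s" "sinh (2 * al0 * l) ~= 0" using False by (auto simp: family_cond_def)
 thus ?thesis using S2_square[of al0] by auto
qed simp

text \<open>A constant torus element multiplies \<open>a\<close> and \<open>w12\<close> by some m
  and divides \<open>b\<close> and \<open>w21\<close> by it. When the product a b is nonzero,
  \<alpha> can thus be normalized to al0 times \<open>sigma_x\<close>; when one entry vanishes the
  other becomes 1 / L, and when both vanish the same scaling normalizes \<beta>.\<close>

lemma family_orbits_eq: "family_orbits L x0 xL P = {nahm_sol a b w12 w21 | a b w12 w21.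
  a * w21 - b * w12 = \<i> * z1fun (a * b) 0 & family_cond P (a * b)}" (is "_ = ?R")
proof
 have inR: "gact (%t. h) (nahm_sol a b w12 w21) : ?R"
  if "h : torus" "a * w21 - b * w12 = \<i> * z1fun (a * b) 0" "family_cond P (a * b)" for h a b w12 w21
 proof -
  define m n where "m = (h $ 2 $ 2)\<^sup>2" and "n = (h $ 1 $ 1)\<^sup>2"
  have mn: "m * n = 1" using torus_units(1)[OF that(1)] by (simp add: m_def n_def mult.commute)
  have ab: "a * m * (b * n) = a * b" using mn by simp
  have "a * m * (w21 * n) - b * n * (w12 * m) = (m * n) * (a * w21 - b * w12)" by (simp add: algebra_simps)
  hence "a * m * (w21 * n) - b * n * (w12 * m) = \<i> * z1fun (a * m * (b * n)) 0" unfolding ab mn that(2) by simp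
  moreover have "family_cond P (a * m * (b * n))" unfolding ab by (rule that(3))
  ultimately show ?thesis unfolding gact_nahm_sol[OF that(1)] m_def[symmetric] n_def[symmetric] by blast
 qed
 show "family_orbits L x0 xL P <= ?R"
 proof
  fix B assume "B : family_orbits L x0 xL P"
  then obtain B0 h where B: "B0 : nahm_families L x0 xL P" "h : torus" "B = gact (%t. h) B0"
   by (auto simp: family_orbits_def nahm_torus_orbit_def)
  from B(1) consider (a) al0 bex where "B0 = data_a L x0 xL al0 bex" "P al0" "sinh (2 * al0 * l) ~= 0"
   | (b) c where "B0 = data_b L x0 xL c" | (c) c where "B0 = data_c L x0 xL c"
   | (d) M where "B0 = data_d L x0 M" "x0 = xL" "M = 0 | M = mat2 0 (1 / l) 0 0 | (EX c. M = mat2 0 c (1 / l) 0)"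
   unfolding nahm_families_def by blast
  thus "B : ?R"
  proof cases
   case a
   have "al0 ~= 0" using a(3) by auto
   hence "al0 * (bex + \<i> * z1fun (al0^2) 0 / (2 * al0)) - al0 * (bex - \<i> * z1fun (al0^2) 0 / (2 * al0)) = \<i> * z1fun (al0 * al0) 0"
    by (simp add: field_simps power2_eq_square)
   moreover have "family_cond P (al0 * al0)" using a(2,3) by (auto simp: family_cond_def power2_eq_square)
   ultimately show ?thesis unfolding B(3) a(1) data_a_eq[OF a(3)] by (intro inR B(2))
  next
   case b
   show ?thesis unfolding B(3) b data_b_eq by (intro inR B(2)) (simp_all add: sol_s0 family_cond_def)
  next
   case c
   show ?thesis unfolding B(3) c data_c_eq by (intro inR B(2)) (simp_all add: sol_s0 family_cond_def field_simps)
  next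
   case d
   have "0 = mat2 0 0 0 0" by (simp add: cmat_iff)
   then obtain p q where M: "M = mat2 0 p q 0" using d(3) by metis
   show ?thesis unfolding B(3) d(1) M data_d_eq[OF d(2)]
    by (intro inR B(2), unfold mult_zero_left sol_s0) (simp_all add: family_cond_def d(2))
  qed
 qed
 show "?R <= family_orbits L x0 xL P"
 proof
  fix B assume "B : ?R"
  then obtain a b w12 w21 where B: "B = nahm_sol a b w12 w21" "a * w21 - b * w12 = \<i> * z1fun (a * b) 0" "family_cond P (a * b)"
   by blast
  \<comment> \<open>It remains to find the scaling m and a family member whose \<alpha> has the
    entries a0 and b0; its off-diagonal entries of \<beta> at 0 are then forced to be w12 / m and
    w21 m.\<close>
  have inO: "B : family_orbits L x0 xL P" if m: "m ~= 0" and e: "a = a0 * m" "b = b0 * inverse m" and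
    fam: "!!u v. a0 * v - b0 * u = \<i> * z1fun (a0 * b0) 0 ==> u = w12 * inverse m ==> v = w21 * m ==>
     nahm_sol a0 b0 u v : nahm_families L x0 xL P" for m a0 b0
  proof -
   obtain h where h: "h : torus" "(h $ 2 $ 2)\<^sup>2 = m" "(h $ 1 $ 1)\<^sup>2 = inverse m" using torus_exists[OF m] .
   have "w12 * inverse m * m = w12" "w21 * m * inverse m = w21" using m by auto
   hence "gact (%t. h) (nahm_sol a0 b0 (w12 * inverse m) (w21 * m)) = B"
    unfolding gact_nahm_sol[OF h(1)] h B(1) e by (simp only:)
   moreover have ab: "a * b = a0 * b0" using m by (simp add: e)
   have "a0 * (w21 * m) - b0 * (w12 * inverse m) = \<i> * z1fun (a0 * b0) 0" using B(2) unfolding ab by (simp add: e mult_ac)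
   hence "nahm_sol a0 b0 (w12 * inverse m) (w21 * m) : nahm_families L x0 xL P" by (rule fam) simp_all
   ultimately show ?thesis using h(1) by (force simp: family_orbits_def nahm_torus_orbit_def)
  qed
  consider (s) "a * b ~= 0" | (a) "a ~= 0" "b = 0" | (b) "a = 0" "b ~= 0" | (z) "a = 0" "b = 0" by auto
  thus "B : family_orbits L x0 xL P"
  proof cases
   case s
   then obtain al0 where al0: "P al0" "al0\<^sup>2 = a * b" "sinh (2 * al0 * l) ~= 0"
    using B(3) by (auto simp: family_cond_def)
   have nz: "al0 ~= 0" using s al0(2) by auto
   show ?thesis
   proof (rule inO[of "a / al0" al0 al0])
    show "a / al0 ~= 0" "a = al0 * (a / al0)" using s nz by auto
    show "b = al0 * inverse (a / al0)" using s al0(2) by (simp add: power2_eq_square)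
    fix u v assume "al0 * v - al0 * u = \<i> * z1fun (al0 * al0) 0"
    hence d: "v - u = \<i> * z1fun (al0^2) 0 / al0" using nz by (simp add: field_simps power2_eq_square)
    have "data_a L x0 xL al0 ((u + v) / 2) = nahm_sol al0 al0 ((u + v) / 2 - (v - u) / 2) ((u + v) / 2 + (v - u) / 2)"
     unfolding data_a_eq[OF al0(3)] d by (simp add: mult.commute)
    moreover have "(u + v) / 2 - (v - u) / 2 = u" "(u + v) / 2 + (v - u) / 2 = v" by (simp_all add: field_simps)
    ultimately have e: "data_a L x0 xL al0 ((u + v) / 2) = nahm_sol al0 al0 u v" by simp
  show "nahm_sol al0 al0 u v : nahm_families L x0 xL P" using al0(1,3) unfolding nahm_families_def e[symmetric] by blast
   qed
  next
   case a
   show ?thesis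
   proof (rule inO[of "a * l" "1 / l" 0])
    fix u v assume "1 / l * v - 0 * u = \<i> * z1fun (1 / l * 0) 0"
    hence v: "v = \<i> * (xL - x0)" by (simp add: sol_s0)
    have "\<i> * (x0 - xL) - \<i> * (\<i> * l * (u - \<i> * (x0 - xL))) / l = u" by simp
    \<comment> \<open>The parameter of family (b) comes from solving \<open>data_b_eq\<close> for
      the prescribed upper entry \<open>u\<close>; the lower entry is fixed by the
      constraint.\<close>
    hence e: "data_b L x0 xL (\<i> * l * (u - \<i> * (x0 - xL))) = nahm_sol (1 / l) 0 u v" unfolding data_b_eq v by simp
  show "nahm_sol (1 / l) 0 u v : nahm_families L x0 xL P" unfolding nahm_families_def e[symmetric] by blast
   qed (use a in auto)
  next
   case b
   show ?thesis
   proof (rule inO[of "inverse (b * l)" 0 "1 / l"])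
    fix u v assume "0 * v - 1 / l * u = \<i> * z1fun (0 * (1 / l)) 0"
    hence u: "u = \<i> * (x0 - xL)" by (simp add: sol_s0 field_simps)
    have "\<i> * (xL - x0) - \<i> * (\<i> * l * (v - \<i> * (xL - x0))) / l = v" by simp
    hence e: "data_c L x0 xL (\<i> * l * (v - \<i> * (xL - x0))) = nahm_sol 0 (1 / l) u v" unfolding data_c_eq u by simp
  show "nahm_sol 0 (1 / l) u v : nahm_families L x0 xL P" unfolding nahm_families_def e[symmetric] by blast
   qed (use b in auto)
  next
   case z
   have x: "x0 = xL" using B(2) by (simp add: z sol_s0)
   have fam: "nahm_sol 0 0 p q : nahm_families L x0 xL P"
    if "q = 1 / l | q = 0 & (p = 1 / l | p = 0)" for p q
   proof -
    have "mat2 0 0 0 0 = 0" by (simp add: cmat_iff)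
    hence "mat2 0 p q 0 = 0 | mat2 0 p q 0 = mat2 0 (1 / l) 0 0 | (EX c. mat2 0 p q 0 = mat2 0 c (1 / l) 0)"
     using that by auto
    thus ?thesis using x unfolding nahm_families_def data_d_eq[OF x, symmetric] by blast
   qed
   consider (1) "w21 ~= 0" | (2) "w21 = 0" "w12 ~= 0" | (3) "w21 = 0" "w12 = 0" by blast
   thus ?thesis
   proof cases
    case 1
    show ?thesis by (rule inO[of "inverse (w21 * l)" 0 0]) (use z 1 in "auto intro!: fam simp: field_simps")
   next
    case 2
    show ?thesis by (rule inO[of "w12 * l" 0 0]) (use z 2 in "auto intro!: fam simp: field_simps")
   next
    case 3
    show ?thesis by (rule inO[of 1 0 0]) (use z 3 in "auto intro!: fam")
   qed
  qed
 qed
qed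

lemma upper_half_nz: "upper_half z ==> z ~= 0" by (auto simp: upper_half_def)

lemma upper_half_root: "s ~= 0 ==> EX w. upper_half w & w\<^sup>2 = s"
proof -
 assume "s ~= 0"
 then obtain w where w: "w\<^sup>2 = s" "w ~= 0" using square_root_exists[of s] by auto
 have "upper_half w | upper_half (- w)" using w(2) by (auto simp: upper_half_def complex_eq_iff)
 moreover have "(- w)\<^sup>2 = s" using w(1) by simp
 ultimately show ?thesis using w(1) by blast
qed

lemma family_cond_upper_half: "family_cond upper_half s <-> S2 s ~= 0"
proof
 assume *: "S2 s ~= 0"
 show "family_cond upper_half s"
 proof (cases "s = 0")
  case False
  then obtain w where w: "upper_half w" "w\<^sup>2 = s" using upper_half_root by blast
  hence "sinh (2 * w * l) ~= 0" using S2_square[of w] * upper_half_nz[of w] by auto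
  thus ?thesis using w by (auto simp: family_cond_def)
 qed (simp add: family_cond_def)
qed (rule family_cond_S2)

lemma S2_stumpff: "S2 s = l * stumpff 1 (4 * (s * l^2))" by (simp add: S2_def stf_def mult.assoc)

lemma parab_S2: "s * l^2 : parab ==> S2 s ~= 0"
 unfolding S2_stumpff stumpff_1_double using stumpff_nonzero by simp

text \<open>The restriction on family (a) reads |Im (w L)| < pi/2, which is insensitive to the sign
  of w. It is therefore a condition on s L^2 alone, and it already excludes the zeros of the
  denominator.\<close>

lemma family_cond_half_strip: "family_cond (half_strip L) s <-> s * l^2 : parab"
proof (cases "s = 0")
 case False
 have eq: "w\<^sup>2 * l^2 : parab <-> \<bar>Im w\<bar> < pi / (2 * L)" for w
  using square_in_parab[of "w * l"] L_pos by (simp add: abs_mult field_simps)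
 show ?thesis
 proof
  assume "family_cond (half_strip L) s"
  then obtain w where "half_strip L w" "w\<^sup>2 = s" using False by (auto simp: family_cond_def)
  thus "s * l^2 : parab" using eq[of w] by (auto simp: half_strip_def upper_half_def)
 next
  assume s: "s * l^2 : parab"
  obtain w where w: "upper_half w" "w\<^sup>2 = s" using upper_half_root[OF False] by blast
  hence "half_strip L w" using s eq[of w] by (auto simp: half_strip_def)
  moreover have "sinh (2 * w * l) ~= 0" using S2_square[of w] parab_S2[OF s] upper_half_nz[OF w(1)] w(2) by auto
  ultimately show "family_cond (half_strip L) s" using w(2) by (auto simp: family_cond_def)
 qed
qed (simp add: family_cond_def)

lemma family_orbits_kron: "family_orbits L x0 xL P = {of_kron (kdat a b c d) | a b c d.
  kdat a b c d : KD & family_cond P (a * b)}"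
proof (rule set_eqI, rule iffI)
 fix B assume "B : family_orbits L x0 xL P"
 then obtain a b w12 w21 where B: "B = nahm_sol a b w12 w21" "a * w21 - b * w12 = \<i> * z1fun (a * b) 0" "family_cond P (a * b)"
  unfolding family_orbits_eq by blast
 have "B = of_kron (RG L B)" unfolding B(1) of_kron_RG ..
 moreover have "RG L B : KD" unfolding B(1) by (rule sol_constraint[OF family_cond_S2[OF B(3)] B(2)])
 ultimately show "B : {of_kron (kdat a b c d) | a b c d.
  kdat a b c d : KD & family_cond P (a * b)}"
  using B(3) unfolding B(1) RG_nahm_sol by blast
next
 fix B assume "B : {of_kron (kdat a b c d) | a b c d.
  kdat a b c d : KD & family_cond P (a * b)}"
 then obtain a b c d where B: "B = of_kron (kdat a b c d)" "kdat a b c d : KD" "family_cond P (a * b)" by blast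
 have "a * ((d - 2 * \<i> * b * ZZ (a * b)) / l) - b * ((c + 2 * \<i> * a * ZZ (a * b)) / l) = \<i> * z1fun (a * b) 0"
  using kron_constraint[OF family_cond_S2[OF B(3)], of d c] B(2) unfolding kdat_in_KD by blast
 thus "B : family_orbits L x0 xL P" unfolding family_orbits_eq B(1) of_kron_kdat using B(3) by blast
qed

text \<open>Since sinh (2 al0 L) = 2 al0 S2 (al0^2) and al0 is nonzero, the undefined parameters are
  the zeros of \<open>S2\<close>; at these a b is nonzero, so \<alpha> is conjugate to a multiple of
  \<open>sigma_x\<close>.\<close>

lemma exceptional_kron_iff:
 "kdat a b c d : exceptional_kron L (xL - x0) <-> kdat a b c d : KD & S2 (a * b) = 0"
proof -
 have "(EX al0. EX h:torus. upper_half al0 & sinh (2 * al0 * l) = 0 &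
   mat2 0 a b 0 = matrix_inv h ** cscale al0 sigma_x ** h) <-> S2 (a * b) = 0" (is "?L <-> _")
 proof
  assume ?L
  then obtain al0 h where h: "h : torus" "upper_half al0" "sinh (2 * al0 * l) = 0"
   "mat2 0 a b 0 = matrix_inv h ** cscale al0 sigma_x ** h" by blast
  have "cscale al0 sigma_x = mat2 0 al0 al0 0" by (simp add: cmat_iff)
  hence "mat2 0 a b 0 = mat2 0 (al0 * (h $ 2 $ 2)\<^sup>2) (al0 * (h $ 1 $ 1)\<^sup>2) 0"
   using h(4) by (simp add: matrix_inv_eq_adj2[OF torus_det[OF h(1)]] torus_conj_eq[OF h(1)])
  hence "a * b = al0^2 * ((h $ 1 $ 1)\<^sup>2 * (h $ 2 $ 2)\<^sup>2)" by (simp add: cmat_iff power2_eq_square)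
  hence "a * b = al0^2" by (simp add: torus_units[OF h(1)])
  thus "S2 (a * b) = 0" using S2_square[of al0] h(3) upper_half_nz[OF h(2)] by simp
 next
  assume s: "S2 (a * b) = 0"
  hence nz: "a * b ~= 0" by auto
  then obtain al0 where al0: "upper_half al0" "al0\<^sup>2 = a * b" using upper_half_root by blast
  have "al0 ~= 0" using nz al0(2) by auto
  hence "a / al0 ~= 0" using nz by auto
  then obtain h where h: "h : torus" "(h $ 2 $ 2)\<^sup>2 = a / al0" "(h $ 1 $ 1)\<^sup>2 = inverse (a / al0)"
   using torus_exists by metis
  have "cscale al0 sigma_x = mat2 0 al0 al0 0" by (simp add: cmat_iff)
  hence "matrix_inv h ** cscale al0 sigma_x ** h = mat2 0 (al0 * (h $ 2 $ 2)\<^sup>2) (al0 * (h $ 1 $ 1)\<^sup>2) 0"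
   by (simp add: matrix_inv_eq_adj2[OF torus_det[OF h(1)]] torus_conj_eq[OF h(1)])
  also have "\<dots> = mat2 0 a b 0"
   unfolding h using `al0 \<noteq> 0` nz al0(2) by (simp add: power2_eq_square)
  finally show ?L using h(1) al0 s S2_square[of al0] by (metis mult_zero_right)
 qed
 thus ?thesis by (auto simp: exceptional_kron_def kdat_def)
qed

text \<open>Integrating Nahm's equation over the interval gives [-A, b] = be L - be 0 for the
  integral b of \<beta>. As A is off-diagonal, the diagonal of this identity sees only the
  projection of b.\<close>

lemma RG_KD: assumes "B : ND" "B : constant_alpha L" shows "RG L B : KD"
proof -
 obtain al be where B: "B = (al, be)" by (cases B)
 note N = NDD[OF assms(1)[unfolded B]]
 obtain A where A: "A : t_perp" "!!t. t : II ==> al t = A" using assms(2) by (auto simp: B constant_alpha_def)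
 define b where "b = integral II be"
 have I: "(be has_integral b) II" unfolding b_def using smooth_cont[OF pathsD(1)[OF N(2)]]
  by (intro integrable_integral integrable_continuous_interval)
 have "blin (%X. comm (- A) X)" by (rule bounded_bilinear.bounded_linear_right[OF bil_comm])
 from has_integral_linear[OF I this]
 have "((%t. comm (- A) (be t)) has_integral comm (- A) b) II" by (simp add: o_def)
 moreover have "((%t. comm (- A) (be t)) has_integral be L - be 0) II"
 proof (rule fundamental_theorem_of_calculus)
  show "(be has_der comm (- A) (be t)) t" if "t : II" for t
   using N(9)[OF that] A(2)[OF that] by (simp add: comm_def mat_ring)
 qed (use L_pos in simp)
 ultimately have e: "comm (- A) b = be L - be 0" by (rule has_integral_unique)
 have "comm (- A) b $ 1 $ 1 = - \<i> * xL + \<i> * x0" "comm (- A) b $ 2 $ 2 = \<i> * xL - \<i> * x0"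
  unfolding e by (simp_all add: N)
 hence "A $ 1 $ 2 * b $ 2 $ 1 - A $ 2 $ 1 * b $ 1 $ 2 = \<i> * (xL - x0)" by (simp add: comm_nth algebra_simps)
 hence "kdat (A $ 1 $ 2) (A $ 2 $ 1) (b $ 1 $ 2) (b $ 2 $ 1) : KD" by (simp add: kdat_in_KD)
 moreover have "RG L B = kdat (A $ 1 $ 2) (A $ 2 $ 1) (b $ 1 $ 2) (b $ 2 $ 1)"
  using A L_pos by (simp add: B RG.simps kdat_def proj_perp_def b_def[symmetric] cmat_iff t_perp_iff)
 ultimately show ?thesis by simp
qed

theorem part_ii: "family_orbits L x0 xL upper_half <= ND Int constant_alpha L"
 "bij_betw (RG L) (family_orbits L x0 xL upper_half) (KD - exceptional_kron L (xL - x0))"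
proof -
 show "family_orbits L x0 xL upper_half <= ND Int constant_alpha L"
  unfolding family_orbits_kron family_cond_upper_half using of_kron_ND by blast
 show "bij_betw (RG L) (family_orbits L x0 xL upper_half) (KD - exceptional_kron L (xL - x0))"
 proof (rule bij_betw_byWitness[of _ of_kron])
  show "ALL B:family_orbits L x0 xL upper_half. of_kron (RG L B) = B"
   unfolding family_orbits_kron using RG_of_kron by auto
  have *: "EX a b c d. A = kdat a b c d & kdat a b c d : KD & S2 (a * b) ~= 0"
   if "A : KD - exceptional_kron L (xL - x0)" for A using that exceptional_kron_iff by (metis DiffD1 DiffD2 KD_kdat)
  thus "ALL A:KD - exceptional_kron L (xL - x0). RG L (of_kron A) = A" using RG_of_kron by metis
  show "RG L ` family_orbits L x0 xL upper_half <= KD - exceptional_kron L (xL - x0)"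
   unfolding family_orbits_kron family_cond_upper_half using RG_of_kron exceptional_kron_iff by auto
  show "of_kron ` (KD - exceptional_kron L (xL - x0)) <= family_orbits L x0 xL upper_half"
   unfolding family_orbits_kron family_cond_upper_half using * by blast
 qed
qed

end


lemma kron_subline_kdat:
 "kron_subline (kdat a b c d) W <-> W = cline e1 & b = 0 & d = 0 | W = cline e2 & a = 0 & c = 0"
proof -
 have 1: "(ALL v:cline e1. mat2 0 p q 0 *v v : cline e1) <-> q = 0" for p q
 proof
  assume "ALL v:cline e1. mat2 0 p q 0 *v v : cline e1"
  hence "mat2 0 p q 0 *v e1 : cline e1" using cline_self by blast
  thus "q = 0" by (simp add: cline_e1 mulv_nth)
 qed (simp add: cline_e1 mulv_nth)
 have 2: "(ALL v:cline e2. mat2 0 p q 0 *v v : cline e2) <-> p = 0" for p q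
 proof
  assume "ALL v:cline e2. mat2 0 p q 0 *v v : cline e2"
  hence "mat2 0 p q 0 *v e2 : cline e2" using cline_self by blast
  thus "p = 0" by (simp add: cline_e2 mulv_nth)
 qed (simp add: cline_e2 mulv_nth)
 show ?thesis unfolding kdat_def kron_subline.simps using cline_e12_neq
  by (cases "W = cline e1"; cases "W = cline e2") (simp_all add: 1 2)
qed

context nahm_params
begin

section \<open>Sublines of data with constant \<open>\<alpha>\<close>\<close>

text \<open>The exponential of -t \<alpha>, computed from \<alpha>^2 = a b.\<close>

definition hol :: "complex => complex => complex => cmat" where
 "hol a b t = mat2 (stf 0 (a * b) t) (- (stf 1 (a * b) t * a))
  (- (stf 1 (a * b) t * b)) (stf 0 (a * b) t)"

lemma par_const: assumes "t : II" shows "par (onI (%t. mat2 0 a b 0)) t = hol a b t"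
proof (rule par_unique[OF _ assms, symmetric])
 show "cont II (onI (%t. mat2 0 a b 0))"
  by (rule continuous_on_eq[OF continuous_on_const[of _ "mat2 0 a b 0"]]) (simp add: on_I_eq)
 show "hol a b (complex_of_real 0) = mat 1" by (simp add: hol_def cmat_iff)
 fix t assume t: "t : II"
 have d0: "((%t. stf 0 (a * b) (complex_of_real t)) has_der a * b * stf 1 (a * b) t) t"
  by (rule has_vector_derivative_real_field[OF stf_deriv_0_1(1)])
 have d1: "((%t. - (stf 1 (a * b) (complex_of_real t) * k)) has_der - (stf 0 (a * b) t * k)) t" for k
  by (rule has_vector_derivative_minus[OF has_vector_derivative_mult_left[OF has_vector_derivative_real_field[OF stf_deriv_0_1(2)]]])
 have "((%t. hol a b (complex_of_real t)) has_der
   mat2 (a * b * stf 1 (a * b) t) (- (stf 0 (a * b) t * a)) (- (stf 0 (a * b) t * b)) (a * b * stf 1 (a * b) t)) t"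
  unfolding hol_def by (intro hvd_mat2 d0 d1)
 thus "((%t. hol a b (complex_of_real t)) has_der (- onI (%t. mat2 0 a b 0) t) ** hol a b t) t"
  by (rule has_vector_derivative_eq_rhs) (simp add: on_I_eq[OF t] hol_def cmat_simps)
qed

lemma S2_factor: "S2 s = stf 0 s l * stf 1 s l" unfolding S2_stumpff stumpff_1_double by (simp add: stf_def)

lemma beta0_of_kron: assumes "S2 (a * b) ~= 0" shows "snd (of_kron (kdat a b c d)) 0 =
  mat2 (- \<i> * x0) ((c + 2 * \<i> * a * ZZ (a * b)) / l) ((d - 2 * \<i> * b * ZZ (a * b)) / l) (\<i> * x0)"
 unfolding of_kron_kdat nahm_sol_def using L_pos assms by (simp add: on_I_eq zfun_ends)

text \<open>Since \<open>stf 0\<close> is nonzero at L, the holonomy cannot exchange the coordinate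
  lines; since \<open>stf 1\<close> is nonzero, it fixes one of them only if the corresponding entry
  of \<alpha> vanishes. The term with \<open>ZZ\<close> then drops out of \<beta> at 0, which leaves
  the Kronheimer condition. At other t the same entry vanishes, so the transported line is
  constant.\<close>

lemma of_kron_fixed_line:
 fixes a b c d :: complex assumes nz: "S2 (a * b) ~= 0" and e: "e : {e1, e2}"
 defines "B == of_kron (kdat a b c d)"
 shows "fixed_line B e <-> kron_subline (kdat a b c d) (cline e)"
  "fixed_line B e ==> flat_line (fst B) e = II \<times> cline e"
proof -
 have tr: "par (fst B) t = hol a b t" if "t : II" for t
  using par_const[OF that] by (simp add: B_def of_kron_kdat nahm_sol_def)
 have L: "L : II" using L_pos by simp
 have CS: "stf 0 (a * b) l ~= 0" "stf 1 (a * b) l ~= 0" using nz unfolding S2_factor by auto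
 have m: "v : cline e1 <-> v $ 2 = 0" "v : cline e2 <-> v $ 1 = 0" for v by (simp_all add: cline_e1 cline_e2)
 from e consider "e = e1" | "e = e2" by blast
 note c = this
 show f: "fixed_line B e <-> kron_subline (kdat a b c d) (cline e)"
  unfolding fixed_line_def tr[OF L] beta0_of_kron[OF nz, of c d, folded B_def] using c
  by cases (auto simp: kron_subline_kdat cline_eq_e m mulv_nth hol_def CS CS[unfolded One_nat_def] cline_e12_neq cline_e12_neq[symmetric])
 have "cline (hol a b t *v e) = cline e" if "kron_subline (kdat a b c d) (cline e)" for t
  using c that by cases (auto simp: kron_subline_kdat cline_eq_e mulv_nth hol_def stf_s0 cline_e12_neq cline_e12_neq[symmetric])
 thus "flat_line (fst B) e = II \<times> cline e" if "fixed_line B e"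
  using that tr unfolding f flat_line_def by auto
qed

lemma Times_fibre: "t : II ==> (II \<times> W) `` {t} = W" by auto

lemma degree_eq: "nahm_degree L r0 rL (II \<times> W) = kron_degree (rL - r0) W"
 using L_pos Times_fibre[of 0 W] Times_fibre[of L W] by (simp add: nahm_degree_def kron_degree_def right_diff_distrib)

lemma kron_subline_trivial: assumes "A : KD" "kron_subline A W" shows "xL - x0 = 0"
proof -
 obtain a b c d where A: "A = kdat a b c d" "a * d - b * c = \<i> * (xL - x0)" using KD_kdat[OF assms(1)] .
 hence "a * d - b * c = 0" using assms(2) by (auto simp: kron_subline_kdat)
 thus ?thesis using A(2) by simp
qed

lemma TN_eq: "TN = {of_kron (kdat a b c d) | a b c d.
  kdat a b c d : KD & a * b * l^2 : parab}"
 unfolding tilde_nahm_def family_orbits_kron family_cond_half_strip ..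

lemma TK_eq: "TK = {kdat a b c d | a b c d.
  kdat a b c d : KD & a * b * l^2 : parab}"
proof -
 have "RG L ` {of_kron (kdat a b c d) | a b c d. P a b c d} = {kdat a b c d | a b c d. P a b c d}" for P
  by (force simp: RG_of_kron image_iff)
 thus ?thesis unfolding tilde_kron_def TN_eq .
qed

lemma nahm_kron_correspondence: assumes "B : TN"
 shows "bij_betw (%W. II \<times> W) {W. kron_subline (RG L B) W} {V. nahm_subline L B V}"
  "kron_subline (RG L B) W ==> xL - x0 = 0"
  "nahm_semistable L r0 rL B <-> kron_semistable (rL - r0) (RG L B)"
  "nstable B <-> kstable (RG L B)"
  "nahm_polystable L r0 rL B <-> kron_polystable (rL - r0) (RG L B)"
proof -
 obtain a b c d where B: "B = of_kron (kdat a b c d)" "kdat a b c d : KD" "a * b * l^2 : parab"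
  using assms unfolding TN_eq by blast
 note nz = parab_S2[OF B(3)]
 define A where "A = kdat a b c d"
 have R: "RG L B = A" unfolding B(1) A_def by (rule RG_of_kron)
 have N: "B : ND" unfolding B(1) using of_kron_ND[OF B(2) nz] by blast
 note F = of_kron_fixed_line[OF nz, of _ c d, folded B(1) A_def]
 have c: "W : {cline e1, cline e2}" if "kron_subline A W" for W using that by (cases A) simp
 have sub: "nahm_subline L B V <-> (EX W. kron_subline A W & V = II \<times> W)" for V
 proof
  assume "nahm_subline L B V"
  then obtain e where e: "e : {e1, e2}" "V = flat_line (fst B) e" "fixed_line B e" unfolding nahm_subline_iff[OF N] by blast
  show "EX W. kron_subline A W & V = II \<times> W" using F[OF e(1)] e(2,3) by auto
 next
  assume "EX W. kron_subline A W & V = II \<times> W"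
  then obtain W where W: "kron_subline A W" "V = II \<times> W" by blast
  obtain e where e: "e : {e1, e2}" "W = cline e" using c[OF W(1)] by blast
  show "nahm_subline L B V" unfolding nahm_subline_iff[OF N] using F[OF e(1)] W e by (intro bexI[OF _ e(1)]) simp
 qed
 have "inj_on (%W. II \<times> W) X" for X :: "(complex^2) set set"
  by (rule inj_onI) (metis Times_fibre[of 0] L_pos atLeastAtMost_iff order_refl less_imp_le)
 thus "bij_betw (%W. II \<times> W) {W. kron_subline (RG L B) W} {V. nahm_subline L B V}"
  unfolding bij_betw_def R using sub by auto
 show "xL - x0 = 0" if "kron_subline (RG L B) W" using kron_subline_trivial[OF B(2)] that by (simp add: R A_def)
 show "nahm_semistable L r0 rL B <-> kron_semistable (rL - r0) (RG L B)"
  unfolding nahm_semistable_def kron_semistable_def sub R using degree_eq by metis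
 show st: "nstable B <-> kstable (RG L B)"
  unfolding nahm_stable_def kron_stable_def sub R using degree_eq by metis
 have "fixed_line B e & nahm_degree L r0 rL (flat_line (fst B) e) = 0 <-> kron_subline A (cline e) & kron_degree (rL - r0) (cline e) = 0"
  if "e : {e1, e2}" for e using F[OF that] by (auto simp: degree_eq)
 thus "nahm_polystable L r0 rL B <-> kron_polystable (rL - r0) (RG L B)"
  unfolding nahm_stab_iff(3)[OF N] kron_polystable_def st R by simp
qed

end


section \<open>Doubling formula and the branch of the square root\<close>

lemma stumpff_0_double: "stumpff 0 (4 * x) = (stumpff 0 x)\<^sup>2 + x * (stumpff 1 x)\<^sup>2"
proof -
 obtain w where w: "w\<^sup>2 = x" using square_root_exists by blast
 have "stumpff 0 ((2 * w)\<^sup>2) = (stumpff 0 (w^2))\<^sup>2 + (w * stumpff 1 (w^2))\<^sup>2"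
  unfolding stumpff_1 stumpff_0 by (rule cosh_double)
 thus ?thesis by (simp add: w power_mult_distrib)
qed

lemma csqrt_Re_pos: "z ~: \<real>\<^sub>\<le>\<^sub>0 ==> 0 < Re (csqrt z)"
proof -
 assume z: "z ~: \<real>\<^sub>\<le>\<^sub>0"
 have "Re (csqrt z) ~= 0"
 proof
  assume "Re (csqrt z) = 0"
  hence "csqrt z = \<i> * of_real (Im (csqrt z))" by (simp add: complex_eq_iff)
  hence "(csqrt z)\<^sup>2 = - of_real ((Im (csqrt z))\<^sup>2)" by (metis (no_types) i_times_eq_iff mult.commute of_real_power power2_eq_square power_mult_distrib square_eq_iff mult_minus1)
  hence "z = of_real (- (Im (csqrt z))\<^sup>2)" by simp
  thus False using z by (metis nonpos_Reals_of_real_iff neg_le_0_iff_le zero_le_power2)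
 qed
 thus ?thesis using Re_csqrt[of z] by simp
qed

lemma square_not_nonpos: "0 < Re z ==> z\<^sup>2 ~: \<real>\<^sub>\<le>\<^sub>0"
proof
 assume z: "0 < Re z" "z\<^sup>2 : \<real>\<^sub>\<le>\<^sub>0"
 hence "Re z * Im z = 0" "(Re z)\<^sup>2 - (Im z)\<^sup>2 <= 0"
  by (auto simp: complex_nonpos_Reals_iff power2_eq_square)
 thus False using z(1) by auto
qed

context nahm_params
begin

section \<open>Recovering the Kronheimer datum from a Nahm datum\<close>

definition holon :: "nahm => cmat" where "holon B = par (fst B) L"

text \<open>The product of the two diagonal entries is invariant under the torus at both ends. On
  constant normal forms it is cosh^2 (w L); on this domain it has a root in the right half plane,
  the image of \<open>parab\<close> under \<open>stumpff 0\<close>.\<close>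

definition rho_dom :: "nahm set" where
 "rho_dom = {B. holon B $ 1 $ 1 * holon B $ 2 $ 2 ~: \<real>\<^sub>\<le>\<^sub>0}"

text \<open>These functions solve M = diag(nu, 1/nu) \<open>hol a b l\<close> for nu, a and b:
  \<open>rho_C\<close> is the cosine in the right half plane, \<open>rho_nu\<close> the torus
  element acting at L, and \<open>rho_s\<close> the product a b.\<close>

definition rho_C :: "cmat => complex" where "rho_C M = csqrt (M $ 1 $ 1 * M $ 2 $ 2)"
definition rho_nu :: "cmat => complex" where "rho_nu M = M $ 1 $ 1 / rho_C M"
definition rho_s :: "cmat => complex" where "rho_s M = stumpff_inv (rho_C M) / l^2"
definition rho_a :: "cmat => complex" where "rho_a M = - M $ 1 $ 2 / (rho_nu M * stf 1 (rho_s M) l)"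
definition rho_b :: "cmat => complex" where "rho_b M = - M $ 2 $ 1 * rho_nu M / stf 1 (rho_s M) l"

definition rho :: "nahm => kron" where
 "rho B = (let M = holon B in
  kdat (rho_a M) (rho_b M)
   (l * snd B 0 $ 1 $ 2 - 2 * \<i> * rho_a M * ZZ (rho_s M))
   (l * snd B 0 $ 2 $ 1 + 2 * \<i> * rho_b M * ZZ (rho_s M)))"

lemma rho_M_basic: assumes M: "M $ 1 $ 1 * M $ 2 $ 2 ~: \<real>\<^sub>\<le>\<^sub>0"
 shows "0 < Re (rho_C M)" "(rho_C M)\<^sup>2 = M $ 1 $ 1 * M $ 2 $ 2" "rho_C M ~= 0" "rho_nu M ~= 0"
  "rho_s M * l^2 : parab" "stf 0 (rho_s M) l = rho_C M" "stf 1 (rho_s M) l ~= 0"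
proof -
 show C: "0 < Re (rho_C M)" unfolding rho_C_def by (rule csqrt_Re_pos[OF M(1)])
 show C2: "(rho_C M)\<^sup>2 = M $ 1 $ 1 * M $ 2 $ 2" by (simp add: rho_C_def)
 show Cnz: "rho_C M ~= 0" using C by auto
 have m11: "M $ 1 $ 1 ~= 0" "M $ 2 $ 2 ~= 0" using C2 Cnz by auto
 thus nu: "rho_nu M ~= 0" using Cnz by (simp add: rho_nu_def)
 have sl: "rho_s M * l^2 = stumpff_inv (rho_C M)" by (simp add: rho_s_def)
 thus reg: "rho_s M * l^2 : parab" using stumpff_inv_works(1)[OF C] by simp
 have "stumpff 0 (rho_s M * l^2) = rho_C M" unfolding sl by (rule stumpff_inv_works(2)[OF C])
 thus t0: "stf 0 (rho_s M) l = rho_C M" by (simp add: stf_def)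
 show t1: "stf 1 (rho_s M) l ~= 0" using stumpff_nonzero(2)[OF reg] by (simp add: stf_def)
qed

text \<open>Comparing the Pythagorean identity of the Stumpff functions with det M = 1 shows that
  the product of the recovered entries is indeed \<open>rho_s\<close>.\<close>

lemma rho_M: assumes M: "M $ 1 $ 1 * M $ 2 $ 2 ~: \<real>\<^sub>\<le>\<^sub>0" "det M = 1"
 shows "rho_a M * rho_b M = rho_s M" "hol (rho_a M) (rho_b M) l = adj2 (mat2 (rho_nu M) 0 0 (inverse (rho_nu M))) ** M"
proof -
 note C2 = rho_M_basic(2)[OF M(1)] and Cnz = rho_M_basic(3)[OF M(1)] and nu = rho_M_basic(4)[OF M(1)]
  and t0 = rho_M_basic(6)[OF M(1)] and t1 = rho_M_basic(7)[OF M(1)]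
 have "(stf 0 (rho_s M) l)\<^sup>2 - rho_s M * (stf 1 (rho_s M) l)\<^sup>2 = 1"
  using stumpff_pythagoras[of "rho_s M * l^2"] by (simp add: stf_def power_mult_distrib mult_ac)
 hence "rho_s M * (stf 1 (rho_s M) l)\<^sup>2 = M $ 1 $ 2 * M $ 2 $ 1"
  using M(2) unfolding t0 C2 det_cmat by (simp add: algebra_simps)
 thus ab: "rho_a M * rho_b M = rho_s M" using nu t1 by (simp add: rho_a_def rho_b_def field_simps power2_eq_square)
 have "M $ 1 $ 1 = rho_nu M * rho_C M" "M $ 2 $ 2 * rho_nu M = rho_C M"
  using Cnz C2 by (simp_all add: rho_nu_def field_simps power2_eq_square)
 thus "hol (rho_a M) (rho_b M) l = adj2 (mat2 (rho_nu M) 0 0 (inverse (rho_nu M))) ** M"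
  using nu t1 unfolding hol_def ab t0 by (simp add: cmat_simps rho_a_def rho_b_def field_simps)
qed

lemma ND_paths: "B : ND ==> fst B : PP & snd B : PP" using NDD(1,2)[of "fst B" "snd B"] by simp

lemma holon_det: "fst B : PP ==> det (holon B) = 1"
using holon_def L_pos pathsD par_det by auto

lemma holon_of_kron: "holon (of_kron (kdat a b c d)) = hol a b l"
 unfolding holon_def of_kron_kdat nahm_sol_def using L_pos by (simp add: par_const)

lemma rho_of_kron: assumes reg: "a * b * l^2 : parab"
 shows "of_kron (kdat a b c d) : rho_dom" "rho (of_kron (kdat a b c d)) = kdat a b c d"
proof -
 note nz = parab_S2[OF reg]
 define C where "C = stf 0 (a * b) l"
 have C: "C = stumpff 0 (a * b * l^2)" by (simp add: C_def stf_def)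
 have ReC: "0 < Re C" unfolding C by (rule stumpff_0_Re_pos[OF reg])
 have h: "hol a b l $ 1 $ 1 = C" "hol a b l $ 2 $ 2 = C" "hol a b l $ 1 $ 2 = - (stf 1 (a * b) l * a)"
  "hol a b l $ 2 $ 1 = - (stf 1 (a * b) l * b)" by (simp_all add: hol_def C_def)
 show "of_kron (kdat a b c d) : rho_dom" unfolding rho_dom_def mem_Collect_eq holon_of_kron h
  using square_not_nonpos[OF ReC] by (simp add: power2_eq_square)
 have rC: "rho_C (hol a b l) = C" unfolding rho_C_def h power2_eq_square[symmetric] by (rule csqrt_square) (use ReC in simp)
 have nu: "rho_nu (hol a b l) = 1" unfolding rho_nu_def rC h using ReC by auto
 have s: "rho_s (hol a b l) = a * b" unfolding rho_s_def rC C stumpff_inv_eq[OF reg] by simp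
 have S: "stf 1 (a * b) l ~= 0" using stumpff_nonzero(2)[OF reg] by (simp add: stf_def)
 have ra: "rho_a (hol a b l) = a" "rho_b (hol a b l) = b" unfolding rho_a_def rho_b_def s nu h using S by auto
 show "rho (of_kron (kdat a b c d)) = kdat a b c d" unfolding rho_def Let_def holon_of_kron ra s beta0_of_kron[OF nz] by simp
qed

text \<open>The constant solution with the recovered \<alpha> and the same \<beta> at 0 has the
  holonomy of \<open>B\<close> up to a torus element at L, which a gauge transformation starting at
  1 absorbs.\<close>

lemma rho_ND: assumes B: "B : ND" and dom: "B : rho_dom"
 obtains a b c d where "rho B = kdat a b c d" "a * b * l^2 : parab" "kdat a b c d : KD"
  "EX g:GG. g 0 = mat 1 & of_kron (kdat a b c d) = gact g B"
proof -
 obtain al be where B': "B = (al, be)" by (cases B)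
 note N = NDD[OF B[unfolded B']]
 define M where "M = holon B"
 have M: "M $ 1 $ 1 * M $ 2 $ 2 ~: \<real>\<^sub>\<le>\<^sub>0" "det M = 1"
  using dom holon_det ND_paths[OF B] by (auto simp: M_def rho_dom_def)
 note R = rho_M[OF M]
 define a b s w12 w21 where "a = rho_a M" and "b = rho_b M" and "s = rho_s M"
  and "w12 = be 0 $ 1 $ 2" and "w21 = be 0 $ 2 $ 1"
 have ab: "a * b = s" using R(1) by (simp add: a_def b_def s_def)
 have reg: "a * b * l^2 : parab" unfolding ab using rho_M_basic(5)[OF M(1)] by (simp add: s_def)
 note nz = parab_S2[OF reg]
 define h where "h = mat2 (rho_nu M) 0 0 (inverse (rho_nu M))"
 have h: "h : torus" using rho_M_basic(4)[OF M(1)] by (simp add: h_def torus_iff)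
 have hol: "hol a b l = adj2 h ** M" using R(2) by (simp add: a_def b_def h_def)
 have b0: "be 0 = mat2 (- \<i> * x0) w12 w21 (\<i> * x0)" by (simp add: cmat_iff w12_def w21_def N)
 have "be L = M ** be 0 ** adj2 M" using nahm_beta_par[OF B[unfolded B'] ends(2)] by (simp add: M_def holon_def B')
 hence "adj2 h ** be L ** h = (adj2 h ** M) ** be 0 ** adj2 (adj2 h ** M)" by (simp add: adj2_mult mat_ring)
 hence "hol a b l ** be 0 ** adj2 (hol a b l) = adj2 h ** be L ** h" by (simp add: hol)
 \<comment> \<open>The boundary condition on \<beta> at L, read off after transporting \<beta> from
   0, supplies the relation between a, b, w12 and w21.\<close>
 hence "(hol a b l ** be 0 ** adj2 (hol a b l)) $ 1 $ 1 = - \<i> * xL" by (simp add: torus_conj_diag[OF h] N)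
 moreover define C S where "C = stf 0 s l" and "S = stf 1 s l"
 have hCS: "hol a b l = mat2 C (- (S * a)) (- (S * b)) C" by (simp add: hol_def ab C_def S_def)
 ultimately have e: "- \<i> * x0 * (C^2 + S^2 * (a * b)) - S * C * (a * w21 - b * w12) = - \<i> * xL"
  unfolding b0 by (simp add: cmat_simps algebra_simps power2_eq_square)
 have C2: "stf 0 (4 * s) l = C^2 + S^2 * s"
  using stumpff_0_double[of "s * l^2"] by (simp add: C_def S_def stf_def power_mult_distrib mult_ac)
 have S2: "S2 s = C * S" by (simp add: S2_factor C_def S_def)
 have z10: "z1fun s 0 * S2 s = xL - x0 * (C^2 + S^2 * s)" using nz unfolding ab by (simp add: z1fun_def C2)
 have "S2 s * (a * w21 - b * w12) = \<i> * (z1fun s 0 * S2 s)"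
 proof -
  have "S * C * (a * w21 - b * w12) = \<i> * (xL - x0 * (C^2 + S^2 * s))"
   using e unfolding ab by (simp add: algebra_simps)
  thus ?thesis unfolding z10 unfolding S2 by (simp only: mult.commute[of C S])
 qed
 hence constr: "a * w21 - b * w12 = \<i> * z1fun (a * b) 0" using nz unfolding ab by simp
 define c d where "c = l * w12 - 2 * \<i> * a * ZZ s" and "d = l * w21 + 2 * \<i> * b * ZZ s"
 have rho: "rho B = kdat a b c d" unfolding rho_def M_def[symmetric]
  by (simp add: a_def b_def c_def d_def s_def w12_def w21_def B')
 have kd: "kdat a b c d : KD" using sol_constraint[OF nz constr] by (simp add: RG_nahm_sol c_def d_def ab)
 have ND: "of_kron (kdat a b c d) : ND" by (rule of_kron_ND(1)[OF kd nz])
 define al' be' where "al' = fst (of_kron (kdat a b c d))" and "be' = snd (of_kron (kdat a b c d))"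
 have B2: "of_kron (kdat a b c d) = (al', be')" by (simp add: al'_def be'_def)
 have "EX g:GG. g 0 = mat 1 & (al', be') = gact g (al, be)"
 proof (rule nahm_gauge_exists[OF B[unfolded B'] ND[unfolded B2] _ h])
  show "mat 1 : torus" by (simp add: torus_iff)
  have "par al' L = hol a b l" using holon_of_kron[of a b c d] by (simp add: holon_def al'_def)
  thus "par al' L = adj2 h ** par al L ** mat 1" unfolding hol by (simp add: M_def holon_def B')
  have "be' 0 = be 0" unfolding be'_def beta0_of_kron[OF nz] b0 by (simp add: c_def d_def ab)
  thus "be' 0 = adj2 (mat 1) ** be 0 ** mat 1" by simp
 qed
 thus ?thesis using that[OF rho reg kd] unfolding B2 B' by blast
qed

text \<open>The value of g at L only enters \<open>rho_nu\<close> and cancels in the recovered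
  entries; the value at 0 acts on them as the Kronheimer torus.\<close>

lemma rho_gauge: assumes g: "g : GG" and B: "fst B : PP" "snd B : PP"
 shows "gact g B : rho_dom <-> B : rho_dom" "rho (gact g B) = kron_act (g 0) (rho B)"
proof -
 obtain al be where B': "B = (al, be)" by (cases B)
 define M where "M = holon B"
 define p q where "p = g 0" and "q = g L"
 have p: "p : torus" and q: "q : torus" using ggD[OF g] by (auto simp: p_def q_def)
 have pq: "p $ 1 $ 1 * p $ 2 $ 2 = 1" "p $ 1 $ 2 = 0" "p $ 2 $ 1 = 0"
  "q $ 1 $ 1 * q $ 2 $ 2 = 1" "q $ 1 $ 2 = 0" "q $ 2 $ 1 = 0" using p q by (auto simp: torus_iff)
 have "holon (gact g B) = adj2 q ** M ** p"
  using par_gauge[OF g B(1) ends(2), of be] by (simp add: holon_def M_def p_def q_def B')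
 hence M': "holon (gact g B) $ 1 $ 1 = q $ 2 $ 2 * M $ 1 $ 1 * p $ 1 $ 1"
  "holon (gact g B) $ 2 $ 2 = q $ 1 $ 1 * M $ 2 $ 2 * p $ 2 $ 2"
  "holon (gact g B) $ 1 $ 2 = q $ 2 $ 2 * M $ 1 $ 2 * p $ 2 $ 2"
  "holon (gact g B) $ 2 $ 1 = q $ 1 $ 1 * M $ 2 $ 1 * p $ 1 $ 1" by (simp_all add: mult_nth pq)
 define M' where "M' = holon (gact g B)"
 note M' = M'[folded M'_def]
 have "M' $ 1 $ 1 * M' $ 2 $ 2 = (q $ 1 $ 1 * q $ 2 $ 2) * (p $ 1 $ 1 * p $ 2 $ 2) * (M $ 1 $ 1 * M $ 2 $ 2)"
  unfolding M' by simp
 hence mm: "M' $ 1 $ 1 * M' $ 2 $ 2 = M $ 1 $ 1 * M $ 2 $ 2" by (simp add: pq)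
 thus "gact g B : rho_dom <-> B : rho_dom" by (simp add: rho_dom_def M_def M'_def)
 have C: "rho_C M' = rho_C M" by (simp add: rho_C_def mm)
 have s: "rho_s M' = rho_s M" by (simp add: rho_s_def C)
 have nu: "rho_nu M' = q $ 2 $ 2 * p $ 1 $ 1 * rho_nu M" by (simp add: rho_nu_def C M')
 have nz: "p $ 1 $ 1 ~= 0" "p $ 2 $ 2 ~= 0" "q $ 1 $ 1 ~= 0" "q $ 2 $ 2 ~= 0" using pq by auto
 have inv: "inverse (p $ 1 $ 1) = p $ 2 $ 2" using pq(1) by (rule inverse_unique)
 have "rho_a M' = (p $ 2 $ 2 * inverse (p $ 1 $ 1)) * rho_a M"
  unfolding rho_a_def s nu M' using nz by (simp add: field_simps)
 hence a: "rho_a M' = rho_a M * (p $ 2 $ 2)\<^sup>2" unfolding inv by (simp add: power2_eq_square)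
 have "rho_b M' = (q $ 1 $ 1 * q $ 2 $ 2) * (rho_b M * (p $ 1 $ 1)\<^sup>2)"
  unfolding rho_b_def s nu M' by (simp add: power2_eq_square)
 hence b: "rho_b M' = rho_b M * (p $ 1 $ 1)\<^sup>2" by (simp add: pq)
 have "snd (gact g B) 0 = adj2 p ** snd B 0 ** p"
  unfolding B' gact_adj2[OF gg_det[OF g]] using ends by (simp add: on_I_eq p_def)
 hence w: "snd (gact g B) 0 $ 1 $ 2 = snd B 0 $ 1 $ 2 * (p $ 2 $ 2)\<^sup>2"
  "snd (gact g B) 0 $ 2 $ 1 = snd B 0 $ 2 $ 1 * (p $ 1 $ 1)\<^sup>2" by (simp_all add: torus_conj_diag[OF p])
 show "rho (gact g B) = kron_act (g 0) (rho B)"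
  unfolding rho_def Let_def M_def[symmetric] M'_def[symmetric] p_def[symmetric] kron_act_kdat[OF p] a b s w
  by (simp add: algebra_simps)
qed

lemma TKD: assumes "A : TK" shows "A : KD" "of_kron A : ND" "of_kron A : rho_dom"
  "rho (of_kron A) = A" "of_kron A : TN" "RG L (of_kron A) = A" "h : torus ==> kron_act h A : TK"
  "h : torus ==> of_kron (kron_act h A) = gact (%t. h) (of_kron A)"
proof -
 obtain a b c d where A: "A = kdat a b c d" "kdat a b c d : KD" "a * b * l^2 : parab"
  using assms unfolding TK_eq by blast
 show "A : KD" using A by simp
 show "of_kron A : ND" unfolding A(1) by (rule of_kron_ND(1)[OF A(2) parab_S2[OF A(3)]])
 show "of_kron A : rho_dom" "rho (of_kron A) = A" unfolding A(1) by (rule rho_of_kron[OF A(3)])+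
 show "of_kron A : TN" unfolding TN_eq using A by blast
 show "RG L (of_kron A) = A" unfolding A(1) by (rule RG_of_kron)
 assume h: "h : torus"
 show "of_kron (kron_act h A) = gact (%t. h) (of_kron A)" unfolding A(1) by (rule of_kron_equivariant[OF h])
 define m n where "m = (h $ 2 $ 2)\<^sup>2" and "n = (h $ 1 $ 1)\<^sup>2"
 have mn: "m * n = 1" using torus_units(1)[OF h] by (simp add: m_def n_def mult.commute)
 have "a * m * (d * n) - b * n * (c * m) = (m * n) * (a * d - b * c)" by (simp add: algebra_simps)
 hence "a * m * (d * n) - b * n * (c * m) = \<i> * (xL - x0)" using A(2) by (simp add: mn kdat_in_KD)
 moreover have "a * m * (b * n) = a * b" using mn by simp
 ultimately have "kdat (a * m) (b * n) (c * m) (d * n) : KD" "a * m * (b * n) * l^2 : parab"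
  using A(3) by (simp_all only: kdat_in_KD)
 thus "kron_act h A : TK" unfolding A(1) kron_act_kdat[OF h] m_def[symmetric] n_def[symmetric] TK_eq by blast
qed

lemma rho_TK: assumes "B : ND" "B : rho_dom" shows "rho B : TK" "orb (of_kron (rho B)) = orb B"
  "EX g:GG. of_kron (rho B) = gact g B"
proof -
 obtain a b c d where r: "rho B = kdat a b c d" "a * b * l^2 : parab" "kdat a b c d : KD"
  "EX g:GG. g 0 = mat 1 & of_kron (kdat a b c d) = gact g B" using rho_ND[OF assms] .
 show "rho B : TK" unfolding TK_eq using r by blast
 show "EX g:GG. of_kron (rho B) = gact g B" unfolding r(1) using r(4) by blast
 thus "orb (of_kron (rho B)) = orb B" using orb_gauge_act[OF _ assms(1)] by metis
qed

lemma nahm_kron_stab: assumes "A : TK" shows "nstable (of_kron A) <-> kstable A"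
  "nahm_polystable L r0 rL (of_kron A) <-> kron_polystable (rL - r0) A"
 using nahm_kron_correspondence(4,5) TKD(5,6)[OF assms] by metis+

lemma rho_stab: assumes "B : ND" "B : rho_dom" shows "nstable B <-> kstable (rho B)"
  "nahm_polystable L r0 rL B <-> kron_polystable (rL - r0) (rho B)"
proof -
 obtain g where "g : GG" "of_kron (rho B) = gact g B" using rho_TK(3)[OF assms] by blast
 thus "nstable B <-> kstable (rho B)"
  "nahm_polystable L r0 rL B <-> kron_polystable (rL - r0) (rho B)"
  using nahm_kron_stab[OF rho_TK(1)[OF assms]] nahm_stab_gauge[OF _ assms(1)] by metis+
qed

lemma torus_mat1: "mat 1 : torus" by (simp add: torus_iff)

lemma kron_orbit_self: "A : kron_data x ==> A : kron_orbit A"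
proof -
 assume "A : kron_data x"
 then obtain a b c d where A: "A = kdat a b c d" using KD_kdat by metis
 have "kron_act (mat 1) A = A" unfolding A kron_act_kdat[OF torus_mat1] by simp
 thus ?thesis using torus_mat1 unfolding kron_orbit_def by (metis imageI)
qed

lemma torus_mult: "h : torus ==> k : torus ==> h ** k : torus" by (simp add: torus_def det_mul mult_nth)

lemma torus_adj2: "h : torus ==> adj2 h : torus" by (simp add: torus_iff mult.commute)

lemma kron_act_mult: assumes "h : torus" "k : torus" shows "kron_act (h ** k) A = kron_act k (kron_act h A)"
 using assms by (cases A) (simp add: matrix_inv_eq_adj2 torus_det torus_mult adj2_mult mat_ring)

lemma kron_act_inv: assumes "h : torus"
 shows "kron_act (adj2 h) (kron_act h A) = A" "kron_act h (kron_act (adj2 h) A) = A" using assms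
 by (cases A; simp add: matrix_inv_eq_adj2 torus_det mat_ring adj2_cancel mult_adj2)+

lemma kron_orbit_act: assumes "h : torus" shows "kron_orbit (kron_act h A) = kron_orbit A"
proof (rule set_eqI, rule iffI)
 fix X assume "X : kron_orbit (kron_act h A)"
 then obtain k where k: "k : torus" "X = kron_act k (kron_act h A)" by (auto simp: kron_orbit_def)
 hence "X = kron_act (h ** k) A" using kron_act_mult[OF assms] by simp
 thus "X : kron_orbit A" using torus_mult[OF assms k(1)] by (auto simp: kron_orbit_def)
next
 fix X assume "X : kron_orbit A"
 then obtain k where k: "k : torus" "X = kron_act k A" by (auto simp: kron_orbit_def)
 hence "X = kron_act (adj2 h ** k) (kron_act h A)"
  using kron_act_mult[OF torus_adj2[OF assms] k(1)] kron_act_inv[OF assms] by simp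
 thus "X : kron_orbit (kron_act h A)" using torus_mult[OF torus_adj2[OF assms] k(1)] by (auto simp: kron_orbit_def)
qed

section \<open>The map of moduli spaces\<close>

definition mmap :: "kron set => nahm set" where
 "mmap X = orb (of_kron (SOME A. A : X))"

lemma mmap_orbit: assumes A: "A : TK" shows "mmap (kron_orbit A) = orb (of_kron A)"
proof -
 define A' where "A' = (SOME A'. A' : kron_orbit A)"
 have "A' : kron_orbit A" unfolding A'_def using kron_orbit_self[OF TKD(1)[OF A]] by (rule someI)
 then obtain h where h: "h : torus" "A' = kron_act h A" by (auto simp: kron_orbit_def)
 have "orb (of_kron A') = orb (of_kron A)" unfolding h(2) TKD(8)[OF A h(1)]
  by (rule orb_gauge_act[OF gg_const[OF h(1)] TKD(2)[OF A]])
 thus ?thesis by (simp add: mmap_def A'_def)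
qed

text \<open>Injectivity on orbits: \<open>rho\<close> recovers A from its Nahm datum and turns gauge
  transformations into torus elements.\<close>

lemma of_kron_orbit_eq: assumes "A : TK" "A' : TK"
 shows "orb (of_kron A) = orb (of_kron A') <-> kron_orbit A = kron_orbit A'"
proof
 assume "orb (of_kron A) = orb (of_kron A')"
 then obtain g where g: "g : GG" "of_kron A' = gact g (of_kron A)"
  using orb_eq_iff[OF TKD(2)[OF assms(1)] TKD(2)[OF assms(2)]] by blast
 have "A' = kron_act (g 0) A" using rho_gauge(2)[OF g(1), of "of_kron A"] ND_paths[OF TKD(2)[OF assms(1)]]
  by (simp add: g(2)[symmetric] TKD(4)[OF assms(1)] TKD(4)[OF assms(2)])
 thus "kron_orbit A = kron_orbit A'" using kron_orbit_act[OF ggD(3)[OF g(1)]] by simp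
next
 assume "kron_orbit A = kron_orbit A'"
 thus "orb (of_kron A) = orb (of_kron A')" using mmap_orbit assms by metis
qed

lemma rho_TN: assumes "B : TN" shows "B : ND" "B : rho_dom" "RG L B : TK" "of_kron (RG L B) = B"
  "rho B = RG L B"
proof -
 obtain a b c d where B: "B = of_kron (kdat a b c d)" "kdat a b c d : KD" "a * b * l^2 : parab"
  using assms unfolding TN_eq by blast
 have A: "kdat a b c d : TK" unfolding TK_eq using B by blast
 show "B : ND" "B : rho_dom" "RG L B : TK" "of_kron (RG L B) = B" "rho B = RG L B"
  using TKD[OF A] A unfolding B(1) by auto
qed

lemma tilde_ps_iff: "B : TN ==>
  B : TNP <-> RG L B : TKP"
 using rho_TN[of B] nahm_kron_correspondence(5)[of B] TKD(1)[of "RG L B"]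
 by (auto simp: tilde_nahm_ps_def tilde_kron_ps_def nahm_ps_def kron_ps_def)

lemma mmap_saturation: "mmap ` TKM = gauge_saturation L ` TNM" "inj_on (gauge_saturation L) TNM"
proof -
 have sat: "gauge_saturation L (nahm_torus_orbit L B) = orb B" if "B : ND" for B
 proof -
  have "orb X = orb B" if "X : nahm_torus_orbit L B" for X
   using that orb_gauge_act[OF gg_const `B \<in> ND`] by (auto simp: nahm_torus_orbit_def)
  moreover have "gact (%t. mat 1) B : nahm_torus_orbit L B" using torus_mat1 by (auto simp: nahm_torus_orbit_def)
  ultimately show ?thesis unfolding gauge_saturation_def by blast
 qed
 have tn: "B : TN" if "B : TNP" for B using that by (simp add: tilde_nahm_ps_def)
 have tk: "A : TK" if "A : TKP" for A using that by (simp add: tilde_kron_ps_def)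
 have im: "TKP = RG L ` TNP"
 proof (rule set_eqI, rule iffI)
  fix A assume A: "A : TKP"
  note T = TKD[OF tk[OF A]]
  have "of_kron A : TNP" using tilde_ps_iff[OF T(5)] T(6) A by simp
  thus "A : RG L ` TNP" using T(6) by (metis imageI)
 next
  fix A assume "A : RG L ` TNP"
  then obtain B where "B : TNP" "A = RG L B" by blast
  thus "A : TKP" using tilde_ps_iff[OF tn] by metis
 qed
 have mm: "mmap (kron_orbit (RG L B)) = orb B" if "B : TNP" for B
  using mmap_orbit[OF rho_TN(3)[OF tn[OF that]]] rho_TN(4)[OF tn[OF that]] by simp
 show "mmap ` TKM = gauge_saturation L ` TNM" unfolding tilde_kron_moduli_def tilde_nahm_moduli_def im image_image
  using mm sat rho_TN(1)[OF tn] by simp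
 show "inj_on (gauge_saturation L) TNM"
 proof (rule inj_onI)
  fix X Y assume XY: "X : TNM" "Y : TNM" "gauge_saturation L X = gauge_saturation L Y"
  then obtain B B' where B: "X = nahm_torus_orbit L B" "B : TN" "Y = nahm_torus_orbit L B'" "B' : TN"
   using tn by (auto simp: tilde_nahm_moduli_def)
  note R = rho_TN[OF B(2)] and R' = rho_TN[OF B(4)]
  have "orb B = orb B'" using XY(3) sat R(1) R'(1) by (simp add: B)
  hence "kron_orbit (RG L B) = kron_orbit (RG L B')" using of_kron_orbit_eq[OF R(3) R'(3)] R(4) R'(4) by simp
  moreover have "nahm_torus_orbit L (of_kron A) = of_kron ` kron_orbit A" if "A : TK" for A
   unfolding nahm_torus_orbit_def kron_orbit_def image_image using TKD(8)[OF that] by simp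
  ultimately show "X = Y" using R(3,4) R'(3,4) B(1,3) by metis
 qed
qed

end


section \<open>Coordinates and limits of Kronheimer and Nahm data\<close>

definition kdat' :: "complex \<times> complex \<times> complex \<times> complex => kron" where
 "kdat' = (%(a, b, c, d). kdat a b c d)"

definition kcoords :: "kron => complex \<times> complex \<times> complex \<times> complex" where
 "kcoords A = (fst A $ 1 $ 2, fst A $ 2 $ 1, snd A $ 1 $ 2, snd A $ 2 $ 1)"

lemma kcoords_kdat [simp]: "kcoords (kdat a b c d) = (a, b, c, d)" by (simp add: kcoords_def kdat_def)

lemma tendsto_mat2:
 assumes "(a ---> a') F" "(b ---> b') F" "(c ---> c') F" "(d ---> d') F"
 shows "((%i. mat2 (a i) (b i) (c i) (d i)) ---> mat2 a' b' c' d') F"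
proof (rule vec_tendstoI)
 fix i :: 2
 have *: "mat2 p q r s $ i = (\<chi> j. if i = 1 then (if j = 1 then p else q) else (if j = 1 then r else s))" for p q r s
 proof -
  have "mat2 p q r s $ i $ j = (if i = 1 then (if j = 1 then p else q) else (if j = 1 then r else s))" for j
   using exhaust_2[of i] exhaust_2[of j] by auto
  thus ?thesis by (simp add: vec_eq_iff)
 qed
 show "((%k. mat2 (a k) (b k) (c k) (d k) $ i) ---> mat2 a' b' c' d' $ i) F"
  unfolding * by (rule vec_tendstoI) (use assms in auto)
qed

lemma tendsto_kdat:
 assumes "(a ---> a') F" "(b ---> b') F" "(c ---> c') F" "(d ---> d') F"
 shows "((%i. kdat (a i) (b i) (c i) (d i)) ---> kdat a' b' c' d') F"
 unfolding kdat_def by (intro tendsto_Pair tendsto_mat2 tendsto_const assms)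

lemma tendsto_nth2: "(A ---> A') F ==> ((%i. A i $ p $ q) ---> A' $ p $ q) F"
 by (intro tendsto_vec_nth)

context interval
begin

lemma limitin_NS: "limitin NS r B F <->
  limitin (path_top L) (%i. fst (r i)) (fst B) F & limitin (path_top L) (%i. snd (r i)) (snd B) F"
 unfolding nahm_space_def limitin_pairwise by (simp add: o_def)

lemma tops_NS: "topspace NS = PP \<times> PP" by (simp add: nahm_space_def)

lemma par_lim: assumes "limitin (path_top L) al al0 F" "t : II"
 shows "((%i. par (al i) t) ---> par al0 t) F" and "uniform_limit II (%i. par (al i)) (par al0) F"
proof -
 note a = assms(1)[unfolded limitin_path_top]
 have a0: "cont II al0" using a path_smooth smooth_cont by blast
 show *: "uniform_limit II (%i. par (al i)) (par al0) F"
 proof (rule lode_lim[OF bil_mmult])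
  show "cont II (%t. - al0 t)" by (intro continuous_intros a0)
  show "uniform_limit II (%i t. - al i t) (%t. - al0 t) F" using a slimD(4) by (intro uniform_limit_uminus) blast
  show "uniform_limit II (%i t. 0::cmat) (%t. 0) F" by (rule uniform_limit_const)
  have "ev F (%i. al i : PP)" using a by blast
  thus "ev F (%i. ALL t:II. (par (al i) has_der (- al i t) ** par (al i) t + 0) t)"
  proof eventually_elim
   case (elim i)
   thus ?case using par_works(2)[OF smooth_cont[OF path_smooth]] by simp
  qed
  show "(par al0 has_der (- al0 t) ** par al0 t + 0) t" if "t : II" for t using par_works(2)[OF a0 that] by simp
  show "((%i. par (al i) 0) ---> par al0 0) F"
  proof (rule tendsto_eventually)
   show "ev F (%i. par (al i) 0 = par al0 0)" using `\<forall>\<^sub>F i in F. al i \<in> PP`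
    by eventually_elim (simp add: par_works(1)[OF a0] par_works(1)[OF smooth_cont[OF path_smooth]])
  qed
 qed
 show "((%i. par (al i) t) ---> par al0 t) F" by (rule tendsto_uniform_limitI[OF * assms(2)])
qed

lemma path_eval_lim: assumes "limitin (path_top L) be be0 F" "t : II"
 shows "((%i. be i t) ---> be0 t) F"
 using assms unfolding limitin_path_top by (intro tendsto_uniform_limitI[OF slimD(4)]) auto

end

context nahm_params
begin

section \<open>Continuity\<close>

lemma holon_lim: assumes "limitin NS r B F"
 shows "((%i. holon (r i)) ---> holon B) F" "((%i. snd (r i) 0) ---> snd B 0) F"
proof -
 note ends
 thus "((%i. holon (r i)) ---> holon B) F" "((%i. snd (r i) 0) ---> snd B 0) F"
  using assms par_lim(1) path_eval_lim unfolding limitin_NS holon_def by blast+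
qed

text \<open>\<open>rho\<close> factors through the pair of holonomy and initial value. Its
  continuity thereby splits into a statement about differential equations and one about finitely
  many complex variables.\<close>

definition rho_map :: "cmat \<times> cmat => kron" where
 "rho_map p = kdat (rho_a (fst p)) (rho_b (fst p))
   (l * snd p $ 1 $ 2 - 2 * \<i> * rho_a (fst p) * ZZ (rho_s (fst p)))
   (l * snd p $ 2 $ 1 + 2 * \<i> * rho_b (fst p) * ZZ (rho_s (fst p)))"

lemma rho_eq: "rho B = rho_map (holon B, snd B 0)" by (simp add: rho_def rho_map_def Let_def)

definition hol_dom :: "(cmat \<times> cmat) set" where
 "hol_dom = {p. fst p $ 1 $ 1 * fst p $ 2 $ 2 ~: \<real>\<^sub>\<le>\<^sub>0}"

lemma rho_dom_iff: "B : rho_dom <-> (holon B, snd B 0) : hol_dom"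
 by (simp add: rho_dom_def hol_dom_def)

lemma open_hol_dom: "open hol_dom"
proof -
 have *: "hol_dom = (%p. fst p $ 1 $ 1 * fst p $ 2 $ 2) -` (- \<real>\<^sub>\<le>\<^sub>0)" by (auto simp: hol_dom_def)
 show ?thesis unfolding * by (auto intro!: continuous_intros)
qed

lemma S2_holo: "S2 holomorphic_on A" unfolding S2_stumpff[abs_def] by (intro holomorphic_intros)

lemma S2_nz_open: "open {s. S2 s ~= 0}"
 by (intro open_Collect_neq holomorphic_on_imp_continuous_on S2_holo continuous_on_const)

lemma ZZ_holo: "ZZ holomorphic_on {s. S2 s ~= 0}" unfolding ZZ_def[abs_def] Z2fun_def stf_def
 by (intro holomorphic_intros S2_holo) auto

lemma rho_field_diff: assumes M: "!!i j. (%z. M z $ i $ j) fdiff (at z0)"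
  and dom: "M z0 $ 1 $ 1 * M z0 $ 2 $ 2 ~: \<real>\<^sub>\<le>\<^sub>0"
 shows "(%z. rho_a (M z)) fdiff (at z0)" "(%z. rho_b (M z)) fdiff (at z0)"
  "(%z. ZZ (rho_s (M z))) fdiff (at z0)"
proof -
 note b = rho_M_basic[OF dom]
 have "csqrt fdiff (at (M z0 $ 1 $ 1 * M z0 $ 2 $ 2))" by (rule field_differentiable_at_csqrt[OF dom])
 from field_differentiable_compose[OF field_differentiable_mult[OF M[of 1 1] M[of 2 2]] this]
 have C: "(%z. rho_C (M z)) fdiff (at z0)" by (simp add: rho_C_def o_def)
 have nu: "(%z. rho_nu (M z)) fdiff (at z0)"
  unfolding rho_nu_def by (rule field_differentiable_divide[OF M C b(3)])
 have "stumpff_inv fdiff (at (rho_C (M z0)))"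
  by (rule holomorphic_on_imp_differentiable_at[OF stumpff_inv_holo])
   (use b(1) in "auto intro: open_halfspace_Re_gt")
 from field_differentiable_compose[OF C this]
 have "(%z. stumpff_inv (rho_C (M z))) fdiff (at z0)" by (simp add: o_def)
 hence s: "(%z. rho_s (M z)) fdiff (at z0)"
  unfolding rho_s_def by (intro field_differentiable_divide) auto
 have "(%s. stf 1 s l) fdiff (at (rho_s (M z0)))" unfolding stf_def
  by (rule holomorphic_on_imp_differentiable_at[of _ UNIV]) (auto intro!: holomorphic_intros)
 from field_differentiable_compose[OF s this]
 have S: "(%z. stf 1 (rho_s (M z)) l) fdiff (at z0)" by (simp add: o_def)
 show "(%z. rho_a (M z)) fdiff (at z0)" unfolding rho_a_def
  by (intro field_differentiable_divide field_differentiable_minus field_differentiable_mult M nu S)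
   (use b in auto)
 show "(%z. rho_b (M z)) fdiff (at z0)" unfolding rho_b_def
  by (intro field_differentiable_divide field_differentiable_minus field_differentiable_mult M nu S)
   (use b in auto)
 have "S2 (rho_s (M z0)) ~= 0" by (rule parab_S2[OF b(5)])
 hence "ZZ fdiff (at (rho_s (M z0)))"
  by (intro holomorphic_on_imp_differentiable_at[OF ZZ_holo S2_nz_open]) simp
 from field_differentiable_compose[OF s this]
 show "(%z. ZZ (rho_s (M z))) fdiff (at z0)" by (simp add: o_def)
qed

lemma rho_map_cont: "cont hol_dom rho_map"
proof -
 define D where "D = {M :: cmat. M $ 1 $ 1 * M $ 2 $ 2 ~: \<real>\<^sub>\<le>\<^sub>0}"
 note b = rho_M_basic
 have csq: "cont D rho_C" unfolding rho_C_def[abs_def]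
 proof (rule continuous_on_compose2[of "- \<real>\<^sub>\<le>\<^sub>0" csqrt])
  show "cont (- \<real>\<^sub>\<le>\<^sub>0) csqrt" by (auto intro!: continuous_at_imp_continuous_on)
  show "cont D (%M. M $ 1 $ 1 * M $ 2 $ 2)" by (intro continuous_intros)
 qed (auto simp: D_def)
 have nu: "cont D rho_nu"
  unfolding rho_nu_def[abs_def] by (intro continuous_intros csq) (use b(3) in "auto simp: D_def")
 have "cont D (%M. stumpff_inv (rho_C M))"
  by (rule continuous_on_compose2[OF holomorphic_on_imp_continuous_on[OF stumpff_inv_holo] csq])
   (use b(1) in "auto simp: D_def")
 hence s: "cont D rho_s" unfolding rho_s_def[abs_def] by (intro continuous_intros) auto
 have "cont UNIV (%s. stf 1 s l)" unfolding stf_def by (intro holomorphic_on_imp_continuous_on holomorphic_intros)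
 from continuous_on_compose2[OF this s] have S: "cont D (%M. stf 1 (rho_s M) l)" by simp
 have ra: "cont D rho_a" unfolding rho_a_def[abs_def]
  by (intro continuous_intros S nu) (use b in "auto simp: D_def")
 have rb: "cont D rho_b" unfolding rho_b_def[abs_def]
  by (intro continuous_intros S nu) (use b in "auto simp: D_def")
 have Z: "cont D (%M. ZZ (rho_s M))"
  by (rule continuous_on_compose2[OF holomorphic_on_imp_continuous_on[OF ZZ_holo] s])
   (use b(5) parab_S2 in "auto simp: D_def")
 have fD: "fst ` hol_dom <= D" by (auto simp: hol_dom_def D_def)
 have c: "cont hol_dom (%p. f (fst p))" if "cont D f" for f :: "cmat => complex"
  by (rule continuous_on_compose2[OF that _ fD]) (intro continuous_intros)
 show ?thesis unfolding continuous_on_def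
 proof
  fix p assume p: "p : hol_dom"
  have t: "((%p. f (fst p)) ---> f (fst p)) (at p within hol_dom)" if "cont D f" for f :: "cmat => complex"
   using c[OF that] p by (auto simp: continuous_on_def)
  have n: "((%p. snd p $ i $ j) ---> snd p $ i $ j) (at p within hol_dom)" for i j by (intro tendsto_intros)
  show "(rho_map ---> rho_map p) (at p within hol_dom)" unfolding rho_map_def[abs_def]
   by (intro tendsto_kdat tendsto_add tendsto_diff tendsto_mult tendsto_const t[OF ra] t[OF rb] t[OF Z] n)
 qed
qed

lemma hol_map_cont: "continuous_map NS euclidean (%B. (holon B, snd B 0))" unfolding continuous_map_atin
proof
 fix B assume "B : topspace NS"
 hence "limitin NS (%x. x) B (atin NS B)"
  using continuous_map_id[of "NS"] unfolding continuous_map_atin by (simp add: id_def)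
 from holon_lim[OF this]
 show "limitin euclidean (%B. (holon B, snd B 0)) (holon B, snd B 0) (atin NS B)" by (simp add: tendsto_Pair)
qed

lemma openin_rho_vimage: assumes "open U" shows "openin NS {B : topspace NS. B : rho_dom & rho B : U}"
proof -
 have "open (hol_dom Int rho_map -` U)" by (rule continuous_open_preimage[OF rho_map_cont open_hol_dom assms])
 hence "openin NS {B : topspace NS. (holon B, snd B 0) : hol_dom Int rho_map -` U}"
  by (rule openin_continuous_map_preimage[OF hol_map_cont, unfolded open_openin[symmetric]])
 thus ?thesis by (simp add: rho_dom_iff rho_eq)
qed

lemma kron_entries_lim: assumes "(A ---> A0) F"
 shows "((%i. fst (A i) $ p $ q) ---> fst A0 $ p $ q) F" "((%i. snd (A i) $ p $ q) ---> snd A0 $ p $ q) F"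
 using tendsto_nth2[OF tendsto_fst[OF assms]] tendsto_nth2[OF tendsto_snd[OF assms]] by auto

definition good_kron :: "kron set" where
 "good_kron = {A : KD. S2 (fst A $ 1 $ 2 * fst A $ 2 $ 1) ~= 0}"

lemma kdat_in_good: "kdat a b c d : good_kron <-> kdat a b c d : KD & S2 (a * b) ~= 0"
 by (simp add: good_kron_def kdat_def)

lemma good_kron_kdat: assumes "A : good_kron"
 shows "A = kdat (fst A $ 1 $ 2) (fst A $ 2 $ 1) (snd A $ 1 $ 2) (snd A $ 2 $ 1)"
proof -
 obtain a b c d where "A = kdat a b c d" using assms KD_kdat unfolding good_kron_def by blast
 hence "kcoords A = (a, b, c, d)" by simp
 with `A = kdat a b c d` show ?thesis unfolding kcoords_def by simp
qed

lemma good_kron_nahm: assumes "A : good_kron"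
 defines "a == fst A $ 1 $ 2" and "b == fst A $ 2 $ 1" and "c == snd A $ 1 $ 2" and "d == snd A $ 2 $ 1"
 shows "of_kron A : ND" "fst (of_kron A) = onI (%t. fst A)"
  "snd (of_kron A) 0 = mat2 (- \<i> * x0) ((c + 2 * \<i> * a * ZZ (a * b)) / l) ((d - 2 * \<i> * b * ZZ (a * b)) / l) (\<i> * x0)"
  "t : II ==> (snd (of_kron A) has_der comm (- fst A) (snd (of_kron A) t)) t"
proof -
 have A: "A = kdat a b c d" unfolding a_def b_def c_def d_def by (rule good_kron_kdat[OF assms(1)])
 have g: "kdat a b c d : KD" "S2 (a * b) ~= 0" using assms(1) unfolding A kdat_in_good by auto
 show nd: "of_kron A : ND" unfolding A by (rule of_kron_ND(1)[OF g])
 show f: "fst (of_kron A) = onI (%t. fst A)" unfolding A of_kron_kdat nahm_sol_def by (simp add: kdat_def)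
 show "snd (of_kron A) 0 = mat2 (- \<i> * x0) ((c + 2 * \<i> * a * ZZ (a * b)) / l) ((d - 2 * \<i> * b * ZZ (a * b)) / l) (\<i> * x0)"
  unfolding A by (rule beta0_of_kron[OF g(2)])
 show "t : II ==> (snd (of_kron A) has_der comm (- fst A) (snd (of_kron A) t)) t"
  using NDD(9)[of "fst (of_kron A)" "snd (of_kron A)" x0 xL t, unfolded prod.collapse, OF nd]
  by (simp add: f on_I_eq comm_def mat_ring)
qed

lemma good_kron_eventually:
 assumes "(A ---> A0) F" "A0 : good_kron" "ev F (%i. A i : KD)"
 shows "ev F (%i. A i : good_kron)"
proof -
 have "((%i. fst (A i) $ 1 $ 2 * fst (A i) $ 2 $ 1) ---> fst A0 $ 1 $ 2 * fst A0 $ 2 $ 1) F"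
  by (intro tendsto_mult kron_entries_lim assms(1))
 moreover have "fst A0 $ 1 $ 2 * fst A0 $ 2 $ 1 : {s. S2 s ~= 0}" using assms(2) by (simp add: good_kron_def)
 ultimately have "ev F (%i. fst (A i) $ 1 $ 2 * fst (A i) $ 2 $ 1 : {s. S2 s ~= 0})"
  by (rule topological_tendstoD[OF _ S2_nz_open])
 with assms(3) show ?thesis by eventually_elim (simp add: good_kron_def)
qed

text \<open>Both components solve linear equations whose coefficients and initial values depend
  continuously on A, so \<open>lode_slim\<close> gives convergence of all derivatives.\<close>

lemma of_kron_lim: assumes A: "(A ---> A0) F" "A0 : good_kron" "ev F (%i. A i : KD)"
 shows "limitin NS (%i. of_kron (A i)) (of_kron A0) F"
proof -
 note ev = good_kron_eventually[OF A]
 note G0 = good_kron_nahm[OF A(2)]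
 have p: "fst (of_kron X) : PP & snd (of_kron X) : PP" if "X : good_kron" for X
  using ND_paths[OF good_kron_nahm(1)[OF that]] .
 have alq: "((%i. fst (A i)) ---> fst A0) F" by (intro tendsto_intros A(1))
 have "slim F (%i t. fst (A i)) (%t. fst A0)" by (rule slim_const[OF alq])
 moreover have "ev F (%i. ALL t:II. fst (of_kron (A i)) t = fst (A i))"
  using ev by eventually_elim (simp add: good_kron_nahm(2) on_I_eq)
 ultimately have 1: "slim F (%i. fst (of_kron (A i))) (fst (of_kron A0))"
  by (subst slim_cong[of _ "%i t. fst (A i)" F _ "%t. fst A0"]) (simp_all add: G0(2) on_I_eq)
 have 2: "slim F (%i. snd (of_kron (A i))) (snd (of_kron A0))"
 proof (rule lode_slim[OF bil_comm slim_const[OF tendsto_minus[OF alq]]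
    slim_const[OF tendsto_const[of 0]]])
  show "ev F (%i. ALL t:II. (snd (of_kron (A i)) has_der
    comm (- fst (A i)) (snd (of_kron (A i)) t) + 0) t)"
   using ev by eventually_elim (simp add: good_kron_nahm(4) del: atLeastAtMost_iff)
  show "(snd (of_kron A0) has_der comm (- fst A0) (snd (of_kron A0) t) + 0) t"
   if "t : II" for t using G0(4)[OF that] by simp
  define s where "s = (%X::kron. fst X $ 1 $ 2 * fst X $ 2 $ 1)"
  have s: "((%i. s (A i)) ---> s A0) F" unfolding s_def by (intro tendsto_mult kron_entries_lim A(1))
  have "isCont ZZ (s A0)"
   using holomorphic_on_imp_continuous_on[OF ZZ_holo] continuous_on_eq_continuous_at[OF S2_nz_open] A(2)
   by (auto simp: good_kron_def s_def)
  hence Z: "((%i. ZZ (s (A i))) ---> ZZ (s A0)) F" by (rule isCont_tendsto_compose[OF _ s])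
  define f where "f = (%X::kron. mat2 (- \<i> * x0) ((snd X $ 1 $ 2 + 2 * \<i> * fst X $ 1 $ 2 * ZZ (s X)) / l)
   ((snd X $ 2 $ 1 - 2 * \<i> * fst X $ 2 $ 1 * ZZ (s X)) / l) (\<i> * x0))"
  have "((%i. f (A i)) ---> f A0) F" unfolding f_def by (intro tendsto_mat2 tendsto_intros A(1) Z) auto
  moreover have "ev F (%i. snd (of_kron (A i)) 0 = f (A i))"
   using ev by eventually_elim (simp add: good_kron_nahm(3) f_def s_def)
  moreover have "snd (of_kron A0) 0 = f A0" by (simp add: G0(3) f_def s_def)
  ultimately show "((%i. snd (of_kron (A i)) 0) ---> snd (of_kron A0) 0) F"
   using tendsto_cong[of "%i. snd (of_kron (A i)) 0" "%i. f (A i)" F "f A0"] by metis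
 qed
 have "ev F (%i. fst (of_kron (A i)) : PP)" "ev F (%i. snd (of_kron (A i)) : PP)"
  using ev by (eventually_elim, use p in blast)+
 thus ?thesis unfolding limitin_NS limitin_path_top using 1 2 p[OF A(2)] by blast
qed

lemma TK_iff: "A : TK <-> A : KD & fst A $ 1 $ 2 * fst A $ 2 $ 1 * l^2 : parab"
proof
 assume "A : TK"
 thus "A : KD & fst A $ 1 $ 2 * fst A $ 2 $ 1 * l^2 : parab" unfolding TK_eq by (auto simp: kdat_def)
next
 assume *: "A : KD & fst A $ 1 $ 2 * fst A $ 2 $ 1 * l^2 : parab"
 then obtain a b c d where A: "A = kdat a b c d" using KD_kdat by metis
 show "A : TK" using * unfolding A TK_eq by (auto simp: kdat_def)
qed

lemma TK_good: "A : TK ==> A : good_kron" unfolding TK_iff good_kron_def using parab_S2 by auto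

definition treg :: "kron set" where
 "treg = {A. fst A $ 1 $ 2 * fst A $ 2 $ 1 * l^2 : parab}"

lemma open_treg: "open treg"
proof -
 have *: "treg = (%A. fst A $ 1 $ 2 * fst A $ 2 $ 1 * l^2) -` parab" by (auto simp: treg_def)
 show ?thesis unfolding * by (rule open_vimage[OF open_parab]) (intro continuous_intros)
qed

lemma TK_Int: "TK = KD Int treg" by (auto simp: TK_iff treg_def)

end


section \<open>Quotient topologies and the topological embedding\<close>

lemma tops_quot_top [simp]: "topspace (quot_top X q) = q ` topspace X"
proof
 show "topspace (quot_top X q) <= q ` topspace X"
  using openin_topspace[of "quot_top X q"] unfolding openin_quot_top by blast
 have "{x : topspace X. q x : q ` topspace X} = topspace X" by blast
 hence "openin (quot_top X q) (q ` topspace X)" by (simp add: openin_quot_top)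
 thus "q ` topspace X <= topspace (quot_top X q)" by (rule openin_subset)
qed

lemma atin_self_limit: assumes "x : topspace X" shows "limitin X (%x. x) x (atin X x)"
 using continuous_map_id[of X] assms unfolding continuous_map_atin by (simp add: id_def)

context nahm_params
begin

lemma nahm_ps_subset: "NPS \<subseteq> topspace NS" using ND_paths unfolding nahm_ps_def tops_NS by auto

lemma tops_nahm_moduli_top [simp]: "topspace NMT = orb ` NPS"
 using nahm_ps_subset by (simp add: nahm_moduli_top_def Int_absorb1)

lemma tops_kron_moduli_top [simp]: "topspace (kron_moduli_top r x) = kron_orbit ` kron_ps r x"
 by (simp add: kron_moduli_top_def)

lemma openin_kron_moduli_top: "openin (kron_moduli_top r x) U <->
  U <= kron_orbit ` kron_ps r x & openin (top_of_set (kron_ps r x)) {A : kron_ps r x. kron_orbit A : U}"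
 by (simp add: kron_moduli_top_def openin_quot_top)

lemma openin_nahm_moduli_top: "openin NMT U <->
  U <= orb ` NPS &
  openin (subtopology NS NPS) {B : NPS. orb B : U}"
 using nahm_ps_subset by (simp add: nahm_moduli_top_def openin_quot_top Int_absorb1)

lemma TK_ps_iff: "A : TKP <-> A : KPS & A : treg"
 unfolding tilde_kron_ps_def TK_Int by (auto simp: kron_ps_def)

lemma TK_psD: assumes "A : TKP" shows "A : TK" "A : KD" "kron_polystable (rL - r0) A"
 using assms unfolding tilde_kron_ps_def kron_ps_def by auto

lemma kron_orbit_in_tilde: assumes "A : KD" shows "kron_orbit A : kron_orbit ` TK <-> A : treg"
proof
 assume "kron_orbit A : kron_orbit ` TK"
 then obtain A' where A': "A' : TK" "kron_orbit A = kron_orbit A'" by blast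
 hence "A : kron_orbit A'" using kron_orbit_self[OF assms] by simp
 then obtain h where "h : torus" "A = kron_act h A'" unfolding kron_orbit_def by blast
 hence "A : TK" using TKD(7)[OF A'(1)] by simp
 thus "A : treg" unfolding TK_Int by blast
qed (use assms in "auto simp: TK_Int")

lemma kron_orbit_tilde_iff: assumes "A : KPS" shows "kron_orbit A : TKM <-> A : treg"
proof
 assume "kron_orbit A : TKM"
 hence "kron_orbit A : kron_orbit ` TK" unfolding tilde_kron_moduli_def using TK_psD(1) by blast
 thus "A : treg" using kron_orbit_in_tilde assms by (simp add: kron_ps_def)
next
 assume "A : treg"
 thus "kron_orbit A : TKM" unfolding tilde_kron_moduli_def using assms TK_ps_iff by blast
qed

lemma TK_moduli_open: "openin KMT TKM"
proof -
 have "{A : KPS. kron_orbit A : TKM} =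
   KPS Int treg"
  using kron_orbit_tilde_iff by blast
 moreover have "TKM <= kron_orbit ` KPS" unfolding tilde_kron_moduli_def tilde_kron_ps_def by blast
 ultimately show ?thesis unfolding openin_kron_moduli_top using openin_open_Int[OF open_treg] by simp
qed

lemma of_kron_ps: assumes "A : TKP" shows "of_kron A : NPS" using TKD(2)[OF TK_psD(1)[OF assms]] TK_psD(3)[OF assms]
  nahm_kron_stab(2)[OF TK_psD(1)[OF assms]] unfolding nahm_ps_def by blast

lemma of_kron_cont: "continuous_map (top_of_set TKP)
  (subtopology NS NPS) of_kron"
proof -
 have "continuous_map (top_of_set TKP) NS of_kron" unfolding continuous_map_atin
 proof
  fix A assume "A : topspace (top_of_set TKP)"
  hence A: "A : TKP" by simp
  let ?F = "atin (top_of_set TKP) A"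
  have "limitin (top_of_set TKP) (%x. x) A ?F" by (rule atin_self_limit) (use A in simp)
  hence 1: "((%x. x) ---> A) ?F" "ev ?F (%x. x : TKP)"
   unfolding limitin_subtopology by auto
  have 2: "ev ?F (%x. x : KD)" using 1(2) by eventually_elim (rule TK_psD(2))
  show "limitin NS of_kron (of_kron A) ?F" by (rule of_kron_lim[OF 1(1) TK_good[OF TK_psD(1)[OF A]] 2])
 qed
 thus ?thesis by (rule continuous_map_into_subtopology) (use of_kron_ps in auto)
qed

lemma mmap_vimage: assumes "A : TKP" shows "mmap (kron_orbit A) = orb (of_kron A)"
 by (rule mmap_orbit[OF TK_psD(1)[OF assms]])

text \<open>Describes the preimage of an image set in the space of data through \<open>rho\<close>;
  this is how openness is tested in the quotient topology.\<close>

lemma orb_moduli_iff: assumes B: "B : NPS" and S: "S <= TKM"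
 shows "orb B : mmap ` S <-> B : rho_dom & kron_orbit (rho B) : S"
proof
 have Bd: "B : ND" "nahm_polystable L r0 rL B" using B unfolding nahm_ps_def by auto
 assume "orb B : mmap ` S" obtain A where A: "A : TKP" "kron_orbit A : S" "orb B = orb (of_kron A)"
 proof -
  obtain p where p: "p : S" "orb B = mmap p" using \<open>orb B \<in> mmap ` S\<close> by blast
  obtain A where A: "A : TKP" "p = kron_orbit A" using p(1) S unfolding tilde_kron_moduli_def by blast
  show ?thesis by (rule that[OF A(1)]) (use p A(2) mmap_vimage[OF A(1)] in simp_all)
 qed
 note T = TKD[OF TK_psD(1)[OF A(1)]]
 obtain g where g: "g : GG" "B = gact g (of_kron A)" using A(3) orb_eq_iff[OF T(2) Bd(1)] by auto
 have "B : rho_dom" "rho B = kron_act (g 0) A" using rho_gauge[OF g(1)] ND_paths[OF T(2)] T(3,4) g(2) by auto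
 thus "B : rho_dom & kron_orbit (rho B) : S" using kron_orbit_act[OF ggD(3)[OF g(1)]] A(2) by simp
next
 have Bd: "B : ND" "nahm_polystable L r0 rL B" using B unfolding nahm_ps_def by auto
 assume R: "B : rho_dom & kron_orbit (rho B) : S"
 note T = rho_TK[OF Bd(1) conjunct1[OF R]]
 have "mmap (kron_orbit (rho B)) = orb B" using mmap_orbit[OF T(1)] T(2) by simp
 thus "orb B : mmap ` S" using R by auto
qed

text \<open>Both directions are lifted to the spaces of data: continuity uses the section
  \<open>of_kron\<close>, and openness uses preimages under the continuous map
  \<open>rho\<close>.\<close>

lemma mmap_embedding: "embedding_map (subtopology KMT TKM)
  NMT mmap"
 "open_map (subtopology KMT TKM)
  NMT mmap"
 "topspace (subtopology KMT TKM) =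
  TKM"
proof -
 let ?T = "TKM" and ?K = "KPS" and ?N = "NPS" and ?TK = "TKP"
 let ?X = "subtopology KMT ?T"
 have Tsub: "?T <= kron_orbit ` ?K" unfolding tilde_kron_moduli_def tilde_kron_ps_def by blast
 show X: "topspace ?X = ?T" using Tsub by auto
 have TKo: "openin (top_of_set ?K) ?TK"
 proof -
  have "?TK = ?K Int treg" using TK_ps_iff by blast
  thus ?thesis using openin_open_Int[OF open_treg] by simp
 qed
 have "continuous_map ?X NMT mmap" unfolding continuous_map_def
 proof (intro conjI allI impI)
  show "mmap : topspace ?X \<rightarrow> topspace NMT"
   unfolding tilde_kron_moduli_def by (auto simp: mmap_vimage intro: of_kron_ps)
  fix V assume "openin NMT V"
  hence "openin (subtopology NS ?N) {B : ?N. orb B : V}" unfolding openin_nahm_moduli_top by blast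
  from openin_continuous_map_preimage[OF of_kron_cont this]
  have "openin (top_of_set ?TK) {A : topspace (top_of_set ?TK). of_kron A : {B : ?N. orb B : V}}" .
  moreover have "{A : topspace (top_of_set ?TK). of_kron A : {B : ?N. orb B : V}} =
    {A : ?K. kron_orbit A : {p : topspace ?X. mmap p : V}}" using kron_orbit_tilde_iff TK_ps_iff mmap_vimage of_kron_ps by auto
  ultimately have "openin (top_of_set ?K) {A : ?K. kron_orbit A : {p : topspace ?X. mmap p : V}}"
   using openin_trans[OF _ TKo] by simp
  hence "openin KMT {p : topspace ?X. mmap p : V}" unfolding openin_kron_moduli_top X using Tsub by blast
  thus "openin ?X {p : topspace ?X. mmap p : V}" unfolding openin_open_subtopology[OF TK_moduli_open] X by blast
 qed
 moreover show op: "open_map ?X NMT mmap" unfolding open_map_def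
 proof (intro allI impI)
  fix S assume "openin ?X S"
  hence S: "openin KMT S" "S <= ?T" unfolding openin_open_subtopology[OF TK_moduli_open] by auto
  hence "openin (top_of_set ?K) {A : ?K. kron_orbit A : S}" unfolding openin_kron_moduli_top by blast
  then obtain Q where Q: "open Q" "{A : ?K. kron_orbit A : S} = ?K Int Q" unfolding openin_open by blast
  have "{B : ?N. orb B : mmap ` S} =
    {B : topspace NS. B : rho_dom & rho B : Q} Int ?N"
  proof -
   have "kron_orbit (rho B) : S <-> rho B : Q" if B: "B : ?N" "B : rho_dom" for B
   using B(1) nahm_ps_def TKD(1) rho_TK(1) B(2) rho_stab(2) kron_ps_def Q(2) by blast
   thus ?thesis using orb_moduli_iff[OF _ S(2)] nahm_ps_subset by blast
  qed
  hence "openin (subtopology NS ?N) {B : ?N. orb B : mmap ` S}"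
   unfolding openin_subtopology using openin_rho_vimage[OF Q(1)] by blast
  moreover have "mmap ` S <= orb ` ?N" using S(2) tilde_kron_moduli_def mmap_vimage of_kron_ps by auto
  ultimately show "openin NMT (mmap ` S)" unfolding openin_nahm_moduli_top by blast
 qed
 moreover have "inj_on mmap (topspace ?X)" unfolding X
 proof (rule inj_onI)
  fix p q assume "p : ?T" "q : ?T" "mmap p = mmap q"
  then obtain A A' where A: "A : ?TK" "A' : ?TK" "p = kron_orbit A" "q = kron_orbit A'"
   unfolding tilde_kron_moduli_def by blast
  thus "p = q" using `mmap p = mmap q` of_kron_orbit_eq[OF TK_psD(1)[OF A(1)] TK_psD(1)[OF A(2)]]
   by (simp add: mmap_vimage)
 qed
 ultimately show "embedding_map ?X NMT mmap" by (intro injective_open_imp_embedding_map)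
qed

end


section \<open>Holomorphic functions along curves\<close>

text \<open>Turns a uniform bound on a disc into a bound linear in \<open>h\<close>, which is what a
  difference quotient requires.\<close>

lemma Schwarz_scaled: assumes d: "d holomorphic_on ball 0 R" "0 < R" "0 < ep" "d 0 = 0"
  and b: "!!z. norm z < R ==> norm (d z) < ep" and h: "norm h < R" shows "norm (d h) <= ep * norm h / R"
proof -
 define f where "f = (%w. d (of_real R * w) / of_real ep)"
 have "norm (f (h / of_real R)) <= norm (h / of_real R)"
 proof (rule Schwarz_Lemma(1))
  have "(%w. d (of_real R * w)) holomorphic_on ball 0 1"
   by (rule holomorphic_on_compose_gen[of "%w. of_real R * w" _ d "ball 0 R", unfolded o_def])
    (use d in "auto simp: norm_mult")
  thus "f holomorphic_on ball 0 1" unfolding f_def by (intro holomorphic_intros) auto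
  show "norm (f z) < 1" if "norm z < 1" for z
   using b[of "of_real R * z"] that d(2,3) by (simp add: f_def norm_mult norm_divide)
 qed (use d h in "auto simp: f_def norm_divide")
 thus ?thesis using d(2,3) by (simp add: f_def norm_divide field_simps)
qed

text \<open>Chain rule along p + (z - z0) r(z) with r(z) tending to v. Along the fixed direction v
  the derivative exists by assumption. Replacing v by r(z) changes the function by something
  holomorphic in the step h that vanishes at h = 0 and is uniformly small on a disc, so by the
  Schwarz lemma the change in the difference quotient tends to 0.\<close>

lemma amb_holo_crv:
 fixes G :: "'e => complex" and c r :: "complex => 'e" assumes G: "ambient_holomorphic T lin Om G" and p: "p : Om"
  and lin0: "!!u. u : topspace T ==> lin p 0 u = p"
  and cont: "continuous_map (prod_topology euclidean T) T (%q. lin p (fst q) (snd q))" and r: "limitin T r v (at z0)"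
  and c: "c z0 = p" "ev (at z0) (%z. c z = lin p (z - z0) (r z))"
 shows "(%z. G (c z)) fdiff (at z0)"
proof -
 have v: "v : topspace T" using r by (rule limitin_topspace)
 note G' = G[unfolded ambient_holomorphic_def]
 define M where "M = {q : topspace (prod_topology euclidean T). lin p (fst q) (snd q) : Om}"
 have "openin (prod_topology euclidean T) M"
  unfolding M_def by (rule openin_continuous_map_preimage[OF cont]) (use G' in blast)
 moreover have "(0, v) : M" using v p lin0 by (simp add: M_def)
 ultimately obtain U V where UV: "open U" "openin T V" "0 : U" "v : V" "U \<times> V <= M"
  unfolding openin_prod_topology_alt by (metis open_openin)
 obtain R where R: "0 < R" "cball 0 R <= U" using open_contains_cball UV(1,3) by blast
 have Vs: "V <= topspace T" using UV(2) openin_subset by blast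
 have hol: "(%h. G (lin p h u)) holomorphic_on U" if "u : V" for u
 proof -
  have "(%h. G (lin p h u)) holomorphic_on {z. lin p z u : Om}" using G' p that Vs by blast
  moreover have "U <= {z. lin p z u : Om}" using UV(5) that by (auto simp: M_def)
  ultimately show ?thesis by auto
 qed
 define g where "g = (%h. G (lin p h v))"
 let ?P = "prod_topology (top_of_set U) (subtopology T V)"
 have P: "?P = subtopology (prod_topology euclidean T) (U \<times> V)" by (simp add: subtopology_Times)
 have "continuous_map ?P (subtopology T Om) (%q. lin p (fst q) (snd q))" unfolding P using UV(5)
  by (intro continuous_map_into_subtopology continuous_map_from_subtopology cont) (auto simp: M_def)
 from continuous_map_compose[OF this, of euclidean G]
 have c1: "continuous_map ?P euclidean (%q. G (lin p (fst q) (snd q)))" using G' by (simp add: o_def)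
 have "continuous_map (top_of_set U) euclidean g"
  using holomorphic_on_imp_continuous_on[OF hol[OF UV(4)]] by (simp add: g_def)
 from continuous_map_compose[OF continuous_map_fst this, of "subtopology T V"]
 have c2: "continuous_map ?P euclidean (%q. g (fst q))" by (simp add: o_def)
 have c3: "continuous_map ?P euclidean (%q. G (lin p (fst q) (snd q)) - g (fst q))" by (rule continuous_map_diff[OF c1 c2])
 have *: "ev (at z0) (%z. norm ((G (c z) - G p) / (z - z0) - (g (z - z0) - G p) / (z - z0)) <= ep / R)"
  if ep: "0 < ep" for ep
 proof -
  define W where "W = {q : topspace ?P. G (lin p (fst q) (snd q)) - g (fst q) : ball 0 ep}"
  have "openin ?P W" unfolding W_def by (rule openin_continuous_map_preimage[OF c3]) simp
  moreover have "compactin (top_of_set U) (cball 0 R)" using R by (simp add: compactin_subtopology)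
  moreover have "v : topspace (subtopology T V)" using v UV(4) by simp
  moreover have "cball 0 R \<times> {v} <= W" using R v UV(4) ep by (auto simp: W_def g_def)
  \<comment> \<open>Compactness of the closed disc makes the bound uniform in the step for all
    directions near \<open>v\<close>.\<close>
  ultimately obtain U' V' where V': "openin (subtopology T V) V'" "cball 0 R <= U'" "v : V'" "U' \<times> V' <= W"
   using tube_lemma_left by metis
  have "openin T V'" using V'(1) openin_open_subtopology[OF UV(2)] by blast
  hence "ev (at z0) (%z. r z : V')" using r V'(3) unfolding limitin_def by blast
  moreover have "ev (at z0) (%z. dist z z0 < R & z ~= z0)" using R(1) by (auto simp: eventually_at)
  ultimately show ?thesis using c(2)
  proof eventually_elim
   case (elim z)
   define h where "h = z - z0"
   have V: "V' <= V" using V'(1) openin_subset[of "subtopology T V"] by force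
   have h: "norm h < R" "h ~= 0" using elim by (auto simp: h_def dist_norm)
   have bd: "norm (G (lin p k (r z)) - g k) <= ep * norm k / R" if k: "norm k < R" for k
   proof (rule Schwarz_scaled[of _ R ep])
    show "(%k. G (lin p k (r z)) - g k) holomorphic_on ball 0 R" unfolding g_def
     by (intro holomorphic_on_diff holomorphic_on_subset[OF hol[OF subsetD[OF V elim(1)]]] holomorphic_on_subset[OF hol[OF UV(4)]])
      (use R ball_subset_cball in blast)+
    show "G (lin p 0 (r z)) - g 0 = 0" using lin0[OF v] lin0[of "r z"] elim(1) V Vs by (auto simp: g_def)
    show "norm (G (lin p w (r z)) - g w) < ep" if "norm w < R" for w
    proof -
     have "w : cball 0 R" using that by simp
     hence "(w, r z) : W" using V'(2,4) elim(1) by blast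
     thus ?thesis by (simp add: W_def)
    qed
   qed (use R ep k in auto)
   have "(G (c z) - G p) / h - (g h - G p) / h = (G (lin p h (r z)) - g h) / h"
    using elim(3) by (simp add: h_def diff_divide_distrib)
   hence "norm ((G (c z) - G p) / h - (g h - G p) / h) = norm (G (lin p h (r z)) - g h) / norm h"
    by (simp add: norm_divide)
   also have "\<dots> <= (ep * norm h / R) / norm h" by (intro divide_right_mono bd h) simp
   also have "\<dots> = ep / R" using h by simp
   finally show ?case by (simp add: h_def)
  qed
 qed
 have "((%z. (G (c z) - G p) / (z - z0) - (g (z - z0) - G p) / (z - z0)) ---> 0) (at z0)"
 proof (rule tendstoI)
  fix e :: real assume "0 < e"
  hence "0 < R * (e / 2)" using R by simp
  from *[OF this] show "ev (at z0) (%z. dist ((G (c z) - G p) / (z - z0) - (g (z - z0) - G p) / (z - z0)) 0 < e)"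
   by eventually_elim (use R `0 < e` in simp)
 qed
 moreover have "((%z. (g (z - z0) - G p) / (z - z0)) ---> deriv g 0) (at z0)"
 proof -
  have "(DERIV g 0 :> deriv g 0)" unfolding g_def by (rule holomorphic_derivI[OF hol[OF UV(4)] UV(1,3)])
  hence "((%h. (g h - g 0) / h) ---> deriv g 0) (at 0)" by (simp add: has_field_derivative_iff)
  moreover have "g 0 = G p" using lin0[OF v] by (simp add: g_def)
  ultimately show ?thesis by (subst LIM_offset_zero_iff) simp_all
 qed
 ultimately have "((%z. (G (c z) - G p) / (z - z0)) ---> deriv g 0) (at z0)" using tendsto_add by fastforce
 thus ?thesis unfolding field_differentiable_def has_field_derivative_iff using c(1) by blast
qed

lemma kron_line_simps: "fst (kron_line p h u) = fst p + cscale h (fst u)" "snd (kron_line p h u) = snd p + cscale h (snd u)"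
 by (cases p; cases u; simp)+

lemma nahm_line_simps: "fst (nahm_line p h u) = (%t. fst p t + cscale h (fst u t))"
 "snd (nahm_line p h u) = (%t. snd p t + cscale h (snd u t))" by (cases p; cases u; simp)+

lemma kron_line_cont: "cont UNIV (%q. kron_line p (fst q) (snd q))"
proof -
 have *: "(%q. kron_line p (fst q) (snd q)) =
   (%q. (fst p + cscale (fst q) (fst (snd q)), snd p + cscale (fst q) (snd (snd q))))"
  by (simp add: fun_eq_iff prod_eq_iff kron_line_simps)
 show ?thesis unfolding * by (intro continuous_intros bounded_bilinear.continuous_on[OF bil_cscale])
qed

lemma amb_holo_kron_crv: assumes G: "ambient_holomorphic euclidean kron_line Om G" and p: "c z0 : Om"
  and d: "!!i j. (%z. fst (c z) $ i $ j) fdiff (at z0)"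
  "!!i j. (%z. snd (c z) $ i $ j) fdiff (at z0)" shows "(%z. G (c z)) fdiff (at z0)"
proof (rule amb_holo_crv[OF G p])
 define f where "f = (%i j. deriv (%z. fst (c z) $ i $ j) z0)"
 define g where "g = (%i j. deriv (%z. snd (c z) $ i $ j) z0)"
 let ?r = "%z. (cscale (1 / (z - z0)) (fst (c z) - fst (c z0)), cscale (1 / (z - z0)) (snd (c z) - snd (c z0)))"
 have "((%z. fst (?r z)) ---> (\<chi> i j. f i j)) (at z0)" "((%z. snd (?r z)) ---> (\<chi> i j. g i j)) (at z0)"
  using d[THEN field_differentiable_derivI] unfolding f_def g_def has_field_derivative_iff by (auto intro!: vec_tendstoI)
 from tendsto_Pair[OF this]
 show "limitin euclidean ?r ((\<chi> i j. f i j), (\<chi> i j. g i j)) (at z0)" by simp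
 have *: "c z = kron_line (c z0) (z - z0) (?r z)" if "z ~= z0" for z by (simp add: prod_eq_iff kron_line_simps cscale_simps)
 show "ev (at z0) (%z. c z = kron_line (c z0) (z - z0) (?r z))"
  unfolding eventually_at by (rule exI[of _ 1]) (use * in auto)
 show "continuous_map (prod_topology euclidean euclidean) euclidean (%q. kron_line (c z0) (fst q) (snd q))"
  using kron_line_cont by simp
qed (simp_all add: prod_eq_iff kron_line_simps cscale_simps)

context interval
begin

lemma paths_add_cscale: assumes "al : PP" "a : PP" shows "(%t. al t + cscale h (a t)) : PP"
proof -
 have "smooth (%t. al t + cscale h (a t))" by (intro smooth_add path_smooth assms smooth_cscale[OF smooth_const])
 thus ?thesis using assms unfolding paths_def by (simp add: sl2_iff cscale_simps)
qed

lemma limitin_path_line: assumes "al : PP" "limitin (path_top L) r v F" "(h ---> h0) F"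
 shows "limitin (path_top L) (%z t. al t + cscale (h z) (r z t)) (%t. al t + cscale h0 (v t)) F"
proof -
 note r = assms(2)[unfolded limitin_path_top]
 have "slim F (%z t. al t + cscale (h z) (r z t)) (%t. al t + cscale h0 (v t))"
  using slim_add[OF slim_const_seq[OF path_smooth[OF assms(1)]]
   slim_bilinear[OF bil_cscale slim_const[OF assms(3)]]] r by blast
 moreover have "ev F (%z. r z : PP)" using r by blast
 hence "ev F (%z. (%t. al t + cscale (h z) (r z t)) : PP)"
  by eventually_elim (rule paths_add_cscale[OF assms(1)])
 ultimately show ?thesis unfolding limitin_path_top using paths_add_cscale[OF assms(1)] r by blast
qed

lemma nahm_line_lim: assumes "B : topspace NS" "limitin NS r v F" "(h ---> h0) F"
 shows "limitin NS (%z. nahm_line B (h z) (r z)) (nahm_line B h0 v) F"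
 using assms unfolding limitin_NS tops_NS nahm_line_simps by (auto intro: limitin_path_line)

lemma nahm_line_0: "u : topspace NS ==> nahm_line p 0 u = p" by (simp add: prod_eq_iff nahm_line_simps cscale_simps)

lemma nahm_line_cont: assumes "B : topspace NS"
 shows "continuous_map (prod_topology euclidean NS) NS (%q. nahm_line B (fst q) (snd q))" unfolding continuous_map_atin
proof
 let ?P = "prod_topology euclidean NS :: (complex \<times> nahm) topology"
 fix q assume q: "q : topspace ?P"
 from atin_self_limit[OF this]
 have "limitin euclidean fst (fst q) (atin ?P q)" "limitin NS snd (snd q) (atin ?P q)"
  unfolding limitin_pairwise by (auto simp: o_def)
 thus "limitin NS (%q. nahm_line B (fst q) (snd q)) (nahm_line B (fst q) (snd q)) (atin ?P q)"
  by (intro nahm_line_lim[OF assms]) auto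
qed

lemma amb_holo_nahm_crv: assumes "ambient_holomorphic NS nahm_line Om G" "c z0 : Om"
  "limitin NS r v (at z0)" "ev (at z0) (%z. c z = nahm_line (c z0) (z - z0) (r z))"
 shows "(%z. G (c z)) fdiff (at z0)"
proof -
 have "c z0 : topspace NS" using assms(1,2) openin_subset unfolding ambient_holomorphic_def by blast
 thus ?thesis by (intro amb_holo_crv[OF assms(1,2) nahm_line_0 nahm_line_cont assms(3) refl assms(4)])
qed

lemma par_variation_exists: assumes "al : PP" "v : PP"
 obtains Y where "Y 0 = 0" "!!t. t : II ==> (Y has_der (- al t) ** Y t + - (v t ** par al t)) t"
proof -
 have "cont II (%t. - al t)" "cont II (%t. - (v t ** par al t))"
  by (intro smooth_cont smooth_minus smooth_mmult path_smooth par_smooth assms)+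
 from lode_exists[OF bil_mmult this] that show ?thesis by blast
qed

lemma difference_quotient_rearrange:
 fixes A P P0 R :: cmat assumes "k * h = 1" shows "cscale k ((- (A + cscale h R)) ** P - (- A) ** P0) =
  (- (A + cscale h R)) ** cscale k (P - P0) + - (R ** P0)"
 using assms by (simp add: mat_ring cscale_simps)

text \<open>The difference quotients of the parallel transport solve linear equations whose
  coefficients, forcing terms and initial values converge to those of the equation of first
  variation.\<close>

lemma par_crv: assumes r: "limitin (path_top L) r v (at z0)" and al0: "al0 : PP"
  and c: "ev (at z0) (%z. al z = (%t. al0 t + cscale (z - z0) (r z t)))" and Y: "Y 0 = 0"
  "!!t. t : II ==> (Y has_der (- al0 t) ** Y t + - (v t ** par al0 t)) t" and t: "t : II"
 shows "((%z. cscale (1 / (z - z0)) (par (al z) t - par al0 t)) ---> Y t) (at z0)"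
proof -
 let ?F = "at z0"
 note r' = r[unfolded limitin_path_top]
 have hz: "((%z. z - z0) ---> 0) ?F" by (rule LIM_offset_zero_iff[THEN iffD2]) auto
 have P0: "smooth (par al0)" by (rule par_smooth[OF path_smooth[OF al0]])
 have "limitin (path_top L) (%z t. al0 t + cscale (z - z0) (r z t)) (%t. al0 t + cscale 0 (v t)) ?F"
  by (rule limitin_path_line[OF al0 r hz])
 hence lim: "limitin (path_top L) (%z t. al0 t + cscale (z - z0) (r z t)) al0 ?F" by (simp add: cscale_simps)
 have alq: "uniform_limit II (%z t. al0 t + cscale (z - z0) (r z t)) al0 ?F"
  using lim unfolding limitin_path_top by (blast intro: slimD(4))
 have ev: "ev ?F (%z. (%t. al0 t + cscale (z - z0) (r z t)) : PP)" using lim unfolding limitin_path_top by blast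
 have "slim ?F (%z t. r z t ** par al0 t) (%t. v t ** par al0 t)"
  by (rule slim_bilinear[OF bil_mmult _ slim_const_seq[OF P0]]) (use r' in blast)
 from uniform_limit_uminus[OF slimD(4)[OF this]]
 have f: "uniform_limit II (%z t. - (r z t ** par al0 t)) (%t. - (v t ** par al0 t)) ?F" .
 have "uniform_limit II (%z t. cscale (1 / (z - z0)) (par (al z) t - par al0 t)) Y ?F"
 proof (rule lode_lim[OF bil_mmult _ uniform_limit_uminus[OF alq] f _ Y(2)])
  show "cont II (%t. - al0 t)" by (intro smooth_cont smooth_minus path_smooth al0)
  have "ev ?F (%z. z ~= z0)" by (simp add: eventually_at_filter)
  with c ev
  show "ev ?F (%z. ALL t:II. ((%t. cscale (1 / (z - z0)) (par (al z) t - par al0 t)) has_der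
    (- (al0 t + cscale (z - z0) (r z t))) ** cscale (1 / (z - z0)) (par (al z) t - par al0 t)
    + - (r z t ** par al0 t)) t)"
  proof eventually_elim
   case (elim z)
   show ?case
   proof
    fix t assume t: "t : II"
    have "al z : PP" using elim by simp
    note d = par_works(2)[OF smooth_cont[OF path_smooth[OF this]] t]
     par_works(2)[OF smooth_cont[OF path_smooth[OF al0]] t]
    have "((%t. cscale (1 / (z - z0)) (par (al z) t - par al0 t)) has_der
      cscale (1 / (z - z0)) ((- al z t) ** par (al z) t - (- al0 t) ** par al0 t)) t"
     by (rule blin_deriv[OF bounded_bilinear.bounded_linear_right[OF bil_cscale]
        has_vector_derivative_diff[OF d]])
    moreover have "cscale (1 / (z - z0)) ((- al z t) ** par (al z) t - (- al0 t) ** par al0 t) =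
     (- (al0 t + cscale (z - z0) (r z t))) ** cscale (1 / (z - z0)) (par (al z) t - par al0 t)
     + - (r z t ** par al0 t)"
     using difference_quotient_rearrange[of "1 / (z - z0)" "z - z0" "al0 t"] elim(3)
     unfolding fun_cong[OF elim(1), of t] by simp
    ultimately show "((%t. cscale (1 / (z - z0)) (par (al z) t - par al0 t)) has_der
    (- (al0 t + cscale (z - z0) (r z t))) ** cscale (1 / (z - z0)) (par (al z) t - par al0 t)
    + - (r z t ** par al0 t)) t" by simp
   qed
  qed
  have z: "par (al z) 0 = mat 1" if "al z = (%t. al0 t + cscale (z - z0) (r z t))"
   "(%t. al0 t + cscale (z - z0) (r z t)) : PP" for z using par_works(1)[OF smooth_cont[OF path_smooth]] that by simp
  have "ev ?F (%z. cscale (1 / (z - z0)) (par (al z) 0 - par al0 0) = Y 0)" using c ev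
  proof eventually_elim
   case (elim z)
   show ?case using z[OF elim] by (simp add: Y(1) par_works(1)[OF smooth_cont[OF path_smooth[OF al0]]] cscale_simps)
  qed
  thus "((%z. cscale (1 / (z - z0)) (par (al z) 0 - par al0 0)) ---> Y 0) ?F"
   by (rule tendsto_eventually)
 qed
 thus ?thesis by (rule tendsto_uniform_limitI[OF _ t])
qed

end


section \<open>Slice invariance and pulling functions back along \<open>rho\<close>\<close>

lemma cadj_mult: "cadj (A ** B) = cadj B ** cadj A" by (simp add: cmat_iff mult_nth)

lemma cadj_simps [simp]: "cadj (cadj A) = A" "cadj (A + B) = cadj A + cadj B" "cadj (A - B) = cadj A - cadj B"
 "cadj (- A) = - cadj A" "cadj 0 = 0" "cadj (adj2 A) = adj2 (cadj A)" "det (cadj A) = cnj (det A)"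
 by (simp_all add: cmat_simps)

text \<open>Taking adjoints in the stabilizer condition for \<open>g\<^sup>*\<close> shows that conjugation by \<open>g\<close> is
 compatible with \<open>\<partial> + [al0\<^sup>*, \<sqdot>]\<close>.\<close>

lemma slice_gauge_algebra: assumes g: "det g = 1"
  and st: "adj2 (cadj g) ** A ** cadj g + adj2 (cadj g) ** cadj g' = A" "adj2 (cadj g) ** B ** cadj g = B"
 shows "(adj2 g ** a) ** g' + (adj2 g ** (comm (cadj A) a + comm (cadj B) b) + - (adj2 g ** g' ** adj2 g) ** a) ** g =
  comm (cadj A) (adj2 g ** a ** g) + comm (cadj B) (adj2 g ** b ** g)"
proof -
 define H where "H = adj2 g"
 have A: "cadj A = g ** (cadj A ** H) + g' ** H" and B: "cadj B = g ** (cadj B ** H)"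
  using arg_cong[OF st(1), of cadj] arg_cong[OF st(2), of cadj] by (simp_all add: cadj_mult H_def)
 have c: "H ** (g ** X) = X" "H ** g = mat 1" for X :: cmat using adj2_cancel[OF g] mult_adj2[OF g] by (simp_all add: H_def)
 have "H ** cadj A = cadj A ** H + H ** (g' ** H)" by (subst A) (simp add: mat_ring c)
 from arg_cong[OF this, of "%M. M ** X" for X :: cmat]
 have 1: "H ** (cadj A ** X) = cadj A ** (H ** X) + H ** (g' ** (H ** X))" for X :: cmat by (simp add: mat_ring)
 have 2: "cadj A ** g = g ** cadj A + g'" by (subst A) (simp add: mat_ring c)
 have "H ** cadj B = cadj B ** H" by (subst B) (simp add: c)
 from arg_cong[OF this, of "%M. M ** X" for X :: cmat]
 have 3: "H ** (cadj B ** X) = cadj B ** (H ** X)" for X :: cmat by (simp add: mat_ring)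
 have 4: "cadj B ** g = g ** cadj B" by (subst B) (simp add: mat_ring c)
 show ?thesis unfolding H_def[symmetric] comm_def by (simp add: mat_ring 1 2 3 4)
qed

context nahm_params
begin

lemma limitin_tops_start: "limitin NS r v F ==> limitin (path_top L) (%i. fst (r i)) (fst v) F"
 "limitin NS r v F ==> limitin (path_top L) (%i. snd (r i)) (snd v) F" by (simp_all add: limitin_NS)

text \<open>Along a differentiable curve of data the holonomy and \<beta> at 0 have complex
  derivatives, and \<open>rho\<close> is a holomorphic expression in them.\<close>

lemma rho_crv_diff: assumes B: "B z0 : topspace NS" "B z0 : rho_dom" and r: "limitin NS r v (at z0)"
  and c: "ev (at z0) (%z. B z = nahm_line (B z0) (z - z0) (r z))"
 shows "(%z. fst (rho (B z)) $ i $ j) fdiff (at z0)"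
  "(%z. snd (rho (B z)) $ i $ j) fdiff (at z0)"
proof -
 have Bp: "fst (B z0) : PP" using B by (auto simp: tops_NS)
 have vp: "fst v : PP" using limitin_topspace[OF r] by (auto simp: tops_NS)
 have c1: "ev (at z0) (%z. fst (B z) = (%t. fst (B z0) t + cscale (z - z0) (fst (r z) t)))"
  using c by eventually_elim (metis nahm_line_simps(1))
 have "L : II" "0 : II" using L_pos by auto
 obtain Y where Y: "Y 0 = 0" "!!t. t : II ==>
   (Y has_der (- fst (B z0) t) ** Y t + - (fst v t ** par (fst (B z0)) t)) t"
  using par_variation_exists[OF Bp vp] by blast
 have "((%z. cscale (1 / (z - z0)) (par (fst (B z)) L - par (fst (B z0)) L)) ---> Y L) (at z0)"
  by (rule par_crv[OF limitin_tops_start(1)[OF r] Bp c1 Y `L \<in> II`])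
 from tendsto_nth2[OF this]
 have H: "(%z. holon (B z) $ p $ q) fdiff (at z0)" for p q
  unfolding field_differentiable_def has_field_derivative_iff holon_def by auto
 have "((%z. snd (r z) 0) ---> snd v 0) (at z0)"
  by (rule path_eval_lim[OF limitin_tops_start(2)[OF r] `0 \<in> II`])
 moreover have "ev (at z0) (%z. z ~= z0)" by (simp add: eventually_at_filter)
 with c have "ev (at z0) (%z. snd (r z) 0 = cscale (1 / (z - z0)) (snd (B z) 0 - snd (B z0) 0))"
 proof eventually_elim
  case (elim z)
  have "snd (B z) 0 = snd (B z0) 0 + cscale (z - z0) (snd (r z) 0)" by (subst elim(1)) (simp add: nahm_line_simps)
  thus ?case using elim(2) by (simp add: cscale_simps)
 qed
 ultimately have "((%z. cscale (1 / (z - z0)) (snd (B z) 0 - snd (B z0) 0)) ---> snd v 0) (at z0)"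
  by (rule Lim_transform_eventually)
 from tendsto_nth2[OF this]
 have b: "(%z. snd (B z) 0 $ p $ q) fdiff (at z0)" for p q
  unfolding field_differentiable_def has_field_derivative_iff by auto
 have dom: "holon (B z0) $ 1 $ 1 * holon (B z0) $ 2 $ 2 ~: \<real>\<^sub>\<le>\<^sub>0" using B(2) by (simp add: rho_dom_def)
 note R = rho_field_diff[OF H dom]
 have K: "rho (B z) = kdat (rho_a (holon (B z))) (rho_b (holon (B z)))
   (l * snd (B z) 0 $ 1 $ 2 - 2 * \<i> * rho_a (holon (B z)) * ZZ (rho_s (holon (B z))))
   (l * snd (B z) 0 $ 2 $ 1 + 2 * \<i> * rho_b (holon (B z)) * ZZ (rho_s (holon (B z))))" for z
  by (simp add: rho_eq rho_map_def)
 have cases: "P i j" if "P 1 1" "P 1 2" "P 2 1" "P 2 2" for P :: "2 => 2 => bool" and i j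
  using that exhaust_2[of i] exhaust_2[of j] by metis
 show "(%z. fst (rho (B z)) $ i $ j) fdiff (at z0)"
  by (rule cases[of _ i j]) (simp_all add: K kdat_def R(1,2))
 show "(%z. snd (rho (B z)) $ i $ j) fdiff (at z0)" by (rule cases[of _ i j]; simp add: K kdat_def;
    intro field_differentiable_diff field_differentiable_add field_differentiable_mult field_differentiable_const R b)
qed

text \<open>A complex line of Nahm data is mapped by \<open>rho\<close> to a curve that is no longer
  a line, so holomorphy along lines is recovered from the chain rule for Kronheimer data.\<close>

lemma amb_holo_rho: assumes "ambient_holomorphic euclidean kron_line Om G" shows "ambient_holomorphic NS nahm_line
  {B : topspace NS. B : rho_dom & rho B : Om} (%B. G (rho B))"
proof -
 note G = assms[unfolded ambient_holomorphic_def]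
 let ?Om = "{B : topspace NS. B : rho_dom & rho B : Om}"
 have op: "openin NS ?Om" by (rule openin_rho_vimage) (use G in auto)
 have cG: "cont Om G" "open Om" using G by auto
 show ?thesis unfolding ambient_holomorphic_def
 proof (intro conjI ballI op)
  have "cont (hol_dom Int rho_map -` Om) (%p. G (rho_map p))"
   by (rule continuous_on_compose2[OF cG(1)]) (auto intro: continuous_on_subset[OF rho_map_cont])
  moreover have "continuous_map (subtopology NS ?Om) (top_of_set (hol_dom Int rho_map -` Om))
    (%B. (holon B, snd B 0))"
   by (intro continuous_map_into_subtopology continuous_map_from_subtopology hol_map_cont)
    (auto simp: rho_dom_iff rho_eq)
  ultimately show "continuous_map (subtopology NS ?Om) euclidean (%B. G (rho B))"
   using continuous_map_compose[of "subtopology NS ?Om" "top_of_set (hol_dom Int rho_map -` Om)"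
    "%B. (holon B, snd B 0)" euclidean "%p. G (rho_map p)"] by (simp add: o_def rho_eq)
  fix x v assume x: "x : ?Om" and v: "v : topspace NS"
  show "(%z. G (rho (nahm_line x z v))) holomorphic_on {z. nahm_line x z v : ?Om}"
  proof
   fix z0 assume z0: "z0 : {z. nahm_line x z v : ?Om}"
   \<comment> \<open>The line is based anew at \<open>z0\<close>, the form in which the results on
     curves apply.\<close>
   have lin: "nahm_line x z v = nahm_line (nahm_line x z0 v) (z - z0) v" for z
    by (simp add: prod_eq_iff nahm_line_simps fun_eq_iff cmat_iff algebra_simps)
   have r: "limitin NS (%z. v) v (at z0)" using v by simp
   have "(%z. G (rho (nahm_line x z v))) fdiff (at z0)"
   proof (rule amb_holo_kron_crv[OF assms])
    show "rho (nahm_line x z0 v) : Om" using z0 by simp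
    have c: "ev (at z0) (%z. nahm_line x z v = nahm_line (nahm_line x z0 v) (z - z0) v)"
     using lin by (intro always_eventually) blast
    have t: "nahm_line x z0 v : topspace NS" "nahm_line x z0 v : rho_dom" using z0 by auto
    show "(%z. fst (rho (nahm_line x z v)) $ i $ j) fdiff (at z0)"
     "(%z. snd (rho (nahm_line x z v)) $ i $ j) fdiff (at z0)" for i j
     using rho_crv_diff[of "%z. nahm_line x z v", OF t r c] by blast+
   qed
   thus "(%z. G (rho (nahm_line x z v))) fdiff (at z0 within {z. nahm_line x z v : ?Om})"
    by (rule field_differentiable_at_within)
  qed
 qed
qed

lemma kdat_nth [simp]: "fst (kdat a b c d) $ 1 $ 2 = a" "fst (kdat a b c d) $ 2 $ 1 = b"
 "snd (kdat a b c d) $ 1 $ 2 = c" "snd (kdat a b c d) $ 2 $ 1 = d" by (simp_all add: kdat_def)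

lemma kron_semistable_iff:
 "kron_semistable r (kdat a b c d) <-> (r > 0 --> \<not> (b = 0 & d = 0)) & (r < 0 --> \<not> (a = 0 & c = 0))"
using kron_semistable_def kron_subline_kdat kron_degree_def by auto

lemma kron_ss_open: "EX Q. open Q & kron_ss r x = kron_data x Int Q"
proof -
 let ?n = "%i j. {A::kron. \<not> (fst A $ i $ j = 0 & snd A $ i $ j = 0)}"
 have o: "open (?n i j)" for i j
 proof -
  have "?n i j = {A. fst A $ i $ j ~= 0} \<union> {A. snd A $ i $ j ~= 0}" by auto
  moreover have "open {A::kron. fst A $ i $ j ~= 0}" "open {A::kron. snd A $ i $ j ~= 0}"
   by (intro open_Collect_neq continuous_intros)+
  ultimately show ?thesis by auto
 qed
 define Q where "Q = (if r > 0 then ?n 2 1 else if r < 0 then ?n 1 2 else UNIV)"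
 have "A : kron_ss r x <-> A : kron_data x Int Q" for A
 proof (cases "A : kron_data x")
  case True
  then obtain a b c d where "A = kdat a b c d" using KD_kdat by metis
  thus ?thesis by (auto simp: kron_ss_def kron_semistable_iff Q_def)
 qed (auto simp: kron_ss_def)
 moreover have "open Q" unfolding Q_def using o by auto
 ultimately show ?thesis by blast
qed

lemma kron_polystable_semistable: "kron_polystable r A ==> kron_semistable r A"
 unfolding kron_polystable_def kron_stable_def kron_semistable_def by (cases A) auto

text \<open>As the stabilizer fixes \<open>B\<close>, it conjugates the difference from
  \<open>B\<close> linearly; as the adjoint also fixes \<open>B\<close>, the Coulomb equation is
  carried along.\<close>

lemma slice_gauge: assumes B: "B : ND" "slice_centre L B" and g: "g : nahm_stabilizer L B" and y: "y : slice B"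
 shows "gact g y : slice B"
proof -
 obtain al0 be0 where B': "B = (al0, be0)" by (cases B)
 obtain al be where y': "y = (al, be)" by (cases y)
 have G: "g : GG" "gact g B = B" using g unfolding nahm_stabilizer_def by auto
 have "(%t. cadj (g t)) : nahm_stabilizer L B" using B(2) g unfolding slice_centre_def by blast
 hence C: "(%t. cadj (g t)) : GG" "gact (%t. cadj (g t)) B = B" unfolding nahm_stabilizer_def by auto
 note N = NDD[OF B(1)[unfolded B']]
 have yd: "y : ND" using y unfolding B' by auto
 note M = NDD[OF yd[unfolded y']]
 have cl: "der (%t. al t - al0 t) t = comm (cadj (al0 t)) (al t - al0 t) + comm (cadj (be0 t)) (be t - be0 t)"
  if "t : II" for t using y that unfolding B' y' by auto
 have sg: "smooth g" by (rule ggD(1)[OF G(1)])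
 have dg: "det (g t) = 1" if "t : II" for t by (rule ggD(2)[OF G(1) that])
 have stab: "adj2 (g t) ** al0 t ** g t + adj2 (g t) ** der g t = al0 t"
  "adj2 (g t) ** be0 t ** g t = be0 t" if "t : II" for t
 proof -
  have *: "onI (%t. adj2 (g t) ** al0 t ** g t + adj2 (g t) ** der g t) = al0" "onI (%t. adj2 (g t) ** be0 t ** g t) = be0"
   using G(2) unfolding B' gact_adj2[OF gg_det[OF G(1)]] by auto
  from fun_cong[OF *(1), of t] fun_cong[OF *(2), of t] that
  show "adj2 (g t) ** al0 t ** g t + adj2 (g t) ** der g t = al0 t"
   "adj2 (g t) ** be0 t ** g t = be0 t" by (simp_all only: on_I_eq)
 qed
 have cd: "der (%t. cadj (g t)) t = cadj (der g t)" if "t : II" for t by (rule der_linear[OF blin_cadj sg that])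
 have cstab: "adj2 (cadj (g t)) ** al0 t ** cadj (g t) + adj2 (cadj (g t)) ** cadj (der g t) = al0 t"
  "adj2 (cadj (g t)) ** be0 t ** cadj (g t) = be0 t" if "t : II" for t
 proof -
  have *: "onI (%t. adj2 (cadj (g t)) ** al0 t ** cadj (g t) + adj2 (cadj (g t)) ** der (%t. cadj (g t)) t) = al0"
   "onI (%t. adj2 (cadj (g t)) ** be0 t ** cadj (g t)) = be0" using C(2) unfolding B' gact_adj2[OF gg_det[OF C(1)]] by auto
  from fun_cong[OF *(1), of t] fun_cong[OF *(2), of t] that
  show "adj2 (cadj (g t)) ** al0 t ** cadj (g t) + adj2 (cadj (g t)) ** cadj (der g t) = al0 t"
   "adj2 (cadj (g t)) ** be0 t ** cadj (g t) = be0 t" by (simp_all only: on_I_eq cd)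
 qed
 define a where "a = (%t. al t - al0 t)"
 have ideriv_a: "der a t = comm (cadj (al0 t)) (a t) + comm (cadj (be0 t)) (be t - be0 t)" if "t : II" for t
  using cl[OF that] by (simp add: a_def)
 have sa: "smooth a" unfolding a_def by (intro smooth_diff path_smooth M N)
 define al' where "al' = fst (gact g y)"
 define be' where "be' = snd (gact g y)"
 have a': "al' t - al0 t = adj2 (g t) ** a t ** g t" if "t : II" for t
 proof -
  have "adj2 (g t) ** der g t = al0 t - adj2 (g t) ** al0 t ** g t"
   using stab(1)[OF that] by (simp add: eq_diff_eq add.commute)
  thus ?thesis using that unfolding al'_def y' gact_adj2[OF gg_det[OF G(1)]] by (simp add: on_I_eq a_def mat_ring)
 qed
 have b': "be' t - be0 t = adj2 (g t) ** (be t - be0 t) ** g t" if "t : II" for t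
  using stab(2)[OF that] that unfolding be'_def y' gact_adj2[OF gg_det[OF G(1)]] by (simp add: on_I_eq mat_ring)
 have "der (%t. al' t - al0 t) t = comm (cadj (al0 t)) (al' t - al0 t) + comm (cadj (be0 t)) (be' t - be0 t)"
  if t: "t : II" for t
 proof -
  have "((%t. adj2 (g t) ** a t ** g t) has_der
    (adj2 (g t) ** a t) ** der g t +
    (adj2 (g t) ** der a t + - (adj2 (g t) ** der g t ** adj2 (g t)) ** a t) ** g t) t"
   by (intro has_der_mmult gauge_adj2_deriv sg dg t smooth_has_der sa)
  from der_eqI[OF t this] der_cong_I[OF t a']
  have e1: "der (%t. al' t - al0 t) t = (adj2 (g t) ** a t) ** der g t +
    (adj2 (g t) ** der a t + - (adj2 (g t) ** der g t ** adj2 (g t)) ** a t) ** g t" by simp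
  show ?thesis unfolding e1 a'[OF t] b'[OF t] ideriv_a[OF t] by (rule slice_gauge_algebra[OF dg[OF t] cstab[OF t]])
 qed
 moreover have "gact g y : ND" by (rule gact_ND[OF G(1) yd])
 hence "(al', be') : ND" unfolding al'_def be'_def by simp
 ultimately have "(al', be') : slice B" unfolding B' by auto
 thus ?thesis unfolding al'_def be'_def by simp
qed

lemma coulomb_slice_subset: "slice B <= ND" by (cases B) auto

lemma self_in_coulomb_slice: assumes "B : ND" shows "B : slice B"
proof -
 have "comm X 0 = 0" for X by (simp add: comm_def)
 thus ?thesis using assms by (cases B) auto
qed

lemma ND_tops: "B : ND ==> B : topspace NS" using ND_paths[of B] by (simp add: tops_NS mem_Times_iff)

lemma rho_kron_ps: assumes "B : NPS" "B : rho_dom" shows "rho B : TKP"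
 using assms rho_TK(1)[of B] rho_stab(2)[of B] TKD(1)[of "rho B"] by (auto simp: nahm_ps_def tilde_kron_ps_def kron_ps_def)

text \<open>The local function is composed with \<open>rho\<close> and restricted to the slice.
  Relative openness follows because semistability is open in the Kronheimer data, and invariance
  because a stabilizing g acts on \<open>rho\<close> through the torus element
  \<open>g 0\<close>.\<close>

lemma kron_holo_imp_nahm_holo: assumes V: "V <= mmap ` TKM"
  and kh: "kron_holomorphic (rL - r0) (xL - x0) {p : TKM. mmap p : V} (f \<circ> mmap)"
 shows "nahm_holomorphic L r0 rL x0 xL V f" unfolding nahm_holomorphic_def
proof (intro ballI impI, elim conjE)
 let ?U = "{p : TKM. mmap p : V}"
 have dom: "y : rho_dom & kron_orbit (rho y) : ?U & rho y : KPS &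
   mmap (kron_orbit (rho y)) = orb y"
  if y: "y : NPS" "orb y : V" for y
 proof -
  have R: "y : rho_dom" "kron_orbit (rho y) : TKM" using orb_moduli_iff[OF y(1) subset_refl] y(2) V by blast+
  have yd: "y : ND" using y unfolding nahm_ps_def by blast
  have "mmap (kron_orbit (rho y)) = orb y" using mmap_orbit[OF rho_TK(1)[OF yd R(1)]] rho_TK(2)[OF yd R(1)] by simp
  thus ?thesis using R rho_kron_ps[OF y(1) R(1)] y(2) unfolding tilde_kron_ps_def by auto
 qed
 fix B assume B: "B : NPS" and BV: "orb B : V" and sc: "slice_centre L B"
 have Bd: "B : ND" using B unfolding nahm_ps_def by blast
 from kh[unfolded kron_holomorphic_def, rule_format, of "rho B"] dom[OF B BV]
 obtain W F where W: "rho B : W" "openin (top_of_set (kron_ss (rL - r0) (xL - x0))) W"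
  and inv: "!!h y. h : torus ==> y : W ==> kron_act h y : W & F (kron_act h y) = F y"
  and hol: "holomorphic_on_subset euclidean kron_line W F"
  and F: "!!y. y : W ==> y : KPS ==> kron_orbit y : ?U ==> F y = f (mmap (kron_orbit y))"
  unfolding o_def by blast
 obtain Q where Q: "open Q" "kron_ss (rL - r0) (xL - x0) = KD Int Q" using kron_ss_open by blast
 obtain Q' where Q': "open Q'" "W = kron_ss (rL - r0) (xL - x0) Int Q'" using W(2) unfolding openin_open by blast
 define WN where "WN = {y : slice B. y : rho_dom & rho y : W}"
 have nd: "y : ND" if "y : slice B" for y using that coulomb_slice_subset by blast
 have "WN = {y : topspace NS. y : rho_dom & rho y : Q Int Q'} Int slice B"
  using Q Q' nd ND_tops TKD(1)[OF rho_TK(1)] unfolding WN_def by blast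
 hence "openin (subtopology NS (slice B)) WN"
  unfolding openin_subtopology using openin_rho_vimage[OF open_Int[OF Q(1) Q'(1)]] by blast
 moreover have "B : WN" using self_in_coulomb_slice[OF Bd] dom[OF B BV] W(1) by (simp add: WN_def)
 moreover have "gact g y : WN & F (rho (gact g y)) = F (rho y)"
  if g: "g : nahm_stabilizer L B" and y: "y : WN" for g y
 using g nahm_stabilizer_def y WN_def ND_paths nd rho_gauge inv ggD(3) slice_gauge Bd sc by auto
 moreover have "holomorphic_on_subset NS nahm_line WN (%y. F (rho y))" unfolding holomorphic_on_subset_def
 proof
  fix x assume "x : WN"
  hence x: "x : slice B" "x : rho_dom" "rho x : W" by (auto simp: WN_def)
  then obtain Om G where G: "rho x : Om" "ambient_holomorphic euclidean kron_line Om G" "ALL y:W Int Om. F y = G y"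
   using hol unfolding holomorphic_on_subset_def by blast
  show "EX Om G. x : Om & ambient_holomorphic NS nahm_line Om G & (ALL y:WN Int Om. F (rho y) = G y)"
   using amb_holo_rho[OF G(2)] G(1,3) x ND_tops[OF nd[OF x(1)]]
   by (intro exI[of _ "{B : topspace NS. B : rho_dom & rho B : Om}"])
    (auto simp: WN_def)
 qed
 moreover have "F (rho y) = f (orb y)" if y: "y : WN Int NPS" "orb y : V" for y
  using dom[of y] y F[of "rho y"] by (auto simp: WN_def)
 ultimately show "EX W F. B : W & openin (subtopology NS (slice B)) W &
   (ALL g:nahm_stabilizer L B. ALL y:W. gact g y : W & F (gact g y) = F y) &
   holomorphic_on_subset NS nahm_line W F &
   (ALL y:W Int NPS. orb y : V --> F y = f (orb y))"
  by (intro exI[of _ WN] exI[of _ "%y. F (rho y)"]) blast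
qed

end


section \<open>Differentiable dependence on initial values\<close>

lemma has_deriv_quad:
 fixes f :: "'a::real_normed_vector => 'b::real_normed_vector" assumes "blin f'" "0 < d"
  and "!!y. norm (y - x) < d ==> norm (f y - f x - f' (y - x)) <= M * (norm (y - x))\<^sup>2"
 shows "(f has_derivative f') (at x)"
proof (rule has_derivativeI_sandwich[OF assms(2,1), where H = "%y. M * norm (y - x)"])
 show "norm (f y - f x - f' (y - x)) / norm (y - x) <= M * norm (y - x)" if "y ~= x" "dist y x < d" for y
  using assms(3)[of y] that by (simp add: dist_norm divide_le_eq power2_eq_square)
 show "((%y. M * norm (y - x)) ---> 0) (at x)"
  by (rule tendsto_mult_right_zero[OF tendsto_norm_zero[OF LIM_zero[OF tendsto_ident_at]]])
qed

lemma bil_add: assumes "bilin f" "bilin g" shows "bilin (%x y. f x y + g x y)"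
proof -
 interpret f: bounded_bilinear f by fact
 interpret g: bounded_bilinear g by fact
 obtain K where K: "!!a b. norm (f a b) <= norm a * norm b * K" using f.bounded by blast
 obtain K' where K': "!!a b. norm (g a b) <= norm a * norm b * K'" using g.bounded by blast
 show ?thesis by (unfold_locales, simp_all add: f.add_left f.add_right g.add_left g.add_right f.scaleR_left f.scaleR_right
    g.scaleR_left g.scaleR_right scaleR_add_right)
   (rule exI[of _ "K + K'"], use norm_triangle_le[OF add_mono[OF K K']] in "simp add: algebra_simps")
qed

text \<open>The operator e -> B k e + Q u e + Q e v. For u = v it is the linearization of the
  quadratic equation; for two solutions u and v it governs exactly their difference.\<close>

lemma bil_tri:
 fixes B :: "'a::real_normed_vector => 'b::real_normed_vector => 'b" assumes "bilin B" "bilin Q"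
 shows "bilin (%p e. B (fst p) e + (Q (fst (snd p)) e + Q e (snd (snd p))))"
 by (rule bil_add[OF bounded_bilinear.comp1[OF assms(1) bounded_linear_fst]
   bil_add[OF bounded_bilinear.comp1[OF assms(2)] bounded_bilinear.comp1[OF bounded_bilinear.flip[OF assms(2)]]]])
  (intro bounded_linear_compose[OF _ bounded_linear_snd] bounded_linear_fst bounded_linear_snd)+

text \<open>Collects what is used of the flow near 0 of y' = B k y + Q y y; \<open>D xi ze\<close>
  is the derivative of the solution with respect to its initial value \<open>xi\<close> in the
  direction \<open>ze\<close>.\<close>

locale quadratic_flow = interval +
 fixes B :: "'k::real_normed_vector => 'e::banach => 'e" and Q :: "'e => 'e => 'e" and k :: "real => 'k"
  and r C :: real and sol :: "'e => real => 'e" and D :: "'e => 'e => real => 'e"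
 assumes r_pos: "0 < r" and C_pos: "0 < C" and sol_0: "!!xi. norm xi < r ==> sol xi 0 = xi"
  and sol_deriv: "!!xi t. norm xi < r ==> t : II ==>
   (sol xi has_der B (k t) (sol xi t) + Q (sol xi t) (sol xi t)) t"
  and sol_lip: "!!xi xi' t. norm xi < r ==> norm xi' < r ==> t : II ==> norm (sol xi t - sol xi' t) <= C * norm (xi - xi')"
  and sol_zero: "!!t. t : II ==> sol 0 t = 0" and D_0: "!!xi ze. norm xi < r ==> D xi ze 0 = ze"
  and D_deriv: "!!xi ze t. norm xi < r ==> t : II ==> (D xi ze has_der
   B (k t) (D xi ze t) + (Q (sol xi t) (D xi ze t) + Q (D xi ze t) (sol xi t))) t"
  and sol_has_derivative: "!!xi. norm xi < r ==> ((%xi. sol xi L) has_derivative (%ze. D xi ze L)) (at xi)"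
  and D_continuous: "!!ze. cont (ball 0 r) (%xi. D xi ze L)"

context interval
begin

lemma qode_flow:
 fixes B :: "'k::real_normed_vector => 'e::banach => 'e" and Q :: "'e => 'e => 'e"
 assumes "bilin B" "bilin Q" "cont II k"
 obtains r C sol D where "quadratic_flow L B Q k r C sol D"
proof -
 interpret B: bounded_bilinear B by fact
 interpret Q: bounded_bilinear Q by fact
 obtain KQ where KQ: "0 < KQ" "!!a b. norm (Q a b) <= norm a * norm b * KQ" using Q.pos_bounded by blast
 define BB where "BB = (%p e. B (fst p) e + (Q (fst (snd p)) e + Q e (snd (snd p))))"
 interpret BB: bounded_bilinear BB unfolding BB_def by (rule bil_tri[OF assms(1,2)])
 obtain KB where KB: "0 < KB" "!!a b. norm (BB a b) <= norm a * norm b * KB" using BB.pos_bounded by blast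
 obtain Ck where Ck: "0 < Ck" "!!t. t : II ==> norm (k t) <= Ck" using cont_norm_bound[OF assms(3)] by blast
 obtain r C where rC: "0 < r" "0 < C" "!!xi. norm xi <= r ==> (EX y. y 0 = xi &
  (ALL t:II. (y has_der B (k t) (y t) + Q (y t) (y t)) t) &
  (ALL t:II. norm (y t) <= C * norm xi))"
  using qode_exists[OF assms] by blast
 define sol where "sol = (%xi. SOME y. y 0 = xi &
  (ALL t:II. (y has_der B (k t) (y t) + Q (y t) (y t)) t) &
  (ALL t:II. norm (y t) <= C * norm xi))"
 have sol: "sol xi 0 = xi &
  (ALL t:II. (sol xi has_der B (k t) (sol xi t) + Q (sol xi t) (sol xi t)) t) &
  (ALL t:II. norm (sol xi t) <= C * norm xi)" if "norm xi < r" for xi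
  using someI_ex[OF rC(3)[of xi]] that unfolding sol_def by simp
 have sol0: "sol xi 0 = xi" if "norm xi < r" for xi using sol[OF that] by blast
 have sold: "(sol xi has_der B (k t) (sol xi t) + Q (sol xi t) (sol xi t)) t"
  if "norm xi < r" "t : II" for xi t using sol[OF that(1)] that(2) by blast
 have solb: "norm (sol xi t) <= C * r" if "norm xi < r" "t : II" for xi t
 proof -
  have "norm (sol xi t) <= C * norm xi" using sol[OF that(1)] that(2) by blast
  also have "\<dots> <= C * r" using that(1) rC(2) by simp
  finally show ?thesis .
 qed
 have solc: "cont II (sol xi)" if "norm xi < r" for xi by (rule has_der_cont[OF sold[OF that]])
 define R where "R = Ck + (C * r + C * r)"
 have R: "0 < R" using Ck(1) rC by (simp add: R_def add_pos_pos)
 have pb: "norm (k t, sol xi t, sol xi' t) <= R" if "norm xi < r" "norm xi' < r" "t : II" for xi xi' t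
  using norm_Pair_le[of "k t" "(sol xi t, sol xi' t)"] norm_Pair_le[of "sol xi t" "sol xi' t"]
   Ck(2)[OF that(3)] solb[OF that(1,3)] solb[OF that(2,3)] unfolding R_def by simp
 define E where "E = 2 * exp (2 * (R * KB) * L)"
 have E: "0 < E" by (simp add: E_def)
 have bnd: "norm (y t) <= E * (norm (y 0) + c * L)" if "norm xi < r" "norm xi' < r" "0 <= c" "t : II"
   "!!t. t : II ==> (y has_der BB (k t, sol xi t, sol xi' t) (y t) + f t) t"
   "!!t. t : II ==> norm (f t) <= c" for xi xi' c t y f
  using lode_bound[OF KB R that(3,5) pb[OF that(1,2)] that(6,4)] by (simp add: E_def algebra_simps)
 have bnd0: "norm (y t) <= E * norm (y 0)" if "norm xi < r" "norm xi' < r" "t : II"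
   "!!t. t : II ==> (y has_der BB (k t, sol xi t, sol xi' t) (y t)) t" for xi xi' t y
  using bnd[OF that(1,2) order_refl that(3), of y "%t. 0"] that(4) by simp
 have lip: "norm (sol xi t - sol xi' t) <= E * norm (xi - xi')" if "norm xi < r" "norm xi' < r" "t : II" for xi xi' t
 proof -
  have "norm (sol xi t - sol xi' t) <= E * norm (sol xi 0 - sol xi' 0)"
  proof (rule bnd0[of xi xi' t "%t. sol xi t - sol xi' t", OF that])
   fix t assume t: "t : II"
   show "((%t. sol xi t - sol xi' t) has_der BB (k t, sol xi t, sol xi' t) (sol xi t - sol xi' t)) t"
    using has_vector_derivative_diff[OF sold[OF that(1) t] sold[OF that(2) t]]
    by (simp add: BB_def B.diff_right Q.diff_right Q.diff_left algebra_simps)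
  qed
  thus ?thesis using sol0 that by simp
 qed
 define D where "D = (%xi ze. SOME y. y 0 = ze &
  (ALL t:II. (y has_der BB (k t, sol xi t, sol xi t) (y t)) t))"
 have D: "D xi ze 0 = ze &
  (ALL t:II. (D xi ze has_der BB (k t, sol xi t, sol xi t) (D xi ze t)) t)"
  if "norm xi < r" for xi ze
 proof -
  have "cont II (%t. (k t, sol xi t, sol xi t))" by (intro continuous_on_Pair solc[OF that] assms(3))
  from lode_exists[OF BB.bounded_bilinear_axioms this continuous_on_const[of _ 0], of ze]
  have "EX y. y 0 = ze & (ALL t:II. (y has_der BB (k t, sol xi t, sol xi t) (y t)) t)"
   unfolding add_0_right .
  from someI_ex[OF this] show ?thesis unfolding D_def .
 qed
 have D0: "D xi ze 0 = ze" if "norm xi < r" for xi ze using D[OF that] by blast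
 have Dd: "(D xi ze has_der BB (k t, sol xi t, sol xi t) (D xi ze t)) t"
  if "norm xi < r" "t : II" for xi ze t using D[OF that(1)] that(2) by blast
 have Db: "norm (D xi ze t) <= E * norm ze" if "norm xi < r" "t : II" for xi ze t
  using bnd0[OF that(1,1,2), of "D xi ze"] Dd[OF that(1)] D0[OF that(1)] by simp
 have uniq: "y t = D xi ze t" if "norm xi < r" "t : II" "y 0 = ze"
  "!!t. t : II ==> (y has_der BB (k t, sol xi t, sol xi t) (y t)) t" for y xi ze t
 proof -
  have "norm (y t - D xi ze t) <= E * norm (y 0 - D xi ze 0)"
  proof (rule bnd0[of xi xi t "%t. y t - D xi ze t", OF that(1,1,2)])
   fix t assume t: "t : II"
   show "((%t. y t - D xi ze t) has_der BB (k t, sol xi t, sol xi t) (y t - D xi ze t)) t"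
    using has_vector_derivative_diff[OF that(4)[OF t] Dd[OF that(1) t]] by (simp add: BB.diff_right)
  qed
  thus ?thesis using that D0 by simp
 qed
 have lin: "blin (%ze. D xi ze t)" if "norm xi < r" "t : II" for xi t
 proof (rule bounded_linear_intro)
  fix ze ze' and c :: real
  show "D xi (ze + ze') t = D xi ze t + D xi ze' t"
  proof (rule uniq[of xi t "%t. D xi ze t + D xi ze' t", OF that, symmetric])
   show "((%t. D xi ze t + D xi ze' t) has_der BB (k t, sol xi t, sol xi t) (D xi ze t + D xi ze' t)) t"
    if "t : II" for t
    using has_vector_derivative_add[OF Dd Dd] `norm xi < r` that by (simp add: BB.add_right)
  qed (use D0 that in simp)
  show "D xi (c *\<^sub>R ze) t = c *\<^sub>R D xi ze t"
  proof (rule uniq[of xi t "%t. c *\<^sub>R D xi ze t", OF that, symmetric])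
   show "((%t. c *\<^sub>R D xi ze t) has_der BB (k t, sol xi t, sol xi t) (c *\<^sub>R D xi ze t)) t"
    if "t : II" for t using blin_deriv[OF bounded_linear_scaleR_right[of c] Dd[OF `norm xi < r` that]]
    by (simp add: BB.scaleR_right)
  qed (use D0 that in simp)
  show "norm (D xi ze t) <= norm ze * E" using Db[OF that, of ze] by (simp add: mult.commute)
 qed
 \<comment> \<open>The remainder \<open>e\<close> starts at 0 and solves the linearized equation
   with forcing Q d d, where d is the difference of the solutions; since d is Lipschitz in the
   initial value, the remainder is quadratic.\<close>
 have der: "((%xi. sol xi t) has_derivative (%ze. D xi ze t)) (at xi)" if xi: "norm xi < r" and t: "t : II" for xi t
 proof (rule has_deriv_quad[OF lin[OF that], of "r - norm xi"])
  show "0 < r - norm xi" using xi by simp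
  fix xi' assume "norm (xi' - xi) < r - norm xi"
  hence xi': "norm xi' < r" using norm_triangle_sub[of xi' xi] by simp
  define e where "e = (%t. sol xi' t - sol xi t - D xi (xi' - xi) t)"
  define c where "c = E * norm (xi' - xi) * (E * norm (xi' - xi)) * KQ"
  have "norm (e t) <= E * (norm (e 0) + c * L)"
  proof (rule bnd[OF xi xi _ t])
   show "0 <= c" using KQ(1) by (simp add: c_def)
   show "norm (Q (sol xi' t - sol xi t) (sol xi' t - sol xi t)) <= c" if "t : II" for t
    unfolding c_def using lip[OF xi' xi that] KQ(1) E by (intro order_trans[OF KQ(2)] mult_mono) auto
   show "(e has_der BB (k t, sol xi t, sol xi t) (e t) + Q (sol xi' t - sol xi t) (sol xi' t - sol xi t)) t"
    if t: "t : II" for t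
   proof -
    have "BB (k t, sol xi t, sol xi t) (e t) + Q (sol xi' t - sol xi t) (sol xi' t - sol xi t) =
     B (k t) (sol xi' t) + Q (sol xi' t) (sol xi' t) - (B (k t) (sol xi t) + Q (sol xi t) (sol xi t)) - BB (k t, sol xi t, sol xi t) (D xi (xi' - xi) t)"
     unfolding e_def BB_def by (simp add: B.diff_right Q.diff_right Q.diff_left)
    thus ?thesis unfolding e_def
     using has_vector_derivative_diff[OF has_vector_derivative_diff[OF sold[OF xi' t] sold[OF xi t]] Dd[OF xi t, of "xi' - xi"]]
     by simp
   qed
  qed
  moreover have "e 0 = 0" using sol0 D0 xi xi' by (simp add: e_def)
  ultimately show "norm (sol xi' t - sol xi t - D xi (xi' - xi) t) <= E * E * E * KQ * L * (norm (xi' - xi))\<^sup>2"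
   by (simp add: e_def c_def power2_eq_square mult_ac)
 qed
 \<comment> \<open>The difference of two derivatives starts at 0 and is forced by terms bounded by
   the distance of the base points, so the derivative is even Lipschitz in
   \<open>xi\<close>.\<close>
 have cont: "cont (ball 0 r) (%xi. D xi ze L)" for ze
 proof (rule lipschitz_on_continuous_on[OF lipschitz_onI])
  fix xi xi' :: 'e assume "xi : ball 0 r" "xi' : ball 0 r"
  hence xi: "norm xi < r" and xi': "norm xi' < r" by auto
  define e where "e = (%t. D xi ze t - D xi' ze t)"
  define c where "c = 2 * (E * norm (xi - xi') * (E * norm ze) * KQ)"
  have "norm (e L) <= E * (norm (e 0) + c * L)"
  proof (rule bnd[OF xi xi])
   show "0 <= c" using E KQ(1) by (simp add: c_def)
   show "L : II" using L_pos by simp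
   show "norm (Q (sol xi t - sol xi' t) (D xi' ze t) + Q (D xi' ze t) (sol xi t - sol xi' t)) <= c" if t: "t : II" for t
   proof -
    have "norm (Q (sol xi t - sol xi' t) (D xi' ze t)) <= E * norm (xi - xi') * (E * norm ze) * KQ"
     using lip[OF xi xi' t] Db[OF xi' t] KQ(1) E by (intro order_trans[OF KQ(2)] mult_mono) auto
    moreover have "norm (Q (D xi' ze t) (sol xi t - sol xi' t)) <= E * norm ze * (E * norm (xi - xi')) * KQ"
     using lip[OF xi xi' t] Db[OF xi' t] KQ(1) E by (intro order_trans[OF KQ(2)] mult_mono) auto
    ultimately show ?thesis
     using norm_triangle_ineq[of "Q (sol xi t - sol xi' t) (D xi' ze t)" "Q (D xi' ze t) (sol xi t - sol xi' t)"]
     by (simp add: c_def mult_ac)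
   qed
   show "(e has_der BB (k t, sol xi t, sol xi t) (e t) +
     (Q (sol xi t - sol xi' t) (D xi' ze t) + Q (D xi' ze t) (sol xi t - sol xi' t))) t"
    if t: "t : II" for t unfolding e_def using has_vector_derivative_diff[OF Dd[OF xi t, of ze] Dd[OF xi' t, of ze]]
    by (simp add: BB_def B.diff_right Q.diff_right Q.diff_left algebra_simps)
  qed
  moreover have "e 0 = 0" using D0 xi xi' by (simp add: e_def)
  ultimately show "dist (D xi ze L) (D xi' ze L) <= (E * E * E * 2 * norm ze * KQ * L) * dist xi xi'"
   by (simp add: e_def c_def dist_norm mult_ac)
 qed (use E KQ(1) L_pos in simp)
 have sol00: "sol 0 t = 0" if "t : II" for t using sol[of 0] rC(1) that by auto
 have DdQ: "(D xi ze has_der B (k t) (D xi ze t) + (Q (sol xi t) (D xi ze t) + Q (D xi ze t) (sol xi t))) t"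
  if "norm xi < r" "t : II" for xi ze t using Dd[OF that] by (simp add: BB_def)
 have derL: "((%xi. sol xi L) has_derivative (%ze. D xi ze L)) (at xi)" if "norm xi < r" for xi
  by (rule der[OF that]) (use L_pos in simp)
 show thesis by (rule that[of r E sol D], unfold_locales) (fact rC(1) E sol0 sold lip sol00 D0 DdQ derL cont)+
qed

end

text \<open>In finite dimension continuity of the derivative on each vector is continuity in
  operator norm, and injectivity is invertibility. The two last conclusions are what later yields
  complex linearity of the inverse derivative.\<close>

lemma inverse_function_diff:
 fixes f :: "'a::euclidean_space => 'a"
 assumes U: "open U" "x0 : U" and f: "!!x. x : U ==> (f has_derivative f' x) (at x)"
  and c: "!!e. cont U (%x. f' x e)" and inj: "!!e. f' x0 e = 0 ==> e = 0"
 obtains V g g' where "open V" "f x0 : V" "g (f x0) = x0" "!!y. y : V ==> g y : U & f (g y) = y"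
  "!!y. y : V ==> (g has_derivative g' y) (at y)"
  "!!y e. y : V ==> f' (g y) (g' y e) = e" "!!y e. y : V ==> g' y (f' (g y) e) = e"
proof -
 have bl: "blin (f' x)" if "x : U" for x using f[OF that] by blast
 define F where "F = (%x. Blinfun (f' x))"
 have F: "blinfun_apply (F x) = f' x" if "x : U" for x
  unfolding F_def by (rule bounded_linear_Blinfun_apply[OF bl[OF that]])
 have "cont U F" by (rule continuous_on_blinfun_componentwise)
   (use c F in "simp cong: continuous_on_cong")
 have "linear (f' x0)" using bl[OF U(2)] by (rule bounded_linear.linear)
 moreover have "inj (f' x0)" using inj linear_injective_0[OF `linear (f' x0)`] by blast
 ultimately obtain h where h: "linear h" "h \<circ> f' x0 = id" using linear_injective_left_inverse by blast
 have "blin h" by (rule linear_conv_bounded_linear[THEN iffD1, OF h(1)])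
 hence "Blinfun h o\<^sub>L F x0 = id_blinfun"
  by (intro blinfun_eqI) (use h(2) in "simp add: bounded_linear_Blinfun_apply F[OF U(2)] fun_eq_iff")
 from inverse_function_theorem[OF U(1) _ `continuous_on U F` U(2) this, of f]
 obtain U' V g g' where R: "open U'" "U' <= U" "x0 : U'" "open V" "f x0 : V" "homeomorphism U' V f g"
  "!!y. y : V ==> (g has_derivative (g' y)) (at y)" "!!y. y : V ==> g' y = inv (blinfun_apply (F (g y)))"
  "!!y. y : V ==> bij (blinfun_apply (F (g y)))" using f F by (metis)
 have gU: "g y : U & f (g y) = y" if "y : V" for y using R(2,6) that unfolding homeomorphism_def by blast
 have g0: "g (f x0) = x0" using R(3,6) unfolding homeomorphism_def by blast
 have "f' (g y) (g' y e) = e" "g' y (f' (g y) e) = e" if "y : V" for y e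
  using R(8,9)[OF that] F gU[OF that] by (auto simp: bij_def surj_f_inv_f)
 thus thesis using that[OF R(4,5) g0 gU R(7)] by blast
qed


section \<open>Coulomb slices\<close>

lemma bil_linear: assumes "blin T" "bilin f" shows "bilin (%x y. T (f x y))"
proof -
 interpret T: bounded_linear T by fact
 interpret f: bounded_bilinear f by fact
 obtain K where K: "0 <= K" "!!a b. norm (f a b) <= norm a * norm b * K" using f.nonneg_bounded by blast
 obtain K' where K': "0 <= K'" "!!x. norm (T x) <= norm x * K'" using T.nonneg_bounded by blast
 have "norm (T (f a b)) <= norm a * norm b * (K * K')" for a b
  using order_trans[OF K'(2) mult_right_mono[OF K(2) K'(1)]] by (simp add: mult.assoc)
 thus ?thesis by unfold_locales (auto simp: f.add_left f.add_right f.scaleR_left f.scaleR_right T.add T.scaleR)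
qed

lemma bil_Pair: assumes "bilin f" "bilin g" shows "bilin (%x y. (f x y, g x y))"
proof -
 have "blin (%x. (x, 0))" "blin (%x. (0, x))"
  by (intro bounded_linear_Pair bounded_linear_ident bounded_linear_zero)+
 from bil_add[OF bil_linear[OF this(1) assms(1)] bil_linear[OF this(2) assms(2)]]
 show ?thesis by simp
qed

text \<open>The Coulomb and Nahm equations for \<open>(al0 + a, be0 + b)\<close>, together with the equation for the
 variation \<open>p\<close> of the parallel transport \<open>P0\<close> of \<open>al0\<close>, form the system
 \<open>y' = slin (al0, be0, P0) y + squad y y\<close> for \<open>y = (a, b, p)\<close>.\<close>

type_synonym cmat3 = "cmat \<times> cmat \<times> cmat"

definition slin :: "cmat3 => cmat3 => cmat3" where
 "slin k e = (comm (cadj (fst k)) (fst e) + comm (cadj (fst (snd k))) (fst (snd e)),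
  - comm (fst k) (fst (snd e)) + - comm (fst e) (fst (snd k)),
  - (fst k ** snd (snd e)) + - (fst e ** snd (snd k)))"

definition squad :: "cmat3 => cmat3 => cmat3" where
 "squad e e' = (0, - comm (fst e) (fst (snd e')), - (fst e ** snd (snd e')))"

lemma blin_proj:
 "blin (%k::cmat3. fst k)" "blin (%k::cmat3. fst (snd k))" "blin (%k::cmat3. snd (snd k))"
 "blin (%k::cmat3. cadj (fst k))" "blin (%k::cmat3. cadj (fst (snd k)))"
 using bounded_linear_fst bounded_linear_compose[OF bounded_linear_fst bounded_linear_snd] bounded_linear_compose[OF bounded_linear_snd bounded_linear_snd] bounded_linear_compose[OF blin_cadj bounded_linear_fst] bounded_linear_compose[OF blin_cadj bounded_linear_compose[OF bounded_linear_fst bounded_linear_snd]]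
 by blast+

lemma bil_flip_comp: assumes "bilin m" "blin f" "blin g"
 shows "bilin (%x y. - m (f x) (g y))" "bilin (%x y. - m (g y) (f x))"
  "bilin (%x y. m (f x) (g y))"
proof -
 show *: "bilin (%x y. m (f x) (g y))" using bounded_bilinear.comp[OF assms] by simp
 have **: "bilin (%x y. m (g y) (f x))"
  using bounded_bilinear.comp[OF bounded_bilinear.flip[OF assms(1)] assms(2,3)] by simp
 show "bilin (%x y. - m (f x) (g y))" "bilin (%x y. - m (g y) (f x))"
  by (rule bil_linear[OF bounded_linear_minus[OF bounded_linear_ident]], fact)+
qed

lemma bil_slin: "bilin slin" unfolding slin_def[abs_def] by (rule bil_Pair[OF
   bil_add[OF bil_flip_comp(3)[OF bil_comm blin_proj(4,1)]
    bil_flip_comp(3)[OF bil_comm blin_proj(5,2)]]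
   bil_Pair[OF
    bil_add[OF bil_flip_comp(1)[OF bil_comm blin_proj(1,2)]
     bil_flip_comp(2)[OF bil_comm blin_proj(2,1)]]
    bil_add[OF bil_flip_comp(1)[OF bil_mmult blin_proj(1,3)]
     bil_flip_comp(2)[OF bil_mmult blin_proj(3,1)]]]])

lemma bil_zero: "bilin (%x y. 0)" by unfold_locales (auto intro: exI[of _ 0])

lemma bil_squad: "bilin squad" unfolding squad_def[abs_def] by (rule bil_Pair[OF bil_zero bil_Pair[OF
   bil_flip_comp(1)[OF bil_comm blin_proj(1,2)]
   bil_flip_comp(1)[OF bil_mmult blin_proj(1,3)]]])

definition cnorm2 :: "cmat => real" where
 "cnorm2 X = (cmod (X $ 1 $ 1))\<^sup>2 + (cmod (X $ 1 $ 2))\<^sup>2 + (cmod (X $ 2 $ 1))\<^sup>2 + (cmod (X $ 2 $ 2))\<^sup>2"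

lemma cnorm2_trace: "trace (cadj X ** X) = complex_of_real (cnorm2 X)"
 by (simp add: cmat_simps cnorm2_def mult.commute[of "cnj _"] complex_norm_square[symmetric])

lemma cnorm2_nonneg: "0 <= cnorm2 X" and cnorm2_eq_0: "cnorm2 X = 0 <-> X = 0"
 by (auto simp: cnorm2_def cmat_iff add_nonneg_eq_0_iff)

lemma energy_identity: "trace (cadj (comm (cadj A) a + comm (cadj B) b) ** u + cadj a ** (a - comm A u)) =
  trace (cadj a ** a) + trace (cadj b ** comm B u)"
 by (simp add: cmat_simps algebra_simps)

context interval
begin

text \<open>The linearized slice equations with torus boundary conditions have only the trivial
 solution: \<open>(a, b)\<close> is the infinitesimal action of \<open>u\<close>, and \<open>\<langle>a, u\<rangle>\<close> has derivative
 \<open>\<bar>a\<bar>\<^sup>2 + \<bar>b\<bar>\<^sup>2\<close> and vanishes at both ends.\<close>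

lemma slice_rigidity: assumes B: "al0 : PP" "smooth be0" "!!t. t : II ==> (be0 has_der - comm (al0 t) (be0 t)) t"
  and a: "!!t. t : II ==> (a has_der
   comm (cadj (al0 t)) (a t) + comm (cadj (be0 t)) (b t)) t"
  and b: "!!t. t : II ==> (b has_der - comm (al0 t) (b t) + - comm (a t) (be0 t)) t"
  and p: "!!t. t : II ==> (p has_der
   - (al0 t ** p t) + - (a t ** par al0 t)) t"
  and init: "p 0 = 0" "b 0 = comm (be0 0) H" "trace (cadj (a 0) ** H) = 0"
  and final: "p L = par al0 L ** H - H' ** par al0 L" "trace (cadj (a L) ** H') = 0" and t: "t : II"
 shows "a t = 0" "b t = 0" "p t = 0"
proof -
 define P where "P = par al0"
 have s0: "smooth al0" by (rule path_smooth[OF B(1)])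
 note T = par_works[OF smooth_cont[OF s0], folded P_def]
 have det: "det (P t) = 1" if "t : II" for t unfolding P_def by (rule par_det[OF s0 pathsD(2)[OF B(1)] that])
 \<comment> \<open>Chosen so that p = P H - u P. Then a = u' + [al0, u], so u is the infinitesimal
   gauge transformation generating \<open>a\<close>, with boundary values H and H'.\<close>
 define u where "u = (%t. (P t ** H - p t) ** adj2 (P t))"
 have u: "(u has_der a t - comm (al0 t) (u t)) t" if t: "t : II" for t
 proof -
  have "((%t. P t ** H) has_der P t ** 0 + (- al0 t ** P t) ** H) t"
   by (rule has_der_mmult[OF T(2)[OF t] has_vector_derivative_const])
  from has_der_mmult[OF has_vector_derivative_diff[OF this p[OF t, folded P_def]]
    adj2_par_deriv[OF s0 t pathsD(2)[OF B(1) t], folded P_def]]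
  show ?thesis unfolding u_def by (simp add: comm_def mat_ring mult_adj2[OF det[OF t]] algebra_simps)
 qed
 \<comment> \<open>The failure of \<open>b\<close> to be generated by u. It solves a homogeneous
   linear equation and vanishes at 0 by the initial condition on \<open>b\<close>.\<close>
 define w where "w = (%t. b t - comm (be0 t) (u t))"
 have w: "(w has_der comm (- al0 t) (w t) + 0) t" if t: "t : II" for t
 proof -
  have "((%t. comm (be0 t) (u t)) has_der
    comm (be0 t) (a t - comm (al0 t) (u t)) + comm (- comm (al0 t) (be0 t)) (u t)) t"
   by (rule bil_deriv[OF bil_comm B(3)[OF t] u[OF t]])
  from has_vector_derivative_diff[OF b[OF t] this]
  show ?thesis unfolding w_def by (simp add: comm_def mat_ring algebra_simps)
 qed
 have u0: "u 0 = H" unfolding u_def by (simp add: T(1) init(1))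
 have w0: "w 0 = 0" unfolding w_def by (simp add: init(2) u0)
 have uL: "u L = H'" unfolding u_def using final(1)[folded P_def] mult_adj2[OF det[of L]] L_pos by (simp add: mat_ring)
 have "w t = 0" if "t : II" for t
 proof (rule lode_unique[OF bil_comm _ w _ _ that, where z = "%t. 0"])
  show "cont II (%t. - al0 t)" by (intro smooth_cont smooth_minus s0)
 qed (use w0 in "auto simp: comm_def mat_ring")
 hence bu: "b t = comm (be0 t) (u t)" if "t : II" for t using that by (simp add: w_def)
 define En where "En = (%t. Re (trace (cadj (a t) ** u t)))"
 have En: "(En has_der cnorm2 (a t) + cnorm2 (b t)) t" if t: "t : II" for t
 proof -
  have "blin (%X::cmat. Re (trace X))" by (rule bounded_linear_compose[OF bounded_linear_Re blin_trace])
  from blin_deriv[OF this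
    has_der_mmult[OF blin_deriv[OF blin_cadj a[OF t]] u[OF t]]]
  have "(En has_der Re (trace (cadj (comm (cadj (al0 t)) (a t) + comm (cadj (be0 t)) (b t)) ** u t +
    cadj (a t) ** (a t - comm (al0 t) (u t))))) t"
   unfolding En_def by (simp only: add.commute)
  thus ?thesis unfolding energy_identity by (simp only: bu[OF t, symmetric] cnorm2_trace) simp
 qed
 have "((%t. cnorm2 (a t) + cnorm2 (b t)) has_integral En L - En 0) II"
  using L_pos En by (intro fundamental_theorem_of_calculus) auto
 moreover have "En L = 0" "En 0 = 0" using init(3) final(2) by (simp_all add: En_def u0 uL)
 ultimately have I: "((%t. cnorm2 (a t) + cnorm2 (b t)) has_integral 0) (cbox 0 L)" by simp
 have ca: "cont II a" "cont II b" using has_der_cont[OF a] has_der_cont[OF b] by blast+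
 have "cnorm2 (a t) + cnorm2 (b t) = 0" if "t : II" for t
 proof (rule has_integral_0_cbox_imp_0[OF _ _ I])
  show "cont (cbox 0 L) (%t. cnorm2 (a t) + cnorm2 (b t))"
   unfolding cnorm2_def cbox_interval by (intro continuous_intros ca)
 qed (use that L_pos cnorm2_nonneg in "auto simp: add_nonneg_nonneg")
 hence ab: "a t = 0 & b t = 0" if "t : II" for t
  using that cnorm2_nonneg cnorm2_eq_0 by (metis add_nonneg_eq_0_iff)
 show "a t = 0" "b t = 0" using ab[OF t] by auto
 show "p t = 0"
 proof (rule lode_unique[OF bil_mmult _ _ _ _ t, where k = "%t. - al0 t" and z = "%t. 0" and f = "%t. 0"])
  show "cont II (%t. - al0 t)" by (intro smooth_cont smooth_minus s0)
  show "(p has_der (- al0 t) ** p t + 0) t" if "t : II" for t using p[OF that] ab[OF that] by (simp add: mat_ring)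
 qed (use init(1) in "auto simp: mat_ring")
qed

lemma hvd_comp: assumes "(y has_vector_derivative y') F"
 shows "((%t. fst (y t)) has_vector_derivative fst y') F" "((%t. snd (y t)) has_vector_derivative snd y') F"
 by (rule blin_deriv[OF bounded_linear_fst assms]
   blin_deriv[OF bounded_linear_snd assms])+

definition scoef :: "nahm => real => cmat3" where
 "scoef B t = (fst B t, snd B t, par (fst B) t)"

definition spath :: "nahm => (real => cmat3) => nahm" where
 "spath B y = (onI (%t. fst B t + fst (y t)), onI (%t. snd B t + fst (snd (y t))))"

lemma scoef_smooth: "fst B : PP ==> snd B : PP ==> smooth (scoef B)"
 unfolding scoef_def[abs_def] by (intro smooth_Pair path_smooth par_smooth)

lemma slice_solution: assumes B: "fst B : PP" "snd B : PP"
  and y: "!!t. t : II ==> (y has_der slin (scoef B t) (y t) + squad (y t) (y t)) t"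
  and init: "fst (y 0) : sl2" "fst (snd (y 0)) : sl2" "snd (snd (y 0)) = 0"
 shows "smooth y" "t : II ==> fst (y t) : sl2" "t : II ==> fst (snd (y t)) : sl2"
  "fst (spath B y) : PP" "snd (spath B y) : PP"
  "t : II ==> par (fst (spath B y)) t = par (fst B) t + snd (snd (y t))"
proof -
 show sy: "smooth y" by (rule qode_smooth[OF bil_slin bil_squad scoef_smooth[OF B] y])
 have tr: "trace (comm X Y) = 0" for X Y by (simp add: cmat_simps)
 have d1: "((%t. fst (y t)) has_der
   comm (cadj (fst B t)) (fst (y t)) + comm (cadj (snd B t)) (fst (snd (y t)))) t"
  "((%t. fst (snd (y t))) has_der - comm (fst B t) (fst (snd (y t))) + - comm (fst (y t)) (snd B t)
   + - comm (fst (y t)) (fst (snd (y t)))) t"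
  "((%t. snd (snd (y t))) has_der - (fst B t ** snd (snd (y t))) + - (fst (y t) ** par (fst B) t)
   + - (fst (y t) ** snd (snd (y t)))) t"
  if "t : II" for t using hvd_comp(1)[OF y[OF that]]
   hvd_comp[OF hvd_comp(2)[OF y[OF that]]] by (simp_all add: slin_def squad_def scoef_def)
 have t0: "trace (f t) = trace (f 0)" if "t : II"
  "!!t. t : II ==> (f has_der f' t) t" "!!t. t : II ==> trace (f' t) = 0" for f f' :: "real => cmat" and t
  by (rule der_zero_const[OF _ that(1)])
   (use blin_deriv[OF blin_trace that(2)] that(3) in fastforce)
 have neg: "trace (- X) = - trace X" for X :: cmat by (simp add: trace_cmat)
 show s1: "t : II ==> fst (y t) : sl2" for t
 proof -
  assume t: "t : II"
  have "trace (fst (y t)) = trace (fst (y 0))" by (rule t0[of t "%t. fst (y t)", OF t d1(1)]) (simp_all add: trace_add tr)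
  thus ?thesis using init(1) by (simp add: sl2_def)
 qed
 show s2: "t : II ==> fst (snd (y t)) : sl2" for t
 proof -
  assume t: "t : II"
  have "trace (fst (snd (y t))) = trace (fst (snd (y 0)))"
   by (rule t0[of t "%t. fst (snd (y t))", OF t d1(2)]) (simp_all only: trace_add tr neg minus_zero add_0)
  thus ?thesis using init(2) by (simp add: sl2_def)
 qed
 have sl: "X + Y : sl2" if "X : sl2" "Y : sl2" for X Y using that by (simp add: sl2_def trace_add)
 have sm: "smooth (%t. fst B t + fst (y t))" "smooth (%t. snd B t + fst (snd (y t)))"
  by (intro smooth_add path_smooth B smooth_fst smooth_snd sy)+
 show p1: "fst (spath B y) : PP" unfolding spath_def fst_conv
  by (rule on_I_in_paths[OF sm(1)]) (intro sl pathsD(2)[OF B(1)] s1)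
 show "snd (spath B y) : PP" unfolding spath_def snd_conv
  by (rule on_I_in_paths[OF sm(2)]) (intro sl pathsD(2)[OF B(2)] s2)
 show "par (fst (spath B y)) t = par (fst B) t + snd (snd (y t))" if "t : II"
 proof (rule par_unique[OF smooth_cont[OF path_smooth[OF p1]] that, symmetric])
  show "par (fst B) 0 + snd (snd (y 0)) = mat 1" using par_works(1)[OF smooth_cont[OF path_smooth[OF B(1)]]] init(3) by simp
  show "((%t. par (fst B) t + snd (snd (y t))) has_der
    (- fst (spath B y) t) ** (par (fst B) t + snd (snd (y t)))) t" if t: "t : II" for t
   using has_vector_derivative_add[OF par_works(2)[OF smooth_cont[OF path_smooth[OF B(1)]] t] d1(3)[OF t]] t
   by (simp add: spath_def on_I_eq mat_ring algebra_simps)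
 qed
qed

text \<open>The flow yields the differential equations of the slice; what is open are the boundary
  conditions at L. For \<alpha> this is \<open>fin\<close>. For \<beta> it is inherited from
  \<open>B'\<close>, because \<beta> at L is determined by holonomy and initial value and torus
  conjugation preserves its diagonal. The same data produce the gauge equivalence.\<close>

lemma slice_point: assumes B: "B : nahm_data L x0 xL" and B': "B' : nahm_data L x0 xL"
  and y: "!!t. t : II ==> (y has_der slin (scoef B t) (y t) + squad (y t) (y t)) t"
  and init: "y 0 = (a0, b0, 0)" "a0 : t_perp" "b0 : t_perp" and fin: "fst (y L) $ 1 $ 1 = 0"
  and h: "h0 : torus" "hL : torus" and hol: "par (fst B') L = adj2 hL ** (par (fst B) L + snd (snd (y L))) ** h0"
  and beq: "snd B' 0 = adj2 h0 ** (snd B 0 + b0) ** h0"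
 shows "spath B y : coulomb_slice L x0 xL B" "orb (spath B y) = orb B'"
proof -
 obtain al0 be0 where BB: "B = (al0, be0)" by (cases B)
 obtain al' be' where BB': "B' = (al', be')" by (cases B')
 note N = NDD[OF B[unfolded BB]] and N' = NDD[OF B'[unfolded BB']]
 have Bp: "fst B : PP" "snd B : PP" using N BB by auto
 have sl: "fst (y 0) : sl2" "fst (snd (y 0)) : sl2" "snd (snd (y 0)) = 0" using init by (auto simp: t_perp_def)
 note S = slice_solution[OF Bp y sl]
 have S2: "fst (y L) : sl2" and S6: "par (fst (spath B y)) L = par (fst B) L + snd (snd (y L))"
  using S(2)[OF _ ends(2)] S(6)[OF _ ends(2)] by blast+
 define al where "al = fst (spath B y)"
 define be where "be = snd (spath B y)"
 have alq: "al t = al0 t + fst (y t)" "be t = be0 t + fst (snd (y t))" if "t : II" for t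
  using that by (auto simp: al_def be_def spath_def on_I_eq BB)
 have d1: "((%t. fst (y t)) has_der
   comm (cadj (al0 t)) (fst (y t)) + comm (cadj (be0 t)) (fst (snd (y t)))) t"
  "((%t. fst (snd (y t))) has_der - comm (al0 t) (fst (snd (y t))) + - comm (fst (y t)) (be0 t)
   + - comm (fst (y t)) (fst (snd (y t)))) t"
  if "t : II" for t using hvd_comp(1)[OF y[OF that]]
   hvd_comp(1)[OF hvd_comp(2)[OF y[OF that]]] by (simp_all add: slin_def squad_def scoef_def BB)
 have der: "(be has_der - comm (al t) (be t)) t" if t: "t : II" for t
 proof (rule has_der_cong_I[OF t, of "%t. be0 t + fst (snd (y t))"])
  show "((%t. be0 t + fst (snd (y t))) has_der - comm (al t) (be t)) t"
   using has_vector_derivative_add[OF N(9)[OF t] d1(2)[OF t]] by (simp add: alq[OF t] comm_def mat_ring algebra_simps)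
 qed (simp add: alq)
 have alp: "al : PP" "be : PP" unfolding al_def be_def using S(4,5) by blast+
 have hol': "par al' L = adj2 hL ** par al L ** h0" using hol S6 by (simp add: al_def BB')
 have beq': "be' 0 = adj2 h0 ** be 0 ** h0" using beq alq(2)[OF ends(1)] init(1) by (simp add: BB BB')
 have "be' L = adj2 hL ** be L ** hL"
 proof -
  have "be' L = par al' L ** be' 0 ** adj2 (par al' L)" by (rule beta_par[OF N'(1) ends(2) N'(9)])
  also have "\<dots> = adj2 hL ** (par al L ** be 0 ** adj2 (par al L)) ** hL"
   unfolding hol' beq' using torus_det[OF h(1)] by (simp add: adj2_mult mat_ring adj2_cancel)
  also have "par al L ** be 0 ** adj2 (par al L) = be L" by (rule beta_par[OF alp(1) ends(2) der, symmetric])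
  finally show ?thesis .
 qed
 hence bL: "be L $ 1 $ 1 = - \<i> * xL" using torus_conj_diag(1)[OF h(2), of "be L"] N'(7) by simp
 have "(al, be) : nahm_data L x0 xL"
 proof (rule NDI[OF alp])
  show "al 0 : t_perp" using alq(1)[OF ends(1)] N(3) init by (simp add: t_perp_iff)
  show "al L : t_perp" using alq(1)[OF ends(2)] N(4) fin S2 by (simp add: t_perp_iff sl2_iff)
  show "be 0 $ 1 $ 1 = - \<i> * x0" using alq(2)[OF ends(1)] N(5) init by (simp add: t_perp_iff)
 qed (fact bL, fact der)
 moreover have "der (%t. al t - al0 t) t = comm (cadj (al0 t)) (al t - al0 t) + comm (cadj (be0 t)) (be t - be0 t)"
  if t: "t : II" for t
 proof -
  have "der (%t. al t - al0 t) t = der (%t. fst (y t)) t" by (rule der_cong_I[OF t]) (simp add: alq)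
  thus ?thesis using der_eqI[OF t d1(1)[OF t]] alq[OF t] by simp
 qed
 ultimately have "(al, be) : coulomb_slice L x0 xL B" unfolding BB by auto
 thus "spath B y : coulomb_slice L x0 xL B" unfolding al_def be_def by simp
 obtain g where "g : GG" "(al', be') = gact g (al, be)"
  using nahm_gauge_exists[OF `(al, be) \<in> nahm_data L x0 xL` B'[unfolded BB'] h hol' beq'] by blast
 thus "orb (spath B y) = orb B'"
  using orb_gauge_act[OF _ `(al, be) \<in> nahm_data L x0 xL`] unfolding BB' al_def be_def by simp
qed

end


section \<open>Coordinates on the slice near a point\<close>

type_synonym complex6 = "complex \<times> complex \<times> complex \<times> complex \<times> complex \<times> complex"

definition cmul6 :: "complex => complex6 => complex6" where
 "cmul6 c x = (c * fst x, c * fst (snd x), c * fst (snd (snd x)), c * fst (snd (snd (snd x))),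
  c * fst (snd (snd (snd (snd x)))), c * snd (snd (snd (snd (snd x)))))"

definition cmul3 :: "complex => cmat3 => cmat3" where
 "cmul3 c y = (cscale c (fst y), cscale c (fst (snd y)), cscale c (snd (snd y)))"

text \<open>The first four coordinates are the off-diagonal initial values of the variations of
  \<alpha> and \<beta>; the last two, ignored here, are logarithms of torus elements at 0 and at L.
  The variation of the parallel transport starts at 0.\<close>

definition sini :: "complex6 => cmat3" where
 "sini x = (mat2 0 (fst x) (fst (snd x)) 0, mat2 0 (fst (snd (snd x))) (fst (snd (snd (snd x)))) 0, 0)"

lemma blin_sini: "blin sini" unfolding linear_conv_bounded_linear[symmetric]
 by (rule linearI) (simp_all add: sini_def cmat_iff)

lemma sini_cmul: "sini (cmul6 c x) = cmul3 c (sini x)" by (simp add: sini_def cmul6_def cmul3_def cmat_iff)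

lemma blin_cmul3: "blin (cmul3 c)" unfolding cmul3_def[abs_def]
 by (intro bounded_linear_Pair bounded_linear_compose[OF bounded_bilinear.bounded_linear_right[OF bil_cscale]]
   blin_proj)

lemma comm_cscale: "comm X (cscale c Y) = cscale c (comm X Y)" "comm (cscale c X) Y = cscale c (comm X Y)"
 by (simp_all add: cmat_iff comm_nth algebra_simps)

lemma slice_cmul: "slin k (cmul3 c e) = cmul3 c (slin k e)"
 "squad u (cmul3 c e) = cmul3 c (squad u e)" "squad (cmul3 c e) u = cmul3 c (squad e u)"
 by (simp_all add: slin_def squad_def cmul3_def comm_cscale cscale_simps)

lemma cmul3_simps: "cmul3 c (x + y) = cmul3 c x + cmul3 c y" "cmul3 c (x - y) = cmul3 c x - cmul3 c y"
 "cmul3 c (cmul3 d x) = cmul3 (c * d) x" "cmul3 1 x = x" by (simp_all add: cmul3_def cscale_simps)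

lemma has_deriv_times_flip: "(f has_derivative (*) D) F ==> (f has_derivative (%h. h * (D::complex))) F"
 by (erule has_derivative_eq_rhs) (simp add: fun_eq_iff)

lemma has_deriv_exp_mult:
 fixes g u :: "'a::real_normed_vector => complex" assumes "(g has_derivative g') (at x)" "(u has_derivative u') (at x)"
 shows "((%x. exp (g x) * u x) has_derivative (%e. exp (g x) * (g' e * u x + u' e))) (at x)"
proof -
 have "(exp has_derivative (%e. e * exp (g x))) (at (g x))"
  using DERIV_exp[of "g x"] unfolding has_field_derivative_def by (rule has_deriv_times_flip)
 from has_derivative_mult[OF has_derivative_compose[OF assms(1) this] assms(2)]
 show ?thesis by (simp add: algebra_simps)
qed

lemma blin_proj6: "blin (%x::complex6. fst x)" "blin (%x::complex6. fst (snd x))"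
 "blin (%x::complex6. fst (snd (snd x)))" "blin (%x::complex6. fst (snd (snd (snd x))))"
 "blin (%x::complex6. fst (snd (snd (snd (snd x)))))" "blin (%x::complex6. snd (snd (snd (snd (snd x)))))"
 by (simp_all add: linear_conv_bounded_linear[symmetric] linear_iff)

lemma cmul6_quotient: assumes "(x has_derivative (%ze. cmul6 ze e)) (at z0)"
 shows "((%z. cmul6 (1 / (z - z0)) (x z - x z0)) ---> e) (at z0)"
proof -
 have q: "((%z. (1 / (z - z0)) * p (x z - x z0)) ---> p e) (at z0)"
  if p: "blin p" "!!c x. p (cmul6 c x) = c * p x" for p :: "complex6 => complex"
 proof -
  have "((%z. p (x z)) has_derivative (%ze. ze * p e)) (at z0)"
   using bounded_linear.has_derivative[OF p(1) assms] by (simp add: p(2))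
  hence "(DERIV (%z. p (x z)) z0 :> p e)"
   unfolding has_field_derivative_def by (rule has_derivative_eq_rhs) (simp add: fun_eq_iff)
  thus ?thesis by (simp add: has_field_derivative_iff linear_diff[OF bounded_linear.linear[OF p(1)]])
 qed
 have "((%z. cmul6 (1 / (z - z0)) (x z - x z0)) ---> (fst e, fst (snd e), fst (snd (snd e)),
   fst (snd (snd (snd e))), fst (snd (snd (snd (snd e)))), snd (snd (snd (snd (snd e)))))) (at z0)"
  unfolding cmul6_def by (intro tendsto_Pair q blin_proj6) (simp_all add: cmul6_def)
 thus ?thesis by simp
qed

context nahm_params
begin

text \<open>The target of the chart for the datum X: 0 for the boundary condition at L, three
  entries of the holonomy of \<open>of_kron X\<close> (the fourth follows from the determinant), and
  the two off-diagonal entries of its \<beta> at 0.\<close>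

definition kinv :: "kron => complex6" where
 "kinv X = (let a = fst X $ 1 $ 2; b = fst X $ 2 $ 1; c = snd X $ 1 $ 2; d = snd X $ 2 $ 1 in
  (0, stf 0 (a * b) l, - (stf 1 (a * b) l * a), - (stf 1 (a * b) l * b),
   (c + 2 * \<i> * a * ZZ (a * b)) / l, (d - 2 * \<i> * b * ZZ (a * b)) / l))"

lemma stf_diff: assumes "f fdiff (at z)" shows "(%z. stf k (f z) l) fdiff (at z)"
proof -
 have "(%s. stf k s l) holomorphic_on UNIV" unfolding stf_def by (intro holomorphic_intros)
 hence "(%s. stf k s l) fdiff (at (f z))" by (rule) auto
 from field_differentiable_compose[OF assms this] show ?thesis by (simp add: o_def)
qed

lemma ZZ_diff:
 assumes "f fdiff (at z)" "S2 (f z) ~= 0" shows "(%z. ZZ (f z)) fdiff (at z)"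
proof -
 have "ZZ fdiff (at (f z))"
  by (rule holomorphic_on_imp_differentiable_at[OF ZZ_holo S2_nz_open]) (use assms(2) in simp)
 from field_differentiable_compose[OF assms(1) this] show ?thesis by (simp add: o_def)
qed

lemma kinv_diff: assumes d: "!!i j. (%z. fst (c z) $ i $ j) fdiff (at z0)"
  "!!i j. (%z. snd (c z) $ i $ j) fdiff (at z0)" and c: "c z0 : treg"
 obtains s' where "((%z. kinv (c z)) has_derivative (%ze. cmul6 ze s')) (at z0)"
proof -
 define a where "a = (%z. fst (c z) $ 1 $ 2 * fst (c z) $ 2 $ 1)"
 have nz: "S2 (a z0) ~= 0" unfolding a_def by (rule parab_S2) (use c in "simp add: treg_def")
 have a: "a fdiff (at z0)" unfolding a_def by (intro field_differentiable_mult d)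
 note S = stf_diff[OF a] and Z = ZZ_diff[OF a nz]
 have "(%z. stf 0 (a z) l) fdiff (at z0)"
  "(%z. - (stf 1 (a z) l * fst (c z) $ 1 $ 2)) fdiff (at z0)"
  "(%z. - (stf 1 (a z) l * fst (c z) $ 2 $ 1)) fdiff (at z0)"
  "(%z. (snd (c z) $ 1 $ 2 + 2 * \<i> * fst (c z) $ 1 $ 2 * ZZ (a z)) / l) fdiff (at z0)"
  "(%z. (snd (c z) $ 2 $ 1 - 2 * \<i> * fst (c z) $ 2 $ 1 * ZZ (a z)) / l) fdiff (at z0)"
  by (intro S field_differentiable_minus field_differentiable_mult field_differentiable_add field_differentiable_diff
    field_differentiable_divide Z d; simp)+
 then obtain D1 D2 D3 D4 D5 where D: "((%z. stf 0 (a z) l) has_derivative (*) D1) (at z0)"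
  "((%z. - (stf 1 (a z) l * fst (c z) $ 1 $ 2)) has_derivative (*) D2) (at z0)"
  "((%z. - (stf 1 (a z) l * fst (c z) $ 2 $ 1)) has_derivative (*) D3) (at z0)"
  "((%z. (snd (c z) $ 1 $ 2 + 2 * \<i> * fst (c z) $ 1 $ 2 * ZZ (a z)) / l) has_derivative (*) D4) (at z0)"
  "((%z. (snd (c z) $ 2 $ 1 - 2 * \<i> * fst (c z) $ 2 $ 1 * ZZ (a z)) / l) has_derivative (*) D5) (at z0)"
  unfolding field_differentiable_def has_field_derivative_def by blast
 show thesis
 proof (rule that[of "(0, D1, D2, D3, D4, D5)"])
  have e: "kinv (c z) = (0, stf 0 (a z) l, - (stf 1 (a z) l * fst (c z) $ 1 $ 2),
   - (stf 1 (a z) l * fst (c z) $ 2 $ 1), (snd (c z) $ 1 $ 2 + 2 * \<i> * fst (c z) $ 1 $ 2 * ZZ (a z)) / l,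
   (snd (c z) $ 2 $ 1 - 2 * \<i> * fst (c z) $ 2 $ 1 * ZZ (a z)) / l)" for z
   by (simp add: kinv_def Let_def a_def)
  show "((%z. kinv (c z)) has_derivative (%ze. cmul6 ze (0, D1, D2, D3, D4, D5))) (at z0)"
   unfolding e cmul6_def fst_conv snd_conv mult_zero_right
   by (intro has_derivative_Pair has_derivative_const D[THEN has_deriv_times_flip])
 qed
qed

lemma kinv_cont: "cont treg kinv"
proof -
 define a where "a = (%X::kron. fst X $ 1 $ 2 * fst X $ 2 $ 1)"
 have nz: "a X : {s. S2 s ~= 0}" if "X : treg" for X
  using parab_S2[of "a X"] that unfolding a_def treg_def by auto
 have a: "cont treg a" unfolding a_def by (intro continuous_intros)
 have "cont UNIV (%s. stf k s l)" for k
  unfolding stf_def by (intro holomorphic_on_imp_continuous_on holomorphic_intros)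
 from continuous_on_compose2[OF this a] have S: "cont treg (%X. stf k (a X) l)" for k by simp
 have Z: "cont treg (%X. ZZ (a X))"
  by (rule continuous_on_compose2[OF holomorphic_on_imp_continuous_on[OF ZZ_holo] a]) (use nz in blast)
 show ?thesis unfolding kinv_def[abs_def] Let_def using S Z by (auto simp: a_def intro!: continuous_intros)
qed

end

locale slice_flow = nahm_params + quadratic_flow L slin squad "scoef (of_kron A)" r C sol D
 for A :: kron and r C sol D +
 assumes A: "A : TK"
begin

abbreviation B :: nahm where "B == of_kron A"

lemma B_data: "B : ND" by (rule TKD(2)[OF A])

lemma B_paths: "fst B : PP" "snd B : PP" using ND_paths[OF B_data] by auto

lemma bil_flow: "bilin (%p e. slin (fst p) e + (squad (fst (snd p)) e + squad e (snd (snd p))))"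
 by (rule bil_tri[OF bil_slin bil_squad])

lemma coeff_smooth: "smooth (scoef B)" by (rule scoef_smooth[OF B_paths])

lemma sol_smooth: "norm xi < r ==> smooth (sol xi)" by (rule qode_smooth[OF bil_slin bil_squad coeff_smooth sol_deriv])

text \<open>The linearized equation is complex linear, so uniqueness of solutions makes the
  derivative in the initial value complex linear. The inverse function theorem, applied over the
  reals, thereby produces complex derivatives.\<close>

lemma D_cmul: assumes "norm xi < r" "t : II" shows "D xi (cmul3 c ze) t = cmul3 c (D xi ze t)"
proof (rule lode_unique[OF bil_flow _ _ _ _ assms(2), where f = "%t. 0"
   and k = "%t. (scoef B t, sol xi t, sol xi t)"])
 show "cont II (%t. (scoef B t, sol xi t, sol xi t))"
  by (intro smooth_cont smooth_Pair coeff_smooth sol_smooth assms(1))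
 show "(D xi (cmul3 c ze) has_der slin (fst (scoef B t, sol xi t, sol xi t)) (D xi (cmul3 c ze) t) +
   (squad (fst (snd (scoef B t, sol xi t, sol xi t))) (D xi (cmul3 c ze) t) +
   squad (D xi (cmul3 c ze) t) (snd (snd (scoef B t, sol xi t, sol xi t)))) + 0) t"
  if "t : II" for t using D_deriv[OF assms(1) that, of "cmul3 c ze"] by simp
 show "((%t. cmul3 c (D xi ze t)) has_der slin (fst (scoef B t, sol xi t, sol xi t)) (cmul3 c (D xi ze t)) +
   (squad (fst (snd (scoef B t, sol xi t, sol xi t))) (cmul3 c (D xi ze t)) +
   squad (cmul3 c (D xi ze t)) (snd (snd (scoef B t, sol xi t, sol xi t)))) + 0) t"
  if "t : II" for t using blin_deriv[OF blin_cmul3 D_deriv[OF assms(1) that, of ze], of c]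
  by (simp add: slice_cmul cmul3_simps)
 show "D xi (cmul3 c ze) 0 = cmul3 c (D xi ze 0)" by (simp add: D_0[OF assms(1)])
qed

lemma flow_lim: assumes "norm xi0 < r" "(xi ---> xi0) F"
 shows "slim F (%z. sol (xi z)) (sol xi0)" "ev F (%z. norm (xi z) < r)"
proof -
 show ev: "ev F (%z. norm (xi z) < r)" by (rule order_tendstoD(2)[OF tendsto_norm[OF assms(2)] assms(1)])
 have u: "uniform_limit II (%z. sol (xi z)) (sol xi0) F"
 proof (rule uniform_limitI)
  fix ep :: real assume "0 < ep"
  hence "0 < ep / C" using C_pos by simp
  from tendstoD[OF assms(2) this] ev
  show "ev F (%z. ALL t:II. dist (sol (xi z) t) (sol xi0 t) < ep)"
  proof eventually_elim
   case (elim z)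
   show ?case
   proof
    fix t assume "t : II"
    from sol_lip[OF elim(2) assms(1) this] elim(1) C_pos
    show "dist (sol (xi z) t) (sol xi0 t) < ep" by (simp add: dist_norm field_simps)
   qed
  qed
 qed
 show "slim F (%z. sol (xi z)) (sol xi0)"
 proof (rule qode_slim[OF bil_slin bil_squad coeff_smooth _ _ u])
  show "ev F (%z. ALL t:II. (sol (xi z) has_der
    slin (scoef B t) (sol (xi z) t) + squad (sol (xi z) t) (sol (xi z) t)) t)"
   using ev by eventually_elim (use sol_deriv in blast)
 qed (rule sol_deriv[OF assms(1)])
qed

text \<open>The difference quotients solve the equation of \<open>bil_tri\<close> at the two
  solutions with parameters z0 and z; as z tends to z0 it becomes the linearized equation.\<close>

lemma flow_crv:
 assumes "norm (xi z0) < r" and e: "((%z. cmul3 (1 / (z - z0)) (xi z - xi z0)) ---> e) (at z0)" and cont: "(xi ---> xi z0) (at z0)"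
 shows "slim (at z0) (%z t. cmul3 (1 / (z - z0)) (sol (xi z) t - sol (xi z0) t)) (D (xi z0) e)"
proof (rule lode_slim[OF bil_flow, where fn = "%z t. 0" and f = "%t. 0"
   and kn = "%z t. (scoef B t, sol (xi z0) t, sol (xi z) t)" and k = "%t. (scoef B t, sol (xi z0) t, sol (xi z0) t)"])
 note ev = flow_lim(2)[OF assms(1) cont]
 show "slim (at z0) (%z t. (scoef B t, sol (xi z0) t, sol (xi z) t)) (%t. (scoef B t, sol (xi z0) t, sol (xi z0) t))" by (intro slim_Pair slim_const_seq coeff_smooth sol_smooth assms(1)) (rule flow_lim[OF assms(1) cont])
 show "slim (at z0) (%z t. 0) (%t. 0)" by (rule slim_const_seq) simp
 show "((%z. cmul3 (1 / (z - z0)) (sol (xi z) 0 - sol (xi z0) 0)) ---> D (xi z0) e 0) (at z0)"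
 proof (rule Lim_transform_eventually)
  show "((%z. cmul3 (1 / (z - z0)) (xi z - xi z0)) ---> D (xi z0) e 0) (at z0)"
   using e by (simp add: D_0[OF assms(1)])
  show "ev (at z0) (%z. cmul3 (1 / (z - z0)) (xi z - xi z0) = cmul3 (1 / (z - z0)) (sol (xi z) 0 - sol (xi z0) 0))"
   using ev by eventually_elim (simp add: sol_0 assms(1))
 qed
 interpret Q: bounded_bilinear squad by (rule bil_squad)
 interpret S: bounded_bilinear slin by (rule bil_slin)
 show "ev (at z0) (%z. ALL t:II. ((%t. cmul3 (1 / (z - z0)) (sol (xi z) t - sol (xi z0) t)) has_der
   slin (fst (scoef B t, sol (xi z0) t, sol (xi z) t)) (cmul3 (1 / (z - z0)) (sol (xi z) t - sol (xi z0) t)) +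
   (squad (fst (snd (scoef B t, sol (xi z0) t, sol (xi z) t))) (cmul3 (1 / (z - z0)) (sol (xi z) t - sol (xi z0) t)) +
   squad (cmul3 (1 / (z - z0)) (sol (xi z) t - sol (xi z0) t)) (snd (snd (scoef B t, sol (xi z0) t, sol (xi z) t)))) + 0) t)"
  using ev
 proof eventually_elim
  case (elim z)
  show ?case
  proof
   fix t assume t: "t : II"
   from blin_deriv[OF blin_cmul3[of "1 / (z - z0)"]
     has_vector_derivative_diff[OF sol_deriv[OF elim t] sol_deriv[OF assms(1) t]]]
   show "((%t. cmul3 (1 / (z - z0)) (sol (xi z) t - sol (xi z0) t)) has_der
   slin (fst (scoef B t, sol (xi z0) t, sol (xi z) t)) (cmul3 (1 / (z - z0)) (sol (xi z) t - sol (xi z0) t)) +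
   (squad (fst (snd (scoef B t, sol (xi z0) t, sol (xi z) t))) (cmul3 (1 / (z - z0)) (sol (xi z) t - sol (xi z0) t)) +
   squad (cmul3 (1 / (z - z0)) (sol (xi z) t - sol (xi z0) t)) (snd (snd (scoef B t, sol (xi z0) t, sol (xi z) t)))) + 0) t"
    by (simp add: slice_cmul cmul3_simps S.diff_right Q.diff_right Q.diff_left algebra_simps)
  qed
 qed
 show "(D (xi z0) e has_der
   slin (fst (scoef B t, sol (xi z0) t, sol (xi z0) t)) (D (xi z0) e t) +
   (squad (fst (snd (scoef B t, sol (xi z0) t, sol (xi z0) t))) (D (xi z0) e t) +
   squad (D (xi z0) e t) (snd (snd (scoef B t, sol (xi z0) t, sol (xi z0) t)))) + 0) t"
  if "t : II" for t using D_deriv[OF assms(1) that, of e] by simp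
qed

abbreviation "hh x == fst (snd (snd (snd (snd (x::complex6)))))"
abbreviation "kk x == snd (snd (snd (snd (snd (x::complex6)))))"
abbreviation "x3 x == fst (snd (snd (x::complex6)))"
abbreviation "x4 x == fst (snd (snd (snd (x::complex6))))"
abbreviation "M0 == par (fst B) L"
abbreviation "w0 == snd B 0"

text \<open>At the fixed point \<open>A = 0\<close> of the torus, the residual gauge freedom has to be removed by
 hand; elsewhere it is already removed by the first equation.\<close>

definition chi :: complex where "chi = (if fst A = 0 & snd A = 0 then 1 else 0)"

text \<open>The first entry expresses that \<alpha> be off-diagonal at L. The others are holonomy
  and \<beta> at 0 of the point of the slice after the torus elements diag(exp(-hh), exp hh) at 0
  and diag(exp(-kk), exp kk) at L have acted.\<close>

definition chart :: "complex6 => complex6" where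
 "chart x = (fst (sol (sini x) L) $ 1 $ 1 + chi * hh x,
  exp (kk x - hh x) * (M0 $ 1 $ 1 + snd (snd (sol (sini x) L)) $ 1 $ 1),
  exp (kk x + hh x) * (M0 $ 1 $ 2 + snd (snd (sol (sini x) L)) $ 1 $ 2),
  exp (- kk x - hh x) * (M0 $ 2 $ 1 + snd (snd (sol (sini x) L)) $ 2 $ 1),
  exp (2 * hh x) * (w0 $ 1 $ 2 + x3 x), exp (- 2 * hh x) * (w0 $ 2 $ 1 + x4 x))"

definition chartD :: "complex6 => complex6 => complex6" where
 "chartD x e = (fst (D (sini x) (sini e) L) $ 1 $ 1 + chi * hh e,
  exp (kk x - hh x) * ((kk e - hh e) * (M0 $ 1 $ 1 + snd (snd (sol (sini x) L)) $ 1 $ 1)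
   + snd (snd (D (sini x) (sini e) L)) $ 1 $ 1),
  exp (kk x + hh x) * ((kk e + hh e) * (M0 $ 1 $ 2 + snd (snd (sol (sini x) L)) $ 1 $ 2)
   + snd (snd (D (sini x) (sini e) L)) $ 1 $ 2),
  exp (- kk x - hh x) * ((- kk e - hh e) * (M0 $ 2 $ 1 + snd (snd (sol (sini x) L)) $ 2 $ 1)
   + snd (snd (D (sini x) (sini e) L)) $ 2 $ 1),
  exp (2 * hh x) * ((2 * hh e) * (w0 $ 1 $ 2 + x3 x) + x3 e),
  exp (- 2 * hh x) * ((- 2 * hh e) * (w0 $ 2 $ 1 + x4 x) + x4 e))"

definition chart_dom :: "complex6 set" where "chart_dom = {x. norm (sini x) < r}"

lemma open_chart_dom: "open chart_dom" unfolding chart_dom_def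
 by (intro open_Collect_less continuous_intros linear_continuous_on blin_sini)

lemma sini_0 [simp]: "sini 0 = 0" by (simp add: bounded_linear.linear[OF blin_sini] linear_0)

lemma zero_in_chart_dom: "0 : chart_dom" using r_pos by (simp add: chart_dom_def)

lemma sol_init_deriv: assumes "x : chart_dom"
 shows "((%x. sol (sini x) L) has_derivative (%e. D (sini x) (sini e) L)) (at x)"
 using has_derivative_compose[OF bounded_linear_imp_has_derivative[OF blin_sini] sol_has_derivative]
  assms by (simp add: chart_dom_def)

lemma chart_deriv: assumes x: "x : chart_dom" shows "(chart has_derivative chartD x) (at x)"
proof -
 note d = sol_init_deriv[OF x]
 have n: "blin (%y::cmat3. fst y $ 1 $ 1)" "blin (%y::cmat3. snd (snd y) $ i $ j)" for i j
  using bounded_linear_compose[OF blin_nth2 blin_proj(1)]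
   bounded_linear_compose[OF blin_nth2 blin_proj(3)] by auto
 note pr = bounded_linear_imp_has_derivative[OF blin_proj6(3)]
  bounded_linear_imp_has_derivative[OF blin_proj6(4)]
  bounded_linear_imp_has_derivative[OF blin_proj6(5)]
  bounded_linear_imp_has_derivative[OF blin_proj6(6)]
 have m: "((%x. M0 $ i $ j + snd (snd (sol (sini x) L)) $ i $ j) has_derivative
   (%e. snd (snd (D (sini x) (sini e) L)) $ i $ j)) (at x)" for i j
  using has_derivative_add[OF has_derivative_const bounded_linear.has_derivative[OF n(2) d]] by simp
 have w: "((%x. w0 $ i $ j + x3 x) has_derivative x3) (at x)" "((%x. w0 $ i $ j + x4 x) has_derivative x4) (at x)" for i j
  using has_derivative_add[OF has_derivative_const pr(1)] has_derivative_add[OF has_derivative_const pr(2)] by auto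
 have k: "((%x. kk x - hh x) has_derivative (%x. kk x - hh x)) (at x)"
  "((%x. kk x + hh x) has_derivative (%x. kk x + hh x)) (at x)"
  "((%x. - kk x - hh x) has_derivative (%x. - kk x - hh x)) (at x)" "((%x. 2 * hh x) has_derivative (%x. 2 * hh x)) (at x)"
  "((%x. - 2 * hh x) has_derivative (%x. - 2 * hh x)) (at x)" "((%x. chi * hh x) has_derivative (%x. chi * hh x)) (at x)"
  by (intro has_derivative_diff has_derivative_add has_derivative_minus has_derivative_mult_right pr)+
 show ?thesis unfolding chart_def[abs_def] chartD_def[abs_def]
  by (rule has_derivative_Pair[OF has_derivative_add[OF bounded_linear.has_derivative[OF n(1) d] k(6)]
    has_derivative_Pair[OF has_deriv_exp_mult[OF k(1) m] has_derivative_Pair[OF has_deriv_exp_mult[OF k(2) m]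
    has_derivative_Pair[OF has_deriv_exp_mult[OF k(3) m]
    has_derivative_Pair[OF has_deriv_exp_mult[OF k(4) w(1)] has_deriv_exp_mult[OF k(5) w(2)]]]]]])
qed

lemma chartD_cont: "cont chart_dom (%x. chartD x e)"
proof -
 have i: "cont chart_dom sini" by (rule linear_continuous_on[OF blin_sini])
 have s: "cont chart_dom (%x. sol (sini x) L)"
  using sol_init_deriv has_derivative_continuous by (blast intro: continuous_at_imp_continuous_on)
 have d: "cont chart_dom (%x. D (sini x) (sini e) L)"
  by (rule continuous_on_compose2[OF D_continuous i]) (auto simp: chart_dom_def)
 show ?thesis unfolding chartD_def by (intro continuous_intros s d)
qed

lemma chartD_cmul: assumes "x : chart_dom" shows "chartD x (cmul6 c e) = cmul6 c (chartD x e)"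
 unfolding chartD_def sini_cmul D_cmul[OF assms[unfolded chart_dom_def mem_Collect_eq] ends(2)]
 by (simp add: cmul6_def cmul3_def algebra_simps)

lemma A_kdat:
 obtains a b c d where "A = kdat a b c d" "a * b * l^2 : parab" "kdat a b c d : KD"
 using A unfolding TK_eq by blast

lemma chart_0: "chart 0 = kinv A"
proof -
 obtain a b c d where Ab: "A = kdat a b c d" "a * b * l^2 : parab" "kdat a b c d : KD" by (rule A_kdat)
 have "M0 = hol a b l" using holon_of_kron[of a b c d] by (simp add: holon_def Ab)
 moreover have "w0 = mat2 (- \<i> * x0) ((c + 2 * \<i> * a * ZZ (a * b)) / l) ((d - 2 * \<i> * b * ZZ (a * b)) / l) (\<i> * x0)"
  unfolding Ab by (rule beta0_of_kron[OF parab_S2[OF Ab(2)]])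
 moreover have "kinv A = (0, stf 0 (a * b) l, - (stf 1 (a * b) l * a), - (stf 1 (a * b) l * b),
   (c + 2 * \<i> * a * ZZ (a * b)) / l, (d - 2 * \<i> * b * ZZ (a * b)) / l)"
  by (simp add: kinv_def Ab)
 ultimately show ?thesis by (simp add: chart_def hol_def sol_zero[OF ends(2)])
qed

lemma A_zero_diag:
 assumes "chi ~= 0" shows "t : II ==> fst B t = 0" "t : II ==> snd B t = mat2 (- \<i> * x0) 0 0 (\<i> * x0)"
proof -
 obtain a b c d where Ab: "A = kdat a b c d" "a * b * l^2 : parab" "kdat a b c d : KD" by (rule A_kdat)
 have z: "a = 0" "b = 0" "c = 0" "d = 0"
 proof -
  have "fst A = 0 & snd A = 0" using assms by (auto simp: chi_def split: if_splits)
  thus "a = 0" "b = 0" "c = 0" "d = 0" unfolding Ab(1) by (simp_all add: cmat_iff)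
 qed
 have x: "zfun 0 (complex_of_real t) = x0" for t using Ab(3) z unfolding sol_s0(1) by (simp add: field_simps) (simp add: kdat_in_KD)
 show "t : II ==> fst B t = 0" "t : II ==> snd B t = mat2 (- \<i> * x0) 0 0 (\<i> * x0)"
  unfolding Ab z of_kron_kdat nahm_sol_def by (simp_all add: on_I_eq cmat_iff x)
qed

text \<open>At A = 0 the base point has \<alpha> = 0 and diagonal \<beta>, so the diagonal of a'
  vanishes. The boundary condition at L then holds automatically, and the first entry of the chart
  reduces to hh, removing the freedom left by the torus.\<close>

lemma diag_comp: assumes "chi ~= 0" and y: "!!t. t : II ==> (y has_der slin (scoef B t) (y t) + q t) t"
  "!!t. t : II ==> fst (q t) = 0" "fst (y 0) $ 1 $ 1 = 0" shows "fst (y L) $ 1 $ 1 = 0"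
proof -
 have "((%t. fst (y t) $ 1 $ 1) has_der 0) t" if t: "t : II" for t
  using blin_deriv[OF blin_nth2 hvd_comp(1)[OF y(1)[OF t]], of 1 1]
  by (simp add: slin_def scoef_def A_zero_diag[OF assms(1) t] y(2)[OF t] comm_nth)
 from der_zero_const[OF this ends(2)] show ?thesis using y(3) by simp
qed

text \<open>A kernel vector is a solution of the linearized slice equations whose boundary values
  are those of infinitesimal torus elements H at 0 and H' at L. Rigidity kills the solution, and
  only a torus direction fixing the base point could survive.\<close>

lemma chart_inj: assumes e: "chartD 0 e = 0" shows "e = 0"
proof -
 obtain a b c d where Ab: "A = kdat a b c d" "a * b * l^2 : parab" "kdat a b c d : KD" by (rule A_kdat)
 have M: "M0 = hol a b l" using holon_of_kron[of a b c d] by (simp add: holon_def Ab)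
 have w: "w0 = mat2 (- \<i> * x0) ((c + 2 * \<i> * a * ZZ (a * b)) / l) ((d - 2 * \<i> * b * ZZ (a * b)) / l) (\<i> * x0)"
  unfolding Ab by (rule beta0_of_kron[OF parab_S2[OF Ab(2)]])
 have "S2 (a * b) ~= 0" by (rule parab_S2[OF Ab(2)])
 hence nz: "stf 0 (a * b) l ~= 0" "stf 1 (a * b) l ~= 0" by (auto simp: S2_factor)
 define y where "y = D 0 (sini e)"
 have yd: "(y has_der slin (scoef B t) (y t) + 0) t" if "t : II" for t
  using D_deriv[of 0 t "sini e"] that r_pos sol_zero[OF that] by (simp add: y_def squad_def comm_def zero_prod_def)
 have y0: "y 0 = sini e" using D_0[of 0] r_pos by (simp add: y_def)
 have d1: "((%t. fst (y t)) has_der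
   comm (cadj (fst B t)) (fst (y t)) + comm (cadj (snd B t)) (fst (snd (y t)))) t"
  "((%t. fst (snd (y t))) has_der - comm (fst B t) (fst (snd (y t))) + - comm (fst (y t)) (snd B t)) t"
  "((%t. snd (snd (y t))) has_der - (fst B t ** snd (snd (y t))) + - (fst (y t) ** par (fst B) t)) t"
  if "t : II" for t using hvd_comp(1)[OF yd[OF that]]
   hvd_comp[OF hvd_comp(2)[OF yd[OF that]]] by (simp_all add: slin_def scoef_def)
 have tr: "trace (fst (y L)) = 0"
 proof -
  have "((%t. trace (fst (y t))) has_der 0) t" if "t : II" for t
   using blin_deriv[OF blin_trace d1(1)[OF that]] by (simp add: cmat_simps)
  from der_zero_const[OF this ends(2)] show ?thesis by (simp add: y0 sini_def trace_cmat)
 qed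
 \<comment> \<open>To first order the determinant of the transport stays 1. This supplies the (2,2)
   entry of its variation, which is not a coordinate of the chart.\<close>
 have tp: "trace (adj2 M0 ** snd (snd (y L))) = 0"
 proof -
  note s0 = path_smooth[OF B_paths(1)]
  have "((%t. trace (adj2 (par (fst B) t) ** snd (snd (y t)))) has_der 0) t" if t: "t : II" for t
  proof -
   have "trace (fst (y t)) = 0"
   proof -
    have "((%t. trace (fst (y t))) has_der 0) t" if "t : II" for t
     using blin_deriv[OF blin_trace d1(1)[OF that]] by (simp add: cmat_simps)
    from der_zero_const[OF this t] show ?thesis by (simp add: y0 sini_def trace_cmat)
   qed
   moreover have "trace (adj2 P ** (fst (y t) ** P)) = det P * trace (fst (y t))" for P
    by (simp add: cmat_simps algebra_simps)
   moreover have "trace (- X) = - trace X" for X :: cmat by (simp add: trace_cmat)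
   ultimately show ?thesis using blin_deriv[OF blin_trace
      has_der_mmult[OF adj2_par_deriv[OF s0 t pathsD(2)[OF B_paths(1) t]] d1(3)[OF t]]] by (simp add: mat_ring)
  qed
  from der_zero_const[OF this ends(2)] show ?thesis by (simp add: y0 sini_def trace_cmat)
 qed
 define H where "H = mat2 (hh e) 0 0 (- hh e)"
 define H' where "H' = mat2 (kk e) 0 0 (- kk e)"
 have E: "fst (y L) $ 1 $ 1 + chi * hh e = 0" "(kk e - hh e) * M0 $ 1 $ 1 + snd (snd (y L)) $ 1 $ 1 = 0"
  "(kk e + hh e) * M0 $ 1 $ 2 + snd (snd (y L)) $ 1 $ 2 = 0" "(- kk e - hh e) * M0 $ 2 $ 1 + snd (snd (y L)) $ 2 $ 1 = 0"
  "(2 * hh e) * w0 $ 1 $ 2 + x3 e = 0" "(- 2 * hh e) * w0 $ 2 $ 1 + x4 e = 0"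
  using e unfolding chartD_def sini_0 y_def[symmetric] sol_zero[OF ends(2)] by (simp_all add: zero_prod_def)
 have epq: "snd (snd (y L)) $ 1 $ 1 = (hh e - kk e) * M0 $ 1 $ 1" "snd (snd (y L)) $ 1 $ 2 = - (kk e + hh e) * M0 $ 1 $ 2"
  "snd (snd (y L)) $ 2 $ 1 = (kk e + hh e) * M0 $ 2 $ 1" "x3 e = - (2 * hh e) * w0 $ 1 $ 2" "x4 e = 2 * hh e * w0 $ 2 $ 1"
  using E(2-6) by (simp_all add: add_eq_0_iff2 algebra_simps)
 have p22: "snd (snd (y L)) $ 2 $ 2 = (kk e - hh e) * M0 $ 2 $ 2"
 proof -
  have "M0 $ 1 $ 1 * (snd (snd (y L)) $ 2 $ 2 - (kk e - hh e) * M0 $ 2 $ 2) = 0"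
   using tp epq by (simp add: cmat_simps algebra_simps)
  thus ?thesis using nz by (simp add: M hol_def)
 qed
 have fin: "snd (snd (y L)) = M0 ** H - H' ** M0"
  unfolding cmat_iff H_def H'_def using epq p22 by (simp add: mult_nth algebra_simps)
 have ini: "fst (snd (y 0)) = comm w0 H" unfolding y0 sini_def H_def cmat_iff using epq(4,5) by (simp add: comm_nth)
 have aL: "fst (y L) $ 1 $ 1 = 0"
 proof (cases "chi = 0")
  case True
  thus ?thesis using E(1) by simp
 next
  case False
  show ?thesis by (rule diag_comp[OF False yd]) (simp_all add: y0 sini_def)
 qed
 have cc: "chi * hh e = 0" using E(1) aL by simp
 have t1: "trace (cadj (fst (y 0)) ** H) = 0" unfolding y0 sini_def H_def by (simp add: cmat_simps)
 have t2: "trace (cadj (fst (y L)) ** H') = 0" unfolding H'_def using aL tr by (simp add: cmat_simps)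
 have p0: "snd (snd (y 0)) = 0" by (simp add: y0 sini_def)
 note N = NDD(9)[of "fst B" "snd B", unfolded prod.collapse, OF B_data]
 note R = slice_rigidity[OF B_paths(1) path_smooth[OF B_paths(2)] N d1 p0 ini t1 fin t2]
 have "fst (y 0) = 0" "fst (snd (y 0)) = 0" "snd (snd (y L)) = 0" using R ends by blast+
 hence z: "fst e = 0" "fst (snd e) = 0" "x3 e = 0" "x4 e = 0" "snd (snd (y L)) = 0"
  unfolding y0 sini_def by (simp_all add: cmat_iff)
 have k: "kk e = hh e" using epq(1) z(5) nz by (simp add: M hol_def)
 \<comment> \<open>A nonzero common torus direction would fix the holonomy and \<beta> at 0 and
   hence force A = 0; but there the additional term of the chart gives hh = 0.\<close>
 have "hh e = 0"
 proof (rule ccontr)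
  assume h: "hh e ~= 0"
  have "a = 0" "b = 0" using epq(2,3) z(5) h k nz by (simp_all add: M hol_def)
  moreover have "w0 $ 1 $ 2 = 0" "w0 $ 2 $ 1 = 0" using epq(4,5) z(3,4) h by auto
  ultimately have "A = kdat 0 0 0 0" using w by (simp add: Ab)
  hence "fst A = 0 & snd A = 0" unfolding kdat_def by (simp add: cmat_iff)
  thus False using cc h by (simp add: chi_def)
 qed
 thus "e = 0" using z(1-4) k by (simp add: prod_eq_iff)
qed

lemma sol_sini: assumes "x : chart_dom" shows "norm (sini x) < r"
  "fst (sol (sini x) 0) : sl2" "fst (snd (sol (sini x) 0)) : sl2" "snd (snd (sol (sini x) 0)) = 0"
 using assms sol_0[of "sini x"] by (simp_all add: chart_dom_def sini_def sl2_iff)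

lemma spaths: assumes "x : chart_dom"
 shows "fst (spath B (sol (sini x))) : PP" "snd (spath B (sol (sini x))) : PP"
  "t : II ==> fst (sol (sini x) t) : sl2" "t : II ==> fst (snd (sol (sini x) t)) : sl2"
 using slice_solution(2-5)[OF B_paths sol_deriv[OF sol_sini(1)[OF assms]] sol_sini(2-4)[OF assms]] by blast+

lemma spath_lim: assumes x: "y0 : chart_dom" "(x ---> y0) F"
 shows "limitin NS (%z. spath B (sol (sini (x z)))) (spath B (sol (sini y0))) F"
proof -
 have t: "((%z. sini (x z)) ---> sini y0) F" by (rule bounded_linear.tendsto[OF blin_sini x(2)])
 note S = flow_lim(1)[OF sol_sini(1)[OF x(1)] t]
 have ev: "ev F (%z. x z : chart_dom)" by (rule topological_tendstoD[OF x(2) open_chart_dom x(1)])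
 have 1: "slim F (%z t. fst B t + fst (sol (sini (x z)) t)) (%t. fst B t + fst (sol (sini y0) t))"
  "slim F (%z t. snd B t + fst (snd (sol (sini (x z)) t))) (%t. snd B t + fst (snd (sol (sini y0) t)))"
  by (rule slim_add[OF slim_const_seq[OF path_smooth[OF B_paths(1)]] slim_linear[OF blin_proj(1) S]]
    slim_add[OF slim_const_seq[OF path_smooth[OF B_paths(2)]] slim_linear[OF blin_proj(2) S]])+
 have "ev F (%z. ALL t:II. fst B t + fst (sol (sini (x z)) t) : sl2)"
  "ev F (%z. ALL t:II. snd B t + fst (snd (sol (sini (x z)) t)) : sl2)"
  using ev by (eventually_elim, use spaths(3,4) pathsD(2)[OF B_paths(1)] pathsD(2)[OF B_paths(2)]
   in "simp add: sl2_iff del: atLeastAtMost_iff")+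
 from limitin_onI[OF 1(1) this(1)] limitin_onI[OF 1(2) this(2)]
 show ?thesis using spaths(1,2)[OF x(1)] unfolding limitin_NS spath_def by simp
qed

lemma spath_crv: assumes x: "x z0 : chart_dom" "(x has_derivative (%ze. cmul6 ze e)) (at z0)"
 shows "EX r v. limitin NS r v (at z0) &
  (ev (at z0) (%z. spath B (sol (sini (x z))) = nahm_line (spath B (sol (sini (x z0)))) (z - z0) (r z)))"
proof -
 let ?xi = "%z. sini (x z)"
 have cont: "(x ---> x z0) (at z0)" using has_derivative_continuous[OF x(2)] by (simp add: continuous_at)
 hence xi: "(?xi ---> ?xi z0) (at z0)" by (rule bounded_linear.tendsto[OF blin_sini])
 have "((%z. sini (cmul6 (1 / (z - z0)) (x z - x z0))) ---> sini e) (at z0)"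
  by (rule bounded_linear.tendsto[OF blin_sini cmul6_quotient[OF x(2)]])
 hence q: "((%z. cmul3 (1 / (z - z0)) (?xi z - ?xi z0)) ---> sini e) (at z0)"
  by (simp add: sini_cmul linear_diff[OF bounded_linear.linear[OF blin_sini]])
 define Q where "Q = (%z t. cmul3 (1 / (z - z0)) (sol (?xi z) t - sol (?xi z0) t))"
 define w where "w = D (?xi z0) (sini e)"
 have S: "slim (at z0) Q w" unfolding Q_def w_def by (rule flow_crv[OF sol_sini(1)[OF x(1)] q xi])
 note S1 = slim_linear[OF blin_proj(1) S] and S2 = slim_linear[OF blin_proj(2) S]
 have ev: "ev (at z0) (%z. x z : chart_dom)" by (rule topological_tendstoD[OF cont open_chart_dom x(1)])
 have sl: "fst (Q z t) : sl2 & fst (snd (Q z t)) : sl2" if "x z : chart_dom" "t : II" for z t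
 proof -
  have c: "cscale k (X - Y) : sl2" if "X : sl2" "Y : sl2" for k X Y
   using that by (simp add: sl2_iff algebra_simps)
  show ?thesis using c spaths(3,4)[OF that] spaths(3,4)[OF x(1) that(2)] by (simp add: Q_def cmul3_def)
 qed
 let ?r = "%z. (onI (%t. fst (Q z t)), onI (%t. fst (snd (Q z t))))"
 let ?v = "(onI (%t. fst (w t)), onI (%t. fst (snd (w t))))"
 have "ev (at z0) (%z. ALL t:II. fst (Q z t) : sl2)" "ev (at z0) (%z. ALL t:II. fst (snd (Q z t)) : sl2)"
  using ev by (eventually_elim, use sl in blast)+
 from limitin_onI[OF S1 this(1)] limitin_onI[OF S2 this(2)] have "limitin NS ?r ?v (at z0)" unfolding limitin_NS by simp
 moreover have "ev (at z0) (%z. spath B (sol (?xi z)) = nahm_line (spath B (sol (?xi z0))) (z - z0) (?r z))"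
 proof eventually_elim
  case (elim z) have e: "cscale (z - z0) (fst (Q z t)) = fst (sol (?xi z) t) - fst (sol (?xi z0) t)"
   "cscale (z - z0) (fst (snd (Q z t))) = fst (snd (sol (?xi z) t)) - fst (snd (sol (?xi z0) t))" for t
   by (simp_all add: Q_def cmul3_def cscale_simps)
  show ?case by (simp add: spath_def on_I_def fun_eq_iff e cscale_simps)
 qed
 ultimately show ?thesis by blast
qed

text \<open>Equality with \<open>kinv X\<close> says that the point of the slice and
  \<open>of_kron X\<close> have the same holonomy and initial value up to the torus elements encoded
  in the last two coordinates.\<close>

lemma slice_chart_point: assumes X: "X : KD" "X : treg" and x: "x : chart_dom" "chart x = kinv X"
 shows "spath B (sol (sini x)) : slice B" "orb (spath B (sol (sini x))) = orb (of_kron X)"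
proof -
 have XK: "X : TK" using X by (simp add: TK_Int)
 then obtain a b c d where Xb: "X = kdat a b c d" "a * b * l^2 : parab" unfolding TK_eq by blast
 define B' where "B' = of_kron X"
 have B': "B' : ND" unfolding B'_def by (rule TKD(2)[OF XK])
 have M': "par (fst B') L = hol a b l" using holon_of_kron[of a b c d] by (simp add: holon_def B'_def Xb)
 have w': "snd B' 0 = mat2 (- \<i> * x0) ((c + 2 * \<i> * a * ZZ (a * b)) / l) ((d - 2 * \<i> * b * ZZ (a * b)) / l) (\<i> * x0)"
  unfolding B'_def Xb by (rule beta0_of_kron[OF parab_S2[OF Xb(2)]])
 have "S2 (a * b) ~= 0" by (rule parab_S2[OF Xb(2)])
 hence nz: "stf 0 (a * b) l ~= 0" by (auto simp: S2_factor)
 define y where "y = sol (sini x)"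
 have yd: "(y has_der slin (scoef B t) (y t) + squad (y t) (y t)) t"
  if "t : II" for t unfolding y_def by (rule sol_deriv[OF sol_sini(1)[OF x(1)] that])
 have y0: "y 0 = sini x" unfolding y_def by (rule sol_0[OF sol_sini(1)[OF x(1)]])
 have T: "par (fst (spath B y)) L = M0 + snd (snd (y L))"
  using slice_solution(6)[OF B_paths yd, of L] sol_sini(2-4)[OF x(1)] ends(2) by (simp add: y_def)
 have dM: "det (M0 + snd (snd (y L))) = 1"
  using par_det[OF path_smooth[OF spaths(1)[OF x(1)]] pathsD(2)[OF spaths(1)[OF x(1)]] ends(2)] T by (simp add: y_def)
 have dM': "det (hol a b l) = 1"
  unfolding M'[symmetric] using ND_paths[OF B'] ends(2) by (intro par_det path_smooth pathsD(2)) auto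
 define h0 where "h0 = mat2 (exp (- hh x)) 0 0 (exp (hh x))"
 define hL where "hL = mat2 (exp (- kk x)) 0 0 (exp (kk x))"
 have h: "h0 : torus" "hL : torus" by (simp_all add: h0_def hL_def torus_iff exp_minus_inverse mult.commute)
 have E: "fst (y L) $ 1 $ 1 + chi * hh x = 0" "exp (kk x - hh x) * (M0 + snd (snd (y L))) $ 1 $ 1 = hol a b l $ 1 $ 1"
  "exp (kk x + hh x) * (M0 + snd (snd (y L))) $ 1 $ 2 = hol a b l $ 1 $ 2"
  "exp (- kk x - hh x) * (M0 + snd (snd (y L))) $ 2 $ 1 = hol a b l $ 2 $ 1"
  "exp (2 * hh x) * (w0 $ 1 $ 2 + x3 x) = snd B' 0 $ 1 $ 2" "exp (- 2 * hh x) * (w0 $ 2 $ 1 + x4 x) = snd B' 0 $ 2 $ 1"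
  using x(2) unfolding chart_def kinv_def y_def[symmetric] w' by (simp_all add: Xb hol_def)
 have fin: "fst (y L) $ 1 $ 1 = 0"
 proof (cases "chi = 0")
  case True
  thus ?thesis using E(1) by simp
 next
  case False
  show ?thesis by (rule diag_comp[OF False yd]) (simp_all add: squad_def y0 sini_def)
 qed
 \<comment> \<open>Three entries agree by the chart; the fourth follows from both determinants being
   1, since the entry \<open>stf 0\<close> is nonzero.\<close>
 define N where "N = adj2 hL ** (M0 + snd (snd (y L))) ** h0"
 have Ne: "N $ 1 $ 1 = hol a b l $ 1 $ 1" "N $ 1 $ 2 = hol a b l $ 1 $ 2" "N $ 2 $ 1 = hol a b l $ 2 $ 1"
  using E(2-4) by (simp_all add: N_def hL_def h0_def mult_nth exp_add exp_diff exp_minus field_simps)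
 have "det N = 1" unfolding N_def using dM torus_det[OF h(1)] torus_det[OF h(2)] by (simp add: det_mul)
 hence "hol a b l $ 1 $ 1 * N $ 2 $ 2 = hol a b l $ 1 $ 1 * hol a b l $ 2 $ 2"
  using dM' Ne by (simp add: det_cmat algebra_simps)
 hence "N $ 2 $ 2 = hol a b l $ 2 $ 2" using nz by (simp add: hol_def)
 with Ne have hol: "par (fst B') L = adj2 hL ** (M0 + snd (snd (y L))) ** h0"
  unfolding M' N_def[symmetric] by (simp add: cmat_iff)
 have B0: "w0 $ 1 $ 1 = - \<i> * x0" "w0 $ 2 $ 2 = \<i> * x0"
  using NDD(5,6)[of "fst B" "snd B", unfolded prod.collapse, OF B_data] by auto
 have beq: "snd B' 0 = adj2 h0 ** (w0 + mat2 0 (x3 x) (x4 x) 0) ** h0" unfolding cmat_iff torus_conj_diag[OF h(1)]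
  using E(5,6) B0 by (simp add: w' h0_def power2_eq_square field_simps flip: exp_add)
 have "y 0 = (mat2 0 (fst x) (fst (snd x)) 0, mat2 0 (x3 x) (x4 x) 0, 0)" by (simp add: y0 sini_def)
 from slice_point[OF B_data B' yd this _ _ fin h hol beq]
 show "spath B (sol (sini x)) : slice B" "orb (spath B (sol (sini x))) = orb (of_kron X)"
  unfolding y_def[symmetric] B'_def[symmetric] by (simp_all add: t_perp_iff)
qed

end

context nahm_params
begin

text \<open>A local lift \<open>ka\<close> of the map of moduli spaces to the Coulomb slice. It is
  defined on a full neighbourhood in the ambient matrix space, but lies in the slice only over
  \<open>KD\<close>. The last clause is complex differentiability along curves in the form that
  \<open>amb_holo_nahm_crv\<close> consumes.\<close>

lemma slice_chart_exists: assumes A: "A : TK"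
 obtains N ka where "open N" "A : N" "N \<subseteq> treg" "ka A = of_kron A" "continuous_map (top_of_set N) NS ka"
  "!!X. X : N ==> X : KD ==> ka X : slice (of_kron A)"
  "!!X. X : N ==> X : KD ==> orb (ka X) = orb (of_kron X)"
  "!!c z0. c z0 : N ==> (!!i j. (%z. fst (c z) $ i $ j) fdiff (at z0)) ==>
   (!!i j. (%z. snd (c z) $ i $ j) fdiff (at z0)) ==>
   EX r v. limitin NS r v (at z0) & (ev (at z0) (%z. ka (c z) = nahm_line (ka (c z0)) (z - z0) (r z)))"
proof -
 have Bp: "fst (of_kron A) : PP" "snd (of_kron A) : PP" using ND_paths[OF TKD(2)[OF A]] by auto
 obtain r C sol D where F: "quadratic_flow L slin squad (scoef (of_kron A)) r C sol D"
  using qode_flow[OF bil_slin bil_squad smooth_cont[OF scoef_smooth[OF Bp]]] by blast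
 interpret S: slice_flow L x0 xL r0 rL A r C sol D by (intro slice_flow.intro F nahm_params_axioms slice_flow_axioms.intro A)
 obtain V g g' where V: "open V" "S.chart 0 : V" "g (S.chart 0) = 0" "!!y. y : V ==> g y : S.chart_dom & S.chart (g y) = y"
  "!!y. y : V ==> (g has_derivative g' y) (at y)"
  "!!y e. y : V ==> S.chartD (g y) (g' y e) = e" "!!y e. y : V ==> g' y (S.chartD (g y) e) = e"
  using inverse_function_diff[OF S.open_chart_dom S.zero_in_chart_dom S.chart_deriv S.chartD_cont S.chart_inj] by blast
 define N where "N = treg \<inter> kinv -` V"
 define ka where "ka = (%X. spath (of_kron A) (sol (sini (g (kinv X)))))"
 have oN: "open N" unfolding N_def by (rule continuous_open_preimage[OF kinv_cont open_treg V(1)])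
 have iV: "kinv X : V" if "X : N" for X using that by (simp add: N_def)
 have "A : N" using A V(2) by (simp add: N_def TK_Int S.chart_0)
 moreover have "ka A = of_kron A"
 proof -
  have e: "sini (g (kinv A)) = 0" using V(3) by (simp add: S.chart_0)
  show ?thesis unfolding ka_def e
   by (simp add: spath_def prod_eq_iff on_I_def fun_eq_iff pathsD(3)[OF Bp(1)] pathsD(3)[OF Bp(2)] S.sol_zero)
 qed
 moreover have "continuous_map (top_of_set N) NS ka" unfolding continuous_map_atin
 proof
  fix X assume "X : topspace (top_of_set N)"
  hence X: "X : N" by simp
  let ?F = "atin (top_of_set N) X"
  have "limitin (top_of_set N) (%x. x) X ?F" by (rule atin_self_limit) (use X in simp)
  hence 1: "((%x. x) ---> X) ?F" unfolding limitin_subtopology by auto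
  have "isCont kinv X" using kinv_cont X open_treg continuous_on_eq_continuous_at by (auto simp: N_def)
  moreover have "isCont g (kinv X)" using has_derivative_continuous[OF V(5)[OF iV[OF X]]] .
  ultimately have "((%X. g (kinv X)) ---> g (kinv X)) ?F"
   by (intro isCont_tendsto_compose[of _ g] isCont_tendsto_compose[of _ kinv] 1)
  thus "limitin NS ka (ka X) ?F" unfolding ka_def by (rule S.spath_lim[OF conjunct1[OF V(4)[OF iV[OF X]]]])
 qed
 moreover have "ka X : slice (of_kron A)" "orb (ka X) = orb (of_kron X)" if "X : N" "X : KD" for X
  using S.slice_chart_point[OF that(2)] V(4)[OF iV[OF that(1)]] that(1) unfolding N_def ka_def by blast+
 moreover have "EX r v. limitin NS r v (at z0) & (ev (at z0) (%z. ka (c z) = nahm_line (ka (c z0)) (z - z0) (r z)))"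
  if c: "c z0 : N" "!!i j. (%z. fst (c z) $ i $ j) fdiff (at z0)"
   "!!i j. (%z. snd (c z) $ i $ j) fdiff (at z0)" for c z0
 proof -
  have "c z0 : treg" using c(1) by (simp add: N_def)
  from kinv_diff[OF c(2,3) this]
  obtain s' where s': "((%z. kinv (c z)) has_derivative (%ze. cmul6 ze s')) (at z0)" by blast
  let ?y = "kinv (c z0)"
  define e where "e = g' ?y s'"
  \<comment> \<open>The inverse derivative is complex linear because it inverts the complex linear
    map \<open>chartD\<close>.\<close>
  have "g' ?y (cmul6 ze s') = cmul6 ze e" for ze
   using V(7)[OF iV[OF c(1)], of "cmul6 ze e"] S.chartD_cmul[OF conjunct1[OF V(4)[OF iV[OF c(1)]]], of ze e] V(6)[OF iV[OF c(1)]]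
   by (simp add: e_def)
  hence "((%z. g (kinv (c z))) has_derivative (%ze. cmul6 ze e)) (at z0)"
   using has_derivative_compose[OF s' V(5)[OF iV[OF c(1)]]] by simp
  from S.spath_crv[OF conjunct1[OF V(4)[OF iV[OF c(1)]]] this]
  show ?thesis unfolding ka_def .
 qed
 ultimately show thesis using that[OF oN, of ka] by (auto simp: N_def)
qed

end


section \<open>Stabilizers, and local functions on Kronheimer data obtained from slices\<close>

context interval
begin

lemma gg_cong: assumes "!!t. t : II ==> g t = h t" "g : GG" shows "h : GG"
proof -
 show ?thesis
  using assms(2) assms(1)[symmetric] smooth_cong[OF assms(1)] der_cong_I[OF ends(1) assms(1)] der_cong_I[OF ends(2) assms(1)] ends
  by (intro ggI) (auto dest: ggD)
qed

lemma nahm_stabilizer_cong: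
 assumes "!!t. t : II ==> g t = h t" "g : nahm_stabilizer L B" shows "h : nahm_stabilizer L B"
 using assms(2) gg_cong[OF assms(1)] gact_cong[OF assms(1), where B = B] unfolding nahm_stabilizer_def by simp

end

lemma torus_square_one:
 assumes "h : torus" "(h $ 2 $ 2)\<^sup>2 = 1 | (h $ 1 $ 1)\<^sup>2 = 1" shows "h = mat 1 | h = - mat 1"
proof -
 have t: "h $ 1 $ 1 * h $ 2 $ 2 = 1" "h $ 1 $ 2 = 0" "h $ 2 $ 1 = 0" using assms(1) by (simp_all add: torus_iff)
 have "(h $ 1 $ 1 * h $ 2 $ 2) * h $ 2 $ 2 = h $ 1 $ 1 * (h $ 2 $ 2)\<^sup>2"
  "(h $ 1 $ 1 * h $ 2 $ 2) * h $ 1 $ 1 = (h $ 1 $ 1)\<^sup>2 * h $ 2 $ 2" by (simp_all add: power2_eq_square)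
 hence e: "h $ 1 $ 1 = h $ 2 $ 2" using assms(2) t(1) by auto
 hence "(h $ 2 $ 2)\<^sup>2 = 1" using assms(2) by simp
 hence "h $ 2 $ 2 = 1 | h $ 2 $ 2 = - 1" by (simp add: power2_eq_1_iff)
 thus ?thesis using t e by (auto simp: cmat_iff)
qed

lemma kron_act_nth: assumes "h : torus"
 shows "fst (kron_act h X) = adj2 h ** fst X ** h" "snd (kron_act h X) = adj2 h ** snd X ** h"
 using matrix_inv_eq_adj2[OF torus_det[OF assms]] by (cases X; simp)+

declare kron_act.simps [simp del]

lemma kron_line_act: assumes "h : torus" shows "kron_act h (kron_line p z v) = kron_line (kron_act h p) z (kron_act h v)"
 by (simp add: prod_eq_iff kron_line_simps kron_act_nth[OF assms] mat_ring cscale_simps)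

lemma kron_act_cont: assumes "h : torus" shows "cont UNIV (kron_act h)"
proof -
 have "kron_act h = (%X. (adj2 h ** fst X ** h, adj2 h ** snd X ** h))"
  by (simp add: fun_eq_iff prod_eq_iff kron_act_nth[OF assms])
 thus ?thesis by (simp only:) (intro continuous_intros bounded_bilinear.continuous_on[OF bil_mmult])
qed

lemma amb_holo_restrict: assumes "ambient_holomorphic T lin Om G" "openin T Om'" "Om' <= Om"
 shows "ambient_holomorphic T lin Om' G"
proof -
 have "(%z. G (lin x z v)) holomorphic_on {z. lin x z v : Om'}" if "x : Om'" "v : topspace T" for x v
  by (rule holomorphic_on_subset[of _ "{z. lin x z v : Om}"])
   (use assms that in "auto simp: ambient_holomorphic_def")
 thus ?thesis
  using assms continuous_map_from_subtopology_mono[of T Om euclidean G Om'] unfolding ambient_holomorphic_def by blast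
qed

lemma amb_holo_act: assumes h: "h : torus" and G: "ambient_holomorphic euclidean kron_line Om G"
 shows "ambient_holomorphic euclidean kron_line {X. kron_act h X : Om} (%X. G (kron_act h X))"
proof -
 have G': "open Om" "cont Om G" "!!x v. x : Om ==> (%z. G (kron_line x z v)) holomorphic_on {z. kron_line x z v : Om}"
  using G by (auto simp: ambient_holomorphic_def)
 have "{X. kron_act h X : Om} = kron_act h -` Om" by auto
 moreover have "open (kron_act h -` Om)" by (rule open_vimage[OF G'(1) kron_act_cont[OF h]])
 moreover have "cont (kron_act h -` Om) (%X. G (kron_act h X))"
  by (rule continuous_on_compose2[OF G'(2) continuous_on_subset[OF kron_act_cont[OF h]]]) auto
 ultimately show ?thesis using G'(3) by (auto simp: ambient_holomorphic_def kron_line_act[OF h])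
qed

context nahm_params
begin

text \<open>A stabilizing g satisfies g' = [-\<alpha>, g], and by \<open>rho_gauge\<close> its value
  at 0 fixes A. If A is nonzero, \<open>g 0\<close> is plus or minus the identity and so is g. If A
  = 0, then \<alpha> = 0, so g is a constant diagonal matrix, and every torus element
  stabilizes.\<close>

lemma of_kron_slice_centre: assumes A: "A : TK" shows "slice_centre L (of_kron A)" unfolding slice_centre_def
proof
 let ?B = "of_kron A"
 note T = TKD[OF A]
 have Bp: "fst ?B : PP" "snd ?B : PP" using ND_paths[OF T(2)] by auto
 fix g assume g: "g : nahm_stabilizer L ?B"
 hence G: "g : GG" "gact g ?B = ?B" unfolding nahm_stabilizer_def by auto
 have g0: "g 0 : torus" by (rule ggD(3)[OF G(1)])
 have act: "kron_act (g 0) A = A" using rho_gauge(2)[OF G(1) Bp] G(2) T(4) by simp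
 have gd: "(g has_der comm (- fst ?B t) (g t) + 0) t" if t: "t : II" for t
 proof -
  have "fst (gact g (fst ?B, snd ?B)) = fst ?B" using G(2) by simp
  hence "onI (%t. adj2 (g t) ** fst ?B t ** g t + adj2 (g t) ** der g t) = fst ?B"
   unfolding gact_adj2[OF gg_det[OF G(1)]] fst_conv .
  from fun_cong[OF this, of t] t
  have "adj2 (g t) ** fst ?B t ** g t + adj2 (g t) ** der g t = fst ?B t" by (simp only: on_I_eq)
  hence "g t ** (adj2 (g t) ** fst ?B t ** g t + adj2 (g t) ** der g t) = g t ** fst ?B t" by simp
  hence "fst ?B t ** g t + der g t = g t ** fst ?B t" using ggD(2)[OF G(1) t] by (simp add: mat_ring adj2_cancel)
  hence "der g t = comm (- fst ?B t) (g t)" by (simp add: comm_def mat_ring algebra_simps)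
  thus ?thesis using smooth_has_der[OF ggD(1)[OF G(1)] t] by simp
 qed
 have cont: "cont II (%t. - fst ?B t)" by (intro smooth_cont smooth_minus path_smooth Bp)
 have const: "g t = g 0" if "t : II" "!!t. t : II ==> comm (- fst ?B t) (g 0) = 0" for t
  by (rule lode_unique[OF bil_comm cont gd _ _ that(1), where z = "%t. g 0"])
   (use that(2) in simp_all)
 obtain a b c d where Ab: "A = kdat a b c d" using T(1) KD_kdat by metis
 show "(%t. cadj (g t)) : nahm_stabilizer L ?B"
 proof (cases "a = 0 & b = 0 & c = 0 & d = 0")
  case False
  have "(g 0 $ 2 $ 2)\<^sup>2 = 1 | (g 0 $ 1 $ 1)\<^sup>2 = 1" using act False unfolding Ab kron_act_kdat[OF g0] by auto
  from torus_square_one[OF g0 this] have pm: "g 0 = mat 1 | g 0 = - mat 1" .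
  have "comm X (g 0) = 0" for X using pm by (auto simp: comm_def mat_ring)
  hence gc: "g t = g 0" if "t : II" for t using const[OF that] by blast
  have cc: "cadj (g 0) = g 0" using pm by (auto simp: cmat_iff)
  have "g t = cadj (g t)" if "t : II" for t unfolding gc[OF that] cc ..
  thus ?thesis by (rule nahm_stabilizer_cong[OF _ g])
 next
  case True
  have fB: "fst ?B t = 0" if "t : II" for t
   using True that by (simp add: Ab of_kron_kdat nahm_sol_def on_I_eq cmat_iff)
  have "comm (- fst ?B t) (g 0) = 0" if "t : II" for t using fB[OF that] by (simp add: comm_def)
  hence gc: "g t = g 0" if "t : II" for t using const[OF that] by blast
  have eq: "cadj (g 0) = cadj (g t)" if "t : II" for t unfolding gc[OF that] ..
  have h: "cadj (g 0) : torus" using g0 by (auto simp: torus_iff) (metis complex_cnj_mult complex_cnj_one)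
  have "kron_act (cadj (g 0)) A = A" unfolding Ab kron_act_kdat[OF h] using True by simp
  hence "gact (%t. cadj (g 0)) ?B = ?B" using T(8)[OF h] by simp
  hence st: "(%t. cadj (g 0)) : nahm_stabilizer L ?B" using gg_const[OF h] unfolding nahm_stabilizer_def by blast
  show ?thesis by (rule nahm_stabilizer_cong[OF _ st]) (rule eq)
 qed
qed

text \<open>The ambient extension of the local function on the slice is composed with the lift
  \<open>ka\<close>. Its value at a polystable X is that of \<open>f\<close> because
  \<open>ka X\<close> lies in the gauge orbit of \<open>of_kron X\<close>.\<close>

lemma local_holo_function: assumes V: "openin NMT V" and nh: "nahm_holomorphic L r0 rL x0 xL V f"
  and A: "A : TKP" "mmap (kron_orbit A) : V"
 obtains N G where "A : N" "ambient_holomorphic euclidean kron_line N G"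
  "!!X. X : N ==> X : KPS ==> X : treg &
   mmap (kron_orbit X) : V & G X = f (mmap (kron_orbit X))"
proof -
 let ?B = "of_kron A"
 have At: "A : TK" by (rule TK_psD(1)[OF A(1)])
 have B: "?B : NPS" "orb ?B : V" using of_kron_ps[OF A(1)] A(2) mmap_vimage[OF A(1)] by auto
 obtain W F where W: "?B : W" "openin (subtopology NS (slice ?B)) W" "holomorphic_on_subset NS nahm_line W F"
  "!!y. y : W ==> y : NPS ==> orb y : V ==> F y = f (orb y)"
  using nh[unfolded nahm_holomorphic_def, rule_format, OF B(1) conjI[OF B(2) of_kron_slice_centre[OF At]]] by blast
 obtain Om G0 where Om: "?B : Om" "ambient_holomorphic NS nahm_line Om G0" "ALL y:W Int Om. F y = G0 y"
  using W(3)[unfolded holomorphic_on_subset_def, rule_format, OF W(1)] by auto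
 obtain O1 where O1: "openin NS O1" "W = O1 Int slice ?B" using W(2) unfolding openin_subtopology by blast
 obtain O2 where O2: "openin NS O2" "{y : NPS. orb y : V} = O2 Int NPS"
  using V unfolding openin_nahm_moduli_top openin_subtopology by blast
 obtain N0 ka where N0: "open N0" "A : N0" "N0 \<subseteq> treg" "ka A = ?B" "continuous_map (top_of_set N0) NS ka"
  "!!X. X : N0 ==> X : KD ==> ka X : slice ?B" "!!X. X : N0 ==> X : KD ==> orb (ka X) = orb (of_kron X)"
  "!!c z0. c z0 : N0 ==> (!!i j. (%z. fst (c z) $ i $ j) fdiff (at z0)) ==>
   (!!i j. (%z. snd (c z) $ i $ j) fdiff (at z0)) ==>
   EX r v. limitin NS r v (at z0) & (ev (at z0) (%z. ka (c z) = nahm_line (ka (c z0)) (z - z0) (r z)))"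
 proof (rule slice_chart_exists[OF At], goal_cases)
  case (1 N0 ka)
  show ?thesis
  proof (rule that[of N0 ka])
   show "EX r v. limitin NS r v (at z0) & (ev (at z0) (%z. ka (c z) = nahm_line (ka (c z0)) (z - z0) (r z)))"
    if "c z0 : N0" "!!i j. (%z. fst (c z) $ i $ j) fdiff (at z0)"
     "!!i j. (%z. snd (c z) $ i $ j) fdiff (at z0)" for c z0 by (rule 1(9)) (rule that)+
  qed (fact 1)+
 qed
 have Omo: "openin NS Om" using Om(2) unfolding ambient_holomorphic_def by blast
 define N where "N = {X : topspace (top_of_set N0). ka X : Om \<inter> (O1 \<inter> O2)}"
 have "openin (top_of_set N0) N" unfolding N_def
  by (rule openin_continuous_map_preimage[OF N0(5)]) (intro openin_Int Omo O1 O2)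
 hence oN: "open N" using N0(1) openin_open_eq by blast
 have NN: "X : N0" "ka X : Om" "ka X : O1" "ka X : O2" if "X : N" for X using that by (auto simp: N_def)
 have "A : N" using N0(2,4) Om(1) W(1) O1(2) O2(2) B by (auto simp: N_def)
 moreover have "ambient_holomorphic euclidean kron_line N (%X. G0 (ka X))" unfolding ambient_holomorphic_def
 proof (intro conjI ballI)
  show "openin euclidean N" using oN by simp
  have "continuous_map (top_of_set N) (subtopology NS Om) ka"
   by (intro continuous_map_into_subtopology continuous_map_from_subtopology_mono[OF N0(5)]) (use NN in auto)
  from continuous_map_compose[OF this, of euclidean G0]
  show "continuous_map (top_of_set N) euclidean (%X. G0 (ka X))" using Om(2) by (simp add: ambient_holomorphic_def)
  fix X v assume "X : N" "v : topspace (euclidean :: kron topology)"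
  show "(%z. G0 (ka (kron_line X z v))) holomorphic_on {z. kron_line X z v : N}"
  proof
   fix z0 assume z0: "z0 : {z. kron_line X z v : N}"
   have d: "(%z. fst (kron_line X z v) $ i $ j) fdiff (at z0)"
    "(%z. snd (kron_line X z v) $ i $ j) fdiff (at z0)" for i j unfolding kron_line_simps
    by (simp_all add: field_differentiable_add field_differentiable_mult)
   have z0': "kron_line X z0 v : N0" "ka (kron_line X z0 v) : Om" using NN z0 by auto
   obtain r w where "limitin NS r w (at z0)"
    "ev (at z0) (%z. ka (kron_line X z v) = nahm_line (ka (kron_line X z0 v)) (z - z0) (r z))"
    using N0(8)[of "%z. kron_line X z v", OF z0'(1) d] by blast
   from amb_holo_nahm_crv[of Om G0 "%z. ka (kron_line X z v)", OF Om(2) z0'(2) this]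
   show "(%z. G0 (ka (kron_line X z v))) fdiff at z0 within {z. kron_line X z v : N}"
    by (rule field_differentiable_at_within)
  qed
 qed
 moreover have "X : treg & mmap (kron_orbit X) : V & G0 (ka X) = f (mmap (kron_orbit X))"
  if X: "X : N" "X : KPS" for X
 proof -
  have Xd: "X : KD" using X(2) by (simp add: kron_ps_def)
  have Xr: "X : treg" using N0(3) NN(1)[OF X(1)] by blast
  hence Xt: "X : TKP" using X(2) TK_ps_iff by blast
  note k = N0(6,7)[OF NN(1)[OF X(1)] Xd]
  have kd: "ka X : ND" using k(1) coulomb_slice_subset by blast
  obtain g where "g : GG" "ka X = gact g (of_kron X)" using orb_eq_iff[OF TKD(2)[OF TK_psD(1)[OF Xt]] kd] k(2) by auto
  hence kp: "ka X : NPS" using nahm_stab_gauge(3)[OF _ TKD(2)[OF TK_psD(1)[OF Xt]]] of_kron_ps[OF Xt] kd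
   by (simp add: nahm_ps_def)
  have kV: "orb (ka X) : V" using O2(2) NN(4)[OF X(1)] kp by blast
  have kW: "ka X : W" using O1(2) NN(3)[OF X(1)] k(1) by blast
  have "F (ka X) = G0 (ka X)" using Om(3) NN(2)[OF X(1)] kW by simp
  hence "G0 (ka X) = f (orb (ka X))" using W(4)[OF kW kp kV] by simp
  thus ?thesis using Xr kV k(2) mmap_vimage[OF Xt] by simp
 qed
 ultimately show thesis by (rule)
qed

section \<open>Stable locus, null cone and the extension of invariant functions\<close>

lemma kron_stable_iff:
 "kron_stable r (kdat a b c d) <-> (b = 0 & d = 0 --> r < 0) & (a = 0 & c = 0 --> 0 < r)"
by (auto simp: kron_stable_def kron_subline_kdat kron_degree_def)

lemma kron_subline_act:
 assumes "h : torus" "X : kron_data x" shows "kron_subline (kron_act h X) W <-> kron_subline X W"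
proof -
 obtain a b c d where "X = kdat a b c d" using assms(2) KD_kdat by metis
 thus ?thesis using torus_units[OF assms(1)] by (simp add: kron_act_kdat[OF assms(1)] kron_subline_kdat)
qed

lemma KD_act: assumes "h : torus" "X : kron_data x" shows "kron_act h X : kron_data x"
proof -
 obtain a b c d where X: "X = kdat a b c d" using assms(2) KD_kdat by metis
 have "a * (h $ 2 $ 2)\<^sup>2 * (d * (h $ 1 $ 1)\<^sup>2) - b * (h $ 1 $ 1)\<^sup>2 * (c * (h $ 2 $ 2)\<^sup>2)
   = (a * d - b * c) * ((h $ 1 $ 1)\<^sup>2 * (h $ 2 $ 2)\<^sup>2)"
  by (simp add: algebra_simps)
 thus ?thesis
  using assms(2) unfolding X kron_act_kdat[OF assms(1)] kdat_in_KD by (simp add: torus_units(1)[OF assms(1)])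
qed

lemma kron_stab_act: assumes "h : torus" "X : kron_data x"
 shows "kron_stable r (kron_act h X) <-> kron_stable r X" "kron_semistable r (kron_act h X) <-> kron_semistable r X"
  "kron_polystable r (kron_act h X) <-> kron_polystable r X"
 unfolding kron_stable_def kron_semistable_def kron_polystable_def by (simp_all add: kron_subline_act[OF assms])

lemma kron_stable_open: "EX Q. open Q & {A : kron_data x. kron_stable r A} = kron_data x Int Q"
proof -
 let ?n = "%i j. {A::kron. \<not> (fst A $ i $ j = 0 & snd A $ i $ j = 0)}"
 have o: "open (?n i j)" for i j
 proof -
  have "?n i j = {A. fst A $ i $ j ~= 0} \<union> {A. snd A $ i $ j ~= 0}" by auto
  moreover have "open {A::kron. fst A $ i $ j ~= 0}" "open {A::kron. snd A $ i $ j ~= 0}"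
   by (intro open_Collect_neq continuous_intros)+
  ultimately show ?thesis by auto
 qed
 define Q where "Q = (if r < 0 then UNIV else ?n 2 1) Int (if 0 < r then UNIV else ?n 1 2)"
 have "kron_stable r A <-> A : Q" if A: "A : kron_data x" for A
 proof -
  obtain a b c d where "A = kdat a b c d" using A KD_kdat by metis
  thus ?thesis by (auto simp: kron_stable_iff Q_def)
 qed
 moreover have "open Q" unfolding Q_def using o by auto
 ultimately show ?thesis by blast
qed

text \<open>Failure of stability means an invariant coordinate line of nonnegative degree, and
  semistability leaves only degree 0. The invariant line makes both matrices triangular of the same
  kind, so their commutator vanishes as well.\<close>

lemma kron_null_cases: assumes "A : kron_ss r x" "\<not> kron_stable r A"
 shows "r = 0" "x = 0" "EX a b. A = kdat a 0 b 0 | A = kdat 0 a 0 b"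
proof -
 obtain a b c d where Ab: "A = kdat a b c d" "a * d - b * c = \<i> * x" using assms KD_kdat unfolding kron_ss_def by blast
 have "kron_semistable r A" using assms by (simp add: kron_ss_def)
 hence *: "r = 0 & (b = 0 & d = 0 | a = 0 & c = 0)"
  using assms(2) unfolding Ab kron_semistable_iff kron_stable_iff by auto
 thus "r = 0" by blast
 show "x = 0" using * Ab(2) by auto
 show "EX a b. A = kdat a 0 b 0 | A = kdat 0 a 0 b" using * Ab(1) by auto
qed

lemma kron_ps_null: assumes "A : kron_ps r x" "\<not> kron_stable r A" shows "A = kdat 0 0 0 0"
proof -
 have "A : kron_data x" using assms(1) by (simp add: kron_ps_def)
 then obtain a b c d where Ab: "A = kdat a b c d" by (rule KD_kdat)
 have "kron_subline A (cline e1)" "kron_subline A (cline e2)" using assms by (auto simp: kron_ps_def kron_polystable_def)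
 thus ?thesis unfolding Ab kron_subline_kdat using cline_e12_neq by auto
qed

lemma zero_kron_ps: assumes "r = 0" "x = 0" shows "kdat 0 0 0 0 : kron_ps r x"
 using assms by (simp add: kron_ps_def kdat_in_KD kron_polystable_def kron_subline_kdat kron_degree_def)

lemma kron_ss_act: assumes "h : torus" "X : kron_ss r x" shows "kron_act h X : kron_ss r x"
proof -
 have X: "X : kron_data x" using assms(2) by (simp add: kron_ss_def)
 show ?thesis using assms(2) KD_act[OF assms(1) X] kron_stab_act(2)[OF assms(1) X] by (simp add: kron_ss_def)
qed

text \<open>A point of the null cone is a limit of stable points \<open>Y\<close> whose orbits contain points
 \<open>P\<close> tending to \<open>0\<close>.\<close>

lemma null_value: assumes N: "kdat 0 0 0 0 : N" "ambient_holomorphic euclidean kron_line N G"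
  and eq: "!!X Y. X : N ==> Y : N ==> X : kron_ps 0 0 ==> Y : kron_ps 0 0 ==> kron_orbit X = kron_orbit Y ==> G X = G Y"
  and Z: "Z : N" "Z = kdat a 0 b 0 | Z = kdat 0 a 0 b" shows "G Z = G (kdat 0 0 0 0)"
proof (cases "a = 0 & b = 0")
 case False
 define s :: "nat => complex" where "s n = of_real (inverse (real (Suc n)))" for n
 have s0: "s n ~= 0" for n by (simp add: s_def del: of_nat_Suc)
 have s: "s \<longlonglongrightarrow> 0" unfolding s_def using tendsto_of_real[OF LIMSEQ_inverse_real_of_nat] unfolding of_real_0 . have s2: "(%n. (s n)\<^sup>2) \<longlonglongrightarrow> 0" using tendsto_power[OF s, of 2] by simp
 have oN: "open N" "cont N G" using N(2) by (auto simp: ambient_holomorphic_def)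
 define P where "P n = kdat (s n * a) (s n * a) (s n * b) (s n * b)" for n
 have Pl: "P \<longlonglongrightarrow> kdat 0 0 0 0" unfolding P_def
  using tendsto_mult_left_zero[OF s] by (intro tendsto_kdat)
 have st: "kron_stable 0 (kdat p q u v) ==> p * v - q * u = 0 ==> kdat p q u v : kron_ps 0 0" for p q u v
  by (simp add: kron_ps_def kron_polystable_def kdat_in_KD)
 have Pp: "P n : kron_ps 0 0" for n unfolding P_def using False s0[of n] by (intro st) (auto simp: kron_stable_iff)
 obtain Y where Y: "Y \<longlonglongrightarrow> Z" "!!n. Y n : kron_ps 0 0" "!!n. kron_orbit (Y n) = kron_orbit (P n)"
 proof (cases "Z = kdat a 0 b 0")
  case True
  \<comment> \<open>The factor is the square of \<open>s n\<close> because a torus element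
    multiplying the upper entries by \<open>s n\<close> divides the lower ones by it; all four
    entries of the result then carry the single factor \<open>s n\<close>, as in
    \<open>P n\<close>.\<close>
  define Y where "Y n = kdat a ((s n)\<^sup>2 * a) b ((s n)\<^sup>2 * b)" for n
  show thesis
  proof (rule that[of Y])
   show "Y \<longlonglongrightarrow> Z" unfolding Y_def True using tendsto_mult_left_zero[OF s2] by (intro tendsto_kdat) auto
   show "Y n : kron_ps 0 0" for n unfolding Y_def using False s0[of n] by (intro st) (auto simp: kron_stable_iff)
   fix n
   obtain h where h: "h : torus" "(h $ 2 $ 2)\<^sup>2 = s n" "(h $ 1 $ 1)\<^sup>2 = inverse (s n)" using torus_exists[OF s0] .
   have "kron_act h (Y n) = P n" unfolding Y_def P_def kron_act_kdat[OF h(1)] h by (simp add: power2_eq_square field_simps)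
   thus "kron_orbit (Y n) = kron_orbit (P n)" using kron_orbit_act[OF h(1), of "Y n"] by simp
  qed
 next
  case F: False
  hence Zb: "Z = kdat 0 a 0 b" using Z(2) by blast
  define Y where "Y n = kdat ((s n)\<^sup>2 * a) a ((s n)\<^sup>2 * b) b" for n
  show thesis
  proof (rule that[of Y])
   show "Y \<longlonglongrightarrow> Z" unfolding Y_def Zb using tendsto_mult_left_zero[OF s2] by (intro tendsto_kdat) auto
   show "Y n : kron_ps 0 0" for n unfolding Y_def using False s0[of n] by (intro st) (auto simp: kron_stable_iff)
   fix n
   have "inverse (s n) ~= 0" using s0 by simp
   obtain h where h: "h : torus" "(h $ 2 $ 2)\<^sup>2 = inverse (s n)" "(h $ 1 $ 1)\<^sup>2 = inverse (inverse (s n))"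
    using torus_exists[OF `inverse (s n) \<noteq> 0`] .
   have "kron_act h (Y n) = P n" unfolding Y_def P_def kron_act_kdat[OF h(1)] h by (simp add: power2_eq_square field_simps)
   thus "kron_orbit (Y n) = kron_orbit (P n)" using kron_orbit_act[OF h(1), of "Y n"] by simp
  qed
 qed
 have GY: "(%n. G (Y n)) \<longlonglongrightarrow> G Z"
  by (rule isCont_tendsto_compose[OF _ Y(1)]) (use oN Z(1) continuous_on_eq_continuous_at in blast)
 have GP: "(%n. G (P n)) \<longlonglongrightarrow> G (kdat 0 0 0 0)"
  by (rule isCont_tendsto_compose[OF _ Pl]) (use oN N(1) continuous_on_eq_continuous_at in blast)
 have ev: "ev sequentially (%n. G (Y n) = G (P n))"
  using topological_tendstoD[OF Y(1) oN(1) Z(1)] topological_tendstoD[OF Pl oN(1) N(1)]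
  by eventually_elim (rule eq[OF _ _ Y(2) Pp Y(3)])
 show ?thesis by (rule LIMSEQ_unique[OF Lim_transform_eventually[OF GY ev] GP])
qed (use Z(2) in auto)

text \<open>The torus contracts each null vector to 0, so a neighbourhood of 0 controls an invariant
  function along the whole null cone.\<close>

lemma scale_to_zero: assumes N: "open N" "kdat 0 0 0 0 : N" and Z: "Z = kdat a 0 b 0 | Z = kdat 0 a 0 b"
 obtains h where "h : torus" "kron_act h Z : N"
proof -
 have z: "((%m. m * u) ---> 0) (at 0)" for u :: complex
  by (rule tendsto_mult_left_zero[OF tendsto_ident_at])
 have "((%m. kdat (m * a) 0 (m * b) 0) ---> kdat 0 0 0 0) (at 0)" "((%m. kdat 0 (m * a) 0 (m * b)) ---> kdat 0 0 0 0) (at 0)"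
  by (intro tendsto_kdat z tendsto_const)+
 from this[THEN topological_tendstoD, OF N]
 have "ev (at 0) (%m. kdat (m * a) 0 (m * b) 0 : N & kdat 0 (m * a) 0 (m * b) : N & m ~= 0)"
  by (auto simp: eventually_conj_iff eventually_at_filter)
 then obtain m where m: "kdat (m * a) 0 (m * b) 0 : N" "kdat 0 (m * a) 0 (m * b) : N" "m ~= 0"
  using eventually_happens[of _ "at (0::complex)"] by auto
 show thesis
 proof (cases "Z = kdat a 0 b 0")
  case True
  obtain h where h: "h : torus" "(h $ 2 $ 2)\<^sup>2 = m" "(h $ 1 $ 1)\<^sup>2 = inverse m" using torus_exists[OF m(3)] .
  show thesis by (rule that[OF h(1)]) (use m(1) in "simp add: True kron_act_kdat[OF h(1)] h mult.commute")
 next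
  case False
  have "inverse m ~= 0" using m(3) by simp
  obtain h where h: "h : torus" "(h $ 2 $ 2)\<^sup>2 = inverse m" "(h $ 1 $ 1)\<^sup>2 = inverse (inverse m)"
   using torus_exists[OF `inverse m \<noteq> 0`] .
  have "Z = kdat 0 a 0 b" using False Z by blast
  show thesis by (rule that[OF h(1)])
    (use m(2) in \<open>simp add: `Z = kdat 0 a 0 b` kron_act_kdat[OF h(1)] h mult.commute\<close>)
 qed
qed

text \<open>The quotient asks for an invariant function on a torus invariant open set of semistable
  data, whereas the Nahm side determines values on polystable orbits only. The values elsewhere are
  dictated by the closed orbit in the closure, and \<open>null_value\<close> shows that the
  extension is still the restriction of a holomorphic function.\<close>

lemma nahm_holo_imp_kron_holo: assumes V: "openin NMT V" and nh: "nahm_holomorphic L r0 rL x0 xL V f"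
 shows "kron_holomorphic (rL - r0) (xL - x0) {p : TKM. mmap p : V} (f \<circ> mmap)"
  (is "kron_holomorphic ?r ?x ?U _")
proof -
 let ?O = "kdat 0 0 0 0"
 \<comment> \<open>A semistable datum that is not stable lies in the null cone, where 0 is the
   closed orbit; it receives the value at 0.\<close>
 define FK where "FK X = f (mmap (kron_orbit (if kron_stable ?r X then X else ?O)))" for X
 define W where "W = {X : kron_ss ?r ?x. kron_orbit (if kron_stable ?r X then X else ?O) : ?U}"
 have Ups: "X : TKP" "mmap (kron_orbit X) : V" if "X : kron_ps ?r ?x" "kron_orbit X : ?U" for X
  using that kron_orbit_tilde_iff[OF that(1)] TK_ps_iff by auto
 have U: "kron_orbit X : ?U" if "X : kron_ps ?r ?x" "X : treg" "mmap (kron_orbit X) : V" for X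
  using that kron_orbit_tilde_iff[OF that(1)] by simp
 have stps: "X : kron_ps ?r ?x" if "X : kron_data ?x" "kron_stable ?r X" for X
  using that by (simp add: kron_ps_def kron_polystable_def)
 obtain Qs where Qs: "open Qs" "{A : kron_data ?x. kron_stable ?r A} = kron_data ?x Int Qs" using kron_stable_open by blast
 have local: "EX Om G. X : Om & ambient_holomorphic euclidean kron_line Om G &
   (ALL Y:kron_ss ?r ?x Int Om. Y : W & FK Y = G Y)" if X: "X : W" for X
 proof (cases "kron_stable ?r X")
  case True
  have Xd: "X : kron_data ?x" using X by (simp add: W_def kron_ss_def)
  have Xp: "X : kron_ps ?r ?x" by (rule stps[OF Xd True])
  have "kron_orbit X : ?U" using X True by (simp add: W_def)
  from local_holo_function[OF V nh Ups[OF Xp this]]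
  obtain N G where N: "X : N" "ambient_holomorphic euclidean kron_line N G"
   "!!X. X : N ==> X : kron_ps ?r ?x ==> X : treg &
    mmap (kron_orbit X) : V & G X = f (mmap (kron_orbit X))" by blast
  have oN: "open N" using N(2) by (simp add: ambient_holomorphic_def)
  have "ambient_holomorphic euclidean kron_line (N Int Qs) G"
   by (rule amb_holo_restrict[OF N(2)]) (use oN Qs(1) in auto)
  moreover have "X : N Int Qs" using N(1) Qs(2) Xd True by blast
  moreover have "Y : W & FK Y = G Y" if Y: "Y : kron_ss ?r ?x Int (N Int Qs)" for Y
  using Y kron_ss_def Qs(2) stps N(3) U W_def FK_def by auto
  ultimately show ?thesis by blast
 next
  case False
  have Xs: "X : kron_ss ?r ?x" and O: "kron_orbit ?O : ?U" using X False by (auto simp: W_def)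
  note null = kron_null_cases[OF Xs False]
  have Op: "?O : kron_ps ?r ?x" by (rule zero_kron_ps[OF null(1,2)])
  from local_holo_function[OF V nh Ups[OF Op O]]
  obtain N G where N: "?O : N" "ambient_holomorphic euclidean kron_line N G"
   "!!X. X : N ==> X : kron_ps ?r ?x ==> X : treg &
    mmap (kron_orbit X) : V & G X = f (mmap (kron_orbit X))" by blast
  have oN: "open N" using N(2) by (simp add: ambient_holomorphic_def)
  obtain a b where "X = kdat a 0 b 0 | X = kdat 0 a 0 b" using null(3) by blast
  from scale_to_zero[OF oN N(1) this] obtain h where h: "h : torus" "kron_act h X : N" by blast
  have eq: "G P = G Q" if "P : N" "Q : N" "P : kron_ps 0 0" "Q : kron_ps 0 0" "kron_orbit P = kron_orbit Q" for P Q
   using N(3)[OF that(1)] N(3)[OF that(2)] that(3-5) unfolding null(1,2) by simp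
  \<comment> \<open>The local function at 0 is transported to a neighbourhood of X by the torus
    element that moves X close to 0.\<close>
  have "Y : W & FK Y = G (kron_act h Y)" if Y: "Y : kron_ss ?r ?x" "kron_act h Y : N" for Y
  proof -
   have Yd: "Y : kron_data ?x" using Y by (simp add: kron_ss_def)
   have hs: "kron_stable ?r (kron_act h Y) <-> kron_stable ?r Y" by (rule kron_stab_act(1)[OF h(1) Yd])
   show ?thesis
   proof (cases "kron_stable ?r Y")
    case True
    have p: "kron_act h Y : kron_ps ?r ?x" using stps[OF KD_act[OF h(1) Yd]] True hs by blast
    note n = N(3)[OF Y(2) p]
    have "kron_orbit (kron_act h Y) : ?U" using U[OF p] n by blast
    thus ?thesis using n Y(1) True by (simp add: W_def FK_def kron_orbit_act[OF h(1)])
   next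
    case False
    have "kron_act h Y : kron_ss ?r ?x" by (rule kron_ss_act[OF h(1) Y(1)])
    from kron_null_cases(3)[OF this] False hs
    obtain a b where "kron_act h Y = kdat a 0 b 0 | kron_act h Y = kdat 0 a 0 b" by blast
    from null_value[OF N(1,2) eq Y(2) this] have "G (kron_act h Y) = G ?O" .
    thus ?thesis using False Y(1) O N(3)[OF N(1) Op] by (simp add: W_def FK_def)
   qed
  qed
  thus ?thesis using amb_holo_act[OF h(1) N(2)] h(2) by (intro exI[of _ "{X. kron_act h X : N}"]) auto
 qed
 have Wo: "openin (top_of_set (kron_ss ?r ?x)) W"
 proof (subst openin_subopen, intro ballI)
  fix X assume X: "X : W"
  from local[OF this] obtain Om G where Om: "X : Om" "ambient_holomorphic euclidean kron_line Om G"
   "ALL Y:kron_ss ?r ?x Int Om. Y : W & FK Y = G Y" by blast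
  have "openin (top_of_set (kron_ss ?r ?x)) (kron_ss ?r ?x Int Om)"
   using Om(2) by (intro openin_open_Int) (simp add: ambient_holomorphic_def)
  moreover have "X : kron_ss ?r ?x" using X by (simp add: W_def)
  ultimately show "EX T. openin (top_of_set (kron_ss ?r ?x)) T & X : T & T <= W" using Om(1,3) by blast
 qed
 have Wh: "holomorphic_on_subset euclidean kron_line W FK" unfolding holomorphic_on_subset_def
 proof
  fix X assume "X : W"
  from local[OF this] obtain Om G where Om: "X : Om" "ambient_holomorphic euclidean kron_line Om G"
   "ALL Y:kron_ss ?r ?x Int Om. Y : W & FK Y = G Y" by blast
  have "W <= kron_ss ?r ?x" by (auto simp: W_def)
  thus "EX Om G. X : Om & ambient_holomorphic euclidean kron_line Om G & (ALL y:W Int Om. FK y = G y)"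
   using Om by blast
 qed
 have inv: "kron_act h X : W & FK (kron_act h X) = FK X" if h: "h : torus" and X: "X : W" for h X
 proof -
  have Xs: "X : kron_ss ?r ?x" using X by (simp add: W_def)
  hence Xd: "X : kron_data ?x" by (simp add: kron_ss_def)
  show ?thesis using X kron_ss_act[OF h Xs] kron_stab_act(1)[OF h Xd, of ?r] kron_orbit_act[OF h, of X]
   by (simp add: W_def FK_def split: if_splits)
 qed
 have val: "FK X = f (mmap (kron_orbit X)) & (kron_orbit X : ?U --> X : W)" if X: "X : kron_ps ?r ?x" for X
 using X kron_polystable_semistable kron_ps_def kron_ss_def kron_ps_null W_def FK_def by auto
 show ?thesis unfolding kron_holomorphic_def
 proof (intro ballI impI)
  fix A assume A: "A : kron_ps ?r ?x" "kron_orbit A : ?U"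
  show "EX W F. A : W & openin (top_of_set (kron_ss ?r ?x)) W &
    (ALL h:torus. ALL y:W. kron_act h y : W & F (kron_act h y) = F y) &
    holomorphic_on_subset euclidean kron_line W F &
    (ALL y:W Int kron_ps ?r ?x. kron_orbit y : ?U --> F y = (f \<circ> mmap) (kron_orbit y))"
   using val[OF A(1)] A(2) Wo Wh inv val by (intro exI[of _ W] exI[of _ FK]) simp
 qed
qed

lemma mmap_analytic_open_embedding: "analytic_open_embedding
  (subtopology KMT TKM)
  (kron_holomorphic (rL - r0) (xL - x0))
  NMT
  (nahm_holomorphic L r0 rL x0 xL) mmap"
 unfolding analytic_open_embedding_def mmap_embedding(3)
proof (intro conjI allI impI mmap_embedding(1))
 have "openin (subtopology KMT TKM)
   TKM"
  using openin_topspace[of "subtopology KMT TKM"] unfolding mmap_embedding(3) .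
 thus "openin NMT (mmap ` TKM)" using mmap_embedding(2) unfolding open_map_def by blast
 fix V f
 assume V: "openin NMT V & V <= mmap ` TKM"
 show "nahm_holomorphic L r0 rL x0 xL V f <->
   kron_holomorphic (rL - r0) (xL - x0) {p : TKM. mmap p : V} (f \<circ> mmap)"
  by (rule iffI[OF nahm_holo_imp_kron_holo[OF conjunct1[OF V]]
     kron_holo_imp_nahm_holo[OF conjunct2[OF V]]])
qed

end


section \<open>The symplectic forms\<close>

definition mderiv :: "(complex => cmat) => cmat => bool" where
 "mderiv F D <-> (ALL i j. (DERIV (%z. F z $ i $ j) 0 :> D $ i $ j))"

lemma mderiv_mult: assumes "mderiv F D" "mderiv G E" shows "mderiv (%z. F z ** G z) (D ** G 0 + F 0 ** E)"
 using assms unfolding mderiv_def matrix_matrix_mult_def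
 by (auto intro!: derivative_eq_intros simp: sum.distrib algebra_simps)

lemma mderiv_adj2: "mderiv F D ==> mderiv (%z. adj2 (F z)) (adj2 D)"
proof -
 assume F: "mderiv F D"
 have "(DERIV (%z. adj2 (F z) $ i $ j) 0 :> adj2 D $ i $ j)" for i j
  using F exhaust_2[of i] exhaust_2[of j] unfolding mderiv_def by (auto intro!: DERIV_minus)
 thus ?thesis by (simp add: mderiv_def)
qed

lemma mderiv_const: "mderiv (%z. M) 0" by (simp add: mderiv_def)

lemma mderiv_unique: assumes "mderiv F D" "mderiv G E" "ev (nhds 0) (%z. F z = G z)" shows "D = E"
proof -
 have "D $ i $ j = E $ i $ j" for i j
 proof -
  have e: "ev (nhds 0) (%z. F z $ i $ j = G z $ i $ j)" using assms(3) by eventually_elim simp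
  have "(DERIV (%z. F z $ i $ j) 0 :> E $ i $ j)"
   unfolding DERIV_cong_ev[OF refl e refl] using assms(2) by (simp add: mderiv_def)
  from DERIV_unique[OF _ this] assms(1) show ?thesis unfolding mderiv_def by blast
 qed
 thus ?thesis by (simp add: vec_eq_iff)
qed

lemma mderiv_quotient: "mderiv F D <-> ((%z. cscale (1 / z) (F z - F 0)) ---> D) (at 0)"
proof
 assume "mderiv F D"
 thus "((%z. cscale (1 / z) (F z - F 0)) ---> D) (at 0)"
  by (intro vec_tendstoI) (simp add: mderiv_def has_field_derivative_iff)
next
 assume "((%z. cscale (1 / z) (F z - F 0)) ---> D) (at 0)"
 from tendsto_nth2[OF this] show "mderiv F D" by (simp add: mderiv_def has_field_derivative_iff)
qed

definition kderiv :: "(complex => kron) => kron => bool" where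
 "kderiv c v <-> mderiv (%z. fst (c z)) (fst v) & mderiv (%z. snd (c z)) (snd v)"

lemma at_0_nz: "ev (at (0::complex)) (%z. z ~= 0)" by (simp add: eventually_at_filter)

lemma eventually_nhds_0: "(ev (at (0::complex)) (%z. P z)) ==> P 0 ==> ev (nhds 0) (%z. P z)"
 unfolding eventually_at_filter by (erule eventually_mono) auto

lemma crv_tangent_kderiv: assumes "curve_tangent euclidean kron_line Z ga v" shows "kderiv ga v"
proof -
 obtain r where r: "ev (at 0) (%z. ga z = kron_line (ga 0) z (r z))" "(r ---> v) (at 0)"
  using assms unfolding curve_tangent_def by auto
 have "ev (at 0) (%z. fst (r z) = cscale (1 / z) (fst (ga z) - fst (ga 0)) & snd (r z) = cscale (1 / z) (snd (ga z) - snd (ga 0)))"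
  using r(1) at_0_nz
 proof eventually_elim
  case (elim z)
  have "fst (ga z) = fst (ga 0) + cscale z (fst (r z))" "snd (ga z) = snd (ga 0) + cscale z (snd (r z))"
   by (subst elim(1), simp add: kron_line_simps)+
  thus ?case using elim(2) by (simp add: cscale_simps)
 qed
 hence e: "ev (at 0) (%z. fst (r z) = cscale (1 / z) (fst (ga z) - fst (ga 0)))"
  "ev (at 0) (%z. snd (r z) = cscale (1 / z) (snd (ga z) - snd (ga 0)))" by (simp_all add: eventually_conj_iff)
 show ?thesis unfolding kderiv_def mderiv_quotient
  using Lim_transform_eventually[OF tendsto_fst[OF r(2)] e(1)] Lim_transform_eventually[OF tendsto_snd[OF r(2)] e(2)] by blast
qed

text \<open>A diagonal change of the holonomy M at L shifts the logarithmic variation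
  \<open>th\<close> by M^-1 H M. The new terms pair H with the variation of \<beta> at L, which has
  no diagonal part, or contain a commutator of diagonal matrices; all of them vanish.\<close>

lemma sympl_invariance:
 assumes "det M = 1" "H $ 1 $ 2 = 0" "H $ 2 $ 1 = 0" "H' $ 1 $ 2 = 0" "H' $ 2 $ 1 = 0" "H $ 2 $ 2 = - H $ 1 $ 1" "H' $ 2 $ 2 = - H' $ 1 $ 1"
  and "(M ** (comm th be + b) ** adj2 M) $ 1 $ 1 = (M ** (comm th be + b) ** adj2 M) $ 2 $ 2"
  and "(M ** (comm th' be + b') ** adj2 M) $ 1 $ 1 = (M ** (comm th' be + b') ** adj2 M) $ 2 $ 2"
 defines "ka == adj2 M ** H ** M" and "ka' == adj2 M ** H' ** M"
 shows "- trace ((th - ka) ** b') + trace ((th' - ka') ** b) - trace (comm (th - ka) (th' - ka') ** be) =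
  - trace (th ** b') + trace (th' ** b) - trace (comm th th' ** be)"
proof -
 define X where "X = comm th be + b"
 define X' where "X' = comm th' be + b'"
 have "comm ka ka' = 0"
 proof -
  have "ka ** ka' = adj2 M ** (H ** H') ** M" "ka' ** ka = adj2 M ** (H' ** H) ** M"
   unfolding ka_def ka'_def by (simp_all add: mat_ring adj2_cancel[OF assms(1)])
  moreover have "H ** H' = H' ** H" using assms(2-5) by (simp add: cmat_simps)
  ultimately show ?thesis by (simp add: comm_def)
 qed
 moreover have t: "trace ((adj2 M ** K ** M) ** Y) = trace (K ** (M ** Y ** adj2 M))" for K Y
  by (simp add: cmat_simps algebra_simps)
 have "trace (ka ** X') = 0" unfolding ka_def t
  using assms(2,3,6) assms(9)[folded X'_def] by (simp add: trace_cmat mult_nth(1)[of H] mult_nth(4)[of H])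
 moreover have "trace (ka' ** X) = 0" unfolding ka'_def t
  using assms(4,5,7) assms(8)[folded X_def] by (simp add: trace_cmat mult_nth(1)[of H'] mult_nth(4)[of H'])
 moreover have "- trace ((th - ka) ** b') + trace ((th' - ka') ** b) - trace (comm (th - ka) (th' - ka') ** be) =
  - trace (th ** b') + trace (th' ** b) - trace (comm th th' ** be)
  + trace (ka ** X') - trace (ka' ** X) - trace (comm ka ka' ** be)"
  unfolding X_def X'_def by (simp add: cmat_simps algebra_simps)
 ultimately show ?thesis by (simp add: trace_cmat)
qed

text \<open>The left-hand side is the derivative of the boundary expression, the right-hand side the
  integrand of the symplectic form.\<close>

lemma omega_deriv_identity:
 fixes P a a' b b' th th' be :: cmat assumes "det P = 1"
 defines "T == - (adj2 P ** a ** P)" and "T' == - (adj2 P ** a' ** P)"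
 shows "- trace (T ** b') + trace (T' ** b) - trace ((comm th T' + comm T th') ** be) =
  trace (a ** (P ** (comm th' be + b') ** adj2 P) - (P ** (comm th be + b) ** adj2 P) ** a')"
proof -
 have t: "trace (a ** (P ** Y ** adj2 P)) = - trace (T ** Y)" "trace ((P ** Y ** adj2 P) ** a') = - trace (T' ** Y)" for Y
  unfolding T_def T'_def by (simp_all add: cmat_simps algebra_simps)
 have s: "trace (X - Y) = trace X - trace Y" for X Y :: cmat by (simp add: trace_cmat)
 show ?thesis unfolding s t by (simp add: cmat_simps algebra_simps)
qed

context interval
begin

definition nahm_crv :: "(complex => nahm) => nahm => bool" where
 "nahm_crv de w <-> (EX r. (ev (at 0) (%z. de z = nahm_line (de 0) z (r z))) & limitin NS r w (at 0))"

text \<open>For a variation w of the data, \<open>th\<close> is the logarithmic variation P^-1 dP of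
  the parallel transport. The last clause is the variation of the identity be t = P be(0)
  P^-1.\<close>

definition vary :: "(real => cmat) => cmat => nahm => (real => cmat) => bool" where
 "vary P be w th <-> th 0 = 0 &
  (ALL t:II. (th has_der - (adj2 (P t) ** fst w t ** P t)) t) &
  (ALL t:II. snd w t = P t ** (comm (th t) be + snd w 0) ** adj2 (P t))"

lemma varyD: assumes "vary P be w th"
 shows "th 0 = 0" "!!t. t : II ==> (th has_der - (adj2 (P t) ** fst w t ** P t)) t"
  "!!t. t : II ==> snd w t = P t ** (comm (th t) be + snd w 0) ** adj2 (P t)"
 using assms unfolding vary_def by blast+

lemma nahm_crv_variation: assumes c: "nahm_crv de w" and nd: "ev (nhds 0) (%z. de z : nahm_data L x0 xL)"
 obtains th where "vary (par (fst (de 0))) (snd (de 0) 0) w th"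
  "mderiv (%z. par (fst (de z)) L) (par (fst (de 0)) L ** th L)"
  "mderiv (%z. snd (de z) 0) (snd w 0)" "snd w L $ 1 $ 1 = 0" "snd w L $ 2 $ 2 = 0"
proof -
 obtain r where r: "ev (at 0) (%z. de z = nahm_line (de 0) z (r z))" "limitin NS r w (at 0)"
  using c unfolding nahm_crv_def by blast
 have d0: "de 0 : nahm_data L x0 xL" using eventually_nhds_x_imp_x[OF nd] .
 define al where "al = fst (de 0)"
 define P where "P = par al"
 have al: "al : PP" using NDD(1)[of "fst (de 0)" "snd (de 0)"] d0 by (simp add: al_def)
 have wp: "fst w : PP" "snd w : PP" using limitin_topspace[OF r(2)] by (auto simp: tops_NS)
 obtain Y where Y: "Y 0 = 0" "!!t. t : II ==> (Y has_der (- al t) ** Y t + - (fst w t ** P t)) t"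
  using par_variation_exists[OF al wp(1)] unfolding P_def by blast
 have fr: "ev (at 0) (%z. fst (de z) = (%t. al t + cscale (z - 0) (fst (r z) t)))"
  using r(1) unfolding al_def by eventually_elim (metis nahm_line_simps(1) diff_zero)
 have dY: "mderiv (%z. par (fst (de z)) t) (Y t)" if t: "t : II" for t
  using par_crv[OF _ al fr Y(1) Y(2)[unfolded P_def] t] r(2) unfolding limitin_NS mderiv_quotient al_def by simp
 have db: "mderiv (%z. snd (de z) t) (snd w t)" if t: "t : II" for t
 proof -
  have "((%z. snd (r z) t) ---> snd w t) (at 0)"
   using path_eval_lim[OF _ t] r(2) unfolding limitin_NS by blast
  moreover have "ev (at 0) (%z. snd (r z) t = cscale (1 / z) (snd (de z) t - snd (de 0) t))" using r(1) at_0_nz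
  proof eventually_elim
   case (elim z)
   have "snd (de z) t = snd (de 0) t + cscale z (snd (r z) t)" by (subst elim(1)) (simp add: nahm_line_simps)
   thus ?case using elim(2) by (simp add: cscale_simps)
  qed
  ultimately show ?thesis unfolding mderiv_quotient by (rule Lim_transform_eventually)
 qed
 note s0 = path_smooth[OF al]
 have det: "det (P t) = 1" if "t : II" for t unfolding P_def by (rule par_det[OF s0 pathsD(2)[OF al] that])
 \<comment> \<open>First order form of the identity \<open>adj2 P ** P = mat 1\<close>, which holds
   along the curve.\<close>
 have adjY: "adj2 (Y t) ** P t = - (adj2 (P t) ** Y t)" if t: "t : II" for t
 proof -
  have "mderiv (%z. adj2 (par (fst (de z)) t) ** par (fst (de z)) t) (adj2 (Y t) ** P t + adj2 (P t) ** Y t)"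
   using mderiv_mult[OF mderiv_adj2[OF dY[OF t]] dY[OF t]] by (simp add: P_def al_def)
  moreover have "ev (nhds 0) (%z. adj2 (par (fst (de z)) t) ** par (fst (de z)) t = mat 1)" using nd
  proof eventually_elim
   case (elim z)
   hence "fst (de z) : PP" using NDD(1)[of "fst (de z)" "snd (de z)"] by simp
   thus ?case by (intro mult_adj2(2) par_det path_smooth pathsD(2) t)
  qed
  ultimately have "adj2 (Y t) ** P t + adj2 (P t) ** Y t = 0" by (rule mderiv_unique[OF _ mderiv_const])
  thus ?thesis by (simp add: add_eq_0_iff2)
 qed
 define th where "th = (%t. adj2 (P t) ** Y t)"
 have c1: "(th has_der - (adj2 (P t) ** fst w t ** P t)) t" if t: "t : II" for t
  using has_der_mmult[OF adj2_par_deriv[OF s0 t pathsD(2)[OF al t], folded P_def] Y(2)[OF t]]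
  unfolding th_def by (simp add: mat_ring)
 have c2: "th 0 = 0" by (simp add: th_def Y(1))
 have c3: "mderiv (%z. par (fst (de z)) L) (P L ** th L)"
  using dY[OF ends(2)] by (simp add: th_def adj2_cancel[OF det[OF ends(2)]])
 have c4: "snd w t = P t ** (comm (th t) (snd (de 0) 0) + snd w 0) ** adj2 (P t)" if t: "t : II" for t
 proof -
  have "ev (nhds 0) (%z. snd (de z) t = par (fst (de z)) t ** snd (de z) 0 ** adj2 (par (fst (de z)) t))"
   using nd by eventually_elim (use nahm_beta_par[of "fst (de _)" "snd (de _)", OF _ t] in simp)
  from mderiv_unique[OF db[OF t] mderiv_mult[OF mderiv_mult[OF dY[OF t] db[OF ends(1)]] mderiv_adj2[OF dY[OF t]]] this]
  have "snd w t = (Y t ** snd (de 0) 0 + P t ** snd w 0) ** adj2 (P t) + P t ** snd (de 0) 0 ** adj2 (Y t)"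
   by (simp add: P_def al_def)
  moreover have "Y t = P t ** th t" by (simp add: th_def adj2_cancel[OF det[OF t]])
  moreover have "adj2 (Y t) = - (th t ** adj2 (P t))"
  proof -
   have "adj2 (Y t) ** P t ** adj2 (P t) = - (th t ** adj2 (P t))" unfolding adjY[OF t] by (simp add: th_def mat_ring)
   thus ?thesis by (simp add: mat_ring mult_adj2[OF det[OF t]])
  qed
  ultimately show ?thesis by (simp add: comm_def mat_ring)
 qed
 have c5: "snd w p $ 1 $ 1 = 0" if p: "p = 0 | p = L" for p
 proof -
  have pI: "p : II" using p ends by auto
  have "(DERIV (%z. snd (de z) p $ 1 $ 1) 0 :> snd w p $ 1 $ 1)" using db[OF pI] by (simp add: mderiv_def)
  moreover have "ev (nhds 0) (%z. snd (de z) p $ 1 $ 1 = (if p = 0 then - \<i> * x0 else - \<i> * xL))" using nd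
  proof eventually_elim
   case (elim z)
   hence "(fst (de z), snd (de z)) : nahm_data L x0 xL" by simp
   from NDD(5,7)[OF this] show ?case using p by auto
  qed
  from DERIV_cong_ev[OF refl this refl] have "(DERIV (%z. snd (de z) p $ 1 $ 1) 0 :> 0)" by simp
  ultimately show ?thesis by (rule DERIV_unique)
 qed
 have c6: "snd w L $ 2 $ 2 = - snd w L $ 1 $ 1" using pathsD(2)[OF wp(2) ends(2)] by (simp add: sl2_iff)
 show thesis by (rule that[of th, folded al_def, folded P_def, OF _ c3 db[OF ends(1)]])
   (use c1 c2 c4 in "simp_all add: c5 c6 vary_def del: atLeastAtMost_iff")
qed

text \<open>The bracket, evaluated at a variable endpoint t, is a primitive of the integrand, and it
  vanishes at 0 because \<open>th\<close> and \<open>th'\<close> do.\<close>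

lemma nahm_omega_boundary: assumes v: "vary P be w th" and v': "vary P be w' th'"
  and P: "!!t. t : II ==> det (P t) = 1" shows "nahm_omega L w w' = - (1 / (2 * complex_of_real L)) *
  (- trace (th L ** snd w' 0) + trace (th' L ** snd w 0) - trace (comm (th L) (th' L) ** be))"
proof -
 note th = varyD[OF v] and th' = varyD[OF v']
 define F where "F = (%t. - trace (th t ** snd w' 0) + trace (th' t ** snd w 0) - trace (comm (th t) (th' t) ** be))"
 have bl: "blin (%X::cmat. trace (X ** C))" for C
  by (rule bounded_linear_compose[OF blin_trace bounded_bilinear.bounded_linear_left[OF bil_mmult]])
 have "(F has_der trace (fst w t ** snd w' t - snd w t ** fst w' t)) t" if t: "t : II" for t
 proof -
  have "(F has_der - trace ((- (adj2 (P t) ** fst w t ** P t)) ** snd w' 0) + trace ((- (adj2 (P t) ** fst w' t ** P t)) ** snd w 0)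
   - trace ((comm (th t) (- (adj2 (P t) ** fst w' t ** P t)) + comm (- (adj2 (P t) ** fst w t ** P t)) (th' t)) ** be)) t"
   unfolding F_def by (rule has_vector_derivative_diff[OF has_vector_derivative_add[OF has_vector_derivative_minus[OF
     blin_deriv[OF bl th(2)[OF t]]] blin_deriv[OF bl th'(2)[OF t]]]
     blin_deriv[OF bl bil_deriv[OF bil_comm th(2)[OF t] th'(2)[OF t]]]])
  thus ?thesis unfolding omega_deriv_identity[OF P[OF t]] th(3)[OF t, symmetric] th'(3)[OF t, symmetric] .
 qed
 hence "((%t. trace (fst w t ** snd w' t - snd w t ** fst w' t)) has_integral F L - F 0) II"
  using L_pos by (intro fundamental_theorem_of_calculus) auto
 moreover have "F 0 = 0" by (simp add: F_def th(1) th'(1) comm_def trace_cmat)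
 ultimately have "integral II (%t. trace (fst w t ** snd w' t - snd w t ** fst w' t)) = F L" by auto
 thus ?thesis by (cases w; cases w') (simp add: F_def)
qed

lemma slim_integral:
 fixes f :: "'i => real => 'a::banach" assumes S: "slim F f g" and F: "F ~= bot"
 shows "((%z. integral II (f z)) ---> integral II g) F"
proof -
 \<comment> \<open>Members of the family are smooth only eventually; the others are replaced by the
   limit so that every member is continuous.\<close>
 define f' where "f' = (%z. if smooth (f z) then f z else g)"
 have ev: "ev F (%z. f z = f' z)" using slimD(1)[OF S] by eventually_elim (simp add: f'_def)
 have "ev F (%z. ALL t:II. f z t = f' z t)" using ev by eventually_elim simp
 from uniform_limit_cong[THEN iffD1, OF this refl slimD(4)[OF S]] have "uniform_limit II f' g F" .
 moreover have "cont II (f' z)" for z unfolding f'_def using slimD(2)[OF S] by (auto intro: smooth_cont)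
 ultimately obtain I J where IJ: "!!z. (f' z has_integral I z) II" "(g has_integral J) II" "(I ---> J) F"
  using uniform_limit_integral[OF _ _ F] by metis
 have "((%z. integral II (f' z)) ---> integral II g) F"
  using IJ(3) by (simp add: integral_unique[OF IJ(1)] integral_unique[OF IJ(2)])
 thus ?thesis by (rule Lim_transform_eventually) (use ev in eventually_elim, simp)
qed

text \<open>When the variations of \<alpha> are constant and off-diagonal, the trace sees only the
  off-diagonal part of the integrated variations of \<beta>, which is how \<open>RG\<close> defines
  its second component.\<close>

lemma nahm_omega_constant:
 assumes w: "fst w = onI (%t. a)" "smooth (snd w)" "proj_perp (integral II (snd w)) = b" "a : t_perp"
  and w': "fst w' = onI (%t. a')" "smooth (snd w')" "proj_perp (integral II (snd w')) = b'" "a' : t_perp"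
 shows "nahm_omega L w w' = kron_omega L (a, b) (a', b')"
proof -
 have bl: "blin (%X. trace (a ** X))" "blin (%X. trace (X ** a'))"
  by (intro bounded_linear_compose[OF blin_trace] bounded_bilinear.bounded_linear_left[OF bil_mmult]
    bounded_bilinear.bounded_linear_right[OF bil_mmult])+
 have i: "snd w integrable_on II" "snd w' integrable_on II"
  using smooth_cont[OF w(2)] smooth_cont[OF w'(2)] by (auto intro: integrable_continuous_real)
 have "integral II (%t. trace (fst w t ** snd w' t - snd w t ** fst w' t)) =
   integral II (%t. trace (a ** snd w' t) - trace (snd w t ** a'))"
  by (rule integral_cong) (simp add: w(1) w'(1) on_I_eq trace_cmat)
 also have "\<dots> = integral II (%t. trace (a ** snd w' t)) - integral II (%t. trace (snd w t ** a'))"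
  using integrable_linear[OF i(2) bl(1)] integrable_linear[OF i(1) bl(2)] by (intro integral_diff) (simp_all add: o_def)
 also have "\<dots> = trace (a ** integral II (snd w')) - trace (integral II (snd w) ** a')"
  using integral_linear[OF i(2) bl(1)] integral_linear[OF i(1) bl(2)] by (simp add: o_def)
 also have "\<dots> = trace (a ** b' - a' ** b)"
  using w(4) w'(4) unfolding w(3)[symmetric] w'(3)[symmetric] by (simp add: cmat_simps proj_perp_def t_perp_iff)
 finally show ?thesis by (cases w; cases w') simp
qed

end

lemma DERIV_product_identity:
 fixes f g h k :: "complex => complex" assumes "(DERIV f 0 :> f')" "(DERIV g 0 :> g')"
  "(DERIV h 0 :> h')" "(DERIV k 0 :> k')" and "ev (nhds 0) (%z. f z * g z = h z * k z)"
 shows "f' * g 0 + f 0 * g' = h' * k 0 + h 0 * k'"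
proof -
 have "(DERIV (%z. f z * g z) 0 :> h' * k 0 + k' * h 0)"
  unfolding DERIV_cong_ev[OF refl assms(5) refl] by (rule DERIV_mult[OF assms(3,4)])
 from DERIV_unique[OF DERIV_mult[OF assms(1,2)] this] show ?thesis by (simp add: mult.commute)
qed

text \<open>The hypotheses are derivatives of torus invariant relations between the entries of two
  curves with pointwise equal orbits. The infinitesimal torus element \<open>k\<close> is recovered
  by dividing by an entry that is nonzero; the relations then determine the other
  derivatives.\<close>

lemma torus_crv_deriv:
 fixes a b c d a' b' c' d' m n :: complex
 assumes mn: "m * n = 1" and nz: "\<not> (a = 0 & b = 0 & c = 0 & d = 0)"
  and R: "a' * (b * n) + a * m * b' = ad * b + a * bd" "a' * (d * n) + a * m * d' = ad * d + a * dd"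
   "c' * (b * n) + c * m * b' = cd * b + c * bd" "c' * (d * n) + c * m * d' = cd * d + c * dd"
   "a' * c + a * m * cd = ad * (c * m) + a * c'" "b' * d + b * n * dd = bd * (d * n) + b * d'"
 obtains k where "a' = m * (ad + k * a)" "b' = n * (bd - k * b)" "c' = m * (cd + k * c)" "d' = n * (dd - k * d)"
proof -
 consider "a ~= 0" | "a = 0" "c ~= 0" | "a = 0" "c = 0" "b ~= 0" | "a = 0" "c = 0" "b = 0" "d ~= 0" using nz by blast
 thus thesis
 proof cases
  case 1
  define k where "k = (a' * n - ad) / a"
  have k: "k * a = a' * n - ad" using 1 by (simp add: k_def)
  have a': "a' = m * (ad + k * a)" using k mn by algebra
  have "a * (b' - n * (bd - k * b)) = 0" "a * (d' - n * (dd - k * d)) = 0" "a * (c' - m * (cd + k * c)) = 0"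
   using R(1,2,5) mn a' by algebra+
  thus thesis using that[OF a'] 1 by simp
 next
  case 2
  define k where "k = (c' * n - cd) / c"
  have k: "k * c = c' * n - cd" using 2 by (simp add: k_def)
  have c': "c' = m * (cd + k * c)" using k mn by algebra
  have "c * (b' - n * (bd - k * b)) = 0" "c * (d' - n * (dd - k * d)) = 0" "c * (a' - m * (ad + k * a)) = 0"
   using R(3,4,5) mn c' by algebra+
  thus thesis using that[of k] c' 2 by simp
 next
  case 3
  define k where "k = (bd - m * b') / b"
  have k: "k * b = bd - m * b'" using 3 by (simp add: k_def)
  have b': "b' = n * (bd - k * b)" using k mn by algebra
  have "b * (a' - m * (ad + k * a)) = 0" "b * (c' - m * (cd + k * c)) = 0" "b * (d' - n * (dd - k * d)) = 0"
   using R(1,3,6) mn b' by algebra+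
  thus thesis using that[of k] b' 3 by simp
 next
  case 4
  define k where "k = (dd - m * d') / d"
  have k: "k * d = dd - m * d'" using 4 by (simp add: k_def)
  have d': "d' = n * (dd - k * d)" using k mn by algebra
  have "d * (a' - m * (ad + k * a)) = 0" "d * (c' - m * (cd + k * c)) = 0" "d * (b' - n * (bd - k * b)) = 0"
   using R(2,4,6) mn d' by algebra+
  thus thesis using that[of k] d' 4 by simp
 qed
qed

text \<open>The orbit direction (a, -b, c, -d) pairs to zero with vectors satisfying the linearized
  Kronheimer equation, which is the content of \<open>v\<close>, and with itself.\<close>

lemma kron_omega_torus:
 fixes k k' :: complex
 assumes mn: "m * n = 1" and v: "ad * d + a * dd - bd * c - b * cd = 0" "ad' * d + a * dd' - bd' * c - b * cd' = 0"
 shows "kron_omega L (kdat (m * (ad + k * a)) (n * (bd - k * b)) (m * (cd + k * c)) (n * (dd - k * d)))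
   (kdat (m * (ad' + k' * a)) (n * (bd' - k' * b)) (m * (cd' + k' * c)) (n * (dd' - k' * d))) =
  kron_omega L (kdat ad bd cd dd) (kdat ad' bd' cd' dd')"
proof -
 have "trace (mat2 0 p q 0 ** mat2 0 r s 0 - mat2 0 p' q' 0 ** mat2 0 r' s' 0) = p * s + q * r - (p' * s' + q' * r')" for p q r s p' q' r' s'
  by (simp add: cmat_simps)
 moreover have "m * (ad + k * a) * (n * (dd' - k' * d)) + n * (bd - k * b) * (m * (cd' + k' * c))
   - (m * (ad' + k' * a) * (n * (dd - k * d)) + n * (bd' - k' * b) * (m * (cd + k * c))) =
  ad * dd' + bd * cd' - (ad' * dd + bd' * cd)"
  using mn v by algebra
 ultimately show ?thesis unfolding kdat_def by simp
qed

section \<open>Tangent vectors in normal form and the comparison of the forms\<close>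

context nahm_params
begin

lemma kderiv_entries: assumes "kderiv c v" shows "(DERIV (%z. fst (c z) $ i $ j) 0 :> fst v $ i $ j)"
  "(DERIV (%z. snd (c z) $ i $ j) 0 :> snd v $ i $ j)"
  "(%z. fst (c z) $ i $ j) fdiff (at 0)" "(%z. snd (c z) $ i $ j) fdiff (at 0)"
 using assms unfolding kderiv_def mderiv_def field_differentiable_def by blast+

lemma kderiv_t_perp:
 assumes "kderiv c v" "ev (nhds 0) (%z. c z : kron_data x)" shows "v = kdat (fst v $ 1 $ 2) (fst v $ 2 $ 1) (snd v $ 1 $ 2) (snd v $ 2 $ 1)"
proof -
 have "fst v $ i $ i = 0 & snd v $ i $ i = 0" for i
 proof -
  have "ev (nhds 0) (%z. fst (c z) $ i $ i = 0 & snd (c z) $ i $ i = 0)"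
   using assms(2) by eventually_elim (use exhaust_2[of i] in "auto simp: kron_data_def t_perp_iff")
  hence e: "ev (nhds 0) (%z. fst (c z) $ i $ i = 0)" "ev (nhds 0) (%z. snd (c z) $ i $ i = 0)"
   by (simp_all add: eventually_conj_iff)
  show ?thesis
   using kderiv_entries(1,2)[OF assms(1), of i i] unfolding DERIV_cong_ev[OF refl e(1) refl] DERIV_cong_ev[OF refl e(2) refl]
   using DERIV_unique DERIV_const by blast
 qed
 thus ?thesis by (simp add: kdat_def prod_eq_iff cmat_iff)
qed

lemma kderiv_cont: assumes "kderiv c v" shows "(c ---> c 0) (at 0)"
proof -
 have "((%z. (fst (c z), snd (c z))) ---> (fst (c 0), snd (c 0))) (at 0)"
  by (intro tendsto_Pair vec_tendstoI)
   (use DERIV_isCont[OF kderiv_entries(1)[OF assms]] DERIV_isCont[OF kderiv_entries(2)[OF assms]] in "auto simp: isCont_def")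
 thus ?thesis by simp
qed

text \<open>Keeps the curve of data with constant \<alpha> inside the differentiable setting. The
  projected integral of the variation of \<beta> is found by differentiating
  \<open>RG L (of_kron A) = A\<close>.\<close>

lemma of_kron_crv: assumes c: "kderiv c v" "ev (nhds 0) (%z. c z : TK)"
 obtains w where "nahm_crv (%z. of_kron (c z)) w" "fst w = onI (%t. fst v)" "smooth (snd w)"
  "proj_perp (integral II (snd w)) = snd v"
proof -
 have ev: "ev (at 0) (%z. c z : TK)" using c(2) eventually_nhds_conv_at by blast
 have c0: "c 0 : TK" using eventually_nhds_x_imp_x[OF c(2)] .
 have cl: "((%z. fst (c z)) ---> fst (c 0)) (at 0)" by (rule tendsto_fst[OF kderiv_cont[OF c(1)]])
 define Q where "Q = (%z. cscale (1 / z) (fst (c z) - fst (c 0)))"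
 have Q: "(Q ---> fst v) (at 0)" using c(1) unfolding kderiv_def mderiv_quotient Q_def by blast
 define be where "be = (%z. snd (of_kron (c z)))"
 have bd: "(be z has_der comm (- fst (c z)) (be z t)) t" if "c z : TK" "t : II" for z t
  unfolding be_def by (rule good_kron_nahm(4)[OF TK_good[OF that(1)] that(2)])
 have bep: "be z : PP" if "c z : TK" for z using ND_paths[OF TKD(2)[OF that]] by (simp add: be_def)
 obtain D0 where D0: "mderiv (%z. be z 0) D0"
 proof -
  define a where "a = (%z. fst (c z) $ 1 $ 2 * fst (c z) $ 2 $ 1)"
  note d = kderiv_entries(3,4)[OF c(1)]
  have nz: "S2 (a 0) ~= 0" using TK_good[OF c0] by (simp add: a_def good_kron_def)
  have a: "a fdiff (at 0)" unfolding a_def by (intro field_differentiable_mult d)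
  have "(%z. (snd (c z) $ 1 $ 2 + 2 * \<i> * fst (c z) $ 1 $ 2 * ZZ (a z)) / l) fdiff (at 0)"
   "(%z. (snd (c z) $ 2 $ 1 - 2 * \<i> * fst (c z) $ 2 $ 1 * ZZ (a z)) / l) fdiff (at 0)"
   by (intro field_differentiable_mult field_differentiable_add field_differentiable_diff
    field_differentiable_divide ZZ_diff[OF a nz] d; simp)+
  then obtain p q where pq: "(DERIV (%z. (snd (c z) $ 1 $ 2 + 2 * \<i> * fst (c z) $ 1 $ 2 * ZZ (a z)) / l) 0 :> p)"
   "(DERIV (%z. (snd (c z) $ 2 $ 1 - 2 * \<i> * fst (c z) $ 2 $ 1 * ZZ (a z)) / l) 0 :> q)"
   unfolding field_differentiable_def by blast
  have e: "ev (nhds 0) (%z. be z 0 = mat2 (- \<i> * x0) ((snd (c z) $ 1 $ 2 + 2 * \<i> * fst (c z) $ 1 $ 2 * ZZ (a z)) / l)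
    ((snd (c z) $ 2 $ 1 - 2 * \<i> * fst (c z) $ 2 $ 1 * ZZ (a z)) / l) (\<i> * x0))"
   using c(2) unfolding be_def a_def by eventually_elim (rule good_kron_nahm(3)[OF TK_good])
  have "(DERIV (%z. be z 0 $ i $ j) 0 :> mat2 0 p q 0 $ i $ j)" for i j
  proof -
   have e': "ev (nhds 0) (%z. be z 0 $ i $ j = mat2 (- \<i> * x0) ((snd (c z) $ 1 $ 2 + 2 * \<i> * fst (c z) $ 1 $ 2 * ZZ (a z)) / l)
    ((snd (c z) $ 2 $ 1 - 2 * \<i> * fst (c z) $ 2 $ 1 * ZZ (a z)) / l) (\<i> * x0) $ i $ j)"
    using e by eventually_elim simp
   show ?thesis unfolding DERIV_cong_ev[OF refl e' refl] using pq exhaust_2[of i] exhaust_2[of j] by auto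
  qed
  hence "mderiv (%z. be z 0) (mat2 0 p q 0)" by (simp add: mderiv_def)
  thus thesis by (rule)
 qed
 \<comment> \<open>Hypotheses for the equation of first variation of \<beta>, whose solution
   \<open>q\<close> is the limit of the difference quotients.\<close>
 have "cont II (%t. - fst (c 0))" "cont II (%t. - comm (fst v) (be 0 t))"
  by (intro smooth_cont smooth_minus smooth_comm smooth_const path_smooth[OF bep[OF c0]])+
 from lode_exists[OF bil_comm this, of D0]
 obtain q where q: "q 0 = D0" "!!t. t : II ==> (q has_der comm (- fst (c 0)) (q t) + - comm (fst v) (be 0 t)) t"
  by blast
 define qz where "qz = (%z t. cscale (1 / z) (be z t - be 0 t))"
 have S: "slim (at 0) qz q"
 proof (rule lode_slim[OF bil_comm slim_const[OF tendsto_minus[OF cl]] _ _ q(2)])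
  show "slim (at 0) (%z t. - comm (Q z) (be 0 t)) (%t. - comm (fst v) (be 0 t))"
   by (rule slim_linear[OF bounded_linear_minus[OF bounded_linear_ident]
     slim_bilinear[OF bil_comm slim_const[OF Q] slim_const_seq[OF path_smooth[OF bep[OF c0]]]]])
  show "((%z. qz z 0) ---> q 0) (at 0)" using D0 unfolding qz_def q(1) mderiv_quotient .
  show "ev (at 0) (%z. ALL t:II. (qz z has_der comm (- fst (c z)) (qz z t) + - comm (Q z) (be 0 t)) t)"
   using ev
  proof eventually_elim
   case (elim z)
   show ?case
   proof
    fix t assume t: "t : II"
    have "comm (- fst (c z)) (qz z t) + - comm (Q z) (be 0 t) = cscale (1 / z) (comm (- fst (c z)) (be z t) - comm (- fst (c 0)) (be 0 t))"
     unfolding qz_def Q_def by (simp add: comm_def mat_ring cscale_simps)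
    thus "(qz z has_der comm (- fst (c z)) (qz z t) + - comm (Q z) (be 0 t)) t" unfolding qz_def
     using blin_deriv[OF bounded_bilinear.bounded_linear_right[OF bil_cscale]
       has_vector_derivative_diff[OF bd[OF elim(1) t] bd[OF c0 t]], of "1 / z"] by simp
   qed
  qed
 qed
 have qzs: "qz z t : sl2" if "c z : TK" "t : II" for z t
  using pathsD(2)[OF bep[OF that(1)] that(2)] pathsD(2)[OF bep[OF c0] that(2)] by (simp add: qz_def sl2_iff algebra_simps)
 let ?r = "%z. (onI (%t. Q z), onI (qz z))"
 let ?w = "(onI (%t. fst v), onI q)"
 have Qs: "Q z : sl2" if "c z : TK" for z
  using TKD(1)[OF that] TKD(1)[OF c0] by (auto simp: Q_def kron_data_def t_perp_iff sl2_iff)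
 have "ev (at 0) (%z. ALL t:II. Q z : sl2)" "ev (at 0) (%z. ALL t:II. qz z t : sl2)"
  using ev by (eventually_elim, use Qs qzs in blast)+
 note p = limitin_onI[OF slim_const[OF Q] this(1) disjI1[OF at_neq_bot]] limitin_onI[OF S this(2) disjI1[OF at_neq_bot]]
 hence lim: "limitin NS ?r ?w (at 0)" unfolding limitin_NS by simp
 have "ev (at 0) (%z. of_kron (c z) = nahm_line (of_kron (c 0)) z (?r z))" using ev at_0_nz
 proof eventually_elim
  case (elim z)
  have "be z t = be 0 t + cscale z (onI (qz z) t)" for t
   using pathsD(3)[OF bep[OF elim(1)], of t] pathsD(3)[OF bep[OF c0], of t] by (auto simp: on_I_def qz_def cscale_simps)
  moreover have "fst (of_kron (c z)) t = fst (of_kron (c 0)) t + cscale z (onI (%t. Q z) t)" for t by (auto simp: good_kron_nahm(2)[OF TK_good[OF elim(1)]] good_kron_nahm(2)[OF TK_good[OF c0]]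
     on_I_def Q_def cscale_simps)
  ultimately show ?case unfolding be_def prod_eq_iff nahm_line_simps by auto
 qed
 hence nc: "nahm_crv (%z. of_kron (c z)) ?w" unfolding nahm_crv_def by (intro exI[of _ ?r] conjI lim)
 have proj: "blin (%X. proj_perp X)" unfolding linear_conv_bounded_linear[symmetric]
  by (rule linearI) (simp_all add: proj_perp_def cmat_iff)
 have int: "be z integrable_on II" if "c z : TK" for z
  using smooth_cont[OF path_smooth[OF bep[OF that]]] by (rule integrable_continuous_real)
 have RGb: "proj_perp (integral II (be z)) = snd (c z)" if "c z : TK" for z
  using arg_cong[OF TKD(6)[OF that], of snd] unfolding be_def by (cases "of_kron (c z)") (simp add: RG.simps)
 have P1: "((%z. proj_perp (integral II (qz z))) ---> proj_perp (integral II q)) (at 0)"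
  by (rule bounded_linear.tendsto[OF proj slim_integral[OF S]]) simp
 have "ev (at 0) (%z. proj_perp (integral II (qz z)) = cscale (1 / z) (snd (c z) - snd (c 0)))" using ev
 proof eventually_elim
  case (elim z)
  have "integral II (qz z) = cscale (1 / z) (integral II (be z) - integral II (be 0))" unfolding qz_def
   using integral_linear[OF integrable_diff[OF int[OF elim] int[OF c0]] bounded_bilinear.bounded_linear_right[OF bil_cscale], of "1 / z"]
    integral_diff[OF int[OF elim] int[OF c0]] by (simp add: o_def)
  moreover have "proj_perp (cscale k (X - Y)) = cscale k (proj_perp X - proj_perp Y)" for k X Y
   by (simp add: proj_perp_def cmat_iff)
  ultimately show ?case by (simp add: RGb[OF elim] RGb[OF c0])
 qed
 from Lim_transform_eventually[OF P1 this]
 have "((%z. cscale (1 / z) (snd (c z) - snd (c 0))) ---> proj_perp (integral II q)) (at 0)" .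
 moreover have "((%z. cscale (1 / z) (snd (c z) - snd (c 0))) ---> snd v) (at 0)"
  using c(1) unfolding kderiv_def mderiv_quotient by blast
 ultimately have "proj_perp (integral II q) = snd v" by (rule tendsto_unique[OF at_neq_bot])
 moreover have "integral II (onI q) = integral II q" by (rule integral_cong) (simp add: on_I_def)
 ultimately show thesis using that[OF nc] p(2) unfolding limitin_path_top using path_smooth by auto
qed

lemma rho_crv_kderiv: assumes c: "nahm_crv de w" and d0: "de 0 : ND" "de 0 : rho_dom"
 obtains ro where "kderiv (%z. rho (de z)) ro" "ev (nhds 0) (%z. de z : rho_dom)"
proof -
 obtain r where r: "ev (at 0) (%z. de z = nahm_line (de 0) z (r z))" "limitin NS r w (at 0)"
  using c unfolding nahm_crv_def by blast
 have t: "de 0 : topspace NS" by (rule ND_tops[OF d0(1)])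
 have r': "ev (at 0) (%z. de z = nahm_line (de 0) (z - 0) (r z))" using r(1) by simp
 note R = rho_crv_diff[OF t d0(2) r(2) r', THEN field_differentiable_derivI]
 define ro where "ro = ((\<chi> i j. deriv (%z. fst (rho (de z)) $ i $ j) 0), (\<chi> i j. deriv (%z. snd (rho (de z)) $ i $ j) 0))"
 have "kderiv (%z. rho (de z)) ro" using R unfolding kderiv_def mderiv_def ro_def by simp
 moreover have "ev (nhds 0) (%z. de z : rho_dom)"
 proof (rule eventually_nhds_0[where P = "%z. de z : rho_dom", OF _ d0(2)])
  have "limitin NS (%z. nahm_line (de 0) z (r z)) (nahm_line (de 0) 0 w) (at 0)"
   by (rule nahm_line_lim[OF t r(2) tendsto_ident_at])
  hence lim: "limitin NS (%z. nahm_line (de 0) z (r z)) (de 0) (at 0)"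
   by (simp add: nahm_line_0[OF limitin_topspace[OF r(2)]])
  have "openin NS {B : topspace NS. B : rho_dom & rho B : UNIV}" by (rule openin_rho_vimage) simp
  hence "ev (at 0) (%z. nahm_line (de 0) z (r z) : {B : topspace NS. B : rho_dom & rho B : UNIV})"
   using lim d0(2) unfolding limitin_def by blast
  with r(1) show "ev (at 0) (%z. de z : rho_dom)" by eventually_elim auto
 qed
 ultimately show thesis by (rule)
qed

text \<open>The gauge transformation provided by \<open>rho_ND\<close> starts at the identity, so
  \<beta> at 0 is unchanged and the holonomies differ by a single torus element at L.\<close>

lemma rho_normal_form: assumes B: "B : ND" "B : rho_dom" shows "snd (of_kron (rho B)) 0 = snd B 0"
  "EX q. q ~= 0 & par (fst B) L = mat2 q 0 0 (1 / q) ** par (fst (of_kron (rho B))) L"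
  "par (fst (of_kron (rho B))) L $ 1 $ 1 ~= 0"
proof -
 obtain a b c d where r: "rho B = kdat a b c d" "a * b * l^2 : parab"
  "kdat a b c d : KD" "EX g:GG. g 0 = mat 1 & of_kron (kdat a b c d) = gact g B" by (rule rho_ND[OF B])
 then obtain g where g: "g : GG" "g 0 = mat 1" "of_kron (rho B) = gact g B" by auto
 have "snd (gact g (fst B, snd B)) 0 = snd B 0"
  unfolding gact_adj2[OF gg_det[OF g(1)]] using ends(1) by (simp add: on_I_eq g(2))
 thus "snd (of_kron (rho B)) 0 = snd B 0" using g(3) by simp
 have N: "par (fst (of_kron (rho B))) L = adj2 (g L) ** par (fst B) L"
  using par_gauge[OF g(1) conjunct1[OF ND_paths[OF B(1)]] ends(2), of "snd B"] by (simp add: g(2,3))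
 have h: "g L : torus" by (rule ggD(4)[OF g(1)])
 have t: "g L $ 1 $ 1 * g L $ 2 $ 2 = 1" using h by (simp add: torus_iff)
 hence "g L $ 1 $ 1 ~= 0" by auto
 moreover from this have "g L $ 2 $ 2 = 1 / g L $ 1 $ 1" using t by (simp add: eq_divide_eq mult.commute) from this have "g L = mat2 (g L $ 1 $ 1) 0 0 (1 / g L $ 1 $ 1)" using h by (simp add: cmat_iff torus_iff)
 moreover have "par (fst B) L = g L ** par (fst (of_kron (rho B))) L"
  unfolding N by (simp add: adj2_cancel[OF torus_det[OF h]])
 ultimately show "EX q. q ~= 0 & par (fst B) L = mat2 q 0 0 (1 / q) ** par (fst (of_kron (rho B))) L" by metis
 have "par (fst (of_kron (rho B))) L = hol a b l" using holon_of_kron[of a b c d] by (simp add: holon_def r(1))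
 moreover have "stf 0 (a * b) l ~= 0" using parab_S2[OF r(2)] by (auto simp: S2_factor)
 ultimately show "par (fst (of_kron (rho B))) L $ 1 $ 1 ~= 0" by (simp add: hol_def)
qed

text \<open>Compares the variation of a curve with that of its normal form. They share the variation
  of \<beta> at 0, and the logarithmic derivative H of the torus factor at L accounts for the
  difference of the variations of the holonomy.\<close>

lemma rho_tangent: assumes c: "nahm_crv de w" and nd: "ev (nhds 0) (%z. de z : ND)"
  and ro: "kderiv (%z. rho (de z)) ro" and B: "de 0 = B" "B : rho_dom"
 obtains th th' w' H where "vary (par (fst B)) (snd B 0) w th" "vary (par (fst (of_kron (rho B)))) (snd B 0) w' th'"
  "fst w' = onI (%t. fst ro)" "smooth (snd w')" "proj_perp (integral II (snd w')) = snd ro" "fst ro : t_perp"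
  "snd w' 0 = snd w 0" "H $ 1 $ 2 = 0" "H $ 2 $ 1 = 0" "H $ 2 $ 2 = - H $ 1 $ 1"
  "th' L = th L - adj2 (par (fst B) L) ** H ** par (fst B) L" "snd w L $ 1 $ 1 = 0" "snd w L $ 2 $ 2 = 0"
proof -
 have d0: "de 0 : ND" and dom: "de 0 : rho_dom" using eventually_nhds_x_imp_x[OF nd] B by auto
 define P where "P = par (fst B)"
 define P' where "P' = par (fst (of_kron (rho B)))"
 obtain ro' where dm: "ev (nhds 0) (%z. de z : rho_dom)" using rho_crv_kderiv[OF c d0 dom] by blast
 have tk: "ev (nhds 0) (%z. rho (de z) : TK)" using nd dm by eventually_elim (rule rho_TK(1))
 have kd: "ev (nhds 0) (%z. rho (de z) : KD)" using tk by eventually_elim (rule TKD(1))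
 have rot: "fst ro : t_perp" using kderiv_t_perp[OF ro kd] by (metis fst_conv kdat_def mat2_nth(1,4) t_perp_iff)
 obtain w' where w': "nahm_crv (%z. of_kron (rho (de z))) w'" "fst w' = onI (%t. fst ro)" "smooth (snd w')"
  "proj_perp (integral II (snd w')) = snd ro" using of_kron_crv[OF ro tk] .
 have nd': "ev (nhds 0) (%z. of_kron (rho (de z)) : ND)" using tk by eventually_elim (rule TKD(2))
 obtain th where th: "vary (par (fst (de 0))) (snd (de 0) 0) w th"
  "mderiv (%z. par (fst (de z)) L) (par (fst (de 0)) L ** th L)"
  "mderiv (%z. snd (de z) 0) (snd w 0)" "snd w L $ 1 $ 1 = 0" "snd w L $ 2 $ 2 = 0" by (rule nahm_crv_variation[OF c nd])
 obtain th' where th': "vary (par (fst (of_kron (rho (de 0))))) (snd (of_kron (rho (de 0))) 0) w' th'"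
  "mderiv (%z. par (fst (of_kron (rho (de z)))) L) (par (fst (of_kron (rho (de 0)))) L ** th' L)"
  "mderiv (%z. snd (of_kron (rho (de z))) 0) (snd w' 0)" by (rule nahm_crv_variation[OF w'(1) nd'])
 have b: "snd w' 0 = snd w 0"
 proof (rule mderiv_unique[OF th'(3) th(3)])
  show "ev (nhds 0) (%z. snd (of_kron (rho (de z))) 0 = snd (de z) 0)"
   using nd dm by eventually_elim (rule rho_normal_form(1))
 qed
 define M where "M = (%z. par (fst (de z)) L)"
 define N where "N = (%z. par (fst (of_kron (rho (de z)))) L)"
 \<comment> \<open>The torus factor at L is only known to exist for each z. Expressed as a quotient
   of holonomy entries it becomes differentiable in z.\<close>
 define q where "q = (%z. M z $ 1 $ 1 / N z $ 1 $ 1)"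
 define E where "E = (%z. mat2 (q z) 0 0 (1 / q z))"
 have E: "M z = E z ** N z & q z ~= 0 & N z $ 1 $ 1 ~= 0" if z: "de z : ND" "de z : rho_dom" for z
 proof -
  obtain p where p: "p ~= 0" "M z = mat2 p 0 0 (1 / p) ** N z" using rho_normal_form(2)[OF z] unfolding M_def N_def by blast
  have n: "N z $ 1 $ 1 \<noteq> 0" unfolding N_def by (rule rho_normal_form(3)[OF z])
  have "q z = p" using p n by (simp add: q_def mult_nth)
  thus ?thesis using p n by (simp add: E_def)
 qed
 note E0 = E[OF d0 dom]
 have M0: "M 0 = P L" "N 0 = P' L" by (simp_all add: M_def N_def P_def P'_def B(1))
 have Md: "mderiv M (P L ** th L)" and Nd: "mderiv N (P' L ** th' L)" using th(2) th'(2) by (simp_all add: M_def N_def P_def P'_def B(1))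
 obtain q' where q': "(DERIV q 0 :> q')"
  unfolding q_def using DERIV_divide[OF Md[unfolded mderiv_def, rule_format, of 1 1] Nd[unfolded mderiv_def, rule_format, of 1 1]] E0 by blast
 have Ed: "mderiv E (mat2 q' 0 0 (- q' / (q 0)\<^sup>2))"
 proof -
  have "(DERIV (%z. 1 / q z) 0 :> - q' / (q 0)\<^sup>2)"
   using DERIV_divide[OF DERIV_const[of 1] q'] E0 by (simp add: power2_eq_square)
  hence "(DERIV (%z. E z $ i $ j) 0 :> mat2 q' 0 0 (- q' / (q 0)\<^sup>2) $ i $ j)" for i j
   using q' exhaust_2[of i] exhaust_2[of j] unfolding E_def by auto
  thus ?thesis by (simp add: mderiv_def)
 qed
 have "ev (nhds 0) (%z. M z = E z ** N z)" using nd dm by eventually_elim (use E in blast)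
 from mderiv_unique[OF Md mderiv_mult[OF Ed Nd] this]
 have "P L ** th L = mat2 q' 0 0 (- q' / (q 0)\<^sup>2) ** P' L + P L ** th' L" using E0 by (simp add: M0 mat_ring)
 moreover have dP: "det (P L) = 1"
  unfolding P_def B(1)[symmetric] using ND_paths[OF d0] by (intro par_det path_smooth pathsD(2) ends(2)) auto have dE: "det (E 0) = 1" using E0 by (simp add: E_def det_cmat)
 define H where "H = mat2 q' 0 0 (- q' / (q 0)\<^sup>2) ** adj2 (E 0)"
 have "P' L = adj2 (E 0) ** P L" using E0 by (simp add: M0 adj2_cancel[OF dE])
 ultimately have "P L ** th L = H ** P L + P L ** th' L" by (simp add: H_def mat_ring)
 hence "adj2 (P L) ** (P L ** th L) = adj2 (P L) ** (H ** P L + P L ** th' L)" by simp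
 hence "th L = adj2 (P L) ** H ** P L + th' L" by (simp add: adj2_cancel[OF dP] mat_ring(1)) (simp add: mat_ring)
 hence H: "th' L = th L - adj2 (P L) ** H ** P L" by simp
 have "H $ 1 $ 2 = 0" "H $ 2 $ 1 = 0" "H $ 2 $ 2 = - H $ 1 $ 1" by (simp_all add: H_def E_def mult_nth power2_eq_square)
 from that[OF th(1)[unfolded B(1)] th'(1)[unfolded rho_normal_form(1)[OF d0 dom], unfolded B(1)] w'(2-4) rot b this H[unfolded P_def] th(4,5)]
 show thesis .
qed

text \<open>The boundary expressions of the original and the normal form variations agree by
  \<open>sympl_invariance\<close>; for the normal form the integral is the Kronheimer form.\<close>

lemma rho_sympl: assumes de: "nahm_crv de w" "ev (nhds 0) (%z. de z : ND)" "kderiv (%z. rho (de z)) ro"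
  and de': "nahm_crv de' w'" "ev (nhds 0) (%z. de' z : ND)" "kderiv (%z. rho (de' z)) ro'"
  and B: "de 0 = B" "de' 0 = B" "B : rho_dom" shows "nahm_omega L w w' = kron_omega L ro ro'"
proof -
 have I: "L : II" using L_pos by auto
 have Bd: "B : ND" using eventually_nhds_x_imp_x[OF de(2)] B(1) by simp
 have Kd: "of_kron (rho B) : ND" by (rule TKD(2)[OF rho_TK(1)[OF Bd B(3)]])
 let ?P = "par (fst B)" and ?Q = "par (fst (of_kron (rho B)))"
 have det: "det (?P t) = 1" "det (?Q t) = 1" if "t : II" for t using ND_paths[OF Bd] ND_paths[OF Kd] that
  by (intro par_det path_smooth pathsD(2); simp)+
 obtain th th' v H where 1: "vary ?P (snd B 0) w th" "vary ?Q (snd B 0) v th'"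
  "fst v = onI (%t. fst ro)" "smooth (snd v)" "proj_perp (integral II (snd v)) = snd ro" "fst ro : t_perp"
  "snd v 0 = snd w 0" "H $ 1 $ 2 = 0" "H $ 2 $ 1 = 0" "H $ 2 $ 2 = - H $ 1 $ 1"
  "th' L = th L - adj2 (?P L) ** H ** ?P L" "snd w L $ 1 $ 1 = 0" "snd w L $ 2 $ 2 = 0" by (rule rho_tangent[OF de B(1,3)])
 obtain \<phi> \<phi>' u K where 2: "vary ?P (snd B 0) w' \<phi>" "vary ?Q (snd B 0) u \<phi>'"
  "fst u = onI (%t. fst ro')" "smooth (snd u)" "proj_perp (integral II (snd u)) = snd ro'" "fst ro' : t_perp"
  "snd u 0 = snd w' 0" "K $ 1 $ 2 = 0" "K $ 2 $ 1 = 0" "K $ 2 $ 2 = - K $ 1 $ 1"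
  "\<phi>' L = \<phi> L - adj2 (?P L) ** K ** ?P L" "snd w' L $ 1 $ 1 = 0" "snd w' L $ 2 $ 2 = 0"
  by (rule rho_tangent[OF de' B(2,3)])
 have c: "nahm_omega L v u = kron_omega L (fst ro, snd ro) (fst ro', snd ro')"
  by (rule nahm_omega_constant[OF 1(3-6) 2(3-6)])
 have b: "nahm_omega L w w' = - (1 / (2 * complex_of_real L)) *
   (- trace (th L ** snd w' 0) + trace (\<phi> L ** snd w 0) - trace (comm (th L) (\<phi> L) ** snd B 0))"
  by (rule nahm_omega_boundary[OF 1(1) 2(1) det(1)])
 have b': "nahm_omega L v u = - (1 / (2 * complex_of_real L)) *
   (- trace (th' L ** snd u 0) + trace (\<phi>' L ** snd v 0) - trace (comm (th' L) (\<phi>' L) ** snd B 0))"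
  by (rule nahm_omega_boundary[OF 1(2) 2(2) det(2)])
 have "nahm_omega L v u = nahm_omega L w w'" unfolding b b' 1(7,11) 2(7,11)
  by (subst sympl_invariance[OF det(1)[OF I] 1(8,9) 2(8,9) 1(10) 2(10)])
   (simp_all add: varyD(3)[OF 1(1) I, symmetric] varyD(3)[OF 2(1) I, symmetric] 1(12,13) 2(12,13))
 with c show ?thesis by simp
qed

text \<open>The torus elements relating the two curves need not depend differentiably on z, so the
  argument differentiates the invariant products listed in \<open>prods\<close>. Differentiating the
  Kronheimer equation gives the last conclusion.\<close>

lemma kron_orbit_tangent:
 assumes ga: "kderiv ga v" "ev (nhds 0) (%z. ga z : kron_data x)" and ze: "kderiv ze ro"
  and orb: "ev (nhds 0) (%z. ze z : kron_orbit (ga z))"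
  and 0: "ga 0 = kdat a b c d" "\<not> (a = 0 & b = 0 & c = 0 & d = 0)" "ze 0 = kdat (a * m) (b * n) (c * m) (d * n)" "m * n = 1"
 obtains k where "ro = kdat (m * (fst v $ 1 $ 2 + k * a)) (n * (fst v $ 2 $ 1 - k * b)) (m * (snd v $ 1 $ 2 + k * c)) (n * (snd v $ 2 $ 1 - k * d))"
  "v = kdat (fst v $ 1 $ 2) (fst v $ 2 $ 1) (snd v $ 1 $ 2) (snd v $ 2 $ 1)"
  "fst v $ 1 $ 2 * d + a * snd v $ 2 $ 1 - fst v $ 2 $ 1 * c - b * snd v $ 1 $ 2 = 0"
proof -
 have prods: "ev (nhds 0) (%z. ze z : kron_data x & fst (ze z) $ 1 $ 2 * fst (ze z) $ 2 $ 1 = fst (ga z) $ 1 $ 2 * fst (ga z) $ 2 $ 1 &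
   fst (ze z) $ 1 $ 2 * snd (ze z) $ 2 $ 1 = fst (ga z) $ 1 $ 2 * snd (ga z) $ 2 $ 1 &
   snd (ze z) $ 1 $ 2 * fst (ze z) $ 2 $ 1 = snd (ga z) $ 1 $ 2 * fst (ga z) $ 2 $ 1 &
   snd (ze z) $ 1 $ 2 * snd (ze z) $ 2 $ 1 = snd (ga z) $ 1 $ 2 * snd (ga z) $ 2 $ 1 &
   fst (ze z) $ 1 $ 2 * snd (ga z) $ 1 $ 2 = fst (ga z) $ 1 $ 2 * snd (ze z) $ 1 $ 2 &
   fst (ze z) $ 2 $ 1 * snd (ga z) $ 2 $ 1 = fst (ga z) $ 2 $ 1 * snd (ze z) $ 2 $ 1)"
  using ga(2) orb
 proof eventually_elim
  case (elim z)
  obtain h where h: "h : torus" "ze z = kron_act h (ga z)" using elim(2) unfolding kron_orbit_def by blast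
  obtain p q r s where g: "ga z = kdat p q r s" using elim(1) by (rule KD_kdat)
  have u: "(h $ 2 $ 2)\<^sup>2 * (h $ 1 $ 1)\<^sup>2 = 1" using torus_units(1)[OF h(1)] by (simp add: mult.commute)
  have e: "p * (h $ 2 $ 2)\<^sup>2 * (q * (h $ 1 $ 1)\<^sup>2) = p * q" for p q using u by auto
  have "ze z : kron_data x" unfolding h(2) by (rule KD_act[OF h(1) elim(1)])
  thus ?case unfolding h(2) g kron_act_kdat[OF h(1)] kdat_nth e by simp
 qed
 have D: "(DERIV (%z. fst (ga z) $ i $ j) 0 :> fst v $ i $ j)" "(DERIV (%z. snd (ga z) $ i $ j) 0 :> snd v $ i $ j)"
  "(DERIV (%z. fst (ze z) $ i $ j) 0 :> fst ro $ i $ j)" "(DERIV (%z. snd (ze z) $ i $ j) 0 :> snd ro $ i $ j)" for i j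
  using kderiv_entries[OF ga(1)] kderiv_entries[OF ze] by blast+
 note p = prods[unfolded eventually_conj_iff]
 note R = DERIV_product_identity[OF D(3)[of 1 2] D(3)[of 2 1] D(1)[of 1 2] D(1)[of 2 1]]
  DERIV_product_identity[OF D(3)[of 1 2] D(4)[of 2 1] D(1)[of 1 2] D(2)[of 2 1]]
  DERIV_product_identity[OF D(4)[of 1 2] D(3)[of 2 1] D(2)[of 1 2] D(1)[of 2 1]]
  DERIV_product_identity[OF D(4)[of 1 2] D(4)[of 2 1] D(2)[of 1 2] D(2)[of 2 1]]
  DERIV_product_identity[OF D(3)[of 1 2] D(2)[of 1 2] D(1)[of 1 2] D(4)[of 1 2]]
  DERIV_product_identity[OF D(3)[of 2 1] D(2)[of 2 1] D(1)[of 2 1] D(4)[of 2 1]]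
 obtain k where k: "fst ro $ 1 $ 2 = m * (fst v $ 1 $ 2 + k * a)" "fst ro $ 2 $ 1 = n * (fst v $ 2 $ 1 - k * b)"
  "snd ro $ 1 $ 2 = m * (snd v $ 1 $ 2 + k * c)" "snd ro $ 2 $ 1 = n * (snd v $ 2 $ 1 - k * d)"
  by (rule torus_crv_deriv[OF 0(4,2)]; use R p in "simp add: 0(1,3)")
 have kd: "ev (nhds 0) (%z. ze z : kron_data x)" using p by blast
 have ve: "v = kdat (fst v $ 1 $ 2) (fst v $ 2 $ 1) (snd v $ 1 $ 2) (snd v $ 2 $ 1)" by (rule kderiv_t_perp[OF ga])
 have "ro = kdat (fst ro $ 1 $ 2) (fst ro $ 2 $ 1) (snd ro $ 1 $ 2) (snd ro $ 2 $ 1)" by (rule kderiv_t_perp[OF ze kd])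
 hence re: "ro = kdat (m * (fst v $ 1 $ 2 + k * a)) (n * (fst v $ 2 $ 1 - k * b)) (m * (snd v $ 1 $ 2 + k * c)) (n * (snd v $ 2 $ 1 - k * d))"
  unfolding k .
 have "(DERIV (%z. fst (ga z) $ 1 $ 2 * snd (ga z) $ 2 $ 1 - fst (ga z) $ 2 $ 1 * snd (ga z) $ 1 $ 2) 0 :> (fst v $ 1 $ 2 * d + snd v $ 2 $ 1 * a) - (fst v $ 2 $ 1 * c + snd v $ 1 $ 2 * b))"
  using DERIV_diff[OF DERIV_mult[OF D(1)[of 1 2] D(2)[of 2 1]] DERIV_mult[OF D(1)[of 2 1] D(2)[of 1 2]]] by (simp add: 0(1))
 moreover have "ev (nhds 0) (%z. fst (ga z) $ 1 $ 2 * snd (ga z) $ 2 $ 1 - fst (ga z) $ 2 $ 1 * snd (ga z) $ 1 $ 2 = \<i> * x)"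
  using ga(2)
 proof eventually_elim
  case (elim z)
  then obtain p q r s where "ga z = kdat p q r s" "p * s - q * r = \<i> * x" by (rule KD_kdat)
  thus ?case by simp
 qed
 from DERIV_cong_ev[OF refl this refl]
 have "(DERIV (%z. fst (ga z) $ 1 $ 2 * snd (ga z) $ 2 $ 1 - fst (ga z) $ 2 $ 1 * snd (ga z) $ 1 $ 2) 0 :> 0)" by simp
 ultimately have "(fst v $ 1 $ 2 * d + snd v $ 2 $ 1 * a) - (fst v $ 2 $ 1 * c + snd v $ 1 $ 2 * b) = 0" by (rule DERIV_unique)
 hence "fst v $ 1 $ 2 * d + a * snd v $ 2 $ 1 - fst v $ 2 $ 1 * c - b * snd v $ 1 $ 2 = 0" by (simp add: algebra_simps)
 from that[OF re ve this] show thesis .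
qed

lemma nahm_crv_gauge: assumes g: "g : GG" and c: "nahm_crv de w" and d0: "de 0 : topspace NS"
 obtains w' where "nahm_crv (%z. gact g (de z)) w'"
proof -
 obtain r where r: "ev (at 0) (%z. de z = nahm_line (de 0) z (r z))" "limitin NS r w (at 0)"
  using c unfolding nahm_crv_def by blast
 define T where "T = (%f. onI (%t. adj2 (g t) ** f t ** g t))"
 have sg: "smooth g" by (rule ggD(1)[OF g])
 have Tl: "limitin (path_top L) (%z. T (f z)) (T f0) (at 0)" if "limitin (path_top L) f f0 (at 0)" for f :: "complex => real => cmat" and f0
 proof -
  note l = that[unfolded limitin_path_top]
  have "slim (at 0) (%z t. adj2 (g t) ** f z t ** g t) (%t. adj2 (g t) ** f0 t ** g t)"
   by (rule slim_bilinear[OF bil_mmult slim_bilinear[OF bil_mmult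
      slim_const_seq[OF smooth_adj2[OF sg]]] slim_const_seq[OF sg]]) (use l in blast)
  moreover have "ev (at 0) (%z. ALL t:II. adj2 (g t) ** f z t ** g t : sl2)"
   using conjunct1[OF conjunct2[OF l]] by eventually_elim (use conj_sl2 ggD(2)[OF g] pathsD(2) in blast)
  ultimately show ?thesis unfolding T_def by (rule limitin_onI) simp
 qed
 have line: "gact g (nahm_line B z u) = nahm_line (gact g B) z (T (fst u), T (snd u))" for B z u
 proof -
  obtain al be where "B = (al, be)" by (cases B)
  moreover obtain a b where "u = (a, b)" by (cases u)
  ultimately show ?thesis by (simp add: gact_adj2[OF gg_det[OF g]] T_def on_I_def fun_eq_iff mat_ring cscale_simps)
 qed
 have "nahm_crv (%z. gact g (de z)) (T (fst w), T (snd w))" unfolding nahm_crv_def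
 proof (intro exI[of _ "%z. (T (fst (r z)), T (snd (r z)))"] conjI)
  show "ev (at 0) (%z. gact g (de z) = nahm_line (gact g (de 0)) z (T (fst (r z)), T (snd (r z))))"
   using r(1) by eventually_elim (metis line)
  show "limitin NS (%z. (T (fst (r z)), T (snd (r z)))) (T (fst w), T (snd w)) (at 0)"
   using r(2) Tl unfolding limitin_NS by simp
 qed
 thus thesis by (rule that)
qed

text \<open>For an arbitrary representative B of the image orbit, a fixed gauge transformation moves
  the curve \<open>of_kron (ga z)\<close> to B, which provides a differential. Conversely, any
  differential is projected by \<open>rho\<close> to a vector that differs from \<open>v\<close> by
  a torus action and an orbit direction, both invisible to the Kronheimer form.\<close>

lemma mmap_sympl: "kron_nahm_symplectic L {A : TK. kstable A}
  {B : ND. nstable B} mmap"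
 unfolding kron_nahm_symplectic_def
proof (intro ballI conjI allI impI; (elim conjE)?)
 let ?ZK = "{A : TK. kstable A}" and ?ZN = "{B : ND. nstable B}"
 fix A B assume AZ: "A : ?ZK" and Bo: "B : mmap (kron_orbit A)"
 hence A: "A : TK" "kstable A" by auto
 note T = TKD[OF A(1)]
 obtain g where g: "g : GG" "B = gact g (of_kron A)" using Bo unfolding mmap_orbit[OF A(1)] nahm_orbit_def by blast
 {
  fix ga v assume ga: "curve_tangent euclidean kron_line ?ZK ga v" "ga 0 = A"
  have kd: "kderiv ga v" by (rule crv_tangent_kderiv[OF ga(1)])
  have Z: "ev (nhds 0) (%z. ga z : ?ZK)" using ga(1) unfolding curve_tangent_def by blast
  hence tk: "ev (nhds 0) (%z. ga z : TK)" by eventually_elim blast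
  obtain w where w: "nahm_crv (%z. of_kron (ga z)) w" using of_kron_crv[OF kd tk] by blast
  obtain w' where w': "nahm_crv (%z. gact g (of_kron (ga z))) w'"
   by (rule nahm_crv_gauge[OF g(1) w]) (use ND_tops[OF T(2)] ga(2) in simp)
  have "curve_tangent NS nahm_line ?ZN (%z. gact g (of_kron (ga z))) w'" unfolding curve_tangent_def
  proof
   show "ev (nhds 0) (%z. gact g (of_kron (ga z)) : ?ZN)" using Z by eventually_elim
     (auto simp: nahm_stab_gauge(2)[OF g(1) TKD(2)] nahm_kron_stab(1) intro: gact_ND[OF g(1)] TKD(2))
   show "EX r. (ev (at 0) (%z. gact g (of_kron (ga z)) = nahm_line (gact g (of_kron (ga 0))) z (r z))) &
     limitin NS r w' (at 0)"
    using w' unfolding nahm_crv_def .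
  qed
  moreover have "ev (nhds 0) (%z. mmap (kron_orbit (ga z)) = orb (gact g (of_kron (ga z))))"
   using tk by eventually_elim (simp add: mmap_orbit orb_gauge_act[OF g(1) TKD(2)])
  ultimately show "EX w. kron_nahm_differential L ?ZK ?ZN mmap A B v w"
   unfolding kron_nahm_differential_def using ga g(2) by blast
 }
 fix v v' w w'
 assume d: "kron_nahm_differential L ?ZK ?ZN mmap A B v w" and d': "kron_nahm_differential L ?ZK ?ZN mmap A B v' w'"
 have AB: "B : rho_dom" "rho B = kron_act (g 0) A" using rho_gauge[OF g(1)] ND_paths[OF T(2)] T(3,4) g(2) by auto
 obtain a b c d where Ab: "A = kdat a b c d" using T(1) by (rule KD_kdat)
 have nz: "\<not> (a = 0 & b = 0 & c = 0 & d = 0)" using A(2) unfolding Ab kron_stable_iff by auto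
 have g0: "g 0 : torus" by (rule ggD(3)[OF g(1)])
 define m where "m = (g 0 $ 2 $ 2)\<^sup>2"
 define n where "n = (g 0 $ 1 $ 1)\<^sup>2"
 have mn: "m * n = 1" using torus_units(1)[OF g0] by (simp add: m_def n_def mult.commute)
 have rB: "rho B = kdat (a * m) (b * n) (c * m) (d * n)" unfolding AB(2) Ab kron_act_kdat[OF g0] m_def n_def ..
 have step: "EX de ro k. nahm_crv de w & (ev (nhds 0) (%z. de z : ND)) & kderiv (%z. rho (de z)) ro & de 0 = B &
   ro = kdat (m * (fst v $ 1 $ 2 + k * a)) (n * (fst v $ 2 $ 1 - k * b)) (m * (snd v $ 1 $ 2 + k * c)) (n * (snd v $ 2 $ 1 - k * d)) &
   v = kdat (fst v $ 1 $ 2) (fst v $ 2 $ 1) (snd v $ 1 $ 2) (snd v $ 2 $ 1) &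
   fst v $ 1 $ 2 * d + a * snd v $ 2 $ 1 - fst v $ 2 $ 1 * c - b * snd v $ 1 $ 2 = 0"
  if D: "kron_nahm_differential L ?ZK ?ZN mmap A B v w" for v w
 proof -
  obtain ga de where cs: "curve_tangent euclidean kron_line ?ZK ga v" "ga 0 = A"
   "curve_tangent NS nahm_line ?ZN de w" "de 0 = B" "ev (nhds 0) (%z. mmap (kron_orbit (ga z)) = orb (de z))"
   using D unfolding kron_nahm_differential_def by blast
  have kd: "kderiv ga v" by (rule crv_tangent_kderiv[OF cs(1)])
  have "ev (nhds 0) (%z. ga z : ?ZK)" using cs(1) unfolding curve_tangent_def by blast
  hence tk: "ev (nhds 0) (%z. ga z : TK)" by eventually_elim blast
  have "ev (nhds 0) (%z. de z : ?ZN)" using cs(3) unfolding curve_tangent_def by blast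
  hence nd: "ev (nhds 0) (%z. de z : ND)" by eventually_elim blast
  have nc: "nahm_crv de w" using cs(3) unfolding nahm_crv_def curve_tangent_def by blast
  have d0: "de 0 : ND" using eventually_nhds_x_imp_x[OF nd] .
  obtain ro where ro: "kderiv (%z. rho (de z)) ro" using rho_crv_kderiv[OF nc d0] AB(1) cs(4) by blast
  have orb: "ev (nhds 0) (%z. rho (de z) : kron_orbit (ga z))" using tk nd cs(5)
  proof eventually_elim
   case (elim z)
   note Tz = TKD[OF elim(1)]
   have "orb (of_kron (ga z)) = orb (de z)" using elim(3) mmap_orbit[OF elim(1)] by simp
   then obtain h where h: "h : GG" "de z = gact h (of_kron (ga z))" using orb_eq_iff[OF Tz(2) elim(2)] by blast
   have "rho (de z) = kron_act (h 0) (ga z)" unfolding h(2) using rho_gauge(2)[OF h(1)] ND_paths[OF Tz(2)] Tz(4) by simp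
   thus ?case using ggD(3)[OF h(1)] unfolding kron_orbit_def by blast
  qed
  have kdd: "ev (nhds 0) (%z. ga z : KD)" using tk by eventually_elim (rule TKD(1))
  have g0': "ga 0 = kdat a b c d" using cs(2) Ab by simp
  have r0': "rho (de 0) = kdat (a * m) (b * n) (c * m) (d * n)" using cs(4) rB by simp
  obtain k where "ro = kdat (m * (fst v $ 1 $ 2 + k * a)) (n * (fst v $ 2 $ 1 - k * b)) (m * (snd v $ 1 $ 2 + k * c)) (n * (snd v $ 2 $ 1 - k * d))"
   "v = kdat (fst v $ 1 $ 2) (fst v $ 2 $ 1) (snd v $ 1 $ 2) (snd v $ 2 $ 1)"
   "fst v $ 1 $ 2 * d + a * snd v $ 2 $ 1 - fst v $ 2 $ 1 * c - b * snd v $ 1 $ 2 = 0"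
   by (rule kron_orbit_tangent[OF kd kdd ro orb g0' nz r0' mn])
  thus ?thesis using nc nd ro cs(4) by blast
 qed
 obtain de ro k where 1: "nahm_crv de w" "ev (nhds 0) (%z. de z : ND)" "kderiv (%z. rho (de z)) ro" "de 0 = B"
  "ro = kdat (m * (fst v $ 1 $ 2 + k * a)) (n * (fst v $ 2 $ 1 - k * b)) (m * (snd v $ 1 $ 2 + k * c)) (n * (snd v $ 2 $ 1 - k * d))"
  "v = kdat (fst v $ 1 $ 2) (fst v $ 2 $ 1) (snd v $ 1 $ 2) (snd v $ 2 $ 1)"
  "fst v $ 1 $ 2 * d + a * snd v $ 2 $ 1 - fst v $ 2 $ 1 * c - b * snd v $ 1 $ 2 = 0" using step[OF d] by blast
 obtain de' ro' k' where 2: "nahm_crv de' w'" "ev (nhds 0) (%z. de' z : ND)" "kderiv (%z. rho (de' z)) ro'" "de' 0 = B"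
  "ro' = kdat (m * (fst v' $ 1 $ 2 + k' * a)) (n * (fst v' $ 2 $ 1 - k' * b)) (m * (snd v' $ 1 $ 2 + k' * c)) (n * (snd v' $ 2 $ 1 - k' * d))"
  "v' = kdat (fst v' $ 1 $ 2) (fst v' $ 2 $ 1) (snd v' $ 1 $ 2) (snd v' $ 2 $ 1)"
  "fst v' $ 1 $ 2 * d + a * snd v' $ 2 $ 1 - fst v' $ 2 $ 1 * c - b * snd v' $ 1 $ 2 = 0" using step[OF d'] by blast
 have "nahm_omega L w w' = kron_omega L ro ro'" by (rule rho_sympl[OF 1(1-3) 2(1-3) 1(4) 2(4) AB(1)])
 also have "\<dots> = kron_omega L v v'"
  unfolding 1(5) 2(5) kron_omega_torus[OF mn 1(7) 2(7)] 1(6)[symmetric] 2(6)[symmetric] ..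
 finally show "nahm_omega L w w' = kron_omega L v v'" .
qed

end

theorem mainTheorem3:
  fixes L r0 rL :: real and x0 xL :: complex
  assumes "L > 0"
  shows
    \<comment> \<open>(i)\<close>
    "(\<forall>B\<in>nahm_data L x0 xL \<inter> constant_alpha L. RG L B \<in> kron_data (xL - x0))
    \<and>
    \<comment> \<open>(ii)\<close>
    family_orbits L x0 xL upper_half \<subseteq> nahm_data L x0 xL \<inter> constant_alpha L \<and>
    bij_betw (RG L) (family_orbits L x0 xL upper_half)
      (kron_data (xL - x0) - exceptional_kron L (xL - x0))
    \<and>
    \<comment> \<open>(iii)\<close>
    (\<forall>B\<in>tilde_nahm L x0 xL.
       bij_betw (\<lambda>W. {0..L} \<times> W) {W. kron_subline (RG L B) W} {V. nahm_subline L B V} \<and>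
       (\<forall>W. kron_subline (RG L B) W \<longrightarrow>
          xL - x0 = 0 \<and> nahm_degree L r0 rL ({0..L} \<times> W) = kron_degree (rL - r0) W) \<and>
       (nahm_semistable L r0 rL B \<longleftrightarrow> kron_semistable (rL - r0) (RG L B)) \<and>
       (nahm_stable L r0 rL B \<longleftrightarrow> kron_stable (rL - r0) (RG L B)) \<and>
       (nahm_polystable L r0 rL B \<longleftrightarrow> kron_polystable (rL - r0) (RG L B)))
    \<and>
    \<comment> \<open>(iv)\<close>
    openin (kron_moduli_top (rL - r0) (xL - x0)) (tilde_kron_moduli L r0 rL x0 xL) \<and>
    (\<exists>\<phi>.
       (\<forall>B\<in>tilde_nahm_ps L r0 rL x0 xL. \<phi> (kron_orbit (RG L B)) = nahm_orbit L B) \<and>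
       analytic_open_embedding
         (subtopology (kron_moduli_top (rL - r0) (xL - x0)) (tilde_kron_moduli L r0 rL x0 xL))
         (kron_holomorphic (rL - r0) (xL - x0))
         (nahm_moduli_top L r0 rL x0 xL)
         (nahm_holomorphic L r0 rL x0 xL) \<phi> \<and>
       kron_nahm_symplectic L
         {A \<in> tilde_kron L x0 xL. kron_stable (rL - r0) A}
         {B \<in> nahm_data L x0 xL. nahm_stable L r0 rL B} \<phi> \<and>
       inj_on (gauge_saturation L) (tilde_nahm_moduli L r0 rL x0 xL) \<and>
       \<phi> ` tilde_kron_moduli L r0 rL x0 xL =
         gauge_saturation L ` tilde_nahm_moduli L r0 rL x0 xL)"
proof -
  interpret nahm_params L x0 xL r0 rL by unfold_locales (fact assms)
  have m: "\<forall>B\<in>tilde_nahm_ps L r0 rL x0 xL. mmap (kron_orbit (RG L B)) = nahm_orbit L B"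
    unfolding tilde_nahm_ps_def by (metis IntD2 mmap_orbit rho_TN(3,4))
  have i: "\<forall>B\<in>nahm_data L x0 xL \<inter> constant_alpha L. RG L B \<in> kron_data (xL - x0)"
    using RG_KD by blast
  have iii: "\<forall>B\<in>tilde_nahm L x0 xL.
       bij_betw (\<lambda>W. {0..L} \<times> W) {W. kron_subline (RG L B) W} {V. nahm_subline L B V} \<and>
       (\<forall>W. kron_subline (RG L B) W \<longrightarrow>
          xL - x0 = 0 \<and> nahm_degree L r0 rL ({0..L} \<times> W) = kron_degree (rL - r0) W) \<and>
       (nahm_semistable L r0 rL B \<longleftrightarrow> kron_semistable (rL - r0) (RG L B)) \<and>
       (nahm_stable L r0 rL B \<longleftrightarrow> kron_stable (rL - r0) (RG L B)) \<and>
       (nahm_polystable L r0 rL B \<longleftrightarrow> kron_polystable (rL - r0) (RG L B))"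
    by (intro ballI conjI allI impI degree_eq nahm_kron_correspondence)
  show ?thesis
    by (intro conjI exI[of _ mmap]) (rule m i part_ii iii TK_moduli_open
        mmap_analytic_open_embedding mmap_sympl mmap_saturation)+
qed

end
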